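(* Let $(D_k,D_k^* )$ be a weighted Lie bi-algebroid of degree $k$, with odd Hamiltonians $\mathcal Q=\mathcal Q_{D_k}$ and $S=S_{D_k^*}$ on $\mathsf T^*(\Pi D_k)$. Then $\mathsf T^*(\Pi D_k)$, equipped with the bi-weight obtained from its natural tri-weight by adding the last two components, its canonical symplectic form $\omega$, and the odd function $\Theta=\mathcal Q+S$, is a weighted Courant algebroid of degree $k$.
   Context: A homogeneity structure of degree $k$ on a (super)manifold is a smooth action $h$ of the monoid $(\mathbb R,\cdot)$ admitting an atlas of coordinates $y$ with $h_t^*y=t^wy$, with weights $w\in\{0,\dots,k\}$. A double graded supermanifold of bi-degree $(a,b)$ is a supermanifold $\mathcal M$ with two commuting homogeneity structures $\mathrm h,\mathrm l$ of degrees $a$ and $b$. $(\mathcal M,\mathrm l)$ is an $N$-manifold if the Grassmann parity of homogeneous coordinates is the parity of their $\mathrm l$-weight. A weighted Courant algebroid of degree $k$ consists of: (1) a double graded supermanifold $(\mathcal M,\mathrm h,\mathrm l)$ of bi-degree $(k-1,2)$ such that $(\mathcal M,\mathrm l)$ is an $N$-manifold; (2) an even symplectic form $\omega$ on $\mathcal M$ of bi-degree $(k-1,2)$; (3) an odd function $\Theta\in C^\infty(\mathcal M)$ of bi-degree $(k-1,3)$ such that $\{\Theta,\Theta\}_\omega=0$, where $\{\cdot,\cdot\}_\omega$ is the Poisson bracket induced by $\omega$. A $\mathcal{GL}$-bundle of degree $k$ is a manifold $D_k$ with commuting homogeneity structures of degree $k-1$ and degree $1$, the latter a vector bundle structure $D_k\to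 B_{k-1}$. Its dual $D_k^*$ is again a $\mathcal{GL}$-bundle of degree $k$: linear coordinates of bi-weight $(u,1)$ on $D_k$ have dual linear coordinates of bi-weight $(k-1-u,1)$. $\Pi D_k$ is obtained by reversing the parity of the linear fibre coordinates. A weighted Lie algebroid of degree $k$ is a $\mathcal{GL}$-bundle $D_k$ of degree $k$ with a homological vector field $Q$ (odd, $Q^2=0$) on $\Pi D_k$ of bi-weight $(0,1)$. On $\mathsf T^*(\Pi D_k)\simeq\mathsf T^*(\Pi D_k^* )$ use homogeneous coordinates with tri-weights $x^\alpha_u:(u,0,0)$, $\theta^I_{u+1}:(u,1,0)$, $p_\beta^{u+2}:(u,1,1)$, $\chi_J^{u+1}:(u,0,1)$, $0\le u\le k-1$, where $x,p$ are even, $\theta,\chi$ odd, $p_\alpha^{k+1-u}$ is conjugate to $x^\alpha_u$ and $\chi_I^{k-u}$ is conjugate to $\theta^I_{u+1}$. A pair $(D_k,D_k^* )$ of weighted Lie algebroids, both of degree $k$, is a weighted Lie bi-algebroid of degree $k$ if the odd Hamiltonians on $\mathsf T^*(\Pi D_k)$ encoding them Poisson commute for the canonical Poisson bracket, $\{\mathcal Q_{D_k},S_{D_k^*}\}=0$. Here $\mathcal Q_{D_k}$, of tri-weight $(k-1,2,1)$, is the symbol (linear Hamiltonian) of the homological vector field of $D_k$, with $\{\mathcal Q_{D_k},\mathcal Q_{D_k}\}=0$; and $S_{D_k^*}$, of tri-weight $(k-1,1,2)$, is the symbol of the homological vector field on $\Pi D_k^*$ encoding the weighted Lie algebroid $D_k^*$,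 transported by $\mathsf T^*(\Pi D_k)\simeq\mathsf T^*(\Pi D_k^* )$, with $\{S_{D_k^*},S_{D_k^*}\}=0$. *)

theory Defs
  imports "HOL-Analysis.Analysis" "HOL-Library.Function_Algebras"
begin

section \<open>Smooth functions on open subsets of coordinate space\<close>

text \<open>
  Coordinate space of dimension \<open>n\<close> (possibly \<open>0\<close>) is the library's \<^const>\<open>Euclidean_space\<close>,
  whose points are the functions \<open>nat \<Rightarrow> real\<close> supported on \<open>{..<n}\<close>.
\<close>

definition pd :: "nat \<Rightarrow> ((nat \<Rightarrow> real) \<Rightarrow> real) \<Rightarrow> (nat \<Rightarrow> real) \<Rightarrow> real" where
  "pd i f v = deriv (\<lambda>s. f (v(i := s))) (v i)"

primrec iter_pd :: "nat list \<Rightarrow> ((nat \<Rightarrow> real) \<Rightarrow> real) \<Rightarrow> (nat \<Rightarrow> real) \<Rightarrow> real" where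
  "iter_pd [] f = f"
| "iter_pd (i # is) f = pd i (iter_pd is f)"

text \<open>All iterated partial derivatives exist and are continuous on the open set \<open>V\<close>;
  the values of \<open>f\<close> outside \<open>V\<close> are irrelevant.\<close>

definition smooth_fun :: "nat \<Rightarrow> (nat \<Rightarrow> real) set \<Rightarrow> ((nat \<Rightarrow> real) \<Rightarrow> real) \<Rightarrow> bool" where
  "smooth_fun n V f \<longleftrightarrow>
     (\<forall>is. set is \<subseteq> {..<n} \<longrightarrow>
        continuous_map (subtopology (Euclidean_space n) V) euclideanreal (iter_pd is f) \<and>
        (\<forall>i<n. \<forall>v\<in>V. (\<lambda>s. iter_pd is f (v(i := s))) differentiable (at (v i))))"

definition trunc :: "nat \<Rightarrow> (nat \<Rightarrow> real) \<Rightarrow> nat \<Rightarrow> real" where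
  "trunc n v = (\<lambda>i. if i < n then v i else 0)"


section \<open>Sheaves of superalgebras\<close>

text \<open>
  Parities are Booleans, \<open>False\<close> even and \<open>True\<close> odd; the sum of parities is \<open>i \<noteq> j\<close>.

  A sheaf of real superalgebras is represented as a sheaf of functions with values in a real
  algebra \<open>'g\<close>, extended by \<open>0\<close> outside their domain, with pointwise algebra operations. This is
  no restriction: every sheaf embeds into the product of its stalks. The value at a point is thus
  to be thought of as the germ there and not as the numerical value, which forgets nilpotents.
  For ordinary manifolds \<open>'g\<close> is \<^typ>\<open>real\<close>.
\<close>

record ('x, 'g) sspace =
  body :: "'x topology"
  sect :: "bool \<Rightarrow> 'x set \<Rightarrow> ('x \<Rightarrow> 'g) set"

definition ksign :: "bool \<Rightarrow> bool \<Rightarrow> real" where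
  "ksign i j = (if i \<and> j then -1 else 1)"

definition scl :: "real \<Rightarrow> ('x \<Rightarrow> 'g::real_algebra_1) \<Rightarrow> 'x \<Rightarrow> 'g" where
  "scl r f = (\<lambda>x. r *\<^sub>R f x)"

definition res :: "'x set \<Rightarrow> ('x \<Rightarrow> 'g::real_algebra_1) \<Rightarrow> 'x \<Rightarrow> 'g" where
  "res U f = (\<lambda>x. if x \<in> U then f x else 0)"

abbreviation total :: "('x, 'g) sspace \<Rightarrow> 'x set" where
  "total M \<equiv> topspace (body M)"

definition secs :: "('x, 'g::real_algebra_1) sspace \<Rightarrow> 'x set \<Rightarrow> ('x \<Rightarrow> 'g) set" where
  "secs M U = {f + g |f g. f \<in> sect M False U \<and> g \<in> sect M True U}"

definition superalgebra_sheaf :: "('x, 'g::real_algebra_1) sspace \<Rightarrow> bool" where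
  "superalgebra_sheaf M \<longleftrightarrow>
     (\<forall>U. openin (body M) U \<longrightarrow>
        res U 1 \<in> sect M False U \<and>
        sect M False U \<inter> sect M True U \<subseteq> {0} \<and>
        (\<forall>i. 0 \<in> sect M i U \<and>
           (\<forall>f\<in>sect M i U. res U f = f \<and> (\<forall>r. scl r f \<in> sect M i U) \<and>
              (\<forall>g\<in>sect M i U. f + g \<in> sect M i U) \<and>
              (\<forall>j. \<forall>g\<in>sect M j U. f * g \<in> sect M (i \<noteq> j) U \<and> f * g = scl (ksign i j) (g * f)) \<and>
              (\<forall>W. openin (body M) W \<and> W \<subseteq> U \<longrightarrow> res W f \<in> sect M i W)) \<and>
           (\<forall>f. res U f = f \<and>
                (\<forall>x\<in>U. \<exists>W. openin (body M) W \<and> x \<in> W \<and> W \<subseteq> U \<and> res W f \<in> sect M i W)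
              \<longrightarrow> f \<in> sect M i U)))"


section \<open>Charts and supermanifolds\<close>

text \<open>
  A chart of dimension \<open>n|m\<close> is an isomorphism of superalgebra sheaves between an open
  sub-superspace and the superdomain \<open>C\<^sup>\<infinity>(V)[\<xi>\<^sub>0,\<dots>,\<xi>\<^sub>m\<^sub>-\<^sub>1]\<close>, \<open>V\<close> open in n-space. It is given by the
  homeomorphism \<open>bmap\<close> onto \<open>V\<close>, the pullback \<open>pull W\<close> of smooth functions on \<open>bmap ` W\<close> to
  even sections over \<open>W\<close>, and the odd coordinates \<open>oddc\<close>.
\<close>

record ('x, 'g) schart =
  cdom :: "'x set"
  bmap :: "'x \<Rightarrow> nat \<Rightarrow> real"
  pull :: "'x set \<Rightarrow> ((nat \<Rightarrow> real) \<Rightarrow> real) \<Rightarrow> 'x \<Rightarrow> 'g"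
  oddc :: "nat \<Rightarrow> 'x \<Rightarrow> 'g"

definition odd_monom :: "(nat \<Rightarrow> 'x \<Rightarrow> 'g::real_algebra_1) \<Rightarrow> nat set \<Rightarrow> 'x \<Rightarrow> 'g" where
  "odd_monom \<xi> S = prod_list (map \<xi> (sorted_list_of_set S))"

definition expansion ::
    "nat \<Rightarrow> ('x, 'g::real_algebra_1) schart \<Rightarrow> 'x set \<Rightarrow> (nat set \<Rightarrow> (nat \<Rightarrow> real) \<Rightarrow> real) \<Rightarrow> 'x \<Rightarrow> 'g"
  where "expansion m c W F = (\<Sum>S\<in>Pow {..<m}. pull c W (F S) * odd_monom (oddc c) S)"

definition chart :: "nat \<Rightarrow> nat \<Rightarrow> ('x, 'g::real_algebra_1) sspace \<Rightarrow> ('x, 'g) schart \<Rightarrow> bool" where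
  "chart n m M c \<longleftrightarrow>
     openin (body M) (cdom c) \<and>
     openin (Euclidean_space n) (bmap c ` cdom c) \<and>
     homeomorphic_map (subtopology (body M) (cdom c))
       (subtopology (Euclidean_space n) (bmap c ` cdom c)) (bmap c) \<and>
     (\<forall>j<m. oddc c j \<in> sect M True (cdom c)) \<and>
     (\<forall>W. openin (body M) W \<and> W \<subseteq> cdom c \<longrightarrow>
        (\<forall>f. smooth_fun n (bmap c ` W) f \<longrightarrow>
           pull c W f \<in> sect M False W \<and>
           (\<forall>g. (\<forall>v\<in>bmap c ` W. g v = f v) \<longrightarrow> pull c W g = pull c W f) \<and>
           (\<forall>g. smooth_fun n (bmap c ` W) g \<longrightarrow>
              pull c W (\<lambda>v. f v + g v) = pull c W f + pull c W g \<and>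
              pull c W (\<lambda>v. f v * g v) = pull c W f * pull c W g) \<and>
           (\<forall>W'. openin (body M) W' \<and> W' \<subseteq> W \<longrightarrow> pull c W' f = res W' (pull c W f))) \<and>
        (\<forall>r. pull c W (\<lambda>v. r) = scl r (res W 1)) \<and>
        (\<forall>f\<in>secs M W. \<exists>F. (\<forall>S\<subseteq>{..<m}. smooth_fun n (bmap c ` W) (F S)) \<and> f = expansion m c W F) \<and>
        (\<forall>F. (\<forall>S\<subseteq>{..<m}. smooth_fun n (bmap c ` W) (F S)) \<and> expansion m c W F = 0
           \<longrightarrow> (\<forall>S\<subseteq>{..<m}. \<forall>v\<in>bmap c ` W. F S v = 0)))"

definition supermanifold :: "nat \<Rightarrow> nat \<Rightarrow> ('x, 'g::real_algebra_1) sspace \<Rightarrow> bool" where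
  "supermanifold n m M \<longleftrightarrow>
     Hausdorff_space (body M) \<and> second_countable (body M) \<and> superalgebra_sheaf M \<and>
     (\<forall>x\<in>total M. \<exists>c. chart n m M c \<and> x \<in> cdom c)"

text \<open>Coordinates are indexed by pairs \<open>(parity, number)\<close>.\<close>

definition cidx :: "nat \<Rightarrow> nat \<Rightarrow> (bool \<times> nat) set" where
  "cidx n m = {False} \<times> {..<n} \<union> {True} \<times> {..<m}"

definition coord :: "('x, 'g) schart \<Rightarrow> bool \<times> nat \<Rightarrow> 'x \<Rightarrow> 'g" where
  "coord c A = (if fst A then oddc c (snd A) else pull c (cdom c) (\<lambda>v. v (snd A)))"


section \<open>Morphisms, homogeneity structures\<close>

record ('x, 'g, 'y, 'h) smor =
  bodymap :: "'x \<Rightarrow> 'y"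
  pb :: "'y set \<Rightarrow> ('y \<Rightarrow> 'h) \<Rightarrow> 'x \<Rightarrow> 'g"

definition preim :: "('x, 'g) sspace \<Rightarrow> ('x, 'g, 'y, 'h) smor \<Rightarrow> 'y set \<Rightarrow> 'x set" where
  "preim M \<phi> W = {x \<in> total M. bodymap \<phi> x \<in> W}"

definition is_mor :: "('x, 'g::real_algebra_1) sspace \<Rightarrow> ('y, 'h::real_algebra_1) sspace \<Rightarrow>
    ('x, 'g, 'y, 'h) smor \<Rightarrow> bool" where
  "is_mor M N \<phi> \<longleftrightarrow>
     continuous_map (body M) (body N) (bodymap \<phi>) \<and>
     (\<forall>W. openin (body N) W \<longrightarrow>
        pb \<phi> W (res W 1) = res (preim M \<phi> W) 1 \<and>
        (\<forall>i. \<forall>f\<in>sect N i W. pb \<phi> W f \<in> sect M i (preim M \<phi> W)) \<and>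
        (\<forall>f\<in>secs N W.
           (\<forall>r. pb \<phi> W (scl r f) = scl r (pb \<phi> W f)) \<and>
           (\<forall>g\<in>secs N W. pb \<phi> W (f + g) = pb \<phi> W f + pb \<phi> W g \<and>
                            pb \<phi> W (f * g) = pb \<phi> W f * pb \<phi> W g) \<and>
           (\<forall>W'. openin (body N) W' \<and> W' \<subseteq> W \<longrightarrow>
              pb \<phi> W' (res W' f) = res (preim M \<phi> W') (pb \<phi> W f))))"

definition mor_eq :: "('x, 'g::real_algebra_1) sspace \<Rightarrow> ('y, 'h::real_algebra_1) sspace \<Rightarrow>
    ('x, 'g, 'y, 'h) smor \<Rightarrow> ('x, 'g, 'y, 'h) smor \<Rightarrow> bool" where
  "mor_eq M N \<phi> \<psi> \<longleftrightarrow>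
     (\<forall>x\<in>total M. bodymap \<phi> x = bodymap \<psi> x) \<and>
     (\<forall>W f. openin (body N) W \<and> f \<in> secs N W \<longrightarrow> pb \<phi> W f = pb \<psi> W f)"

definition mid :: "('x, 'g, 'x, 'g) smor" where
  "mid = \<lparr>bodymap = (\<lambda>x. x), pb = (\<lambda>W f. f)\<rparr>"

text \<open>\<open>mcomp N \<psi> \<phi>\<close> is \<open>\<psi>\<close> after \<open>\<phi>\<close>, where \<open>N\<close> is the source of \<open>\<psi>\<close>.\<close>

definition mcomp :: "('y, 'h) sspace \<Rightarrow> ('y, 'h, 'z, 's) smor \<Rightarrow> ('x, 'g, 'y, 'h) smor \<Rightarrow>
    ('x, 'g, 'z, 's) smor" where
  "mcomp N \<psi> \<phi> = \<lparr>bodymap = bodymap \<psi> \<circ> bodymap \<phi>, pb = (\<lambda>W f. pb \<phi> (preim N \<psi> W) (pb \<psi> W f))\<rparr>"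

type_synonym ('x, 'g) saction = "real \<Rightarrow> ('x, 'g, 'x, 'g) smor"

definition monoid_action :: "('x, 'g::real_algebra_1) sspace \<Rightarrow> ('x, 'g) saction \<Rightarrow> bool" where
  "monoid_action M h \<longleftrightarrow>
     (\<forall>t. is_mor M M (h t)) \<and>
     mor_eq M M (h 1) mid \<and>
     (\<forall>s t. mor_eq M M (h (s * t)) (mcomp M (h s) (h t)))"

definition commuting :: "('x, 'g::real_algebra_1) sspace \<Rightarrow> ('x, 'g) saction \<Rightarrow> ('x, 'g) saction \<Rightarrow> bool"
  where "commuting M h l \<longleftrightarrow> (\<forall>s t. mor_eq M M (mcomp M (h s) (l t)) (mcomp M (l t) (h s)))"

text \<open>
  Smoothness of \<open>(t, x) \<mapsto> h\<^sub>t x\<close> as a map out of the product of the real line with \<open>M\<close>: around every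
  point of \<open>M\<close> there is a chart in which the pullbacks of local sections have coefficients that are
  jointly smooth in \<open>t\<close> (stored as the n-th coordinate) and the chart coordinates.
\<close>

definition smooth_action :: "nat \<Rightarrow> nat \<Rightarrow> ('x, 'g::real_algebra_1) sspace \<Rightarrow> ('x, 'g) saction \<Rightarrow> bool" where
  "smooth_action n m M h \<longleftrightarrow>
     (\<forall>y\<in>total M. \<exists>c. chart n m M c \<and> y \<in> cdom c \<and>
        (\<forall>W f. openin (body M) W \<and> f \<in> secs M W \<longrightarrow>
           (let \<Omega> = {(bmap c x)(n := t) |x t. x \<in> cdom c \<and> bodymap (h t) x \<in> W} in
            openin (Euclidean_space (Suc n)) \<Omega> \<and>
            (\<exists>F. (\<forall>S\<subseteq>{..<m}. smooth_fun (Suc n) \<Omega> (F S)) \<and>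
                 (\<forall>t. res (cdom c) (pb (h t) W f) =
                    expansion m c (cdom c \<inter> preim M (h t) W) (\<lambda>S v. F S (v(n := t))))))))"

text \<open>Coordinates that are homogeneous for \<open>h\<close> with weights \<open>w\<close>; their domain is \<open>h\<close>-invariant.\<close>

definition hom_chart :: "nat \<Rightarrow> nat \<Rightarrow> ('x, 'g::real_algebra_1) sspace \<Rightarrow> ('x, 'g) saction \<Rightarrow>
    ('x, 'g) schart \<Rightarrow> (bool \<times> nat \<Rightarrow> nat) \<Rightarrow> bool" where
  "hom_chart n m M h c w \<longleftrightarrow>
     chart n m M c \<and>
     (\<forall>t. bodymap (h t) ` cdom c \<subseteq> cdom c) \<and>
     (\<forall>A\<in>cidx n m. \<forall>t. res (cdom c) (pb (h t) (cdom c) (coord c A)) = scl (t ^ w A) (coord c A))"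

definition homogeneity_structure ::
    "nat \<Rightarrow> nat \<Rightarrow> nat \<Rightarrow> ('x, 'g::real_algebra_1) sspace \<Rightarrow> ('x, 'g) saction \<Rightarrow> bool" where
  "homogeneity_structure d n m M h \<longleftrightarrow>
     supermanifold n m M \<and> monoid_action M h \<and> smooth_action n m M h \<and>
     (\<forall>x\<in>total M. \<exists>c w. hom_chart n m M h c w \<and> x \<in> cdom c \<and> (\<forall>A\<in>cidx n m. w A \<le> d))"

definition double_graded ::
    "nat \<Rightarrow> nat \<Rightarrow> nat \<Rightarrow> nat \<Rightarrow> ('x, 'g::real_algebra_1) sspace \<Rightarrow> ('x, 'g) saction \<Rightarrow> ('x, 'g) saction \<Rightarrow> bool"
  where
  "double_graded a b n m M h l \<longleftrightarrow>
     homogeneity_structure a n m M h \<and> homogeneity_structure b n m M l \<and> commuting M h l"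

text \<open>The empty chart, on which weights are meaningless, is excluded.\<close>

definition N_manifold ::
    "nat \<Rightarrow> nat \<Rightarrow> nat \<Rightarrow> ('x, 'g::real_algebra_1) sspace \<Rightarrow> ('x, 'g) saction \<Rightarrow> bool" where
  "N_manifold d n m M l \<longleftrightarrow>
     homogeneity_structure d n m M l \<and>
     (\<forall>c w. hom_chart n m M l c w \<and> cdom c \<noteq> {} \<longrightarrow> (\<forall>A\<in>cidx n m. odd (w A) \<longleftrightarrow> fst A))"

text \<open>A global section of weight \<open>w\<close>.\<close>

definition fun_weight ::
    "('x, 'g::real_algebra_1) sspace \<Rightarrow> ('x, 'g) saction \<Rightarrow> nat \<Rightarrow> ('x \<Rightarrow> 'g) \<Rightarrow> bool" where
  "fun_weight M h w f \<longleftrightarrow> (\<forall>t. pb (h t) (total M) f = scl (t ^ w) f)"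


section \<open>Vector fields and differential forms\<close>

text \<open>
  A vector field of parity \<open>i\<close> on \<open>U\<close> is a super-derivation of the sheaf restricted to \<open>U\<close>. It is
  made extensional by the value \<open>0\<close> outside its domain of definition.
\<close>

type_synonym ('x, 'g) svf = "'x set \<Rightarrow> ('x \<Rightarrow> 'g) \<Rightarrow> 'x \<Rightarrow> 'g"

definition vfield ::
    "('x, 'g::real_algebra_1) sspace \<Rightarrow> bool \<Rightarrow> 'x set \<Rightarrow> ('x, 'g) svf \<Rightarrow> bool" where
  "vfield M i U X \<longleftrightarrow>
     (\<forall>W f. \<not> (openin (body M) W \<and> W \<subseteq> U \<and> f \<in> secs M W) \<longrightarrow> X W f = 0) \<and>
     (\<forall>W. openin (body M) W \<and> W \<subseteq> U \<longrightarrow>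
        (\<forall>j. \<forall>f\<in>sect M j W. X W f \<in> sect M (i \<noteq> j) W \<and>
           (\<forall>g\<in>secs M W. X W (f * g) = X W f * g + scl (ksign i j) (f * X W g))) \<and>
        (\<forall>f\<in>secs M W. (\<forall>r. X W (scl r f) = scl r (X W f)) \<and>
           (\<forall>g\<in>secs M W. X W (f + g) = X W f + X W g) \<and>
           (\<forall>W'. openin (body M) W' \<and> W' \<subseteq> W \<longrightarrow> X W' (res W' f) = res W' (X W f))))"

definition vres :: "'x set \<Rightarrow> ('x, 'g::real_algebra_1) svf \<Rightarrow> ('x, 'g) svf" where
  "vres U X = (\<lambda>W f. if W \<subseteq> U then X W f else 0)"

definition vadd :: "('x, 'g::real_algebra_1) svf \<Rightarrow> ('x, 'g) svf \<Rightarrow> ('x, 'g) svf" where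
  "vadd X Y = (\<lambda>W f. X W f + Y W f)"

definition vscl :: "('x \<Rightarrow> 'g::real_algebra_1) \<Rightarrow> ('x, 'g) svf \<Rightarrow> ('x, 'g) svf" where
  "vscl g X = (\<lambda>W f. g * X W f)"

text \<open>Super-commutator of vector fields of parities \<open>i\<close> and \<open>j\<close>.\<close>

definition vbr :: "bool \<Rightarrow> bool \<Rightarrow> ('x, 'g::real_algebra_1) svf \<Rightarrow> ('x, 'g) svf \<Rightarrow> ('x, 'g) svf" where
  "vbr i j X Y = (\<lambda>W f. X W (Y W f) - scl (ksign i j) (Y W (X W f)))"

definition vf_weight ::
    "('x, 'g::real_algebra_1) sspace \<Rightarrow> ('x, 'g) saction \<Rightarrow> nat \<Rightarrow> ('x, 'g) svf \<Rightarrow> bool" where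
  "vf_weight M h w X \<longleftrightarrow>
     (\<forall>t U f. openin (body M) U \<and> f \<in> secs M U \<longrightarrow>
        pb (h t) U (X U f) = scl (t ^ w) (X (preim M (h t) U) (pb (h t) U f)))"

definition homological ::
    "('x, 'g::real_algebra_1) sspace \<Rightarrow> ('x, 'g) svf \<Rightarrow> bool" where
  "homological M X \<longleftrightarrow>
     vfield M True (total M) X \<and>
     (\<forall>W f. openin (body M) W \<and> f \<in> secs M W \<longrightarrow> X W (X W f) = 0)"

text \<open>The coordinate vector field of the coordinate with index \<open>A\<close>.\<close>

definition dcoord ::
    "nat \<Rightarrow> nat \<Rightarrow> ('x, 'g::real_algebra_1) sspace \<Rightarrow> ('x, 'g) schart \<Rightarrow> bool \<times> nat \<Rightarrow> ('x, 'g) svf" where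
  "dcoord n m M c A =
     (THE X. vfield M (fst A) (cdom c) X \<and>
        (\<forall>B\<in>cidx n m. X (cdom c) (coord c B) = (if A = B then res (cdom c) 1 else 0)))"

text \<open>Forms are evaluated on parity-homogeneous vector fields. One-forms are left-linear.\<close>

definition one_form ::
    "('x, 'g::real_algebra_1) sspace \<Rightarrow> bool \<Rightarrow> 'x set \<Rightarrow> ('x set \<Rightarrow> ('x, 'g) svf \<Rightarrow> 'x \<Rightarrow> 'g) \<Rightarrow> bool" where
  "one_form M i U \<eta> \<longleftrightarrow>
     (\<forall>W j X. openin (body M) W \<and> W \<subseteq> U \<and> vfield M j W X \<longrightarrow>
        \<eta> W X \<in> sect M (i \<noteq> j) W \<and>
        (\<forall>Y. vfield M j W Y \<longrightarrow> \<eta> W (vadd X Y) = \<eta> W X + \<eta> W Y) \<and>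
        (\<forall>l. \<forall>f\<in>sect M l W. \<eta> W (vscl f X) = f * \<eta> W X) \<and>
        (\<forall>W'. openin (body M) W' \<and> W' \<subseteq> W \<longrightarrow> \<eta> W' (vres W' X) = res W' (\<eta> W X)))"

type_synonym ('x, 'g) sform2 = "'x set \<Rightarrow> ('x, 'g) svf \<Rightarrow> ('x, 'g) svf \<Rightarrow> 'x \<Rightarrow> 'g"

text \<open>Even two-forms: left-linear in the first argument and super-antisymmetric.\<close>

definition even_two_form ::
    "('x, 'g::real_algebra_1) sspace \<Rightarrow> ('x, 'g) sform2 \<Rightarrow> bool" where
  "even_two_form M \<omega> \<longleftrightarrow>
     (\<forall>U i j X Y. openin (body M) U \<and> vfield M i U X \<and> vfield M j U Y \<longrightarrow>
        \<omega> U X Y \<in> sect M (i \<noteq> j) U \<and>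
        (\<forall>Z. vfield M i U Z \<longrightarrow> \<omega> U (vadd X Z) Y = \<omega> U X Y + \<omega> U Z Y) \<and>
        (\<forall>l. \<forall>f\<in>sect M l U. \<omega> U (vscl f X) Y = f * \<omega> U X Y) \<and>
        \<omega> U Y X = scl (- ksign i j) (\<omega> U X Y) \<and>
        (\<forall>W. openin (body M) W \<and> W \<subseteq> U \<longrightarrow> \<omega> W (vres W X) (vres W Y) = res W (\<omega> U X Y)))"

text \<open>Cartan's formula for the differential of an even two-form, with Koszul signs.\<close>

definition closed_form ::
    "('x, 'g::real_algebra_1) sspace \<Rightarrow> ('x, 'g) sform2 \<Rightarrow> bool" where
  "closed_form M \<omega> \<longleftrightarrow>
     (\<forall>U i j l X Y Z. openin (body M) U \<and> vfield M i U X \<and> vfield M j U Y \<and> vfield M l U Z \<longrightarrow>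
          X U (\<omega> U Y Z)
        - scl (ksign i j) (Y U (\<omega> U X Z))
        + scl (ksign l (i \<noteq> j)) (Z U (\<omega> U X Y))
        - \<omega> U (vbr i j X Y) Z
        + scl (ksign j l) (\<omega> U (vbr i l X Z) Y)
        - scl (ksign i (j \<noteq> l)) (\<omega> U (vbr j l Y Z) X) = 0)"

text \<open>The map \<open>X \<mapsto> \<omega>(\<cdot>, X)\<close> from vector fields to one-forms is an isomorphism of sheaves.\<close>

definition nondegenerate ::
    "('x, 'g::real_algebra_1) sspace \<Rightarrow> ('x, 'g) sform2 \<Rightarrow> bool" where
  "nondegenerate M \<omega> \<longleftrightarrow>
     (\<forall>U i \<eta>. openin (body M) U \<and> one_form M i U \<eta> \<longrightarrow>
        (\<exists>!X. vfield M i U X \<and>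
           (\<forall>W j Y. openin (body M) W \<and> W \<subseteq> U \<and> vfield M j W Y \<longrightarrow> \<omega> W Y (vres W X) = \<eta> W Y)))"

definition even_symplectic :: "('x, 'g::real_algebra_1) sspace \<Rightarrow> ('x, 'g) sform2 \<Rightarrow> bool" where
  "even_symplectic M \<omega> \<longleftrightarrow> even_two_form M \<omega> \<and> closed_form M \<omega> \<and> nondegenerate M \<omega>"

text \<open>\<open>h\<^sub>t\<^sup>* \<omega> = t\<^sup>w \<omega>\<close>, the pullback being evaluated on pairs of \<open>h\<^sub>t\<close>-related vector fields.\<close>

definition related ::
    "('x, 'g::real_algebra_1) sspace \<Rightarrow> ('x, 'g, 'x, 'g) smor \<Rightarrow> 'x set \<Rightarrow> ('x, 'g) svf \<Rightarrow> ('x, 'g) svf \<Rightarrow> bool"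
  where
  "related M \<phi> U X' X \<longleftrightarrow>
     (\<forall>W f. openin (body M) W \<and> W \<subseteq> U \<and> f \<in> secs M W \<longrightarrow>
        X' (preim M \<phi> W) (pb \<phi> W f) = pb \<phi> W (X W f))"

definition form_weight ::
    "('x, 'g::real_algebra_1) sspace \<Rightarrow> ('x, 'g) saction \<Rightarrow> nat \<Rightarrow> ('x, 'g) sform2 \<Rightarrow> bool" where
  "form_weight M h w \<omega> \<longleftrightarrow>
     (\<forall>t U i j X Y X' Y'. openin (body M) U \<and> vfield M i U X \<and> vfield M j U Y \<and>
        vfield M i (preim M (h t) U) X' \<and> vfield M j (preim M (h t) U) Y' \<and>
        related M (h t) U X' X \<and> related M (h t) U Y' Y \<longrightarrow>
        pb (h t) U (\<omega> U X Y) = scl (t ^ w) (\<omega> (preim M (h t) U) X' Y'))"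

text \<open>
  The Hamiltonian vector field \<open>X\<close> of a parity-homogeneous function \<open>f\<close> satisfies
  \<open>\<omega>(Y, X) = Y f\<close>, and \<open>{f, g} = X g\<close>. With this convention no parity signs occur.
\<close>

definition ham_vf ::
    "('x, 'g::real_algebra_1) sspace \<Rightarrow> ('x, 'g) sform2 \<Rightarrow> ('x \<Rightarrow> 'g) \<Rightarrow> ('x, 'g) svf" where
  "ham_vf M \<omega> f =
     (THE X. (\<exists>i. f \<in> sect M i (total M) \<and> vfield M i (total M) X) \<and>
        (\<forall>W j Y. openin (body M) W \<and> vfield M j W Y \<longrightarrow> \<omega> W Y (vres W X) = Y W (res W f)))"

definition poisson ::
    "('x, 'g::real_algebra_1) sspace \<Rightarrow> ('x, 'g) sform2 \<Rightarrow> ('x \<Rightarrow> 'g) \<Rightarrow> ('x \<Rightarrow> 'g) \<Rightarrow> 'x \<Rightarrow> 'g" where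
  "poisson M \<omega> f g = ham_vf M \<omega> f (total M) g"


section \<open>Weighted Courant algebroids\<close>

definition weighted_courant ::
    "nat \<Rightarrow> nat \<Rightarrow> nat \<Rightarrow> ('x, 'g::real_algebra_1) sspace \<Rightarrow> ('x, 'g) saction \<Rightarrow> ('x, 'g) saction \<Rightarrow>
     ('x, 'g) sform2 \<Rightarrow> ('x \<Rightarrow> 'g) \<Rightarrow> bool" where
  "weighted_courant k n m M h l \<omega> \<Theta> \<longleftrightarrow>
     1 \<le> k \<and>
     double_graded (k - 1) 2 n m M h l \<and> N_manifold 2 n m M l \<and>
     even_symplectic M \<omega> \<and> form_weight M h (k - 1) \<omega> \<and> form_weight M l 2 \<omega> \<and>
     \<Theta> \<in> sect M True (total M) \<and> fun_weight M h (k - 1) \<Theta> \<and> fun_weight M l 3 \<Theta> \<and>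
     poisson M \<omega> \<Theta> \<Theta> = 0"


section \<open>GL-bundles, their duals and their parity reversals\<close>

text \<open>
  The base is realised as the image of \<open>l\<^sub>0\<close> inside the total space; \<open>n\<close> is its dimension and \<open>r\<close>
  the rank.
\<close>

definition gl_bundle ::
    "nat \<Rightarrow> nat \<Rightarrow> nat \<Rightarrow> ('x, real) sspace \<Rightarrow> ('x, real) saction \<Rightarrow> ('x, real) saction \<Rightarrow> bool" where
  "gl_bundle k n r D h l \<longleftrightarrow> 1 \<le> k \<and> double_graded (k - 1) 1 (n + r) 0 D h l"

definition base :: "('x, real) sspace \<Rightarrow> ('x, real) saction \<Rightarrow> 'x set" where
  "base D l = bodymap (l 0) ` total D"

text \<open>
  Bi-homogeneous coordinates, the \<open>n\<close> base coordinates of bi-weight \<open>(u a, 0)\<close> preceding the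
  \<open>r\<close> linear ones of bi-weight \<open>(u (n + j), 1)\<close>.
\<close>

definition bundle_chart ::
    "nat \<Rightarrow> nat \<Rightarrow> nat \<Rightarrow> ('x, real) sspace \<Rightarrow> ('x, real) saction \<Rightarrow> ('x, real) saction \<Rightarrow>
     ('x, real) schart \<Rightarrow> (nat \<Rightarrow> nat) \<Rightarrow> bool" where
  "bundle_chart k n r D h l c u \<longleftrightarrow>
     (\<forall>a<n+r. u a \<le> k - 1) \<and>
     hom_chart (n + r) 0 D h c (\<lambda>A. u (snd A)) \<and>
     hom_chart (n + r) 0 D l c (\<lambda>A. if snd A < n then 0 else 1)"

text \<open>Functions over the open set \<open>U\<close> of the base that are basic (\<open>w = 0\<close>) or fibrewise linear (\<open>w = 1\<close>).\<close>

definition fibre_funs ::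
    "('x, real) sspace \<Rightarrow> ('x, real) saction \<Rightarrow> nat \<Rightarrow> 'x set \<Rightarrow> ('x \<Rightarrow> real) set" where
  "fibre_funs D l w U =
     {f \<in> sect D False (preim D (l 0) U). \<forall>t. pb (l t) (preim D (l 0) U) f = scl (t ^ w) f}"

text \<open>The coordinates \<open>(x, \<theta>)\<close> on the parity reversal induced by bundle coordinates \<open>(x, y)\<close>.\<close>

definition pi_chart ::
    "nat \<Rightarrow> ('x, real) sspace \<Rightarrow> ('x, real) saction \<Rightarrow> ('x set \<Rightarrow> ('x \<Rightarrow> real) \<Rightarrow> 'x \<Rightarrow> 'g) \<Rightarrow>
     ('x, real) schart \<Rightarrow> ('x, 'g) schart" where
  "pi_chart n D l P c =
     \<lparr>cdom = cdom c \<inter> base D l,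
      bmap = bmap c,
      pull = (\<lambda>W f. P W (pull c (preim D (l 0) W) (\<lambda>v. f (trunc n v)))),
      oddc = (\<lambda>j. P (cdom c \<inter> base D l) (coord c (False, n + j)))\<rparr>"

text \<open>
  \<open>M\<close> is the supermanifold obtained from \<open>D\<close> by reversing the parity of the linear coordinates. Its
  body is the base of \<open>D\<close>, and \<open>P\<close> sends basic functions on \<open>D\<close> to even and fibrewise linear
  functions to odd sections of \<open>M\<close>. The actions \<open>hM\<close>, \<open>lM\<close> are the ones induced by \<open>h\<close>, \<open>l\<close>.
  The first clause is the bi-homogeneous atlas of \<open>D\<close> from which the construction starts.
\<close>

definition parity_reversal ::
    "nat \<Rightarrow> nat \<Rightarrow> nat \<Rightarrow> ('x, real) sspace \<Rightarrow> ('x, real) saction \<Rightarrow> ('x, real) saction \<Rightarrow>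
     ('x, 'g::real_algebra_1) sspace \<Rightarrow> ('x set \<Rightarrow> ('x \<Rightarrow> real) \<Rightarrow> 'x \<Rightarrow> 'g) \<Rightarrow>
     ('x, 'g) saction \<Rightarrow> ('x, 'g) saction \<Rightarrow> bool" where
  "parity_reversal k n r D h l M P hM lM \<longleftrightarrow>
     (\<forall>x\<in>base D l. \<exists>c u. bundle_chart k n r D h l c u \<and> x \<in> cdom c) \<and>
     supermanifold n r M \<and> body M = subtopology (body D) (base D l) \<and>
     (\<forall>U. openin (body M) U \<longrightarrow>
        P U (res (preim D (l 0) U) 1) = res U 1 \<and>
        (\<forall>w f. w \<le> 1 \<and> f \<in> fibre_funs D l w U \<longrightarrow>
           P U f \<in> sect M (w = 1) U \<and>
           (\<forall>r. P U (scl r f) = scl r (P U f)) \<and>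
           (\<forall>g\<in>fibre_funs D l w U. P U (f + g) = P U f + P U g) \<and>
           (\<forall>g\<in>fibre_funs D l 0 U. P U (g * f) = P U g * P U f) \<and>
           (\<forall>W. openin (body M) W \<and> W \<subseteq> U \<longrightarrow> P W (res (preim D (l 0) W) f) = res W (P U f)))) \<and>
     (\<forall>c u. bundle_chart k n r D h l c u \<longrightarrow> chart n r M (pi_chart n D l P c)) \<and>
     monoid_action M hM \<and> monoid_action M lM \<and> commuting M hM lM \<and>
     (\<forall>(e, eM) \<in> {(h, hM), (l, lM)}.
        \<forall>t. (\<forall>x\<in>base D l. bodymap (eM t) x = bodymap (e t) x) \<and>
            (\<forall>U w f. openin (body M) U \<and> w \<le> 1 \<and> f \<in> fibre_funs D l w U \<longrightarrow>
               pb (eM t) U (P U f) = P (preim M (eM t) U) (pb (e t) (preim D (l 0) U) f)))"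

text \<open>
  Dual linear coordinates. The homeomorphism \<open>\<beta>\<close> identifies the bases of \<open>D\<close> and \<open>D'\<close>, and
  \<open>pr\<close> is the evaluation pairing of the two fibres over the same base point.
\<close>

definition dual_charts ::
    "nat \<Rightarrow> nat \<Rightarrow> nat \<Rightarrow>
     ('x, real) sspace \<Rightarrow> ('x, real) saction \<Rightarrow> ('x, real) saction \<Rightarrow>
     ('y, real) sspace \<Rightarrow> ('y, real) saction \<Rightarrow> ('y, real) saction \<Rightarrow>
     ('x \<Rightarrow> 'y) \<Rightarrow> ('x \<Rightarrow> 'y \<Rightarrow> real) \<Rightarrow>
     ('x, real) schart \<Rightarrow> (nat \<Rightarrow> nat) \<Rightarrow> ('y, real) schart \<Rightarrow> (nat \<Rightarrow> nat) \<Rightarrow> bool" where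
  "dual_charts k n r D h l D' h' l' \<beta> pr c u c' u' \<longleftrightarrow>
     bundle_chart k n r D h l c u \<and> bundle_chart k n r D' h' l' c' u' \<and>
     (\<forall>a<n. u' a = u a) \<and> (\<forall>j<r. u' (n + j) = k - 1 - u (n + j)) \<and>
     cdom c' \<inter> base D' l' = \<beta> ` (cdom c \<inter> base D l) \<and>
     (\<forall>x\<in>cdom c \<inter> base D l. bmap c' (\<beta> x) = bmap c x) \<and>
     (\<forall>d\<in>cdom c. \<forall>d'\<in>cdom c'. bodymap (l' 0) d' = \<beta> (bodymap (l 0) d) \<longrightarrow>
        pr d d' = (\<Sum>j<r. bmap c d (n + j) * bmap c' d' (n + j)))"

definition dual_bundle ::
    "nat \<Rightarrow> nat \<Rightarrow> nat \<Rightarrow>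
     ('x, real) sspace \<Rightarrow> ('x, real) saction \<Rightarrow> ('x, real) saction \<Rightarrow>
     ('y, real) sspace \<Rightarrow> ('y, real) saction \<Rightarrow> ('y, real) saction \<Rightarrow>
     ('x \<Rightarrow> 'y) \<Rightarrow> ('x \<Rightarrow> 'y \<Rightarrow> real) \<Rightarrow> bool" where
  "dual_bundle k n r D h l D' h' l' \<beta> pr \<longleftrightarrow>
     homeomorphic_map (subtopology (body D) (base D l)) (subtopology (body D') (base D' l')) \<beta> \<and>
     (\<forall>c u. bundle_chart k n r D h l c u \<longrightarrow>
        (\<exists>c' u'. dual_charts k n r D h l D' h' l' \<beta> pr c u c' u'))"


section \<open>Weighted Lie algebroids\<close>

text \<open>A GL-bundle with its parity reversal and a vector field on the latter.\<close>

record ('x, 'g) wla =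
  tot :: "('x, real) sspace"
  hact :: "('x, real) saction"
  lact :: "('x, real) saction"
  pim :: "('x, 'g) sspace"
  pemb :: "'x set \<Rightarrow> ('x \<Rightarrow> real) \<Rightarrow> 'x \<Rightarrow> 'g"
  phact :: "('x, 'g) saction"
  plact :: "('x, 'g) saction"
  hvf :: "('x, 'g) svf"

definition weighted_lie_algebroid :: "nat \<Rightarrow> nat \<Rightarrow> nat \<Rightarrow> ('x, 'g::real_algebra_1) wla \<Rightarrow> bool" where
  "weighted_lie_algebroid k n r L \<longleftrightarrow>
     gl_bundle k n r (tot L) (hact L) (lact L) \<and>
     parity_reversal k n r (tot L) (hact L) (lact L) (pim L) (pemb L) (phact L) (plact L) \<and>
     homological (pim L) (hvf L) \<and>
     vf_weight (pim L) (phact L) 0 (hvf L) \<and> vf_weight (pim L) (plact L) 1 (hvf L)"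


section \<open>Cotangent bundles of supermanifolds\<close>

text \<open>
  A cotangent bundle of \<open>M\<close> consists of a supermanifold with a projection onto \<open>M\<close> and the symbol map,
  which turns a vector field on \<open>U\<close> into the corresponding linear function over \<open>U\<close>.
\<close>

record ('z, 's, 'x, 'g) cot =
  csp :: "('z, 's) sspace"
  cpr :: "('z, 's, 'x, 'g) smor"
  csym :: "'x set \<Rightarrow> ('x, 'g) svf \<Rightarrow> 'z \<Rightarrow> 's"

abbreviation cpre :: "('z, 's, 'x, 'g) cot \<Rightarrow> 'x set \<Rightarrow> 'z set" where
  "cpre K U \<equiv> preim (csp K) (cpr K) U"

definition pos :: "('z, 's, 'x, 'g) cot \<Rightarrow> ('x, 'g) schart \<Rightarrow> bool \<times> nat \<Rightarrow> 'z \<Rightarrow> 's" where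
  "pos K c A = pb (cpr K) (cdom c) (coord c A)"

text \<open>The momentum conjugate to a coordinate is the symbol of the coordinate vector field.\<close>

definition mom ::
    "nat \<Rightarrow> nat \<Rightarrow> ('x, 'g::real_algebra_1) sspace \<Rightarrow> ('z, 's, 'x, 'g) cot \<Rightarrow> ('x, 'g) schart \<Rightarrow>
     bool \<times> nat \<Rightarrow> 'z \<Rightarrow> 's" where
  "mom n r M K c A = csym K (cdom c) (dcoord n r M c A)"

text \<open>The canonical chart over \<open>c\<close>: positions come first and the momenta are unrestricted.\<close>

definition cot_chart ::
    "nat \<Rightarrow> nat \<Rightarrow> ('x, 'g::real_algebra_1) sspace \<Rightarrow> ('z, 's::real_algebra_1, 'x, 'g) cot \<Rightarrow>
     ('x, 'g) schart \<Rightarrow> ('z, 's) schart \<Rightarrow> bool" where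
  "cot_chart n r M K c C \<longleftrightarrow>
     chart (2 * n) (2 * r) (csp K) C \<and>
     cdom C = cpre K (cdom c) \<and>
     bmap C ` cdom C = {w \<in> topspace (Euclidean_space (2 * n)). trunc n w \<in> bmap c ` cdom c} \<and>
     (\<forall>a<n. coord C (False, a) = pos K c (False, a) \<and>
            coord C (False, n + a) = mom n r M K c (False, a)) \<and>
     (\<forall>j<r. coord C (True, j) = pos K c (True, j) \<and>
            coord C (True, r + j) = mom n r M K c (True, j))"

definition cotangent ::
    "nat \<Rightarrow> nat \<Rightarrow> ('x, 'g::real_algebra_1) sspace \<Rightarrow> ('z, 's::real_algebra_1, 'x, 'g) cot \<Rightarrow> bool" where
  "cotangent n r M K \<longleftrightarrow>
     supermanifold (2 * n) (2 * r) (csp K) \<and> is_mor (csp K) M (cpr K) \<and>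
     (\<forall>U i X. openin (body M) U \<and> vfield M i U X \<longrightarrow>
        csym K U X \<in> sect (csp K) i (cpre K U) \<and>
        (\<forall>Y. vfield M i U Y \<longrightarrow> csym K U (vadd X Y) = csym K U X + csym K U Y) \<and>
        (\<forall>j. \<forall>f\<in>sect M j U. csym K U (vscl f X) = pb (cpr K) U f * csym K U X) \<and>
        (\<forall>W. openin (body M) W \<and> W \<subseteq> U \<longrightarrow> csym K W (vres W X) = res (cpre K W) (csym K U X))) \<and>
     (\<forall>c. chart n r M c \<longrightarrow> (\<exists>C. cot_chart n r M K c C))"

text \<open>The Liouville form: \<open>\<lambda>(X) = \<Sum>\<^sub>A X(z\<^sup>A) p\<^sub>A\<close> in all coordinates \<open>z\<close> of \<open>M\<close>.\<close>

definition liouville ::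
    "nat \<Rightarrow> nat \<Rightarrow> ('x, 'g::real_algebra_1) sspace \<Rightarrow> ('z, 's::real_algebra_1, 'x, 'g) cot \<Rightarrow>
     'z set \<Rightarrow> ('z, 's) svf \<Rightarrow> 'z \<Rightarrow> 's" where
  "liouville n r M K U X =
     (THE s. res U s = s \<and>
        (\<forall>c. chart n r M c \<longrightarrow>
           (let W = U \<inter> cpre K (cdom c) in
            res W s = (\<Sum>A\<in>cidx n r. X W (res W (pos K c A)) * mom n r M K c A))))"

text \<open>Cartan's formula for the differential of an even one-form; \<open>X\<close> and \<open>Y\<close> are homogeneous.\<close>

definition ext_d ::
    "('x, 'g::real_algebra_1) sspace \<Rightarrow> ('x set \<Rightarrow> ('x, 'g) svf \<Rightarrow> 'x \<Rightarrow> 'g) \<Rightarrow> ('x, 'g) sform2" where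
  "ext_d M \<eta> U X Y =
     (let i = vfield M True U X; j = vfield M True U Y in
      X U (\<eta> U Y) - scl (ksign i j) (Y U (\<eta> U X)) - \<eta> U (vbr i j X Y))"

definition canonical_form ::
    "nat \<Rightarrow> nat \<Rightarrow> ('x, 'g::real_algebra_1) sspace \<Rightarrow> ('z, 's::real_algebra_1, 'x, 'g) cot \<Rightarrow> ('z, 's) sform2"
  where "canonical_form n r M K = ext_d (csp K) (liouville n r M K)"

text \<open>The Hamiltonian of the homological vector field of \<open>L\<close>.\<close>

definition hamiltonian :: "('z, 's, 'x, 'g) cot \<Rightarrow> ('x, 'g) wla \<Rightarrow> 'z \<Rightarrow> 's" where
  "hamiltonian K L = csym K (total (pim L)) (hvf L)"


section \<open>Weighted Lie bi-algebroids\<close>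

text \<open>
  The canonical isomorphism \<open>R\<close> between the cotangent bundles \<open>K\<close> and \<open>K'\<close> of the parity reversals of
  a bundle and of its dual. In dual coordinates \<open>(x, \<theta>)\<close> and \<open>(x, \<chi>)\<close> it identifies the base
  coordinates and their momenta, and it exchanges \<open>\<theta>\<close> and \<open>\<chi>\<close>, each of which becomes the momentum
  conjugate to the other.
\<close>

definition canonical_iso ::
    "nat \<Rightarrow> nat \<Rightarrow> nat \<Rightarrow> ('x, 'g::real_algebra_1) wla \<Rightarrow> ('y, 'h::real_algebra_1) wla \<Rightarrow>
     ('x \<Rightarrow> 'y) \<Rightarrow> ('x \<Rightarrow> 'y \<Rightarrow> real) \<Rightarrow>
     ('z, 's::real_algebra_1, 'x, 'g) cot \<Rightarrow> ('w, 'q::real_algebra_1, 'y, 'h) cot \<Rightarrow>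
     ('z, 's, 'w, 'q) smor \<Rightarrow> bool" where
  "canonical_iso k n r L L' \<beta> pr K K' R \<longleftrightarrow>
     is_mor (csp K) (csp K') R \<and>
     (\<exists>R'. is_mor (csp K') (csp K) R' \<and>
        mor_eq (csp K) (csp K) (mcomp (csp K') R' R) mid \<and>
        mor_eq (csp K') (csp K') (mcomp (csp K) R R') mid) \<and>
     (\<forall>z\<in>total (csp K). bodymap (cpr K') (bodymap R z) = \<beta> (bodymap (cpr K) z)) \<and>
     (\<forall>c u c' u'.
        dual_charts k n r (tot L) (hact L) (lact L) (tot L') (hact L') (lact L') \<beta> pr c u c' u' \<longrightarrow>
        (let b = pi_chart n (tot L) (lact L) (pemb L) c;
             b' = pi_chart n (tot L') (lact L') (pemb L') c';
             U' = cpre K' (cdom b') in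
         (\<forall>a<n. pb R U' (pos K' b' (False, a)) = pos K b (False, a) \<and>
                pb R U' (mom n r (pim L') K' b' (False, a)) = mom n r (pim L) K b (False, a)) \<and>
         (\<forall>j<r. pb R U' (pos K' b' (True, j)) = mom n r (pim L) K b (True, j) \<and>
                pb R U' (mom n r (pim L') K' b' (True, j)) = pos K b (True, j))))"

text \<open>The Hamiltonian of \<open>L'\<close> transported to the cotangent bundle \<open>K\<close>.\<close>

definition dual_hamiltonian ::
    "('z, 's, 'w, 'q) smor \<Rightarrow> ('w, 'q, 'y, 'h) cot \<Rightarrow> ('y, 'h) wla \<Rightarrow> 'z \<Rightarrow> 's" where
  "dual_hamiltonian R K' L' = pb R (total (csp K')) (hamiltonian K' L')"

definition weighted_lie_bialgebroid ::
    "nat \<Rightarrow> nat \<Rightarrow> nat \<Rightarrow> ('x, 'g::real_algebra_1) wla \<Rightarrow> ('y, 'h::real_algebra_1) wla \<Rightarrow>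
     ('x \<Rightarrow> 'y) \<Rightarrow> ('x \<Rightarrow> 'y \<Rightarrow> real) \<Rightarrow>
     ('z, 's::real_algebra_1, 'x, 'g) cot \<Rightarrow> ('w, 'q::real_algebra_1, 'y, 'h) cot \<Rightarrow>
     ('z, 's, 'w, 'q) smor \<Rightarrow> bool" where
  "weighted_lie_bialgebroid k n r L L' \<beta> pr K K' R \<longleftrightarrow>
     weighted_lie_algebroid k n r L \<and> weighted_lie_algebroid k n r L' \<and>
     dual_bundle k n r (tot L) (hact L) (lact L) (tot L') (hact L') (lact L') \<beta> pr \<and>
     cotangent n r (pim L) K \<and> cotangent n r (pim L') K' \<and>
     canonical_iso k n r L L' \<beta> pr K K' R \<and>
     poisson (csp K) (canonical_form n r (pim L) K) (hamiltonian K L) (dual_hamiltonian R K' L') = 0"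

text \<open>
  The natural tri-weight of the cotangent bundle \<open>K\<close> of the parity reversal: the canonical coordinates
  \<open>(x, p | \<theta>, \<chi>)\<close> have tri-weights \<open>(u, 0, 0)\<close>, \<open>(k - 1 - u, 1, 1)\<close>, \<open>(u, 1, 0)\<close>, \<open>(k - 1 - u, 0, 1)\<close>, where
  \<open>u\<close> in the weights of \<open>p\<close> and \<open>\<chi>\<close> is the weight of the conjugate coordinate.
\<close>

definition tri_weight :: "nat \<Rightarrow> nat \<Rightarrow> nat \<Rightarrow> (nat \<Rightarrow> nat) \<Rightarrow> bool \<times> nat \<Rightarrow> nat \<times> nat \<times> nat" where
  "tri_weight k n r u A =
     (case A of
        (False, a) \<Rightarrow> if a < n then (u a, 0, 0) else (k - 1 - u (a - n), 1, 1)
      | (True, j) \<Rightarrow> if j < r then (u (n + j), 1, 0) else (k - 1 - u (n + (j - r)), 0, 1))"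

definition natural_triweight ::
    "nat \<Rightarrow> nat \<Rightarrow> nat \<Rightarrow> ('x, 'g::real_algebra_1) wla \<Rightarrow> ('z, 's::real_algebra_1, 'x, 'g) cot \<Rightarrow>
     ('z, 's) saction \<Rightarrow> ('z, 's) saction \<Rightarrow> ('z, 's) saction \<Rightarrow> bool" where
  "natural_triweight k n r L K h1 h2 h3 \<longleftrightarrow>
     monoid_action (csp K) h1 \<and> monoid_action (csp K) h2 \<and> monoid_action (csp K) h3 \<and>
     commuting (csp K) h1 h2 \<and> commuting (csp K) h1 h3 \<and> commuting (csp K) h2 h3 \<and>
     (\<forall>c u C. bundle_chart k n r (tot L) (hact L) (lact L) c u \<and>
        cot_chart n r (pim L) K (pi_chart n (tot L) (lact L) (pemb L) c) C \<longrightarrow>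
        hom_chart (2 * n) (2 * r) (csp K) h1 C (\<lambda>A. fst (tri_weight k n r u A)) \<and>
        hom_chart (2 * n) (2 * r) (csp K) h2 C (\<lambda>A. fst (snd (tri_weight k n r u A))) \<and>
        hom_chart (2 * n) (2 * r) (csp K) h3 C (\<lambda>A. snd (snd (tri_weight k n r u A))))"

text \<open>The action whose weights are the sums of the weights of two commuting actions.\<close>

definition add_weights ::
    "('x, 'g) sspace \<Rightarrow> ('x, 'g) saction \<Rightarrow> ('x, 'g) saction \<Rightarrow> ('x, 'g) saction" where
  "add_weights M h l = (\<lambda>t. mcomp M (h t) (l t))"

end

theory Submission
  imports Defs
begin

text \<open>
  All conditions are local, so they can be checked in the canonical charts \<open>(x, p | \<theta>, \<chi>)\<close> of the cotangent
  bundle, in which \<open>\<omega> = \<Sum> dp\<^sub>A \<and> dq\<^sub>A\<close> and \<open>\<Q> = \<Sum> \<pi>\<^sup>*(Q(q\<^sup>A)) p\<^sub>A\<close>; the weights of \<open>\<omega>\<close> and \<open>\<Q>\<close> can be read off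
  from these formulas. The Hamiltonian vector field \<open>X\<close> of \<open>\<Q>\<close> is \<open>\<pi>\<close>-related to \<open>Q\<close>, so \<open>Q\<^sup>2 = 0\<close> turns the
  evaluation of \<open>\<omega>\<close> on the pair \<open>(X, X)\<close> into \<open>2 X(\<Q>)\<close>. As it also equals \<open>X(\<Q>)\<close>, the bracket \<open>{\<Q>, \<Q>}\<close>
  vanishes. The dual Hamiltonian \<open>S\<close> has the same shape after the roles of \<open>\<theta>\<close> and \<open>\<chi>\<close> are exchanged; this preserves
  \<open>\<omega>\<close>, because \<open>d\<chi> \<and> d\<theta>\<close> is symmetric for odd coordinates. Hence \<open>{S, S} = 0\<close>, and \<open>{\<Q> + S, \<Q> + S} = 0\<close> by
  bilinearity and the assumption \<open>{\<Q>, S} = 0\<close>.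
\<close>

section \<open>Smooth functions\<close>

text \<open>A section takes germs as values, so sections cannot be compared through numbers, and a
  derivation comes with no continuity. One device closes both gaps: the ideal
  \<open>vanishing x\<close> together with Hadamard's lemma. A section that lies in this ideal at
  every point is zero, hence a morphism or a derivation is known as soon as its effect on
  coordinates is. This yields the coordinate fields, the chain rule and the transformation law of
  the momenta. The morphisms analysed in charts all pull even coordinates back to plain functions,
  without nilpotent parts, so that pullback is substitution and no Taylor series in nilpotents is
  needed. Global objects are given by definite descriptions (\<open>liouville\<close>,
  \<open>ham_vf\<close>); independence of the chart, uniqueness and gluing come before any use of
  them in coordinates. Two conditions resist a local treatment at first: parities of weights are
  demanded in all homogeneous charts, and homogeneity of coordinates is known only on their own
  domain. The first is settled by the action of -1, the second by the saturation of such
  domains.\<close>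

definition ecube :: "nat \<Rightarrow> (nat \<Rightarrow> real) \<Rightarrow> real \<Rightarrow> (nat \<Rightarrow> real) set" where
  "ecube n b e = {v. (\<forall>i<n. \<bar>v i - b i\<bar> < e) \<and> (\<forall>i\<ge>n. v i = 0)}"

lemma Euclidean_space_top_of_set: "Euclidean_space n = top_of_set {x. \<forall>i\<ge>n. x i = 0}"
  by (simp add: Euclidean_space_def euclidean_product_topology)

lemma openin_Euclidean_space_zero:
  "openin (Euclidean_space n) V \<Longrightarrow> v \<in> V \<Longrightarrow> i \<ge> n \<Longrightarrow> v i = 0"
  using openin_subset by (fastforce simp: topspace_Euclidean_space)

lemma openin_ecube: "openin (Euclidean_space n) (ecube n b e)"
proof -
  have "open (\<Inter>i<n. {v::nat \<Rightarrow> real. \<bar>v i - b i\<bar> < e})"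
    by (intro open_INT finite_lessThan ballI open_Collect_less continuous_intros
        continuous_on_product_coordinates)
  moreover have "ecube n b e = {x. \<forall>i\<ge>n. x i = 0} \<inter> (\<Inter>i<n. {v. \<bar>v i - b i\<bar> < e})"
    by (auto simp: ecube_def)
  ultimately show ?thesis
    unfolding Euclidean_space_top_of_set openin_open by blast
qed

text \<open>A basic product set restricts all coordinates at once, but those from \<open>n\<close>
  on are zero, so the first \<open>n\<close> radii decide. A cube around a point of n-space also
  contains the segments to its centre, as Hadamard's lemma requires.\<close>

lemma openin_contains_ecube:
  assumes "openin (Euclidean_space n) V" "b \<in> V"
  obtains e where "e > 0" "ecube n b e \<subseteq> V"
proof -
  obtain T where T: "open T" "V = {x. \<forall>i\<ge>n. x i = 0} \<inter> T"
    using assms(1) unfolding Euclidean_space_top_of_set by (auto simp: openin_open)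
  have "openin (product_topology (\<lambda>i. euclidean) UNIV) T"
    using T(1) by (simp add: euclidean_product_topology)
  from product_topology_open_contains_basis[OF this, of b] T assms(2)
  obtain X where X: "b \<in> (\<Pi>\<^sub>E i\<in>UNIV. X i)" "\<And>i. open (X i)" "(\<Pi>\<^sub>E i\<in>UNIV. X i) \<subseteq> T"
    by auto
  have "\<exists>e>0. \<forall>r. \<bar>r - b i\<bar> < e \<longrightarrow> r \<in> X i" for i
  proof -
    have "open (X i)" "b i \<in> X i" using X(1,2) by auto
    then show ?thesis by (auto simp: open_dist dist_real_def)
  qed
  then obtain e where e: "\<And>i. e i > 0" "\<And>i r. \<bar>r - b i\<bar> < e i \<Longrightarrow> r \<in> X i"
    by metis
  \<comment> \<open>The inserted 1 keeps the minimum defined for \<open>n = 0\<close>.\<close>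
  define d where "d = Min (insert 1 (e ` {..<n}))"
  have "d > 0" using e(1) by (auto simp: d_def)
  moreover have "d \<le> e i" if "i < n" for i
    using that by (auto simp: d_def)
  have "ecube n b d \<subseteq> V"
  proof
    fix v assume v: "v \<in> ecube n b d"
    have "v i \<in> X i" for i
    proof (cases "i < n")
      case True
      then show ?thesis using v e(2)[of "v i" i] \<open>i < n \<Longrightarrow> d \<le> e i\<close> by (force simp: ecube_def)
    next
      case False
      then have "v i = b i" using v T assms(2) by (auto simp: ecube_def)
      then show ?thesis using e by simp
    qed
    then have "v \<in> T" using X(3) by auto
    then show "v \<in> V" using v T by (auto simp: ecube_def)
  qed
  ultimately show ?thesis using that by blast
qed

lemma centre_in_ecube: "e > 0 \<Longrightarrow> openin (Euclidean_space n) V \<Longrightarrow> b \<in> V \<Longrightarrow> b \<in> ecube n b e"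
  using openin_Euclidean_space_zero by (auto simp: ecube_def)

section \<open>Derivatives along coordinate lines\<close>

lemma eventually_fun_upd_in_open:
  assumes "openin (Euclidean_space n) V" "v \<in> V" "i < n"
  shows "eventually (\<lambda>s. v(i := s) \<in> V) (nhds (v i))"
proof -
  obtain e where e: "e > 0" "ecube n v e \<subseteq> V"
    using openin_contains_ecube[OF assms(1,2)] .
  have "eventually (\<lambda>s. dist s (v i) < e) (nhds (v i))"
    using e(1) by (auto simp: eventually_nhds_metric)
  then show ?thesis
  proof eventually_elim
    case (elim s)
    then have "v(i := s) \<in> ecube n v e"
      using e(1) assms openin_Euclidean_space_zero[OF assms(1,2)]
      by (auto simp: ecube_def dist_real_def)
    then show ?case using e by blast
  qed
qed

lemma DERIV_fun_upd_cong:
  assumes "openin (Euclidean_space n) V" "v \<in> V" "i < n" "\<And>w. w \<in> V \<Longrightarrow> f w = g w"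
  shows "((\<lambda>s. f (v(i := s))) has_field_derivative d) (at (v i)) \<longleftrightarrow>
         ((\<lambda>s. g (v(i := s))) has_field_derivative d) (at (v i))"
proof -
  have "eventually (\<lambda>s. f (v(i := s)) = g (v(i := s))) (nhds (v i))"
    using eventually_fun_upd_in_open[OF assms(1-3)] by eventually_elim (rule assms(4))
  then show ?thesis by (intro DERIV_cong_ev) auto
qed

lemma pd_eqI: "((\<lambda>s. f (v(i := s))) has_field_derivative d) (at (v i)) \<Longrightarrow> pd i f v = d"
  unfolding pd_def by (rule DERIV_imp_deriv)

lemma DERIV_pd:
  "(\<lambda>s. f (v(i := s))) differentiable (at (v i)) \<Longrightarrow>
   ((\<lambda>s. f (v(i := s))) has_field_derivative pd i f v) (at (v i))"
  unfolding pd_def by (simp add: DERIV_deriv_iff_real_differentiable)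

lemma differentiable_DERIV_iff:
  fixes f :: "real \<Rightarrow> real"
  shows "f differentiable (at x) \<longleftrightarrow> (\<exists>d. (f has_field_derivative d) (at x))"
  by (simp add: real_differentiable_def)

lemma pd_cong:
  assumes "openin (Euclidean_space n) V" "\<And>w. w \<in> V \<Longrightarrow> f w = g w" "v \<in> V" "i < n"
  shows "pd i f v = pd i g v"
proof -
  have "eventually (\<lambda>s. f (v(i := s)) = g (v(i := s))) (nhds (v i))"
    using eventually_fun_upd_in_open[OF assms(1,3,4)] by eventually_elim (rule assms(2))
  then show ?thesis unfolding pd_def by (rule deriv_cong_ev) simp
qed

text \<open>Differentiability of order \<open>k\<close>, by recursion on \<open>k\<close> instead of
  on lists of indices: the derivative of a product or of a composite again contains the
  undifferentiated functions, one order lower, and this induction provides them.\<close>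

primrec ck :: "nat \<Rightarrow> (nat \<Rightarrow> real) set \<Rightarrow> nat \<Rightarrow> ((nat \<Rightarrow> real) \<Rightarrow> real) \<Rightarrow> bool" where
  "ck n V 0 f \<longleftrightarrow> continuous_on V f"
| "ck n V (Suc k) f \<longleftrightarrow> continuous_on V f \<and>
     (\<forall>i<n. (\<forall>v\<in>V. (\<lambda>s. f (v(i := s))) differentiable (at (v i))) \<and> ck n V k (pd i f))"

lemma ck_continuous_on: "ck n V k f \<Longrightarrow> continuous_on V f"
  by (cases k) auto

lemma ck_pd: "ck n V (Suc k) f \<Longrightarrow> i < n \<Longrightarrow> ck n V k (pd i f)"
  by simp

lemma ck_DERIV: "ck n V (Suc k) f \<Longrightarrow> i < n \<Longrightarrow> v \<in> V \<Longrightarrow>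
   ((\<lambda>s. f (v(i := s))) has_field_derivative pd i f v) (at (v i))"
  by (simp add: DERIV_pd)

lemma iter_pd_append: "iter_pd (xs @ [i]) f = iter_pd xs (pd i f)"
  by (induction xs) auto

text \<open>\<open>iter_pd\<close> applies the last index of its list first, and \<open>ck\<close>
  peels off the derivative that is taken first. Hence lists are extended at their end, and the
  converse goes by reverse induction.\<close>

lemma smooth_fun_iff_ck:
  assumes "openin (Euclidean_space n) V"
  shows "smooth_fun n V f \<longleftrightarrow> (\<forall>k. ck n V k f)"
proof -
  have sub: "V \<subseteq> {x. \<forall>i\<ge>n. x i = 0}"
    using openin_Euclidean_space_zero[OF assms] by blast
  have c: "continuous_map (subtopology (Euclidean_space n) V) euclideanreal g \<longleftrightarrow> continuous_on V g" for g
    using sub by (simp add: Euclidean_space_top_of_set subtopology_subtopology Int_absorb1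
        flip: continuous_map_iff_continuous)
  have s: "smooth_fun n V f \<longleftrightarrow> (\<forall>is. set is \<subseteq> {..<n} \<longrightarrow> continuous_on V (iter_pd is f) \<and>
        (\<forall>i<n. \<forall>v\<in>V. (\<lambda>s. iter_pd is f (v(i := s))) differentiable (at (v i))))" for f
    unfolding smooth_fun_def c ..
  have s0: "continuous_on V f" "i < n \<Longrightarrow> v \<in> V \<Longrightarrow> (\<lambda>s. f (v(i := s))) differentiable (at (v i))"
    if "smooth_fun n V f" for f i v
    using that[unfolded s, rule_format, of "[]"] by auto
  have s1: "smooth_fun n V (pd i f)" if f: "smooth_fun n V f" and i: "i < n" for f i
    unfolding s
  proof (intro allI impI)
    fix js assume "set js \<subseteq> {..<n}"
    then have "set (js @ [i]) \<subseteq> {..<n}" using i by auto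
    from f[unfolded s, rule_format, OF this]
    show "continuous_on V (iter_pd js (pd i f)) \<and>
        (\<forall>ia<n. \<forall>v\<in>V. (\<lambda>s. iter_pd js (pd i f) (v(ia := s))) differentiable (at (v ia)))"
      unfolding iter_pd_append by blast
  qed
  have "ck n V k f" if "smooth_fun n V f" for k f
    using that by (induction k arbitrary: f) (auto simp: s0 s1)
  moreover have "ck n V k (iter_pd js f)"
    if "\<forall>k. ck n V k f" "set js \<subseteq> {..<n}" for js k f
    using that
  proof (induction js arbitrary: f rule: rev_induct)
    case (snoc i js)
    have "\<forall>k. ck n V k (pd i f)"
      using snoc.prems(1)[rule_format, of "Suc _"] snoc.prems(2) by auto
    then show ?case using snoc unfolding iter_pd_append by simp
  qed simp
  then have "smooth_fun n V f" if "\<forall>k. ck n V k f"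
    unfolding s using that ck.simps(2)[of n V 0] by blast
  ultimately show ?thesis by blast
qed

lemma ck_Suc_imp: "ck n V (Suc k) f \<Longrightarrow> ck n V k f"
  by (induction k arbitrary: f) (auto simp del: ck.simps(2) simp add: ck.simps(2)[of n V])

lemma ck_subset: "ck n V k f \<Longrightarrow> V' \<subseteq> V \<Longrightarrow> ck n V' k f"
  by (induction k arbitrary: f) (auto intro: continuous_on_subset)

lemma ck_cong:
  assumes V: "openin (Euclidean_space n) V"
  shows "ck n V k f \<Longrightarrow> (\<And>w. w \<in> V \<Longrightarrow> f w = g w) \<Longrightarrow> ck n V k g"
proof (induction k arbitrary: f g)
  case 0
  then show ?case using continuous_on_cong[of V V f g] by simp
next
  case (Suc k)
  have "ck n V k (pd i g)" if "i < n" for i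
    by (rule Suc.IH[of "pd i f"]) (use Suc.prems that pd_cong[OF V Suc.prems(2)] in auto)
  moreover have "continuous_on V g"
    using Suc.prems continuous_on_cong[of V V f g] by simp
  moreover have "(\<lambda>s. g (v(i := s))) differentiable at (v i)" if "v \<in> V" "i < n" for v i
  proof -
    have "((\<lambda>s. f (v(i := s))) has_field_derivative pd i f v) (at (v i))"
      by (rule ck_DERIV[OF Suc.prems(1)]) (use that in auto)
    then have "((\<lambda>s. g (v(i := s))) has_field_derivative pd i f v) (at (v i))"
      by (subst (asm) DERIV_fun_upd_cong[OF V that Suc.prems(2)])
    then show ?thesis unfolding differentiable_DERIV_iff by blast
  qed
  ultimately show ?case by simp
qed

text \<open>A candidate \<open>f'\<close> has to be the partial derivative on \<open>V\<close> only;
  off \<open>V\<close> it may differ from \<open>pd i f\<close>, which \<open>ck_cong\<close>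
  absorbs.\<close>

lemma ck_SucI:
  assumes V: "openin (Euclidean_space n) V" and f: "continuous_on V f"
    and d: "\<And>i v. i < n \<Longrightarrow> v \<in> V \<Longrightarrow> ((\<lambda>s. f (v(i := s))) has_field_derivative f' i v) (at (v i))"
    and k: "\<And>i. i < n \<Longrightarrow> ck n V k (f' i)"
  shows "ck n V (Suc k) f"
proof -
  have "ck n V k (pd i f)" if "i < n" for i
    by (rule ck_cong[OF V k[OF that]]) (rule sym, rule pd_eqI, rule d[OF that])
  then show ?thesis using f d unfolding ck.simps differentiable_DERIV_iff by blast
qed

section \<open>Operations that preserve differentiability of finite order\<close>

lemma ck_const: "openin (Euclidean_space n) V \<Longrightarrow> ck n V k (\<lambda>v. r)"
proof (induction k arbitrary: r)
  case (Suc k)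
  show ?case
    by (rule ck_SucI[where f' = "\<lambda>i v. 0"]) (use Suc in \<open>auto intro!: derivative_eq_intros\<close>)
qed simp

lemma ck_coord: "openin (Euclidean_space n) V \<Longrightarrow> ck n V k (\<lambda>v. v a)"
proof (induction k)
  case 0
  show ?case using continuous_on_subset[OF continuous_on_product_coordinates] by simp
next
  case (Suc k)
  show ?case
  proof (rule ck_SucI[where f' = "\<lambda>i v. if a = i then 1 else 0"])
    show "continuous_on V (\<lambda>v. v a)"
      by (rule continuous_on_subset[OF continuous_on_product_coordinates]) simp
    show "((\<lambda>s. (v(i := s)) a) has_field_derivative (if a = i then 1 else 0)) (at (v i))" for v i
      by (cases "a = i") (auto intro!: derivative_eq_intros)
  qed (use Suc ck_const in auto)
qed

lemma ck_add: "openin (Euclidean_space n) V \<Longrightarrow> ck n V k f \<Longrightarrow> ck n V k g \<Longrightarrow> ck n V k (\<lambda>v. f v + g v)"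
proof (induction k arbitrary: f g)
  case (Suc k)
  show ?case
  proof (rule ck_SucI[where f' = "\<lambda>i v. pd i f v + pd i g v"])
    show "continuous_on V (\<lambda>v. f v + g v)"
      using Suc.prems by (auto intro!: continuous_intros)
    show "((\<lambda>s. f (v(i := s)) + g (v(i := s))) has_field_derivative pd i f v + pd i g v) (at (v i))"
      if "i < n" "v \<in> V" for v i
      by (intro DERIV_add ck_DERIV[OF Suc.prems(2)] ck_DERIV[OF Suc.prems(3)] that)
  qed (use Suc in auto)
qed (auto intro!: continuous_intros)

lemma ck_mult: "openin (Euclidean_space n) V \<Longrightarrow> ck n V k f \<Longrightarrow> ck n V k g \<Longrightarrow> ck n V k (\<lambda>v. f v * g v)"
proof (induction k arbitrary: f g)
  case (Suc k)
  show ?case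
  proof (rule ck_SucI[where f' = "\<lambda>i v. pd i f v * g v + pd i g v * f v"])
    show "continuous_on V (\<lambda>v. f v * g v)"
      using Suc.prems by (auto intro!: continuous_intros)
    show "((\<lambda>s. f (v(i := s)) * g (v(i := s))) has_field_derivative pd i f v * g v + pd i g v * f v) (at (v i))"
      if "i < n" "v \<in> V" for v i
      by (rule DERIV_cong[OF DERIV_mult'[OF ck_DERIV[OF Suc.prems(2) that] ck_DERIV[OF Suc.prems(3) that]]]) simp
    show "ck n V k (\<lambda>v. pd i f v * g v + pd i g v * f v)" if "i < n" for i
      by (intro ck_add Suc.IH) (use Suc.prems that ck_Suc_imp in auto)
  qed (use Suc in auto)
qed (auto intro!: continuous_intros)

lemma ck_inverse: "openin (Euclidean_space n) V \<Longrightarrow> ck n V k f \<Longrightarrow> (\<And>v. v \<in> V \<Longrightarrow> f v \<noteq> 0) \<Longrightarrow>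
   ck n V k (\<lambda>v. inverse (f v))"
proof (induction k)
  case (Suc k)
  have IH: "ck n V k (\<lambda>v. inverse (f v))"
    using Suc ck_Suc_imp by blast
  \<comment> \<open>The derivative is written with products and a constant factor only, under which
    \<open>ck\<close> is already known to be closed.\<close>
  show ?case
  proof (rule ck_SucI[where f' = "\<lambda>i v. -1 * (pd i f v * (inverse (f v) * inverse (f v)))"])
    show "continuous_on V (\<lambda>v. inverse (f v))"
      using Suc.prems by (auto intro!: continuous_intros)
    show "((\<lambda>s. inverse (f (v(i := s)))) has_field_derivative
        -1 * (pd i f v * (inverse (f v) * inverse (f v)))) (at (v i))"
      if "i < n" "v \<in> V" for v i
    proof -
      have "f (v(i := v i)) \<noteq> 0" using Suc.prems(3)[OF that(2)] by simp
      show ?thesis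
        by (rule DERIV_cong[OF DERIV_inverse'[OF ck_DERIV[OF Suc.prems(2) that] \<open>f (v(i := v i)) \<noteq> 0\<close>]]) simp
    qed
    show "ck n V k (\<lambda>v. -1 * (pd i f v * (inverse (f v) * inverse (f v))))" if "i < n" for i
      by (intro ck_mult IH ck_const) (use Suc.prems that in auto)
  qed (use Suc in auto)
qed (auto intro!: continuous_intros)

lemma ck_sum: "openin (Euclidean_space n) V \<Longrightarrow> (\<And>a. a \<in> A \<Longrightarrow> ck n V k (f a)) \<Longrightarrow>
   ck n V k (\<lambda>v. \<Sum>a\<in>A. f a v)"
  by (induction A rule: infinite_finite_induct) (auto intro: ck_add ck_const)

section \<open>First-order Taylor estimate and the chain rule\<close>

lemma taylor_first_order:
  assumes V: "openin (Euclidean_space n) V" and G: "ck n V 1 G" and v: "v \<in> V" and e: "e > 0"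
  obtains d where "d > 0" "ecube n v d \<subseteq> V"
    "\<And>w. w \<in> ecube n v d \<Longrightarrow>
       \<bar>G w - G v - (\<Sum>a<n. pd a G v * (w a - v a))\<bar> \<le> e * (\<Sum>a<n. \<bar>w a - v a\<bar>)"
proof -
  let ?W = "\<lambda>a. {w \<in> V. \<bar>pd a G w - pd a G v\<bar> < e}"
  have W: "openin (Euclidean_space n) (?W a)" if "a < n" for a
  proof -
    have "continuous_on V (\<lambda>w. \<bar>pd a G w - pd a G v\<bar>)"
      using G that by (auto intro!: continuous_intros)
    then have "openin (top_of_set V) (V \<inter> (\<lambda>w. \<bar>pd a G w - pd a G v\<bar>) -` {..<e})"
      by (intro continuous_openin_preimage_gen) auto
    moreover have "top_of_set V = subtopology (Euclidean_space n) V"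
      using openin_subset[OF V] by (simp add: Euclidean_space_top_of_set subtopology_subtopology Int_absorb1)
    moreover have "V \<inter> (\<lambda>w. \<bar>pd a G w - pd a G v\<bar>) -` {..<e} = ?W a" by auto
    ultimately show ?thesis using openin_trans_full[OF _ V] by simp
  qed
  \<comment> \<open>Intersecting with \<open>V\<close> gives the right set also for
    \<open>n = 0\<close>, when the indexed intersection is everything.\<close>
  let ?U = "V \<inter> (\<Inter>a\<in>{..<n}. ?W a)"
  have "openin (Euclidean_space n) ?U"
    using openin_INT[of "{..<n}" "Euclidean_space n" ?W] W V
    by (cases "n = 0") (auto intro!: openin_Int openin_INT2)
  moreover have "v \<in> ?U" using v e by auto
  ultimately obtain d where d: "d > 0" "ecube n v d \<subseteq> ?U"
    by (rule openin_contains_ecube)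
  have main: "\<bar>G w - G v - (\<Sum>a<n. pd a G v * (w a - v a))\<bar> \<le> e * (\<Sum>a<n. \<bar>w a - v a\<bar>)"
    if w: "w \<in> ecube n v d" for w
  proof -
    \<comment> \<open>Moving from \<open>v\<close> to \<open>w\<close> one coordinate at a time
      turns the estimate into \<open>n\<close> mean value estimates in one variable.\<close>
    define z where "z m = (\<lambda>i. if i < m then w i else v i)" for m :: nat
    have z0: "z 0 = v" by (auto simp: z_def)
    have zn: "z n = w"
      using w openin_Euclidean_space_zero[OF V v] by (auto simp: z_def ecube_def fun_eq_iff)
    have step: "\<bar>G (z (Suc m)) - G (z m) - pd m G v * (w m - v m)\<bar> \<le> e * \<bar>w m - v m\<bar>" if m: "m < n" for m
    proof -
      have zs: "(z m)(m := s) \<in> ecube n v d" if "s \<in> closed_segment (v m) (w m)" for s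
      proof -
        have "\<bar>s - v m\<bar> \<le> \<bar>w m - v m\<bar>"
          using that by (auto simp: closed_segment_eq_real_ivl split: if_splits)
        then show ?thesis
          using w m d(1) openin_Euclidean_space_zero[OF V v] by (auto simp: ecube_def z_def)
      qed
      \<comment> \<open>With the linear part subtracted, the derivative stays below \<open>e\<close>
        on the segment, and the mean value inequality bounds one step.\<close>
      define \<phi> where "\<phi> s = G ((z m)(m := s)) - pd m G v * s" for s
      have "norm (\<phi> (w m) - \<phi> (v m)) \<le> e * norm (w m - v m)"
      proof (rule field_differentiable_bound[where S = "closed_segment (v m) (w m)"])
        fix s assume s: "s \<in> closed_segment (v m) (w m)"
        have "((\<lambda>s'. G (((z m)(m := s))(m := s'))) has_field_derivative pd m G ((z m)(m := s)))
            (at (((z m)(m := s)) m))"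
          by (rule ck_DERIV[OF G[unfolded One_nat_def] m]) (use zs[OF s] d in blast)
        then have "(\<phi> has_field_derivative pd m G ((z m)(m := s)) - pd m G v) (at s)"
          unfolding \<phi>_def by (auto intro!: derivative_eq_intros)
        then show "(\<phi> has_field_derivative pd m G ((z m)(m := s)) - pd m G v)
            (at s within closed_segment (v m) (w m))"
          by (rule has_field_derivative_at_within)
        show "norm (pd m G ((z m)(m := s)) - pd m G v) \<le> e"
          using zs[OF s] d m by (auto intro: less_imp_le)
      qed auto
      moreover have "(z m)(m := w m) = z (Suc m)" "(z m)(m := v m) = z m"
        by (auto simp: z_def)
      ultimately show ?thesis by (simp add: \<phi>_def algebra_simps)
    qed
    have "G w - G v - (\<Sum>a<n. pd a G v * (w a - v a)) =
        (\<Sum>m<n. G (z (Suc m)) - G (z m) - pd m G v * (w m - v m))"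
      using sum_lessThan_telescope[of "\<lambda>m. G (z m)" n] by (simp add: sum_subtractf z0 zn)
    also have "\<bar>\<dots>\<bar> \<le> (\<Sum>m<n. e * \<bar>w m - v m\<bar>)"
      by (rule order_trans[OF sum_abs]) (intro sum_mono, use step in auto)
    finally show ?thesis by (simp add: sum_distrib_left)
  qed
  show ?thesis by (rule that[OF d(1) _ main]) (use d in auto)
qed

text \<open>Points are functions \<open>nat \<Rightarrow> real\<close> without a norm, so the
  derivative of \<open>G\<close> is not at hand as a linear map. Instead the remainder
  \<open>R\<close> after the linear part \<open>L\<close> is shown to have derivative 0, by the
  Taylor estimate and a Lipschitz bound for the coordinates of the curve.\<close>

lemma DERIV_compose_coords:
  assumes V: "openin (Euclidean_space n) V" and G: "ck n V 1 G" and v: "\<gamma> s0 \<in> V"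
    and z: "eventually (\<lambda>s. \<forall>i\<ge>n. \<gamma> s i = 0) (nhds s0)"
    and \<gamma>: "\<And>a. a < n \<Longrightarrow> ((\<lambda>s. \<gamma> s a) has_field_derivative \<gamma>' a) (at s0)"
  shows "((\<lambda>s. G (\<gamma> s)) has_field_derivative (\<Sum>a<n. pd a G (\<gamma> s0) * \<gamma>' a)) (at s0)"
proof -
  let ?v = "\<gamma> s0"
  define L where "L s = (\<Sum>a<n. pd a G ?v * (\<gamma> s a - ?v a))" for s
  define R where "R s = G (\<gamma> s) - G ?v - L s" for s
  \<comment> \<open>\<open>C\<close> bounds the sum of the Lipschitz constants used below, one for
    each coordinate; the last summand makes it positive even for \<open>n = 0\<close>.\<close>
  define C where "C = (\<Sum>a<n. \<bar>\<gamma>' a\<bar> + 1) + 1"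
  have C: "C > 0" by (simp add: C_def add_nonneg_pos sum_nonneg)
  have "(R has_derivative (\<lambda>h. 0)) (at s0)"
    unfolding has_derivative_at_alt
  proof (intro conjI allI impI)
    fix e :: real assume e: "e > 0"
    obtain d where d: "d > 0" "ecube n ?v d \<subseteq> V"
      "\<And>w. w \<in> ecube n ?v d \<Longrightarrow>
       \<bar>G w - G ?v - (\<Sum>a<n. pd a G ?v * (w a - ?v a))\<bar> \<le> e / C * (\<Sum>a<n. \<bar>w a - ?v a\<bar>)"
      using taylor_first_order[OF V G v divide_pos_pos[OF e C]] by blast
    have near: "eventually (\<lambda>s. \<bar>\<gamma> s a - ?v a\<bar> < d) (nhds s0)" if "a < n" for a
    proof -
      have "isCont (\<lambda>s. \<gamma> s a) s0" using \<gamma>[OF that] DERIV_isCont by blast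
      then have "((\<lambda>s. \<gamma> s a) \<longlongrightarrow> ?v a) (nhds s0)"
        using tendsto_at_iff_tendsto_nhds[of "\<lambda>s. \<gamma> s a" s0] by (simp add: isCont_def)
      from tendstoD[OF this d(1)] show ?thesis by (simp add: dist_real_def)
    qed
    have lip: "eventually (\<lambda>s. \<bar>\<gamma> s a - ?v a\<bar> \<le> (\<bar>\<gamma>' a\<bar> + 1) * \<bar>s - s0\<bar>) (nhds s0)" if a: "a < n" for a
    proof -
      obtain \<delta> where \<delta>: "\<delta> > 0" "\<And>y. norm (y - s0) < \<delta> \<Longrightarrow>
          norm (\<gamma> y a - ?v a - \<gamma>' a * (y - s0)) \<le> 1 * norm (y - s0)"
        using \<gamma>[OF a] unfolding has_field_derivative_def has_derivative_at_alt
        by (metis zero_less_one)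
      show ?thesis unfolding eventually_nhds_metric
      proof (intro exI[of _ \<delta>] conjI allI impI \<delta>(1))
        fix y assume "dist y s0 < \<delta>"
        then have "\<bar>\<gamma> y a - ?v a - \<gamma>' a * (y - s0)\<bar> \<le> \<bar>y - s0\<bar>"
          using \<delta>(2)[of y] by (simp add: dist_real_def)
        moreover have "\<bar>\<gamma> y a - ?v a\<bar> \<le> \<bar>\<gamma> y a - ?v a - \<gamma>' a * (y - s0)\<bar> + \<bar>\<gamma>' a * (y - s0)\<bar>"
          by linarith
        ultimately show "\<bar>\<gamma> y a - ?v a\<bar> \<le> (\<bar>\<gamma>' a\<bar> + 1) * \<bar>y - s0\<bar>"
          unfolding abs_mult[of "\<gamma>' a" "y - s0"] distrib_right by linarith
      qed
    qed
    have "eventually (\<lambda>s. (\<forall>i\<ge>n. \<gamma> s i = 0) \<and>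
        (\<forall>a\<in>{..<n}. \<bar>\<gamma> s a - ?v a\<bar> < d \<and> \<bar>\<gamma> s a - ?v a\<bar> \<le> (\<bar>\<gamma>' a\<bar> + 1) * \<bar>s - s0\<bar>)) (nhds s0)"
      by (intro eventually_conj z eventually_ball_finite ballI near lip) auto
    then obtain \<delta> where \<delta>: "\<delta> > 0" "\<And>s. dist s s0 < \<delta> \<Longrightarrow> (\<forall>i\<ge>n. \<gamma> s i = 0) \<and>
        (\<forall>a\<in>{..<n}. \<bar>\<gamma> s a - ?v a\<bar> < d \<and> \<bar>\<gamma> s a - ?v a\<bar> \<le> (\<bar>\<gamma>' a\<bar> + 1) * \<bar>s - s0\<bar>)"
      unfolding eventually_nhds_metric by blast
    show "\<exists>\<delta>>0. \<forall>y. norm (y - s0) < \<delta> \<longrightarrow> norm (R y - R s0 - 0) \<le> e * norm (y - s0)"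
    proof (intro exI[of _ \<delta>] conjI allI impI \<delta>(1))
      fix y assume "norm (y - s0) < \<delta>"
      then have y: "\<forall>i\<ge>n. \<gamma> y i = 0"
        "\<And>a. a < n \<Longrightarrow> \<bar>\<gamma> y a - ?v a\<bar> < d \<and> \<bar>\<gamma> y a - ?v a\<bar> \<le> (\<bar>\<gamma>' a\<bar> + 1) * \<bar>y - s0\<bar>"
        using \<delta>(2)[of y] by (auto simp: dist_real_def)
      have "\<bar>R y\<bar> \<le> e / C * (\<Sum>a<n. \<bar>\<gamma> y a - ?v a\<bar>)"
        unfolding R_def L_def by (rule d(3)) (use y in \<open>auto simp: ecube_def\<close>)
      also have "\<dots> \<le> e / C * (\<Sum>a<n. (\<bar>\<gamma>' a\<bar> + 1) * \<bar>y - s0\<bar>)"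
        using y e C by (intro mult_left_mono sum_mono) auto
      also have "\<dots> = e / C * ((\<Sum>a<n. \<bar>\<gamma>' a\<bar> + 1) * \<bar>y - s0\<bar>)"
        by (simp add: sum_distrib_right)
      also have "\<dots> \<le> e / C * (C * \<bar>y - s0\<bar>)"
        using e C by (intro mult_left_mono mult_right_mono) (auto simp: C_def)
      also have "\<dots> = e * \<bar>y - s0\<bar>" using C by simp
      finally show "norm (R y - R s0 - 0) \<le> e * norm (y - s0)"
        by (simp add: R_def L_def)
    qed
  qed simp
  moreover have "(\<lambda>h. 0) = (*) (0::real)" by auto
  ultimately have "(R has_field_derivative 0) (at s0)"
    by (simp add: has_field_derivative_def)
  moreover have "(L has_field_derivative (\<Sum>a<n. pd a G ?v * \<gamma>' a)) (at s0)"
    unfolding L_def by (auto intro!: derivative_eq_intros \<gamma> sum.cong)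
  ultimately have "((\<lambda>s. R s + L s + G ?v) has_field_derivative 0 + (\<Sum>a<n. pd a G ?v * \<gamma>' a) + 0) (at s0)"
    by (intro DERIV_add DERIV_const)
  then show ?thesis by (simp add: R_def)
qed

lemma ck_compose:
  assumes V: "openin (Euclidean_space n) V" and V': "openin (Euclidean_space n') V'"
    and \<sigma>V: "\<And>v. v \<in> V \<Longrightarrow> \<sigma> v \<in> V'" and \<sigma>: "\<And>a. a < n' \<Longrightarrow> ck n V k (\<lambda>v. \<sigma> v a)"
  shows "ck n' V' k G \<Longrightarrow> ck n V k (\<lambda>v. G (\<sigma> v))"
  using \<sigma>
proof (induction k arbitrary: G)
  \<comment> \<open>Coordinates from \<open>n'\<close> on vanish because \<open>\<sigma>\<close>
    maps into \<open>V'\<close>; the hypotheses speak of the first \<open>n'\<close> only, while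
    continuity of \<open>\<sigma>\<close> concerns all.\<close>
  have cont: "continuous_on V \<sigma>" if "\<And>a. a < n' \<Longrightarrow> continuous_on V (\<lambda>v. \<sigma> v a)"
  proof (rule continuous_on_coordinatewise_then_product)
    fix a show "continuous_on V (\<lambda>v. \<sigma> v a)"
    proof (cases "a < n'")
      case False
      then have "\<And>v. v \<in> V \<Longrightarrow> \<sigma> v a = 0"
        using \<sigma>V openin_Euclidean_space_zero[OF V'] by auto
      then show ?thesis using continuous_on_cong[of V V "\<lambda>v. \<sigma> v a" "\<lambda>_. 0"] by simp
    qed (use that in auto)
  qed
  {
    case 0
    then show ?case using cont \<sigma>V
      by (auto intro: continuous_on_compose2[of V' G V \<sigma>])
  }
  {
    case (Suc k)
    have \<sigma>c: "continuous_on V \<sigma>" by (rule cont) (use Suc.prems(2) in auto)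
    show ?case
    proof (rule ck_SucI[OF V, where f' = "\<lambda>i v. \<Sum>a<n'. pd a G (\<sigma> v) * pd i (\<lambda>v. \<sigma> v a) v"])
      show "continuous_on V (\<lambda>v. G (\<sigma> v))"
        using Suc.prems \<sigma>c \<sigma>V by (auto intro: continuous_on_compose2[of V' G V \<sigma>])
      fix i assume i: "i < n"
      show "((\<lambda>s. G (\<sigma> (v(i := s)))) has_field_derivative
          (\<Sum>a<n'. pd a G (\<sigma> v) * pd i (\<lambda>v. \<sigma> v a) v)) (at (v i))" if v: "v \<in> V" for v
      proof -
        have G1: "ck n' V' 1 G"
          using Suc.prems(1) by (auto intro: ck_continuous_on)
        have e: "eventually (\<lambda>s. \<forall>i'\<ge>n'. \<sigma> (v(i := s)) i' = 0) (nhds (v i))"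
          using eventually_fun_upd_in_open[OF V v i]
          by eventually_elim (use \<sigma>V openin_Euclidean_space_zero[OF V'] in auto)
        show ?thesis
          using DERIV_compose_coords[OF V' G1, of "\<lambda>s. \<sigma> (v(i := s))" "v i" "\<lambda>a. pd i (\<lambda>v. \<sigma> v a) v"]
            e \<sigma>V[OF v] ck_DERIV[OF Suc.prems(2) i v] by simp
      qed
      show "ck n V k (\<lambda>v. \<Sum>a<n'. pd a G (\<sigma> v) * pd i (\<lambda>v. \<sigma> v a) v)"
      proof (intro ck_sum V ck_mult)
        fix a assume a: "a \<in> {..<n'}"
        show "ck n V k (\<lambda>v. pd a G (\<sigma> v))"
          by (rule Suc.IH) (use Suc.prems a ck_Suc_imp in auto)
        show "ck n V k (pd i (\<lambda>v. \<sigma> v a))"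
          using Suc.prems(2)[of a] a i by auto
      qed
    qed
  }
qed

section \<open>Hadamard's lemma on cubes\<close>

context
  fixes n :: nat and b :: "nat \<Rightarrow> real" and e :: real
  assumes e: "e > 0" and b0: "\<And>i. i \<ge> n \<Longrightarrow> b i = 0"
begin

abbreviation (input) "seg s v \<equiv> (\<lambda>i::nat. b i + s * (v i - b i) :: real)"

lemma seg_in_ecube: "v \<in> ecube n b e \<Longrightarrow> s \<in> {0..1} \<Longrightarrow> seg s v \<in> ecube n b e"
proof -
  assume v: "v \<in> ecube n b e" and s: "s \<in> {0..1}"
  have "\<bar>s * (v i - b i)\<bar> < e" if "i < n" for i
  proof -
    have "\<bar>s * (v i - b i)\<bar> \<le> 1 * \<bar>v i - b i\<bar>"
      using s unfolding abs_mult by (intro mult_right_mono) auto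
    then show ?thesis using v that by (auto simp: ecube_def)
  qed
  then show ?thesis using v b0 by (auto simp: ecube_def)
qed

lemma continuous_on_seg: "continuous_on A (\<lambda>(v, s). seg s v)"
  unfolding case_prod_beta
proof (rule continuous_on_coordinatewise_then_product)
  fix i
  have "continuous_on A (\<lambda>p. fst p i)"
    by (rule continuous_on_compose2[OF continuous_on_product_coordinates[of i] continuous_on_fst]) auto
  then show "continuous_on A (\<lambda>p. seg (snd p) (fst p) i)"
    by (intro continuous_intros)
qed

lemma continuous_on_seg_integrand:
  assumes "continuous_on (ecube n b e) K"
  shows "continuous_on (ecube n b e \<times> cbox 0 1) (\<lambda>(v, s). s ^ m * K (seg s v))"
proof -
  have "continuous_on (ecube n b e \<times> cbox 0 1) (\<lambda>p. K ((\<lambda>(v, s). seg s v) p))"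
    by (rule continuous_on_compose2[OF assms continuous_on_seg]) (auto intro!: seg_in_ecube)
  then show ?thesis unfolding case_prod_beta by (auto intro!: continuous_intros)
qed

text \<open>Differentiation under the integral sign turns \<open>s ^ m\<close> into
  \<open>s ^ Suc m\<close>, since the segment has inner derivative \<open>s\<close>. The power is
  therefore kept general in the induction.\<close>

lemma ck_seg_integral:
  assumes "\<And>k. ck n (ecube n b e) k K"
  shows "ck n (ecube n b e) k (\<lambda>v. integral {0..1} (\<lambda>s. s ^ m * K (seg s v)))"
  using assms
proof (induction k arbitrary: m K)
  case (0)
  then show ?case
    using integral_continuous_on_param[OF continuous_on_seg_integrand[OF ck_continuous_on[OF "0.prems"[of 0]], of m]]
    by simp
next
  case (Suc k)
  have K1: "ck n (ecube n b e) 1 K" and K0: "continuous_on (ecube n b e) K"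
    using Suc.prems ck_continuous_on by blast+
  have Kp: "ck n (ecube n b e) k (pd i K)" if "i < n" for i k
    using Suc.prems[of "Suc k"] that by simp
  show ?case
  proof (rule ck_SucI[OF openin_ecube, where f' = "\<lambda>i v. integral {0..1} (\<lambda>s. s ^ Suc m * pd i K (seg s v))"])
    show "continuous_on (ecube n b e) (\<lambda>v. integral {0..1} (\<lambda>s. s ^ m * K (seg s v)))"
      using integral_continuous_on_param[OF continuous_on_seg_integrand[OF K0, of m]] by simp
    fix i assume i: "i < n"
    then show "ck n (ecube n b e) k (\<lambda>v. integral {0..1} (\<lambda>s. s ^ Suc m * pd i K (seg s v)))"
      using Suc.IH Kp by blast
    fix v assume v: "v \<in> ecube n b e"
    let ?U = "{b i - e<..<b i + e}"
    have vU: "v(i := r) \<in> ecube n b e" if "r \<in> ?U" for r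
      using that v i by (auto simp: ecube_def abs_less_iff)
    have vi: "v i \<in> ?U" using v i by (auto simp: ecube_def abs_less_iff)
    have c_upd: "continuous_on A (\<lambda>r. v(i := r))" for A
    proof (rule continuous_on_coordinatewise_then_product)
      show "continuous_on A (\<lambda>r. (v(i := r)) j)" for j
        by (cases "j = i") (auto intro!: continuous_intros)
    qed
    have pair: "continuous_on (?U \<times> cbox 0 1) (\<lambda>p. (v(i := fst p), snd p))"
      by (intro continuous_intros continuous_on_compose2[OF c_upd[of UNIV]]) auto
    have cp: "continuous_on (?U \<times> cbox 0 1) (\<lambda>(r, s). s ^ Suc m * pd i K (seg s (v(i := r))))"
    proof -
      have "(\<lambda>p. (v(i := fst p), snd p)) ` (?U \<times> cbox 0 1) \<subseteq> ecube n b e \<times> cbox 0 1"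
        using vU by (intro image_subsetI) (metis mem_Sigma_iff prod.collapse)
      from continuous_on_compose2[OF continuous_on_seg_integrand[OF ck_continuous_on[OF Kp[OF i, of 0]], of "Suc m"] pair this]
      show ?thesis unfolding case_prod_beta fst_conv snd_conv .
    qed
    have der: "((\<lambda>r. s ^ m * K (seg s (v(i := r)))) has_field_derivative
        s ^ Suc m * pd i K (seg s (v(i := r)))) (at r)"
      if "r \<in> ?U" "s \<in> cbox 0 1" for r s
    proof -
      have in1: "seg s (v(i := r)) \<in> ecube n b e"
        by (rule seg_in_ecube[OF vU[OF that(1)]]) (use that in auto)
      have "((\<lambda>r. K (seg s (v(i := r)))) has_field_derivative
        (\<Sum>a<n. pd a K (seg s (v(i := r))) * (if a = i then s else 0))) (at r)"
      proof (rule DERIV_compose_coords[where \<gamma> = "\<lambda>r. seg s (v(i := r))", OF openin_ecube K1 in1])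
        show "\<forall>\<^sub>F r in nhds r. \<forall>ia\<ge>n. seg s (v(i := r)) ia = 0"
          using v i b0 by (auto simp: ecube_def)
        show "((\<lambda>r. seg s (v(i := r)) a) has_field_derivative (if a = i then s else 0)) (at r)" for a
          by (cases "a = i") (auto intro!: derivative_eq_intros)
      qed
      then have "((\<lambda>r. K (seg s (v(i := r)))) has_field_derivative pd i K (seg s (v(i := r))) * s) (at r)"
        using i by (simp add: if_distrib[of "\<lambda>x. _ * x"] cong: if_cong)
      from DERIV_cmult[OF this, of "s ^ m"] show ?thesis by (simp add: mult_ac)
    qed
    have "((\<lambda>r. integral (cbox 0 1) (\<lambda>s. s ^ m * K (seg s (v(i := r))))) has_field_derivative
        integral (cbox 0 1) (\<lambda>s. s ^ Suc m * pd i K (seg s (v(i := v i))))) (at (v i) within ?U)"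
    proof (rule leibniz_rule_field_derivative[OF _ _ cp vi])
      show "((\<lambda>r. s ^ m * K (seg s (v(i := r)))) has_field_derivative
          s ^ Suc m * pd i K (seg s (v(i := r)))) (at r within ?U)" if "r \<in> ?U" "s \<in> cbox 0 1" for r s
        using der[OF that] by (rule has_field_derivative_at_within)
      show "(\<lambda>s. s ^ m * K (seg s (v(i := r)))) integrable_on cbox 0 1" if "r \<in> ?U" for r
      proof (rule integrable_continuous)
        show "continuous_on (cbox 0 1) (\<lambda>s. s ^ m * K (seg s (v(i := r))))"
        proof -
          have "continuous_on (cbox 0 (1::real)) (\<lambda>s. (v(i := r), s))" by (intro continuous_intros)
          from continuous_on_compose2[OF continuous_on_seg_integrand[OF K0, of m] this] vU[OF that]
          show ?thesis unfolding case_prod_beta fst_conv snd_conv by auto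
        qed
      qed
    qed auto
    then show "((\<lambda>r. integral {0..1} (\<lambda>s. s ^ m * K (seg s (v(i := r))))) has_field_derivative
        integral {0..1} (\<lambda>s. s ^ Suc m * pd i K (seg s v))) (at (v i))"
      using vi by (simp add: at_within_open[OF vi])
  qed
qed

text \<open>The fundamental theorem of calculus along the segment from \<open>b\<close> to
  \<open>v\<close>: each factor \<open>g a\<close> is the mean of a partial derivative of
  \<open>G\<close> over that segment.\<close>

lemma hadamard_ck:
  assumes G: "\<And>k. ck n (ecube n b e) k G"
  shows "\<exists>g. (\<forall>a<n. \<forall>k. ck n (ecube n b e) k (g a)) \<and>
     (\<forall>v\<in>ecube n b e. G v = G b + (\<Sum>a<n. (v a - b a) * g a v))"
proof (intro exI conjI allI impI ballI)
  have Gp: "ck n (ecube n b e) k (pd a G)" if "a < n" for a k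
    using G[of "Suc k"] that by simp
  \<comment> \<open>The factor \<open>s ^ 0\<close> is there to match \<open>ck_seg_integral\<close>
    at \<open>m = 0\<close>.\<close>
  let ?g = "\<lambda>a v. integral {0..1} (\<lambda>s. s ^ 0 * pd a G (seg s v))"
  show "ck n (ecube n b e) k (?g a)" if "a < n" for a k
    by (rule ck_seg_integral) (rule Gp[OF that])
  fix v assume v: "v \<in> ecube n b e"
  have int: "(\<lambda>s. pd a G (seg s v)) integrable_on {0..1}" if "a < n" for a
  proof (rule integrable_continuous_interval)
    show "continuous_on {0..1} (\<lambda>s. pd a G (seg s v))"
    proof -
      have "continuous_on {0..1::real} (\<lambda>s. (v, s))" by (intro continuous_intros)
      from continuous_on_compose2[OF continuous_on_seg_integrand[OF ck_continuous_on[OF Gp[OF that, of 0]], of 0] this] v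
      show ?thesis by auto
    qed
  qed
  have "((\<lambda>s. \<Sum>a<n. pd a G (seg s v) * (v a - b a)) has_integral G (seg 1 v) - G (seg 0 v)) {0..1}"
  proof (rule fundamental_theorem_of_calculus)
    fix s :: real assume s: "s \<in> {0..1}"
    have "((\<lambda>s. G (seg s v)) has_field_derivative (\<Sum>a<n. pd a G (seg s v) * (v a - b a))) (at s)"
    proof (rule DERIV_compose_coords[where \<gamma> = "\<lambda>s. seg s v", OF openin_ecube G])
      show "seg s v \<in> ecube n b e" by (rule seg_in_ecube[OF v s])
      show "\<forall>\<^sub>F s in nhds s. \<forall>i\<ge>n. seg s v i = 0"
        using v b0 by (auto simp: ecube_def)
      show "((\<lambda>s. seg s v a) has_field_derivative v a - b a) (at s)" for a
        by (auto intro!: derivative_eq_intros)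
    qed
    then show "((\<lambda>s. G (seg s v)) has_vector_derivative (\<Sum>a<n. pd a G (seg s v) * (v a - b a))) (at s within {0..1})"
      using has_field_derivative_at_within has_real_derivative_iff_has_vector_derivative by blast
  qed simp
  then have "G v - G b = integral {0..1} (\<lambda>s. \<Sum>a<n. pd a G (seg s v) * (v a - b a))"
    by (simp add: integral_unique)
  also have "\<dots> = (\<Sum>a<n. integral {0..1} (\<lambda>s. pd a G (seg s v) * (v a - b a)))"
    by (rule integral_sum) (use int in \<open>auto intro!: integrable_on_mult_left\<close>)
  also have "\<dots> = (\<Sum>a<n. (v a - b a) * ?g a v)"
    by (simp add: mult.commute)
  finally show "G v = G b + (\<Sum>a<n. (v a - b a) * ?g a v)" by simp
qed

end

section \<open>Closure properties of smooth functions\<close>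

lemma smooth_const: "openin (Euclidean_space n) V \<Longrightarrow> smooth_fun n V (\<lambda>v. r)"
  by (simp add: smooth_fun_iff_ck ck_const)

lemma smooth_coord: "openin (Euclidean_space n) V \<Longrightarrow> smooth_fun n V (\<lambda>v. v a)"
  by (simp add: smooth_fun_iff_ck ck_coord)

lemma smooth_add:
  "openin (Euclidean_space n) V \<Longrightarrow> smooth_fun n V f \<Longrightarrow> smooth_fun n V g \<Longrightarrow> smooth_fun n V (\<lambda>v. f v + g v)"
  by (simp add: smooth_fun_iff_ck ck_add)

lemma smooth_mult:
  "openin (Euclidean_space n) V \<Longrightarrow> smooth_fun n V f \<Longrightarrow> smooth_fun n V g \<Longrightarrow> smooth_fun n V (\<lambda>v. f v * g v)"
  by (simp add: smooth_fun_iff_ck ck_mult)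

lemma smooth_diff:
  "openin (Euclidean_space n) V \<Longrightarrow> smooth_fun n V f \<Longrightarrow> smooth_fun n V g \<Longrightarrow> smooth_fun n V (\<lambda>v. f v - g v)"
  using smooth_add[of n V f "\<lambda>v. -1 * g v"] smooth_mult[of n V "\<lambda>v. -1" g] smooth_const[of n V "-1"] by simp

lemma smooth_inverse:
  "openin (Euclidean_space n) V \<Longrightarrow> smooth_fun n V f \<Longrightarrow> (\<And>v. v \<in> V \<Longrightarrow> f v \<noteq> 0) \<Longrightarrow>
   smooth_fun n V (\<lambda>v. inverse (f v))"
  by (simp add: smooth_fun_iff_ck ck_inverse)

lemma smooth_sum:
  "openin (Euclidean_space n) V \<Longrightarrow> (\<And>a. a \<in> A \<Longrightarrow> smooth_fun n V (f a)) \<Longrightarrow> smooth_fun n V (\<lambda>v. \<Sum>a\<in>A. f a v)"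
  by (simp add: smooth_fun_iff_ck ck_sum)

lemma smooth_power: "openin (Euclidean_space n) V \<Longrightarrow> smooth_fun n V f \<Longrightarrow> smooth_fun n V (\<lambda>v. f v ^ j)"
  by (induction j) (auto intro: smooth_const smooth_mult)

lemma smooth_subset:
  "openin (Euclidean_space n) V \<Longrightarrow> openin (Euclidean_space n) V' \<Longrightarrow> smooth_fun n V f \<Longrightarrow> V' \<subseteq> V \<Longrightarrow>
   smooth_fun n V' f"
  by (simp add: smooth_fun_iff_ck) (blast intro: ck_subset)

lemma smooth_pd: "openin (Euclidean_space n) V \<Longrightarrow> smooth_fun n V f \<Longrightarrow> i < n \<Longrightarrow> smooth_fun n V (pd i f)"
  by (simp add: smooth_fun_iff_ck) (blast intro: ck_pd)

lemma smooth_compose: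
  "openin (Euclidean_space n) V \<Longrightarrow> openin (Euclidean_space n') V' \<Longrightarrow> (\<And>v. v \<in> V \<Longrightarrow> \<sigma> v \<in> V') \<Longrightarrow>
   (\<And>a. a < n' \<Longrightarrow> smooth_fun n V (\<lambda>v. \<sigma> v a)) \<Longrightarrow> smooth_fun n' V' G \<Longrightarrow> smooth_fun n V (\<lambda>v. G (\<sigma> v))"
  unfolding smooth_fun_iff_ck by (blast intro: ck_compose)

lemma smooth_DERIV:
  "openin (Euclidean_space n) V \<Longrightarrow> smooth_fun n V f \<Longrightarrow> i < n \<Longrightarrow> v \<in> V \<Longrightarrow>
   ((\<lambda>s. f (v(i := s))) has_field_derivative pd i f v) (at (v i))"
  unfolding smooth_fun_iff_ck by (blast intro: ck_DERIV)

lemma pd_add: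
  assumes "openin (Euclidean_space n) V" "smooth_fun n V f" "smooth_fun n V g" "i < n" "v \<in> V"
  shows "pd i (\<lambda>v. f v + g v) v = pd i f v + pd i g v"
  by (intro pd_eqI DERIV_add smooth_DERIV) (use assms in auto)

lemma pd_mult:
  assumes "openin (Euclidean_space n) V" "smooth_fun n V f" "smooth_fun n V g" "i < n" "v \<in> V"
  shows "pd i (\<lambda>v. f v * g v) v = pd i f v * g v + f v * pd i g v"
  by (rule pd_eqI, rule DERIV_cong[OF DERIV_mult'[OF smooth_DERIV[OF assms(1,2,4,5)] smooth_DERIV[OF assms(1,3,4,5)]]])
    (simp add: algebra_simps)

lemma pd_const: "pd i (\<lambda>v. r) v = 0"
  by (simp add: pd_def)

lemma pd_coord: "pd i (\<lambda>v. v a) v = (if a = i then 1 else 0)"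
  by (rule pd_eqI) (cases "a = i", auto intro!: derivative_eq_intros)

lemma hadamard:
  assumes V: "openin (Euclidean_space n) V" and b: "b \<in> V" and G: "smooth_fun n V G"
  obtains e g where "e > 0" "ecube n b e \<subseteq> V" "\<And>a. a < n \<Longrightarrow> smooth_fun n (ecube n b e) (g a)"
    "\<And>v. v \<in> ecube n b e \<Longrightarrow> G v = G b + (\<Sum>a<n. (v a - b a) * g a v)"
proof -
  obtain e where e: "e > 0" "ecube n b e \<subseteq> V"
    using openin_contains_ecube[OF V b] .
  have "smooth_fun n (ecube n b e) G"
    using smooth_subset[OF V openin_ecube G] e by blast
  then obtain g where "\<forall>a<n. \<forall>k. ck n (ecube n b e) k (g a)"
    "\<forall>v\<in>ecube n b e. G v = G b + (\<Sum>a<n. (v a - b a) * g a v)"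
    using hadamard_ck[of e n b G] e(1) openin_Euclidean_space_zero[OF V b]
    by (simp add: smooth_fun_iff_ck openin_ecube) blast
  then show ?thesis using that[OF e, of g] by (simp add: smooth_fun_iff_ck openin_ecube)
qed

section \<open>Sheaves of superalgebras and charts\<close>

declare [[coercion_enabled = false]]

section \<open>Scaling and restriction\<close>

lemma scl_simps [simp]:
  "scl 1 f = f" "scl 0 f = 0" "scl r 0 = 0" "scl r (scl s f) = scl (r * s) f"
  "scl (-1) f = - f" "scl r (- f) = - scl r f" "scl (- r) f = - scl r f"
  "scl r f * g = scl r (f * g)" "f * scl r g = scl r (f * g)"
  by (auto simp: scl_def fun_eq_iff)

lemma scl_add: "scl r (f + g) = scl r f + scl r g"
  and scl_diff: "scl r (f - g) = scl r f - scl r g"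
  and scl_add_left: "scl (r + s) f = scl r f + scl s f"
  by (auto simp: scl_def fun_eq_iff algebra_simps)

lemma sum_fun_apply: "(\<Sum>a\<in>A. f a) x = (\<Sum>a\<in>A. f a x)"
  by (induction A rule: infinite_finite_induct) auto

lemma scl_sum: "scl r (\<Sum>a\<in>A. f a) = (\<Sum>a\<in>A. scl r (f a))"
  by (simp add: fun_eq_iff scl_def sum_fun_apply scaleR_sum_right)

lemma res_simps [simp]:
  "res U 0 = 0" "res U (res V f) = res (U \<inter> V) f"
  "res U (f + g) = res U f + res U g" "res U (f - g) = res U f - res U g" "res U (- f) = - res U f"
  "res U (f * g) = res U f * res U g" "res U (scl r f) = scl r (res U f)"
  by (auto simp: res_def scl_def fun_eq_iff)

lemma res_apply: "res U f x = (if x \<in> U then f x else 0)"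
  by (simp add: res_def)

lemma res_mult_left: "res U (f * g) = f * res U g"
  and res_mult_right: "res U (f * g) = res U f * g"
  by (auto simp: res_def fun_eq_iff)

lemma res_sum: "res U (\<Sum>a\<in>A. f a) = (\<Sum>a\<in>A. res U (f a))"
  by (simp add: fun_eq_iff res_def sum_fun_apply)

lemma res_one_mult: "res U 1 * f = res U f" "f * res U 1 = res U f"
  by (auto simp: res_def fun_eq_iff)

lemma res_subset: "res U f = f \<Longrightarrow> U \<subseteq> W \<Longrightarrow> res W f = f"
  by (metis Int_absorb1 res_simps(2))

lemma res_eqI: "(\<And>x. x \<in> U \<Longrightarrow> f x = g x) \<Longrightarrow> res U f = res U g"
  by (auto simp: res_def fun_eq_iff)

lemma res_eqD: "res U f = res U g \<Longrightarrow> x \<in> U \<Longrightarrow> f x = g x"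
  by (auto simp: res_def fun_eq_iff) metis

lemma ksign_simps [simp]: "ksign False j = 1" "ksign i False = 1" "ksign True True = -1"
  by (auto simp: ksign_def)

locale ssheaf =
  fixes M :: "('x, 'g::real_algebra_1) sspace"
  assumes sheaf: "superalgebra_sheaf M"
begin

lemma one_sect [simp]: "openin (body M) U \<Longrightarrow> res U 1 \<in> sect M False U"
  and sect_int: "openin (body M) U \<Longrightarrow> f \<in> sect M False U \<Longrightarrow> f \<in> sect M True U \<Longrightarrow> f = 0"
  and zero_sect [simp]: "openin (body M) U \<Longrightarrow> 0 \<in> sect M i U"
  and sect_id: "openin (body M) U \<Longrightarrow> f \<in> sect M i U \<Longrightarrow> res U f = f"
  and sect_scl: "openin (body M) U \<Longrightarrow> f \<in> sect M i U \<Longrightarrow> scl r f \<in> sect M i U"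
  and sect_add: "openin (body M) U \<Longrightarrow> f \<in> sect M i U \<Longrightarrow> g \<in> sect M i U \<Longrightarrow> f + g \<in> sect M i U"
  and sect_mult: "openin (body M) U \<Longrightarrow> f \<in> sect M i U \<Longrightarrow> g \<in> sect M j U \<Longrightarrow> f * g \<in> sect M (i \<noteq> j) U"
  and sect_commute: "openin (body M) U \<Longrightarrow> f \<in> sect M i U \<Longrightarrow> g \<in> sect M j U \<Longrightarrow>
        f * g = scl (ksign i j) (g * f)"
  and sect_res: "openin (body M) U \<Longrightarrow> f \<in> sect M i U \<Longrightarrow> openin (body M) W \<Longrightarrow> W \<subseteq> U \<Longrightarrow>
        res W f \<in> sect M i W"
  and sect_glue: "openin (body M) U \<Longrightarrow> res U f = f \<Longrightarrow>
        (\<And>x. x \<in> U \<Longrightarrow> \<exists>W. openin (body M) W \<and> x \<in> W \<and> W \<subseteq> U \<and> res W f \<in> sect M i W) \<Longrightarrow>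
        f \<in> sect M i U"
proof -
  assume U: "openin (body M) U"
  note s = sheaf[unfolded superalgebra_sheaf_def, rule_format, OF U]
  note si = s[THEN conjunct2, THEN conjunct2, rule_format]
  show "res U 1 \<in> sect M False U" using s by blast
  show "f \<in> sect M False U \<Longrightarrow> f \<in> sect M True U \<Longrightarrow> f = 0" using s by blast
  show "0 \<in> sect M i U" using si by blast
  {
    assume f: "f \<in> sect M i U"
    note sf = si[THEN conjunct2, THEN conjunct1, rule_format, OF f]
    show "res U f = f" using sf by blast
    show "scl r f \<in> sect M i U" using sf by blast
    show "g \<in> sect M i U \<Longrightarrow> f + g \<in> sect M i U" using sf by blast
    show "g \<in> sect M j U \<Longrightarrow> f * g \<in> sect M (i \<noteq> j) U"
      using sf[THEN conjunct2, THEN conjunct2, THEN conjunct2, THEN conjunct1] by blast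
    show "g \<in> sect M j U \<Longrightarrow> f * g = scl (ksign i j) (g * f)"
      using sf[THEN conjunct2, THEN conjunct2, THEN conjunct2, THEN conjunct1] by blast
    show "openin (body M) W \<Longrightarrow> W \<subseteq> U \<Longrightarrow> res W f \<in> sect M i W" using sf by blast
  }
  show "res U f = f \<Longrightarrow>
        (\<And>x. x \<in> U \<Longrightarrow> \<exists>W. openin (body M) W \<and> x \<in> W \<and> W \<subseteq> U \<and> res W f \<in> sect M i W) \<Longrightarrow>
        f \<in> sect M i U"
    by (rule si[THEN conjunct2, THEN conjunct2, rule_format, OF conjI]) (assumption, blast)
qed

lemma sect_uminus: "openin (body M) U \<Longrightarrow> f \<in> sect M i U \<Longrightarrow> - f \<in> sect M i U"
  using sect_scl[of U f i "-1"] by simp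

lemma sect_diff: "openin (body M) U \<Longrightarrow> f \<in> sect M i U \<Longrightarrow> g \<in> sect M i U \<Longrightarrow> f - g \<in> sect M i U"
  using sect_add[of U f i "- g"] sect_uminus[of U g i] by simp

lemma sect_sum: "openin (body M) U \<Longrightarrow> (\<And>a. a \<in> A \<Longrightarrow> f a \<in> sect M i U) \<Longrightarrow> (\<Sum>a\<in>A. f a) \<in> sect M i U"
  by (induction A rule: infinite_finite_induct) (auto intro: sect_add)

lemma sect_secs: "openin (body M) U \<Longrightarrow> f \<in> sect M i U \<Longrightarrow> f \<in> secs M U"
  unfolding secs_def using zero_sect[of U] by (cases i) (auto intro: exI[of _ f] exI[of _ 0])

lemma secsE:
  assumes "f \<in> secs M U"
  obtains a b where "f = a + b" "a \<in> sect M False U" "b \<in> sect M True U"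
  using assms by (auto simp: secs_def)

lemma secs_id: "openin (body M) U \<Longrightarrow> f \<in> secs M U \<Longrightarrow> res U f = f"
  by (auto simp: secs_def sect_id)

lemma secs_add: "openin (body M) U \<Longrightarrow> f \<in> secs M U \<Longrightarrow> g \<in> secs M U \<Longrightarrow> f + g \<in> secs M U"
proof -
  assume U: "openin (body M) U" and "f \<in> secs M U" "g \<in> secs M U"
  then obtain a b a' b' where "f = a + b" "a \<in> sect M False U" "b \<in> sect M True U"
    "g = a' + b'" "a' \<in> sect M False U" "b' \<in> sect M True U" by (meson secsE)
  then have "f + g = (a + a') + (b + b')" "a + a' \<in> sect M False U" "b + b' \<in> sect M True U"
    using U by (auto intro: sect_add simp: algebra_simps)
  then show ?thesis unfolding secs_def by blast
qed

lemma zero_secs [simp]: "openin (body M) U \<Longrightarrow> 0 \<in> secs M U"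
  using sect_secs by force

lemma one_secs [simp]: "openin (body M) U \<Longrightarrow> res U 1 \<in> secs M U"
  by (rule sect_secs[OF _ one_sect])

lemma secs_sum: "openin (body M) U \<Longrightarrow> (\<And>a. a \<in> A \<Longrightarrow> f a \<in> secs M U) \<Longrightarrow> (\<Sum>a\<in>A. f a) \<in> secs M U"
  by (induction A rule: infinite_finite_induct) (auto intro: secs_add)

lemma secs_scl: "openin (body M) U \<Longrightarrow> f \<in> secs M U \<Longrightarrow> scl r f \<in> secs M U"
  by (elim secsE) (simp add: scl_add, intro secs_add, auto intro: sect_secs[OF _ sect_scl])

lemma secs_uminus: "openin (body M) U \<Longrightarrow> f \<in> secs M U \<Longrightarrow> - f \<in> secs M U"
  using secs_scl[of U f "-1"] by simp

lemma secs_diff: "openin (body M) U \<Longrightarrow> f \<in> secs M U \<Longrightarrow> g \<in> secs M U \<Longrightarrow> f - g \<in> secs M U"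
  using secs_add[of U f "- g"] secs_uminus[of U g] by simp

lemma secs_mult: "openin (body M) U \<Longrightarrow> f \<in> secs M U \<Longrightarrow> g \<in> secs M U \<Longrightarrow> f * g \<in> secs M U"
  by (elim secsE) (auto simp: algebra_simps intro!: secs_add intro: sect_secs sect_mult)

lemma secs_res: "openin (body M) U \<Longrightarrow> f \<in> secs M U \<Longrightarrow> openin (body M) W \<Longrightarrow> W \<subseteq> U \<Longrightarrow> res W f \<in> secs M W"
  by (elim secsE) (auto intro!: secs_add intro: sect_secs sect_res)

lemma even_commute: "openin (body M) U \<Longrightarrow> f \<in> sect M False U \<Longrightarrow> g \<in> secs M U \<Longrightarrow> f * g = g * f"
  by (elim secsE) (auto simp: algebra_simps sect_commute[of U f False])

end

section \<open>Calculus in a single chart\<close>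

locale schart_loc = ssheaf M for M :: "('x, 'g::real_algebra_1) sspace" +
  fixes n m :: nat and c :: "('x, 'g) schart"
  assumes chart: "chart n m M c"
begin

definition sub :: "'x set \<Rightarrow> bool" where
  "sub W \<longleftrightarrow> openin (body M) W \<and> W \<subseteq> cdom c"

abbreviation img :: "'x set \<Rightarrow> (nat \<Rightarrow> real) set" where "img W \<equiv> bmap c ` W"

lemma subI: "openin (body M) W \<Longrightarrow> W \<subseteq> cdom c \<Longrightarrow> sub W"
  and sub_open: "sub W \<Longrightarrow> openin (body M) W"
  and sub_dom: "sub W \<Longrightarrow> W \<subseteq> cdom c"
  by (auto simp: sub_def)

lemma cdom_open [simp]: "openin (body M) (cdom c)"
  and img_cdom_open: "openin (Euclidean_space n) (img (cdom c))"
  and homeo: "homeomorphic_map (subtopology (body M) (cdom c))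
       (subtopology (Euclidean_space n) (img (cdom c))) (bmap c)"
  and oddc_sect: "j < m \<Longrightarrow> oddc c j \<in> sect M True (cdom c)"
  using chart by (auto simp: chart_def)

lemma sub_cdom [simp]: "sub (cdom c)" by (simp add: sub_def)

lemma sub_Int: "sub W \<Longrightarrow> openin (body M) W' \<Longrightarrow> sub (W \<inter> W')"
  by (auto simp: sub_def)

lemma sub_subset: "sub W \<Longrightarrow> openin (body M) W' \<Longrightarrow> W' \<subseteq> W \<Longrightarrow> sub W'"
  by (auto simp: sub_def)

lemma pull_facts:
  assumes "sub W"
  shows pull_sect: "smooth_fun n (img W) f \<Longrightarrow> pull c W f \<in> sect M False W"
    and pull_cong: "smooth_fun n (img W) f \<Longrightarrow> (\<And>v. v \<in> img W \<Longrightarrow> g v = f v) \<Longrightarrow> pull c W g = pull c W f"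
    and pull_add: "smooth_fun n (img W) f \<Longrightarrow> smooth_fun n (img W) g \<Longrightarrow>
      pull c W (\<lambda>v. f v + g v) = pull c W f + pull c W g"
    and pull_mult: "smooth_fun n (img W) f \<Longrightarrow> smooth_fun n (img W) g \<Longrightarrow>
      pull c W (\<lambda>v. f v * g v) = pull c W f * pull c W g"
    and pull_res: "smooth_fun n (img W) f \<Longrightarrow> openin (body M) W' \<Longrightarrow> W' \<subseteq> W \<Longrightarrow>
      pull c W' f = res W' (pull c W f)"
    and pull_const: "pull c W (\<lambda>v. r) = scl r (res W 1)"
    and ex_expansion: "f' \<in> secs M W \<Longrightarrow>
      \<exists>F. (\<forall>S\<subseteq>{..<m}. smooth_fun n (img W) (F S)) \<and> f' = expansion m c W F"
    and expansion_eq_0: "(\<And>S. S \<subseteq> {..<m} \<Longrightarrow> smooth_fun n (img W) (F S)) \<Longrightarrow> expansion m c W F = 0 \<Longrightarrow>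
      S \<subseteq> {..<m} \<Longrightarrow> v \<in> img W \<Longrightarrow> F S v = 0"
proof -
  have *: "openin (body M) W \<and> W \<subseteq> cdom c" using assms by (simp add: sub_def)
  note c = chart[unfolded chart_def, THEN conjunct2, THEN conjunct2, THEN conjunct2, THEN conjunct2, rule_format, OF *]
  note c1 = c[THEN conjunct1, rule_format]
  show "smooth_fun n (img W) f \<Longrightarrow> pull c W f \<in> sect M False W"
    "smooth_fun n (img W) f \<Longrightarrow> (\<And>v. v \<in> img W \<Longrightarrow> g v = f v) \<Longrightarrow> pull c W g = pull c W f"
    "smooth_fun n (img W) f \<Longrightarrow> smooth_fun n (img W) g \<Longrightarrow>
      pull c W (\<lambda>v. f v + g v) = pull c W f + pull c W g"
    "smooth_fun n (img W) f \<Longrightarrow> smooth_fun n (img W) g \<Longrightarrow>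
      pull c W (\<lambda>v. f v * g v) = pull c W f * pull c W g"
    "smooth_fun n (img W) f \<Longrightarrow> openin (body M) W' \<Longrightarrow> W' \<subseteq> W \<Longrightarrow> pull c W' f = res W' (pull c W f)"
    using c1 by blast+
  show "pull c W (\<lambda>v. r) = scl r (res W 1)"
    "f' \<in> secs M W \<Longrightarrow> \<exists>F. (\<forall>S\<subseteq>{..<m}. smooth_fun n (img W) (F S)) \<and> f' = expansion m c W F"
    using c by blast+
  show "(\<And>S. S \<subseteq> {..<m} \<Longrightarrow> smooth_fun n (img W) (F S)) \<Longrightarrow> expansion m c W F = 0 \<Longrightarrow>
      S \<subseteq> {..<m} \<Longrightarrow> v \<in> img W \<Longrightarrow> F S v = 0"
    using c by blast
qed

lemma img_open: "sub W \<Longrightarrow> openin (Euclidean_space n) (img W)"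
proof -
  assume W: "sub W"
  then have "openin (subtopology (body M) (cdom c)) W"
    by (metis cdom_open openin_open_subtopology sub_def)
  then have "openin (subtopology (Euclidean_space n) (img (cdom c))) (img W)"
    using homeomorphic_imp_open_map[OF homeo] unfolding open_map_def by blast
  then show ?thesis using img_cdom_open openin_trans_full by blast
qed

lemma inj_bmap: "inj_on (bmap c) (cdom c)"
  using homeomorphic_imp_injective_map[OF homeo] openin_subset[OF cdom_open]
  by (simp add: topspace_subtopology Int_absorb1)

lemma preimage_open:
  assumes "sub W" "openin (Euclidean_space n) V"
  shows "sub {x \<in> W. bmap c x \<in> V}"
proof -
  have "continuous_map (subtopology (body M) (cdom c)) (subtopology (Euclidean_space n) (img (cdom c))) (bmap c)"
    using homeo homeomorphic_eq_everything_map by blast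
  then have "continuous_map (subtopology (body M) (cdom c)) (Euclidean_space n) (bmap c)"
    using continuous_map_into_fulltopology by blast
  from openin_continuous_map_preimage[OF this assms(2)]
  have "openin (subtopology (body M) (cdom c)) {x \<in> cdom c. bmap c x \<in> V}"
    using openin_subset[OF cdom_open] by (simp add: topspace_subtopology Int_absorb1)
  then have "openin (body M) {x \<in> cdom c. bmap c x \<in> V}"
    using cdom_open openin_trans_full by blast
  then have "openin (body M) (W \<inter> {x \<in> cdom c. bmap c x \<in> V})"
    using assms(1) by (intro openin_Int) (auto simp: sub_def)
  moreover have "W \<inter> {x \<in> cdom c. bmap c x \<in> V} = {x \<in> W. bmap c x \<in> V}"
    using assms(1) by (auto simp: sub_def)
  ultimately show ?thesis using assms(1) by (auto simp: sub_def)
qed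

lemma img_preimage: "sub W \<Longrightarrow> V \<subseteq> img W \<Longrightarrow> img {x \<in> W. bmap c x \<in> V} = V"
  by auto

lemma smooth_img_subset: "sub W \<Longrightarrow> sub W' \<Longrightarrow> W' \<subseteq> W \<Longrightarrow> smooth_fun n (img W) f \<Longrightarrow> smooth_fun n (img W') f"
  by (rule smooth_subset[of n "img W"]) (auto intro: img_open)

lemma img_zero: "x \<in> cdom c \<Longrightarrow> i \<ge> n \<Longrightarrow> bmap c x i = 0"
  using openin_Euclidean_space_zero[OF img_cdom_open] by blast

lemma pull_0: "sub W \<Longrightarrow> pull c W (\<lambda>v. 0) = 0"
  using pull_const[of W 0] by simp

lemma pull_1: "sub W \<Longrightarrow> pull c W (\<lambda>v. 1) = res W 1"
  using pull_const[of W 1] by simp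

lemma pull_sum: "sub W \<Longrightarrow> (\<And>a. a \<in> A \<Longrightarrow> smooth_fun n (img W) (f a)) \<Longrightarrow>
   pull c W (\<lambda>v. \<Sum>a\<in>A. f a v) = (\<Sum>a\<in>A. pull c W (f a))"
proof (induction A rule: infinite_finite_induct)
  case (insert x F)
  then show ?case
    using pull_add[of W "f x" "\<lambda>v. \<Sum>a\<in>F. f a v"] by (simp add: smooth_sum img_open)
qed (simp_all add: pull_0)

lemma pull_scl: "sub W \<Longrightarrow> smooth_fun n (img W) f \<Longrightarrow> pull c W (\<lambda>v. r * f v) = scl r (pull c W f)"
  using pull_mult[of W "\<lambda>v. r" f] sect_id[OF sub_open pull_sect, of W f]
  by (simp add: pull_const smooth_const img_open res_one_mult)

lemma pull_diff: "sub W \<Longrightarrow> smooth_fun n (img W) f \<Longrightarrow> smooth_fun n (img W) g \<Longrightarrow>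
   pull c W (\<lambda>v. f v - g v) = pull c W f - pull c W g"
  using pull_add[of W f "\<lambda>v. -1 * g v"] pull_scl[of W g "-1"] smooth_mult[of n "img W" "\<lambda>v. -1" g]
  by (simp add: smooth_const img_open)

lemma pull_secs: "sub W \<Longrightarrow> smooth_fun n (img W) f \<Longrightarrow> pull c W f \<in> secs M W"
  using pull_sect sect_secs sub_open by blast

lemma pull_id: "sub W \<Longrightarrow> smooth_fun n (img W) f \<Longrightarrow> res W (pull c W f) = pull c W f"
  by (simp add: secs_id pull_secs sub_open)

lemma pull_commute: "sub W \<Longrightarrow> smooth_fun n (img W) f \<Longrightarrow> g \<in> secs M W \<Longrightarrow> pull c W f * g = g * pull c W f"
  using even_commute pull_sect sub_open by blast

section \<open>Expansions in odd monomials\<close>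

abbreviation smooth_coeffs :: "'x set \<Rightarrow> (nat set \<Rightarrow> (nat \<Rightarrow> real) \<Rightarrow> real) \<Rightarrow> bool" where
  "smooth_coeffs W F \<equiv> \<forall>S\<subseteq>{..<m}. smooth_fun n (img W) (F S)"

lemma odd_monom_empty: "odd_monom \<xi> {} = 1"
  by (simp add: odd_monom_def)

text \<open>The restriction matters for the empty list: its product is the constant 1, which need
  not be supported in \<open>W\<close>.\<close>

lemma sect_prod_list:
  assumes "sub W" "set xs \<subseteq> {..<m}"
  shows "res W (prod_list (map (oddc c) xs)) \<in> sect M (odd (length xs)) W"
  using assms(2)
proof (induction xs)
  case (Cons a xs)
  have "res W (oddc c a) \<in> sect M True W"
    using sect_res[OF cdom_open oddc_sect] Cons assms by (auto simp: sub_def)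
  moreover have "res W (prod_list (map (oddc c) xs)) \<in> sect M (odd (length xs)) W"
    using Cons by simp
  ultimately have "res W (oddc c a) * res W (prod_list (map (oddc c) xs)) \<in> sect M (True \<noteq> odd (length xs)) W"
    by (rule sect_mult[OF sub_open[OF assms(1)]])
  moreover have "res W (oddc c a) * res W (prod_list (map (oddc c) xs)) = res W (prod_list (map (oddc c) (a # xs)))"
    by (simp only: res_simps list.map prod_list.Cons)
  moreover have "(True \<noteq> odd (length xs)) = odd (length (a # xs))" by simp
  ultimately have "res W (prod_list (map (oddc c) (a # xs))) \<in> sect M (odd (length (a # xs))) W"
    by (simp only:)
  then show ?case .
next
  case Nil
  show ?case using one_sect[OF sub_open[OF assms(1)]] by (simp add: one_fun_def)
qed

lemma sect_odd_monom:
  assumes "sub W" "S \<subseteq> {..<m}"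
  shows "res W (odd_monom (oddc c) S) \<in> sect M (odd (card S)) W"
proof -
  have "finite S" using assms finite_subset by blast
  then show ?thesis using sect_prod_list[OF assms(1), of "sorted_list_of_set S"] assms(2)
    by (simp add: odd_monom_def)
qed

text \<open>\<open>pull c W f\<close> vanishes outside \<open>W\<close>, so a factor next to it
  counts on \<open>W\<close> only. This is what allows \<open>expansion\<close> to use unrestricted
  odd monomials.\<close>

lemma pull_mult_res: "sub W \<Longrightarrow> smooth_fun n (img W) f \<Longrightarrow> pull c W f * g = pull c W f * res W g"
proof -
  assume "sub W" "smooth_fun n (img W) f"
  then have "pull c W f * g = res W (pull c W f) * g" by (simp add: pull_id)
  also have "\<dots> = res W (pull c W f) * res W g" by (simp flip: res_simps(6) add: res_mult_right)
  finally show ?thesis using \<open>sub W\<close> \<open>smooth_fun n (img W) f\<close> by (simp add: pull_id)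
qed

lemma expansion_term_sect:
  "sub W \<Longrightarrow> smooth_fun n (img W) f \<Longrightarrow> S \<subseteq> {..<m} \<Longrightarrow>
   pull c W f * odd_monom (oddc c) S \<in> sect M (odd (card S)) W"
  using sect_mult[OF sub_open pull_sect sect_odd_monom, of W f S]
  by (simp add: pull_mult_res[of W f "odd_monom (oddc c) S"])

lemma expansion_secs: "sub W \<Longrightarrow> smooth_coeffs W F \<Longrightarrow> expansion m c W F \<in> secs M W"
  unfolding expansion_def
  by (intro secs_sum sub_open) (auto intro!: sect_secs[OF sub_open expansion_term_sect])

lemma expansion_cong:
  "sub W \<Longrightarrow> smooth_coeffs W F \<Longrightarrow> (\<And>S v. S \<subseteq> {..<m} \<Longrightarrow> v \<in> img W \<Longrightarrow> G S v = F S v) \<Longrightarrow>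
   expansion m c W G = expansion m c W F"
  unfolding expansion_def by (rule sum.cong) (auto intro!: arg_cong2[where f = "(*)"] pull_cong)

lemma expansion_add: "sub W \<Longrightarrow> smooth_coeffs W F \<Longrightarrow> smooth_coeffs W G \<Longrightarrow>
   expansion m c W (\<lambda>S v. F S v + G S v) = expansion m c W F + expansion m c W G"
  unfolding expansion_def by (simp add: pull_add distrib_right flip: sum.distrib)

lemma expansion_pull_mult:
  "sub W \<Longrightarrow> smooth_coeffs W F \<Longrightarrow> smooth_fun n (img W) f \<Longrightarrow>
   expansion m c W (\<lambda>S v. f v * F S v) = pull c W f * expansion m c W F"
  unfolding expansion_def by (simp add: pull_mult sum_distrib_left mult.assoc)

lemma expansion_scl: "sub W \<Longrightarrow> smooth_coeffs W F \<Longrightarrow>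
   expansion m c W (\<lambda>S v. r * F S v) = scl r (expansion m c W F)"
  unfolding expansion_def by (simp add: pull_scl scl_sum)

lemma expansion_sum: "sub W \<Longrightarrow> (\<And>a. a \<in> A \<Longrightarrow> smooth_coeffs W (F a)) \<Longrightarrow>
   expansion m c W (\<lambda>S v. \<Sum>a\<in>A. F a S v) = (\<Sum>a\<in>A. expansion m c W (F a))"
proof -
  assume W: "sub W" and F: "\<And>a. a \<in> A \<Longrightarrow> smooth_coeffs W (F a)"
  have "expansion m c W (\<lambda>S v. \<Sum>a\<in>A. F a S v) =
      (\<Sum>S\<in>Pow {..<m}. \<Sum>a\<in>A. pull c W (F a S) * odd_monom (oddc c) S)"
    unfolding expansion_def using W F by (intro sum.cong) (auto simp: pull_sum sum_distrib_right)
  also have "\<dots> = (\<Sum>a\<in>A. expansion m c W (F a))"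
    unfolding expansion_def by (rule sum.swap)
  finally show ?thesis .
qed

lemma expansion_res: "sub W \<Longrightarrow> smooth_coeffs W F \<Longrightarrow> openin (body M) W' \<Longrightarrow> W' \<subseteq> W \<Longrightarrow>
   res W' (expansion m c W F) = expansion m c W' F"
  unfolding expansion_def res_sum by (rule sum.cong) (auto simp: res_mult_right pull_res simp del: res_simps)

lemma expansion_inj:
  assumes W: "sub W" and F: "smooth_coeffs W F" and G: "smooth_coeffs W G"
    and e: "expansion m c W F = expansion m c W G" and S: "S \<subseteq> {..<m}" and v: "v \<in> img W"
  shows "F S v = G S v"
proof -
  let ?H = "\<lambda>S v. F S v + -1 * G S v"
  have sm: "smooth_coeffs W (\<lambda>S v. -1 * G S v)"
    using G by (intro allI impI smooth_mult smooth_const img_open W) auto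
  have "expansion m c W ?H = expansion m c W F + scl (-1) (expansion m c W G)"
    using expansion_add[OF W F sm] expansion_scl[OF W G, of "-1"] by simp
  then have "expansion m c W ?H = 0" using e by simp
  then have "?H S v = 0"
    by (rule expansion_eq_0[OF W _ _ S v, rotated])
      (intro smooth_add img_open W F[rule_format] sm[rule_format])
  then show ?thesis by simp
qed

lemma expansion_pull: "sub W \<Longrightarrow> smooth_fun n (img W) f \<Longrightarrow>
   expansion m c W (\<lambda>S. if S = {} then f else (\<lambda>v. 0)) = pull c W f"
proof -
  assume "sub W" "smooth_fun n (img W) f"
  have "expansion m c W (\<lambda>S. if S = {} then f else (\<lambda>v. 0)) =
      (\<Sum>S\<in>Pow {..<m}. if S = {} then pull c W f else 0)"
    unfolding expansion_def by (rule sum.cong) (auto simp: pull_0 \<open>sub W\<close> odd_monom_empty)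
  then show ?thesis by simp
qed

text \<open>By the expansion, sections are finite sums of pullbacks times products of odd
  coordinates. The odd factor stands on the right because these products are built up from the left,
  one coordinate at a time.\<close>

lemma section_induct [consumes 2, case_names pull add odd]:
  assumes W: "sub W" and f: "f \<in> secs M W"
    and P1: "\<And>g. smooth_fun n (img W) g \<Longrightarrow> P (pull c W g)"
    and P2: "\<And>f g. f \<in> secs M W \<Longrightarrow> g \<in> secs M W \<Longrightarrow> P f \<Longrightarrow> P g \<Longrightarrow> P (f + g)"
    and P3: "\<And>j f. j < m \<Longrightarrow> f \<in> secs M W \<Longrightarrow> P f \<Longrightarrow> P (f * res W (oddc c j))"
  shows "P f"
proof -
  obtain F where F: "smooth_coeffs W F" "f = expansion m c W F"
    using ex_expansion[OF W f] by blast
  have *: "pull c W g * prod_list (map (oddc c) xs) \<in> secs M W \<and> P (pull c W g * prod_list (map (oddc c) xs))"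
    if g: "smooth_fun n (img W) g" and "set xs \<subseteq> {..<m}" for g xs
    using that(2)
  proof (induction xs rule: rev_induct)
    case Nil
    then show ?case using P1[OF g] pull_secs[OF W g] by simp
  next
    case (snoc j xs)
    let ?f = "pull c W g * prod_list (map (oddc c) xs)"
    have j: "j < m" and "set xs \<subseteq> {..<m}" using snoc.prems by auto
    note f = snoc.IH[OF \<open>set xs \<subseteq> {..<m}\<close>, THEN conjunct1] snoc.IH[OF \<open>set xs \<subseteq> {..<m}\<close>, THEN conjunct2]
    have "?f * oddc c j = ?f * res W (oddc c j)"
      using secs_id[OF sub_open[OF W] f(1)] by (metis res_mult_left res_mult_right)
    moreover have "res W (oddc c j) \<in> secs M W"
      using sect_secs[OF sub_open[OF W] sect_res[OF cdom_open oddc_sect[OF j]]] W by (simp add: sub_def)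
    moreover have "pull c W g * prod_list (map (oddc c) (xs @ [j])) = ?f * oddc c j"
      by (simp only: map_append prod_list.append list.map prod_list.Cons prod_list.Nil mult.assoc mult_1_right)
    ultimately show ?case using P3[OF j f] secs_mult[OF sub_open[OF W] f(1)] by metis
  qed
  have 0: "P 0" using P1[OF smooth_const[OF img_open[OF W]], of 0] by (simp add: pull_0 W)
  have t: "pull c W (F S) * odd_monom (oddc c) S \<in> secs M W \<and> P (pull c W (F S) * odd_monom (oddc c) S)"
    if "S \<subseteq> {..<m}" for S
    unfolding odd_monom_def using *[of "F S" "sorted_list_of_set S"] F(1) that finite_subset[OF that] by auto
  have "(\<Sum>S\<in>A. pull c W (F S) * odd_monom (oddc c) S) \<in> secs M W \<and>
      P (\<Sum>S\<in>A. pull c W (F S) * odd_monom (oddc c) S)" if "A \<subseteq> Pow {..<m}" for A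
    using finite_subset[OF that finite_Pow_iff[THEN iffD2, OF finite_lessThan]] that
    by (induction A rule: finite_induct) (auto simp: 0 sub_open[OF W] intro!: P2 secs_add dest!: t)
  then show ?thesis unfolding F(2) expansion_def by blast
qed

lemma coord_sect: "A \<in> cidx n m \<Longrightarrow> coord c A \<in> sect M (fst A) (cdom c)"
  by (auto simp: cidx_def coord_def intro!: pull_sect smooth_coord img_open oddc_sect)

lemma coord_secs: "A \<in> cidx n m \<Longrightarrow> coord c A \<in> secs M (cdom c)"
  by (rule sect_secs[OF cdom_open coord_sect])

lemma coord_res_sect: "A \<in> cidx n m \<Longrightarrow> sub W \<Longrightarrow> res W (coord c A) \<in> sect M (fst A) W"
  using sect_res[OF cdom_open coord_sect] by (auto simp: sub_def)

lemma smooth_coord_img: "sub W \<Longrightarrow> smooth_fun n (img W) (\<lambda>v. v a)"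
  by (intro smooth_coord img_open)

lemma pull_coord: "sub W \<Longrightarrow> pull c W (\<lambda>v. v a) = res W (coord c (False, a))"
  unfolding coord_def using pull_res[OF sub_cdom smooth_coord_img[OF sub_cdom], of W a] by (simp add: sub_def)

lemma pull_coord_minus: "sub W \<Longrightarrow> pull c W (\<lambda>v. v a - r) = res W (coord c (False, a)) - scl r (res W 1)"
  using pull_diff[of W "\<lambda>v. v a" "\<lambda>v. r"]
  by (simp add: pull_coord pull_const smooth_coord_img smooth_const img_open)

text \<open>Membership in the ideal of germs at \<open>x\<close> that is generated by the even coordinates centred at \<open>x\<close>.
  Odd coordinates are not in it, so it detects all coefficients of an expansion.\<close>

definition vanishing :: "'x \<Rightarrow> ('x \<Rightarrow> 'g) \<Rightarrow> bool" where
  "vanishing x f \<longleftrightarrow> (\<exists>W g. sub W \<and> x \<in> W \<and> (\<forall>a<n. g a \<in> secs M W) \<and>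
     res W f = (\<Sum>a<n. pull c W (\<lambda>v. v a - bmap c x a) * g a))"

lemma smooth_coord_minus: "sub W \<Longrightarrow> smooth_fun n (img W) (\<lambda>v. v a - r)"
  by (intro smooth_diff smooth_coord smooth_const img_open)

lemma vanishing_shrink:
  assumes "sub W" "x \<in> W" "\<forall>a<n. g a \<in> secs M W"
    "res W f = (\<Sum>a<n. pull c W (\<lambda>v. v a - bmap c x a) * g a)" "openin (body M) W'" "W' \<subseteq> W"
  shows "\<forall>a<n. res W' (g a) \<in> secs M W'"
    "res W' f = (\<Sum>a<n. pull c W' (\<lambda>v. v a - bmap c x a) * res W' (g a))"
proof -
  show "\<forall>a<n. res W' (g a) \<in> secs M W'" using assms secs_res sub_open by blast
  have "res W' f = res W' (res W f)" using assms(6) by (simp add: Int_absorb2)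
  also have "\<dots> = (\<Sum>a<n. res W' (pull c W (\<lambda>v. v a - bmap c x a)) * res W' (g a))"
    unfolding assms(4) by (simp add: res_sum)
  also have "\<dots> = (\<Sum>a<n. pull c W' (\<lambda>v. v a - bmap c x a) * res W' (g a))"
    using assms by (intro sum.cong) (auto simp: pull_res[OF assms(1) smooth_coord_minus[OF assms(1)]])
  finally show "res W' f = (\<Sum>a<n. pull c W' (\<lambda>v. v a - bmap c x a) * res W' (g a))" .
qed

lemma vanishing_cong:
  assumes "vanishing x f" "openin (body M) U" "x \<in> U" "res U f = res U f'"
  shows "vanishing x f'"
proof -
  obtain W g where W: "sub W" "x \<in> W" "\<forall>a<n. g a \<in> secs M W"
    "res W f = (\<Sum>a<n. pull c W (\<lambda>v. v a - bmap c x a) * g a)"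
    using assms(1) unfolding vanishing_def by blast
  have o: "openin (body M) (W \<inter> U)" using W assms by (auto intro: openin_Int sub_open)
  have "res (W \<inter> U) f' = res (W \<inter> U) f"
    using assms(4) by (metis res_simps(2))
  moreover note vanishing_shrink[OF W o]
  ultimately show ?thesis
    unfolding vanishing_def using W(1,2) assms(3) sub_subset[OF W(1) o]
    by (intro exI[of _ "W \<inter> U"] exI[of _ "\<lambda>a. res (W \<inter> U) (g a)"]) auto
qed

lemma vanishing_add: "vanishing x f \<Longrightarrow> vanishing x f' \<Longrightarrow> vanishing x (f + f')"
proof -
  assume "vanishing x f" "vanishing x f'"
  then obtain W g W' g' where W: "sub W" "x \<in> W" "\<forall>a<n. g a \<in> secs M W"
    "res W f = (\<Sum>a<n. pull c W (\<lambda>v. v a - bmap c x a) * g a)"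
    and W': "sub W'" "x \<in> W'" "\<forall>a<n. g' a \<in> secs M W'"
    "res W' f' = (\<Sum>a<n. pull c W' (\<lambda>v. v a - bmap c x a) * g' a)"
    unfolding vanishing_def by blast
  let ?W = "W \<inter> W'"
  have o: "openin (body M) ?W" using W W' by (auto intro: openin_Int sub_open)
  note 1 = vanishing_shrink[OF W o] and 2 = vanishing_shrink[OF W' o]
  show ?thesis
    unfolding vanishing_def using W(1,2) W'(2) sub_subset[OF W(1) o] 1 2
    by (intro exI[of _ ?W] exI[of _ "\<lambda>a. res ?W (g a) + res ?W (g' a)"])
      (auto simp: sum.distrib distrib_left intro: secs_add[OF o])
qed

lemma vanishing_mult: "vanishing x f \<Longrightarrow> x \<in> U \<Longrightarrow> openin (body M) U \<Longrightarrow> h \<in> secs M U \<Longrightarrow> vanishing x (f * h)"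
proof -
  assume "vanishing x f" and U: "x \<in> U" "openin (body M) U" "h \<in> secs M U"
  then obtain W g where W: "sub W" "x \<in> W" "\<forall>a<n. g a \<in> secs M W"
    "res W f = (\<Sum>a<n. pull c W (\<lambda>v. v a - bmap c x a) * g a)"
    unfolding vanishing_def by blast
  let ?W = "W \<inter> U"
  have o: "openin (body M) ?W" using W U by (auto intro: openin_Int sub_open)
  note 1 = vanishing_shrink[OF W o]
  have h: "res ?W h \<in> secs M ?W" using secs_res[OF U(2,3) o] by simp
  have "res ?W (f * h) = res ?W f * res ?W h" by simp
  then show ?thesis
    unfolding vanishing_def using W(1,2) U(1) sub_subset[OF W(1) o] 1 h
    by (intro exI[of _ ?W] exI[of _ "\<lambda>a. res ?W (g a) * res ?W h"])
      (auto simp: sum_distrib_right mult.assoc intro: secs_mult[OF o])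
qed

lemma vanishing_zero: "x \<in> cdom c \<Longrightarrow> vanishing x 0"
  unfolding vanishing_def by (intro exI[of _ "cdom c"] exI[of _ "\<lambda>a. 0"]) auto

lemma vanishing_sum: "x \<in> cdom c \<Longrightarrow> (\<And>a. a \<in> A \<Longrightarrow> vanishing x (f a)) \<Longrightarrow> vanishing x (\<Sum>a\<in>A. f a)"
  by (induction A rule: infinite_finite_induct) (auto intro: vanishing_add vanishing_zero)

text \<open>Hadamard's lemma at \<open>bmap c x\<close>: the constant term is zero, and the rest is
  a combination of the generators.\<close>

lemma vanishing_pull:
  assumes W: "sub W" "x \<in> W" and h: "smooth_fun n (img W) h" "h (bmap c x) = 0"
  shows "vanishing x (pull c W h)"
proof -
  obtain e g where eg: "e > 0" "ecube n (bmap c x) e \<subseteq> img W"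
    "\<And>a. a < n \<Longrightarrow> smooth_fun n (ecube n (bmap c x) e) (g a)"
    "\<And>v. v \<in> ecube n (bmap c x) e \<Longrightarrow> h v = h (bmap c x) + (\<Sum>a<n. (v a - bmap c x a) * g a v)"
    using hadamard[OF img_open[OF W(1)] imageI[OF W(2)] h(1)] by auto
  let ?E = "ecube n (bmap c x) e"
  let ?W = "{y \<in> W. bmap c y \<in> ?E}"
  have W': "sub ?W" by (rule preimage_open[OF W(1) openin_ecube])
  have im: "img ?W = ?E" by (rule img_preimage[OF W(1) eg(2)])
  have sm: "smooth_fun n ?E (\<lambda>v. (v a - bmap c x a) * g a v)" if "a < n" for a
    using eg(3) that by (intro smooth_mult smooth_diff smooth_coord smooth_const openin_ecube)
  have "res ?W (pull c W h) = pull c ?W h"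
    using pull_res[OF W(1) h(1) sub_open[OF W']] by auto
  also have "\<dots> = pull c ?W (\<lambda>v. \<Sum>a<n. (v a - bmap c x a) * g a v)"
    by (rule pull_cong[OF W']) (use im eg(4) h(2) sm in \<open>auto intro!: smooth_sum openin_ecube\<close>)
  also have "\<dots> = (\<Sum>a<n. pull c ?W (\<lambda>v. (v a - bmap c x a) * g a v))"
    by (rule pull_sum[OF W']) (use im sm in auto)
  also have "\<dots> = (\<Sum>a<n. pull c ?W (\<lambda>v. v a - bmap c x a) * pull c ?W (g a))"
    by (intro sum.cong refl pull_mult[OF W' smooth_coord_minus[OF W']]) (use im eg(3) in auto)
  finally have "res ?W (pull c W h) = (\<Sum>a<n. pull c ?W (\<lambda>v. v a - bmap c x a) * pull c ?W (g a))" .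
  moreover have "x \<in> ?W"
    using W eg(1) centre_in_ecube[OF eg(1) img_open[OF W(1)] imageI[OF W(2)]] by simp
  moreover have "\<forall>a<n. pull c ?W (g a) \<in> secs M ?W"
    using pull_secs[OF W'] im eg(3) by auto
  ultimately show ?thesis unfolding vanishing_def
    by (intro exI[of _ ?W] exI[of _ "\<lambda>a. pull c ?W (g a)"] conjI W')
qed

text \<open>In a combination of the generators every coefficient of the expansion carries a factor
  \<open>v a - bmap c x a\<close>, which is zero at \<open>x\<close>. Uniqueness of expansions
  transfers this to \<open>F\<close>.\<close>

lemma vanishing_expansion:
  assumes W: "sub W" "x \<in> W" and F: "smooth_coeffs W F" and v: "vanishing x (expansion m c W F)"
    and S: "S \<subseteq> {..<m}"
  shows "F S (bmap c x) = 0"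
proof -
  obtain W1 g1 where W1: "sub W1" "x \<in> W1" "\<forall>a<n. g1 a \<in> secs M W1"
    "res W1 (expansion m c W F) = (\<Sum>a<n. pull c W1 (\<lambda>v. v a - bmap c x a) * g1 a)"
    using v unfolding vanishing_def by blast
  let ?W = "W \<inter> W1"
  have o: "openin (body M) ?W" using W W1 by (auto intro: openin_Int sub_open)
  have sW: "sub ?W" using sub_subset[OF W(1) o] by simp
  define g where "g a = res ?W (g1 a)" for a
  have g: "\<forall>a<n. g a \<in> secs M ?W"
    "res ?W (expansion m c W F) = (\<Sum>a<n. pull c ?W (\<lambda>v. v a - bmap c x a) * g a)"
    using vanishing_shrink[OF W1 o] unfolding g_def by auto
  have "\<forall>a\<in>{..<n}. \<exists>G. smooth_coeffs ?W G \<and> g a = expansion m c ?W G"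
    using ex_expansion[OF sW] g(1) by blast
  then obtain G where G: "\<And>a. a < n \<Longrightarrow> smooth_coeffs ?W (G a) \<and> g a = expansion m c ?W (G a)"
    using bchoice[of "{..<n}"] by (metis lessThan_iff)
  let ?H = "\<lambda>S v. \<Sum>a<n. (v a - bmap c x a) * G a S v"
  have H1: "smooth_coeffs ?W (\<lambda>S v. (v a - bmap c x a) * G a S v)" if "a < n" for a
    using G[OF that] by (auto intro!: smooth_mult smooth_coord_minus sW img_open)
  have H: "smooth_coeffs ?W ?H"
    using H1 by (auto intro!: smooth_sum img_open sW)
  have "expansion m c ?W F = res ?W (expansion m c W F)"
    using expansion_res[OF W(1) F o] by simp
  also have "\<dots> = (\<Sum>a<n. expansion m c ?W (\<lambda>S v. (v a - bmap c x a) * G a S v))"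
    unfolding g(2) using G by (intro sum.cong) (auto simp: expansion_pull_mult sW smooth_coord_minus)
  also have "\<dots> = expansion m c ?W ?H"
    using expansion_sum[OF sW, of "{..<n}" "\<lambda>a S v. (v a - bmap c x a) * G a S v"] H1 by simp
  finally have "F S (bmap c x) = ?H S (bmap c x)"
    by (rule expansion_inj[OF sW _ H _ S, rotated])
      (use F W W1 sW in \<open>auto intro: smooth_img_subset\<close>)
  then show ?thesis by simp
qed

text \<open>The substitute for pointwise equality: by \<open>vanishing_expansion\<close> all
  coefficients of \<open>f\<close> are zero at all points of \<open>W\<close>.\<close>

lemma vanishing_imp_0:
  assumes W: "sub W" and f: "f \<in> secs M W" and v: "\<And>x. x \<in> W \<Longrightarrow> vanishing x f"
  shows "f = 0"
proof -
  obtain F where F: "smooth_coeffs W F" "f = expansion m c W F"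
    using ex_expansion[OF W f] by blast
  have "F S v = 0" if "S \<subseteq> {..<m}" "v \<in> img W" for S v
    using vanishing_expansion[OF W _ F(1) v[unfolded F(2)] that(1)] that(2) by auto
  then have "expansion m c W F = expansion m c W (\<lambda>S v. 0)"
    by (intro expansion_cong W) (auto intro: smooth_const img_open W)
  also have "\<dots> = 0" by (simp add: expansion_def pull_0 W)
  finally show ?thesis using F(2) by simp
qed

text \<open>The coefficient at the empty set is 1 at every point. So the ideal is proper, and being
  closed under multiplication it contains no unit.\<close>

lemma not_vanishing_one: "x \<in> W \<Longrightarrow> sub W \<Longrightarrow> \<not> vanishing x (res W 1)"
proof
  assume W: "x \<in> W" "sub W" and "vanishing x (res W 1)"
  let ?F = "\<lambda>S::nat set. if S = {} then (\<lambda>v. 1) else (\<lambda>v. 0::real)"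
  have "res W 1 = expansion m c W ?F"
    using expansion_pull[OF W(2) smooth_const[OF img_open[OF W(2)]], of 1] pull_1[OF W(2)] by simp
  then have v: "vanishing x (expansion m c W ?F)"
    using \<open>vanishing x (res W 1)\<close> by (simp only:)
  have "?F {} (bmap c x) = 0"
  proof (rule vanishing_expansion[where F = ?F and S = "{}", OF W(2,1) _ v])
    show "smooth_coeffs W ?F" using smooth_const[OF img_open[OF W(2)]] by (simp split: if_split)
  qed simp
  then show False by simp
qed

end

section \<open>Vector fields\<close>

lemma mult_res_left: "res W h = h \<Longrightarrow> f * h = res W f * h"
  by (metis res_mult_left res_mult_right)

lemma mult_res_right: "res W h = h \<Longrightarrow> h * f = h * res W f"
  by (metis res_mult_left res_mult_right)

lemma vadd_eq_plus: "vadd X Y = X + Y"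
  by (simp add: vadd_def plus_fun_def)

lemma vbr_apply: "vbr i j X Y W f = X W (Y W f) - scl (ksign i j) (Y W (X W f))"
  by (simp add: vbr_def)

lemma vres_apply: "vres U X W f = (if W \<subseteq> U then X W f else 0)"
  by (simp add: vres_def)

lemma vres_vres: "W \<subseteq> U \<Longrightarrow> vres W (vres U X) = vres W X"
  by (auto simp: vres_def fun_eq_iff)

context ssheaf
begin

lemma vfieldI:
  assumes "\<And>W f. \<not> (openin (body M) W \<and> W \<subseteq> U \<and> f \<in> secs M W) \<Longrightarrow> X W f = 0"
    and "\<And>W j f. openin (body M) W \<Longrightarrow> W \<subseteq> U \<Longrightarrow> f \<in> sect M j W \<Longrightarrow> X W f \<in> sect M (i \<noteq> j) W"
    and "\<And>W j f g. openin (body M) W \<Longrightarrow> W \<subseteq> U \<Longrightarrow> f \<in> sect M j W \<Longrightarrow> g \<in> secs M W \<Longrightarrow>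
      X W (f * g) = X W f * g + scl (ksign i j) (f * X W g)"
    and "\<And>W f r. openin (body M) W \<Longrightarrow> W \<subseteq> U \<Longrightarrow> f \<in> secs M W \<Longrightarrow> X W (scl r f) = scl r (X W f)"
    and "\<And>W f g. openin (body M) W \<Longrightarrow> W \<subseteq> U \<Longrightarrow> f \<in> secs M W \<Longrightarrow> g \<in> secs M W \<Longrightarrow>
      X W (f + g) = X W f + X W g"
    and "\<And>W W' f. openin (body M) W \<Longrightarrow> W \<subseteq> U \<Longrightarrow> f \<in> secs M W \<Longrightarrow> openin (body M) W' \<Longrightarrow> W' \<subseteq> W \<Longrightarrow>
      X W' (res W' f) = res W' (X W f)"
  shows "vfield M i U X"
  unfolding vfield_def
  by (intro conjI allI impI ballI; (elim conjE)?; rule assms; assumption)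

lemma vf_ext: "vfield M i U X \<Longrightarrow> \<not> (openin (body M) W \<and> W \<subseteq> U \<and> f \<in> secs M W) \<Longrightarrow> X W f = 0"
  unfolding vfield_def by (elim conjE) (erule allE[of _ W], erule allE[of _ f], erule mp)

lemma
  assumes X: "vfield M i U X" and W: "openin (body M) W" "W \<subseteq> U"
  shows vf_sect: "f \<in> sect M j W \<Longrightarrow> X W f \<in> sect M (i \<noteq> j) W"
    and vf_leib: "f \<in> sect M j W \<Longrightarrow> g \<in> secs M W \<Longrightarrow> X W (f * g) = X W f * g + scl (ksign i j) (f * X W g)"
    and vf_scl: "h \<in> secs M W \<Longrightarrow> X W (scl r h) = scl r (X W h)"
    and vf_add: "h \<in> secs M W \<Longrightarrow> g \<in> secs M W \<Longrightarrow> X W (h + g) = X W h + X W g"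
    and vf_res: "h \<in> secs M W \<Longrightarrow> openin (body M) W' \<Longrightarrow> W' \<subseteq> W \<Longrightarrow> X W' (res W' h) = res W' (X W h)"
proof -
  note x = X[unfolded vfield_def, THEN conjunct2, rule_format, OF conjI[OF W]]
  note x1 = x[THEN conjunct1, rule_format] and x2 = x[THEN conjunct2, rule_format]
  show "f \<in> sect M j W \<Longrightarrow> X W f \<in> sect M (i \<noteq> j) W" by (rule x1[THEN conjunct1])
  show "f \<in> sect M j W \<Longrightarrow> g \<in> secs M W \<Longrightarrow> X W (f * g) = X W f * g + scl (ksign i j) (f * X W g)"
    by (rule x1[THEN conjunct2, rule_format])
  show "h \<in> secs M W \<Longrightarrow> X W (scl r h) = scl r (X W h)" by (rule x2[THEN conjunct1, rule_format])
  show "h \<in> secs M W \<Longrightarrow> g \<in> secs M W \<Longrightarrow> X W (h + g) = X W h + X W g"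
    by (rule x2[THEN conjunct2, THEN conjunct1, rule_format])
  show "h \<in> secs M W \<Longrightarrow> openin (body M) W' \<Longrightarrow> W' \<subseteq> W \<Longrightarrow> X W' (res W' h) = res W' (X W h)"
    by (rule x2[THEN conjunct2, THEN conjunct2, rule_format, OF _ conjI])
qed

context
  fixes i U X W
  assumes X: "vfield M i U X" and W: "openin (body M) W" "W \<subseteq> U"
begin

lemma vf_zero: "X W 0 = 0"
  using vf_scl[OF X W zero_secs[OF W(1)], of 0] by simp

lemma vf_secs: "f \<in> secs M W \<Longrightarrow> X W f \<in> secs M W"
proof (erule secsE)
  fix a b assume "f = a + b" and a: "a \<in> sect M False W" and b: "b \<in> sect M True W"
  then show "X W f \<in> secs M W"
    using vf_add[OF X W sect_secs[OF W(1) a] sect_secs[OF W(1) b]]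
      secs_add[OF W(1) sect_secs[OF W(1) vf_sect[OF X W a]] sect_secs[OF W(1) vf_sect[OF X W b]]] by simp
qed

lemma vf_uminus: "f \<in> secs M W \<Longrightarrow> X W (- f) = - X W f"
  using vf_scl[OF X W, of f "-1"] by simp

lemma vf_diff: "f \<in> secs M W \<Longrightarrow> g \<in> secs M W \<Longrightarrow> X W (f - g) = X W f - X W g"
  using vf_add[OF X W, of f "- g"] by (simp add: vf_uminus secs_uminus W)

lemma vf_sum: "(\<And>a. a \<in> A \<Longrightarrow> f a \<in> secs M W) \<Longrightarrow> X W (\<Sum>a\<in>A. f a) = (\<Sum>a\<in>A. X W (f a))"
  by (induct A rule: infinite_finite_induct) (simp_all add: vf_zero vf_add[OF X W] secs_sum W)

lemma vf_one: "X W (res W 1) = 0"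
proof -
  have "res W 1 * res W 1 = res W (1 :: 'x \<Rightarrow> 'g)" by (simp add: res_one_mult)
  then have "X W (res W 1) = X W (res W 1) * res W 1 + res W 1 * X W (res W 1)"
    using vf_leib[OF X W one_sect[OF W(1)] one_secs[OF W(1)]] by simp
  moreover have "res W (X W (res W 1)) = X W (res W 1)"
    by (rule secs_id[OF W(1) vf_secs[OF one_secs[OF W(1)]]])
  ultimately show ?thesis by (simp add: res_one_mult)
qed

lemma vf_const: "X W (scl r (res W 1)) = 0"
  using vf_scl[OF X W one_secs[OF W(1)]] vf_one by simp

lemma vf_id: "f \<in> secs M W \<Longrightarrow> res W (X W f) = X W f"
  by (rule secs_id[OF W(1) vf_secs])

end

lemma vfield_eqI:
  assumes X: "vfield M i U X" and Y: "vfield M j U Y"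
    and e: "\<And>W f. openin (body M) W \<Longrightarrow> W \<subseteq> U \<Longrightarrow> f \<in> secs M W \<Longrightarrow> X W f = Y W f"
  shows "X = Y"
proof (intro ext)
  fix W f x
  show "X W f x = Y W f x"
    using e[of W f] vf_ext[OF X, of W f] vf_ext[OF Y, of W f] by metis
qed

lemma vfield_0: "vfield M i U 0"
  by (rule vfieldI) auto

lemma vfield_add:
  assumes X: "vfield M i U X" and Y: "vfield M i U Y"
  shows "vfield M i U (X + Y)"
proof (rule vfieldI)
  fix W f assume "\<not> (openin (body M) W \<and> W \<subseteq> U \<and> f \<in> secs M W)"
  then show "(X + Y) W f = 0" by (simp add: vf_ext[OF X] vf_ext[OF Y])
next
  fix W assume W: "openin (body M) W" "W \<subseteq> U"
  fix j f assume f: "f \<in> sect M j W"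
  show "(X + Y) W f \<in> sect M (i \<noteq> j) W"
    using sect_add[OF W(1) vf_sect[OF X W f] vf_sect[OF Y W f]] by simp
  fix g assume g: "g \<in> secs M W"
  show "(X + Y) W (f * g) = (X + Y) W f * g + scl (ksign i j) (f * (X + Y) W g)"
    using vf_leib[OF X W f g] vf_leib[OF Y W f g] by (simp add: algebra_simps scl_add)
next
  fix W assume W: "openin (body M) W" "W \<subseteq> U"
  fix f assume f: "f \<in> secs M W"
  show "(X + Y) W (scl r f) = scl r ((X + Y) W f)" for r
    by (simp add: vf_scl[OF X W f] vf_scl[OF Y W f] scl_add)
  show "(X + Y) W (f + g) = (X + Y) W f + (X + Y) W g" if "g \<in> secs M W" for g
    by (simp add: vf_add[OF X W f that] vf_add[OF Y W f that])
  show "(X + Y) W' (res W' f) = res W' ((X + Y) W f)" if "openin (body M) W'" "W' \<subseteq> W" for W'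
    by (simp add: vf_res[OF X W f that] vf_res[OF Y W f that])
qed

lemma vfield_sum: "(\<And>a. a \<in> A \<Longrightarrow> vfield M i U (X a)) \<Longrightarrow> vfield M i U (\<Sum>a\<in>A. X a)"
  by (induct A rule: infinite_finite_induct) (auto intro: vfield_0 vfield_add)

lemma vscl_apply: "vscl g X W f = g * X W f"
  by (simp add: vscl_def)

lemma vscl_apply_res: "vfield M i U X \<Longrightarrow> openin (body M) W \<Longrightarrow> W \<subseteq> U \<Longrightarrow> f \<in> secs M W \<Longrightarrow>
   vscl g X W f = res W g * X W f"
  unfolding vscl_apply by (rule mult_res_left) (rule vf_id)

lemma vfield_vscl:
  assumes X: "vfield M i U X" and U: "openin (body M) U" and h: "h \<in> sect M l U"
  shows "vfield M (l \<noteq> i) U (vscl h X)"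
proof (rule vfieldI)
  fix W f assume "\<not> (openin (body M) W \<and> W \<subseteq> U \<and> f \<in> secs M W)"
  then show "vscl h X W f = 0" by (simp add: vf_ext[OF X] vscl_apply)
next
  fix W assume W: "openin (body M) W" "W \<subseteq> U"
  have hW: "res W h \<in> sect M l W" by (rule sect_res[OF U h W])
  fix j f assume f: "f \<in> sect M j W"
  have fs: "f \<in> secs M W" by (rule sect_secs[OF W(1) f])
  have "vscl h X W f \<in> sect M (l \<noteq> (i \<noteq> j)) W"
    using sect_mult[OF W(1) hW vf_sect[OF X W f]] vscl_apply_res[OF X W fs] by simp
  moreover have "(l \<noteq> (i \<noteq> j)) = ((l \<noteq> i) \<noteq> j)" by auto
  ultimately show "vscl h X W f \<in> sect M ((l \<noteq> i) \<noteq> j) W" by (simp only:)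
  fix g assume g: "g \<in> secs M W"
  have "h * f = res W h * f" by (rule mult_res_left) (rule sect_id[OF W(1) f])
  also have "\<dots> = scl (ksign l j) (f * res W h)" by (rule sect_commute[OF W(1) hW f])
  also have "f * res W h = f * h" by (rule mult_res_right[symmetric]) (rule sect_id[OF W(1) f])
  finally have c: "h * f = scl (ksign l j) (f * h)" .
  have "h * (f * X W g) = scl (ksign l j) (f * (h * X W g))"
    using arg_cong[OF c, of "\<lambda>a. a * X W g"] by (simp add: mult.assoc)
  moreover have "ksign l j * ksign i j = ksign (l \<noteq> i) j" by (cases l; cases i; cases j) auto
  ultimately show "vscl h X W (f * g) = vscl h X W f * g + scl (ksign (l \<noteq> i) j) (f * vscl h X W g)"
    unfolding vscl_apply vf_leib[OF X W f g] by (simp add: algebra_simps mult.commute)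
next
  fix W assume W: "openin (body M) W" "W \<subseteq> U"
  fix f assume f: "f \<in> secs M W"
  show "vscl h X W (scl r f) = scl r (vscl h X W f)" for r
    by (simp add: vf_scl[OF X W f] vscl_apply)
  show "vscl h X W (f + g) = vscl h X W f + vscl h X W g" if "g \<in> secs M W" for g
    by (simp add: vf_add[OF X W f that] vscl_apply algebra_simps)
  show "vscl h X W' (res W' f) = res W' (vscl h X W f)" if "openin (body M) W'" "W' \<subseteq> W" for W'
    unfolding vscl_apply vf_res[OF X W f that] by (simp only: res_mult_left)
qed

lemma vfield_vres:
  assumes X: "vfield M i U X" and V: "openin (body M) V" "V \<subseteq> U"
  shows "vfield M i V (vres V X)"
proof (rule vfieldI)
  fix W f assume "\<not> (openin (body M) W \<and> W \<subseteq> V \<and> f \<in> secs M W)"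
  then show "vres V X W f = 0" using V by (auto simp: vres_apply intro!: vf_ext[OF X])
next
  fix W assume W: "openin (body M) W" "W \<subseteq> V"
  then have W': "openin (body M) W" "W \<subseteq> U" using V by auto
  fix j f assume f: "f \<in> sect M j W"
  show "vres V X W f \<in> sect M (i \<noteq> j) W"
    using vf_sect[OF X W' f] W(2) by (simp add: vres_apply)
  fix g assume g: "g \<in> secs M W"
  show "vres V X W (f * g) = vres V X W f * g + scl (ksign i j) (f * vres V X W g)"
    using vf_leib[OF X W' f g] W(2) by (simp add: vres_apply)
next
  fix W assume W: "openin (body M) W" "W \<subseteq> V"
  then have W': "openin (body M) W" "W \<subseteq> U" using V by auto
  fix f assume f: "f \<in> secs M W"
  show "vres V X W (scl r f) = scl r (vres V X W f)" for r
    using W(2) by (simp add: vf_scl[OF X W' f] vres_apply)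
  show "vres V X W (f + g) = vres V X W f + vres V X W g" if "g \<in> secs M W" for g
    using W(2) by (simp add: vf_add[OF X W' f that] vres_apply)
  show "vres V X W'' (res W'' f) = res W'' (vres V X W f)" if "openin (body M) W''" "W'' \<subseteq> W" for W''
    using W(2) subset_trans[OF that(2) W(2)] by (simp add: vf_res[OF X W' f that] vres_apply)
qed

lemma vres_id: "vfield M i U X \<Longrightarrow> vres U X = X"
  by (rule ext, rule ext) (auto simp: vres_apply dest!: vf_ext)

text \<open>In \<open>X (Y (f * g))\<close> and \<open>Y (X (f * g))\<close> the mixed terms
  \<open>X f * Y g\<close> and \<open>Y f * X g\<close> have signs that differ by exactly
  \<open>ksign i j\<close>. The bracket removes them and leaves a first-order operator.\<close>

lemma vfield_vbr:
  assumes X: "vfield M i U X" and Y: "vfield M j U Y" and U: "openin (body M) U"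
  shows "vfield M (i \<noteq> j) U (vbr i j X Y)"
proof (rule vfieldI)
  fix W f assume n: "\<not> (openin (body M) W \<and> W \<subseteq> U \<and> f \<in> secs M W)"
  \<comment> \<open>Off the domain the inner field yields 0, so the outer one is applied to 0, over
    a set where it may or may not be defined.\<close>
  have "X W 0 = 0"
    using vf_zero[OF X, of W] vf_ext[OF X, of W 0] by blast
  moreover have "Y W 0 = 0"
    using vf_zero[OF Y, of W] vf_ext[OF Y, of W 0] by blast
  ultimately show "vbr i j X Y W f = 0"
    using n by (simp add: vf_ext[OF X] vf_ext[OF Y] vbr_apply)
next
  fix W assume W: "openin (body M) W" "W \<subseteq> U"
  fix l f assume f: "f \<in> sect M l W"
  have fs: "f \<in> secs M W" by (rule sect_secs[OF W(1) f])
  have a: "X W (Y W f) \<in> sect M (i \<noteq> (j \<noteq> l)) W" by (rule vf_sect[OF X W vf_sect[OF Y W f]])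
  have b: "Y W (X W f) \<in> sect M (j \<noteq> (i \<noteq> l)) W" by (rule vf_sect[OF Y W vf_sect[OF X W f]])
  have "(i \<noteq> (j \<noteq> l)) = ((i \<noteq> j) \<noteq> l)" "(j \<noteq> (i \<noteq> l)) = ((i \<noteq> j) \<noteq> l)" by auto
  then show "vbr i j X Y W f \<in> sect M ((i \<noteq> j) \<noteq> l) W"
    unfolding vbr_apply using a b by (intro sect_diff W sect_scl) (simp_all only:)
  fix g assume g: "g \<in> secs M W"
  note Xf = vf_sect[OF X W f] and Yf = vf_sect[OF Y W f]
  note s = sect_secs[OF W(1)] vf_secs[OF X W] vf_secs[OF Y W] secs_mult[OF W(1)] secs_scl[OF W(1)]
  have "X W (Y W (f * g)) = X W (Y W f * g) + scl (ksign j l) (X W (f * Y W g))"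
    unfolding vf_leib[OF Y W f g]
    by (subst vf_add[OF X W]) (auto simp: vf_scl[OF X W] fs g s Yf intro!: s)
  also have "\<dots> = X W (Y W f) * g + scl (ksign i (j \<noteq> l)) (Y W f * X W g) +
     scl (ksign j l) (X W f * Y W g + scl (ksign i l) (f * X W (Y W g)))"
    unfolding vf_leib[OF X W Yf g] vf_leib[OF X W f vf_secs[OF Y W g]] ..
  finally have 1: "X W (Y W (f * g)) = \<dots>" .
  have "Y W (X W (f * g)) = Y W (X W f * g) + scl (ksign i l) (Y W (f * X W g))"
    unfolding vf_leib[OF X W f g]
    by (subst vf_add[OF Y W]) (auto simp: vf_scl[OF Y W] fs g s Xf intro!: s)
  also have "\<dots> = Y W (X W f) * g + scl (ksign j (i \<noteq> l)) (X W f * Y W g) +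
     scl (ksign i l) (Y W f * X W g + scl (ksign j l) (f * Y W (X W g)))"
    unfolding vf_leib[OF Y W Xf g] vf_leib[OF Y W f vf_secs[OF X W g]] ..
  finally have 2: "Y W (X W (f * g)) = \<dots>" .
  show "vbr i j X Y W (f * g) = vbr i j X Y W f * g + scl (ksign (i \<noteq> j) l) (f * vbr i j X Y W g)"
    unfolding vbr_apply 1 2
    by (cases i; cases j; cases l) (simp_all add: scl_add scl_diff algebra_simps)
next
  fix W assume W: "openin (body M) W" "W \<subseteq> U"
  note s = sect_secs[OF W(1)] vf_secs[OF X W] vf_secs[OF Y W]
  fix f assume f: "f \<in> secs M W"
  show "vbr i j X Y W (scl r f) = scl r (vbr i j X Y W f)" for r
    by (simp add: vf_scl[OF X W] vf_scl[OF Y W] f s vbr_apply scl_diff mult.commute)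
  show "vbr i j X Y W (f + g) = vbr i j X Y W f + vbr i j X Y W g" if "g \<in> secs M W" for g
    by (simp add: vf_add[OF X W] vf_add[OF Y W] f that s vbr_apply scl_diff scl_add)
  show "vbr i j X Y W' (res W' f) = res W' (vbr i j X Y W f)" if "openin (body M) W'" "W' \<subseteq> W" for W'
    by (simp add: vf_res[OF X W _ that] vf_res[OF Y W _ that] f s vbr_apply)
qed

text \<open>Such a field sends homogeneous sections to sections of both parities, hence to 0. So
  parity is ambiguous for the zero field only, which justifies that \<open>ext_d\<close> reads
  parities off its arguments.\<close>

lemma vfield_both_parities:
  assumes "vfield M False U X" "vfield M True U X"
  shows "X = 0"
proof (rule vfield_eqI[OF assms(1) vfield_0])
  fix W f assume W: "openin (body M) W" "W \<subseteq> U" and f: "f \<in> secs M W"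
  have z: "X W a = 0" if a: "a \<in> sect M j W" for a j
    using vf_sect[OF assms(1) W a] vf_sect[OF assms(2) W a] sect_int[OF W(1)] by (cases j) auto
  from f show "X W f = 0 W f"
  proof (rule secsE)
    fix a b assume "f = a + b" and a: "a \<in> sect M False W" and b: "b \<in> sect M True W"
    then show "X W f = 0 W f"
      using vf_add[OF assms(1) W sect_secs[OF W(1) a] sect_secs[OF W(1) b]] z[OF a] z[OF b] by simp
  qed
qed

section \<open>Locality and gluing of vector fields\<close>

lemma vfield_local_eqI:
  assumes X: "vfield M i U X" and Y: "vfield M j U Y" and U: "openin (body M) U"
    and e: "\<And>x. x \<in> U \<Longrightarrow> \<exists>V. openin (body M) V \<and> x \<in> V \<and> vres (U \<inter> V) X = vres (U \<inter> V) Y"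
  shows "X = Y"
proof (rule vfield_eqI[OF X Y], rule ext)
  fix W f x assume W: "openin (body M) W" "W \<subseteq> U" and f: "f \<in> secs M W"
  show "X W f x = Y W f x"
  proof (cases "x \<in> W")
    case True
    then obtain V where V: "openin (body M) V" "x \<in> V" "vres (U \<inter> V) X = vres (U \<inter> V) Y"
      using e W by blast
    have o: "openin (body M) (W \<inter> V)" "W \<inter> V \<subseteq> W" using V W by auto
    have "W \<inter> V \<subseteq> U \<inter> V" using W by auto
    then have "X (W \<inter> V) (res (W \<inter> V) f) = Y (W \<inter> V) (res (W \<inter> V) f)"
      using fun_cong[OF fun_cong[OF V(3)], of "W \<inter> V" "res (W \<inter> V) f"] by (simp add: vres_apply)
    then have "res (W \<inter> V) (X W f) = res (W \<inter> V) (Y W f)"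
      using vf_res[OF X W f o] vf_res[OF Y W f o] by simp
    then show ?thesis using True V(2) by (auto dest: res_eqD)
  next
    case False
    then show ?thesis using vf_id[OF X W f] vf_id[OF Y W f] by (metis res_apply)
  qed
qed

lemma vfield_glue:
  assumes U: "openin (body M) U"
    and V: "\<And>x. x \<in> U \<Longrightarrow> openin (body M) (V x) \<and> x \<in> V x \<and> V x \<subseteq> U \<and> vfield M i (V x) (X x)"
    and c: "\<And>x y. x \<in> U \<Longrightarrow> y \<in> U \<Longrightarrow> vres (V x \<inter> V y) (X x) = vres (V x \<inter> V y) (X y)"
  shows "\<exists>Y. vfield M i U Y \<and> (\<forall>x\<in>U. vres (V x) Y = X x)"
proof -
  define Y where "Y W f = (if openin (body M) W \<and> W \<subseteq> U \<and> f \<in> secs M W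
      then (\<lambda>x. if x \<in> W then X x (W \<inter> V x) (res (W \<inter> V x) f) x else 0) else 0)" for W f
  have agree: "X x W f = X y W f" if "x \<in> U" "y \<in> U" "W \<subseteq> V x \<inter> V y" for x y W f
    using fun_cong[OF fun_cong[OF c[OF that(1,2)]], of W f] that(3) by (simp add: vres_apply)
  have loc: "res (W \<inter> V x) (Y W f) = X x (W \<inter> V x) (res (W \<inter> V x) f)"
    if W: "openin (body M) W" "W \<subseteq> U" and f: "f \<in> secs M W" and x: "x \<in> U" for W f x
  proof
    fix y
    have oW: "openin (body M) (W \<inter> V z)" if "z \<in> U" for z using V[OF that] W by blast
    have id: "res (W \<inter> V x) (X x (W \<inter> V x) (res (W \<inter> V x) f)) = X x (W \<inter> V x) (res (W \<inter> V x) f)"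
      using V[OF x] W by (intro vf_id[of i "V x"] secs_res[OF W(1) f] oW[OF x]) auto
    show "res (W \<inter> V x) (Y W f) y = X x (W \<inter> V x) (res (W \<inter> V x) f) y"
    proof (cases "y \<in> W \<inter> V x")
      case True
      then have y: "y \<in> U" using W by auto
      let ?T = "W \<inter> V x \<inter> V y"
      have oT: "openin (body M) ?T" using oW[OF x] V[OF y] by blast
      have yT: "y \<in> ?T" using True V[OF y] by auto
      have Ty: "X y ?T (res ?T f) = res ?T (X y (W \<inter> V y) (res (W \<inter> V y) f))"
        using vf_res[of i "V y" "X y" "W \<inter> V y" "res (W \<inter> V y) f" ?T] V[OF y] oW[OF y] oT secs_res[OF W(1) f oW[OF y]]
        by (simp add: Int_ac le_infI2)
      have Tx: "X x ?T (res ?T f) = res ?T (X x (W \<inter> V x) (res (W \<inter> V x) f))"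
        using vf_res[of i "V x" "X x" "W \<inter> V x" "res (W \<inter> V x) f" ?T] V[OF x] oW[OF x] oT secs_res[OF W(1) f oW[OF x]]
        by (simp add: Int_ac le_infI2)
      have "X y (W \<inter> V y) (res (W \<inter> V y) f) y = X y ?T (res ?T f) y"
        unfolding Ty using yT by (simp add: res_apply)
      also have "\<dots> = X x ?T (res ?T f) y"
        by (rule fun_cong, rule agree[OF y x]) blast
      also have "\<dots> = X x (W \<inter> V x) (res (W \<inter> V x) f) y"
        unfolding Tx using yT by (simp add: res_apply)
      finally show ?thesis using True W f by (simp add: res_apply Y_def)
    next
      case False
      then show ?thesis using id by (metis res_apply)
    qed
  qed
  have Yid: "res W (Y W f) = Y W f" for W f
    by (auto simp: Y_def res_def fun_eq_iff)
  have eqI: "g = h" if "res W g = g" "res W h = h" "W \<subseteq> U"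
    "\<And>x. x \<in> U \<Longrightarrow> res (W \<inter> V x) g = res (W \<inter> V x) h" for g h :: "'x \<Rightarrow> 'g" and W
  proof
    fix x
    show "g x = h x"
      using that(1,2) that(4)[of x] V[of x] that(3)
      by (cases "x \<in> W") (metis Int_iff res_apply subsetD, metis res_apply)
  qed
  have oV: "openin (body M) (W \<inter> V x)" "W \<inter> V x \<subseteq> V x" "W \<inter> V x \<subseteq> W"
    if "openin (body M) W" "x \<in> U" for W x
    using V[OF that(2)] that(1) by auto
  have XV: "vfield M i (V x) (X x)" if "x \<in> U" for x using V that by blast
  have "vfield M i U Y"
  proof (rule vfieldI)
    show "\<not> (openin (body M) W \<and> W \<subseteq> U \<and> f \<in> secs M W) \<Longrightarrow> Y W f = 0" for W f
      unfolding Y_def by (rule if_not_P)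
    fix W assume W: "openin (body M) W" "W \<subseteq> U"
    note o = oV[OF W(1)]
    {
      fix j f assume f: "f \<in> sect M j W"
      have fs: "f \<in> secs M W" by (rule sect_secs[OF W(1) f])
      show "Y W f \<in> sect M (i \<noteq> j) W"
      proof (rule sect_glue[OF W(1) Yid])
        fix x assume "x \<in> W"
        then have x: "x \<in> U" using W by auto
        have "res (W \<inter> V x) (Y W f) \<in> sect M (i \<noteq> j) (W \<inter> V x)"
          unfolding loc[OF W fs x] by (rule vf_sect[OF XV[OF x] o(1,2)[OF x] sect_res[OF W(1) f o(1,3)[OF x]]])
        then show "\<exists>W'. openin (body M) W' \<and> x \<in> W' \<and> W' \<subseteq> W \<and> res W' (Y W f) \<in> sect M (i \<noteq> j) W'"
          using o[OF x] \<open>x \<in> W\<close> V[OF x] by (intro exI[of _ "W \<inter> V x"]) auto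
      qed
      fix g assume g: "g \<in> secs M W"
      show "Y W (f * g) = Y W f * g + scl (ksign i j) (f * Y W g)"
      proof (rule eqI[OF Yid _ W(2)])
        show "res W (Y W f * g + scl (ksign i j) (f * Y W g)) = Y W f * g + scl (ksign i j) (f * Y W g)"
          using Yid[of W] secs_id[OF W(1) fs] secs_id[OF W(1) g] by simp
        fix x assume x: "x \<in> U"
        show "res (W \<inter> V x) (Y W (f * g)) = res (W \<inter> V x) (Y W f * g + scl (ksign i j) (f * Y W g))"
          unfolding loc[OF W secs_mult[OF W(1) fs g] x] res_simps loc[OF W fs x] loc[OF W g x]
          by (rule vf_leib[OF XV[OF x] o(1,2)[OF x] sect_res[OF W(1) f o(1,3)[OF x]] secs_res[OF W(1) g o(1,3)[OF x]]])
      qed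
    }
    fix f assume f: "f \<in> secs M W"
    show "Y W (scl r f) = scl r (Y W f)" for r
    proof (rule eqI[OF Yid _ W(2)])
      fix x assume x: "x \<in> U"
      show "res (W \<inter> V x) (Y W (scl r f)) = res (W \<inter> V x) (scl r (Y W f))"
        unfolding loc[OF W secs_scl[OF W(1) f] x] res_simps loc[OF W f x]
        by (rule vf_scl[OF XV[OF x] o(1,2)[OF x] secs_res[OF W(1) f o(1,3)[OF x]]])
    qed (simp add: Yid)
    show "Y W (f + g) = Y W f + Y W g" if g: "g \<in> secs M W" for g
    proof (rule eqI[OF Yid _ W(2)])
      fix x assume x: "x \<in> U"
      show "res (W \<inter> V x) (Y W (f + g)) = res (W \<inter> V x) (Y W f + Y W g)"
        unfolding loc[OF W secs_add[OF W(1) f g] x] res_simps loc[OF W f x] loc[OF W g x]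
        by (rule vf_add[OF XV[OF x] o(1,2)[OF x] secs_res[OF W(1) f o(1,3)[OF x]] secs_res[OF W(1) g o(1,3)[OF x]]])
    qed (simp add: Yid)
    show "Y W' (res W' f) = res W' (Y W f)" if W': "openin (body M) W'" "W' \<subseteq> W" for W'
    proof (rule eqI[OF Yid])
      show "W' \<subseteq> U" using W' W by auto
      fix x assume x: "x \<in> U"
      note o' = oV[OF W'(1) x]
      have sub: "W' \<inter> V x \<subseteq> W \<inter> V x" using W' by auto
      have "res (W' \<inter> V x) (Y W' (res W' f)) = X x (W' \<inter> V x) (res (W' \<inter> V x) f)"
        using loc[OF W'(1) \<open>W' \<subseteq> U\<close> secs_res[OF W(1) f W'] x] by (simp add: Int_ac)
      also have "\<dots> = res (W' \<inter> V x) (res (W \<inter> V x) (Y W f))"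
        unfolding loc[OF W f x]
        using vf_res[OF XV[OF x] o(1,2)[OF x] secs_res[OF W(1) f o(1,3)[OF x]] o'(1) sub]
        by (simp add: Int_absorb2[OF sub])
      also have "\<dots> = res (W' \<inter> V x) (res W' (Y W f))"
      proof -
        have "W' \<inter> V x \<inter> (W \<inter> V x) = W' \<inter> V x" "W' \<inter> V x \<inter> W' = W' \<inter> V x" using W' by auto
        then show ?thesis by (simp only: res_simps(2))
      qed
      finally show "res (W' \<inter> V x) (Y W' (res W' f)) = res (W' \<inter> V x) (res W' (Y W f))" .
    qed simp
  qed
  moreover have "vres (V x) Y = X x" if x: "x \<in> U" for x
  proof (rule vfield_eqI)
    show "vfield M i (V x) (vres (V x) Y)" using \<open>vfield M i U Y\<close> V[OF x] by (blast intro: vfield_vres)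
    show "vfield M i (V x) (X x)" by (rule XV[OF x])
    fix W f assume W: "openin (body M) W" "W \<subseteq> V x" and f: "f \<in> secs M W"
    have "W \<subseteq> U" using W V[OF x] by auto
    from loc[OF W(1) this f x] show "vres (V x) Y W f = X x W f"
      using W secs_id[OF W(1) f] Yid by (simp add: vres_apply Int_absorb2)
  qed
  ultimately show ?thesis by blast
qed

end

section \<open>Morphisms in charts\<close>

locale mor_loc = N: ssheaf N + M: ssheaf M
  for N :: "('x, 'g::real_algebra_1) sspace" and M :: "('y, 'h::real_algebra_1) sspace" +
  fixes \<phi> :: "('x, 'g, 'y, 'h) smor"
  assumes mor: "is_mor N M \<phi>"
begin

abbreviation "pre \<equiv> preim N \<phi>"

lemma pre_open: "openin (body M) W \<Longrightarrow> openin (body N) (pre W)"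
  using mor unfolding is_mor_def continuous_map_def preim_def by blast

lemma bodymap_total: "x \<in> total N \<Longrightarrow> bodymap \<phi> x \<in> total M"
  using mor unfolding is_mor_def continuous_map_def by blast

lemma
  assumes W: "openin (body M) W"
  shows pb_one: "pb \<phi> W (res W 1) = res (pre W) 1"
    and pb_sect: "f \<in> sect M i W \<Longrightarrow> pb \<phi> W f \<in> sect N i (pre W)"
    and pb_scl: "h \<in> secs M W \<Longrightarrow> pb \<phi> W (scl r h) = scl r (pb \<phi> W h)"
    and pb_add: "h \<in> secs M W \<Longrightarrow> g \<in> secs M W \<Longrightarrow> pb \<phi> W (h + g) = pb \<phi> W h + pb \<phi> W g"
    and pb_mult: "h \<in> secs M W \<Longrightarrow> g \<in> secs M W \<Longrightarrow> pb \<phi> W (h * g) = pb \<phi> W h * pb \<phi> W g"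
    and pb_res: "h \<in> secs M W \<Longrightarrow> openin (body M) W' \<Longrightarrow> W' \<subseteq> W \<Longrightarrow>
      pb \<phi> W' (res W' h) = res (pre W') (pb \<phi> W h)"
proof -
  note m = mor[unfolded is_mor_def, THEN conjunct2, rule_format, OF W]
  note m2 = m[THEN conjunct2, THEN conjunct2, rule_format]
  show "pb \<phi> W (res W 1) = res (pre W) 1" by (rule m[THEN conjunct1])
  show "f \<in> sect M i W \<Longrightarrow> pb \<phi> W f \<in> sect N i (pre W)"
    by (rule m[THEN conjunct2, THEN conjunct1, rule_format])
  show "h \<in> secs M W \<Longrightarrow> pb \<phi> W (scl r h) = scl r (pb \<phi> W h)"
    by (rule m2[THEN conjunct1, rule_format])
  show "h \<in> secs M W \<Longrightarrow> g \<in> secs M W \<Longrightarrow> pb \<phi> W (h + g) = pb \<phi> W h + pb \<phi> W g"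
    by (rule m2[THEN conjunct2, THEN conjunct1, rule_format, THEN conjunct1])
  show "h \<in> secs M W \<Longrightarrow> g \<in> secs M W \<Longrightarrow> pb \<phi> W (h * g) = pb \<phi> W h * pb \<phi> W g"
    by (rule m2[THEN conjunct2, THEN conjunct1, rule_format, THEN conjunct2])
  show "h \<in> secs M W \<Longrightarrow> openin (body M) W' \<Longrightarrow> W' \<subseteq> W \<Longrightarrow> pb \<phi> W' (res W' h) = res (pre W') (pb \<phi> W h)"
    by (rule m2[THEN conjunct2, THEN conjunct2, rule_format, OF _ conjI])
qed

lemma pb_secs:
  assumes W: "openin (body M) W" and f: "f \<in> secs M W"
  shows "pb \<phi> W f \<in> secs N (pre W)"
  using f
proof (rule M.secsE)
  fix a b assume f: "f = a + b" and a: "a \<in> sect M False W" and b: "b \<in> sect M True W"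
  have "pb \<phi> W f = pb \<phi> W a + pb \<phi> W b"
    unfolding f by (rule pb_add[OF W M.sect_secs[OF W a] M.sect_secs[OF W b]])
  then show ?thesis
    using N.secs_add[OF pre_open[OF W] N.sect_secs[OF pre_open[OF W] pb_sect[OF W a]]
        N.sect_secs[OF pre_open[OF W] pb_sect[OF W b]]] by simp
qed

lemma pb_zero: "openin (body M) W \<Longrightarrow> pb \<phi> W 0 = 0"
  using pb_scl[of W 0 0] by simp

lemma pb_const: "openin (body M) W \<Longrightarrow> pb \<phi> W (scl r (res W 1)) = scl r (res (pre W) 1)"
  using pb_scl[of W "res W 1" r] pb_one[of W] by simp

lemma pb_uminus: "openin (body M) W \<Longrightarrow> f \<in> secs M W \<Longrightarrow> pb \<phi> W (- f) = - pb \<phi> W f"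
  using pb_scl[of W f "-1"] by simp

lemma pb_diff: "openin (body M) W \<Longrightarrow> f \<in> secs M W \<Longrightarrow> g \<in> secs M W \<Longrightarrow> pb \<phi> W (f - g) = pb \<phi> W f - pb \<phi> W g"
  using pb_add[of W f "- g"] pb_uminus[of W g] M.secs_uminus[of W g] by simp

lemma pb_sum: "openin (body M) W \<Longrightarrow> (\<And>a. a \<in> A \<Longrightarrow> f a \<in> secs M W) \<Longrightarrow>
   pb \<phi> W (\<Sum>a\<in>A. f a) = (\<Sum>a\<in>A. pb \<phi> W (f a))"
  by (induct A rule: infinite_finite_induct) (simp_all add: pb_zero pb_add M.secs_sum)

lemma pb_id: "openin (body M) W \<Longrightarrow> f \<in> secs M W \<Longrightarrow> res (pre W) (pb \<phi> W f) = pb \<phi> W f"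
  by (rule N.secs_id[OF pre_open pb_secs])

lemma pre_mono: "W \<subseteq> W' \<Longrightarrow> pre W \<subseteq> pre W'"
  by (auto simp: preim_def)

end

text \<open>A morphism seen in charts, under a special hypothesis: the pulled-back even coordinates
  are plain functions \<open>\<gamma> a\<close>, with no nilpotent part. Projections, scalings and
  identities in the charts used below are of this kind, and for them the pullback of a function is
  substitution.\<close>

locale chart_mor = mor_loc N M \<phi> + M: schart_loc M n m c + N: schart_loc N n' m' C
  for N :: "('x, 'g::real_algebra_1) sspace" and M :: "('y, 'h::real_algebra_1) sspace" and \<phi>
    and n m c n' m' C +
  fixes V :: "'x set" and \<gamma> :: "nat \<Rightarrow> (nat \<Rightarrow> real) \<Rightarrow> real"
  assumes V: "N.sub V" "V \<subseteq> preim N \<phi> (cdom c)"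
    and \<gamma>: "\<And>a. a < n \<Longrightarrow> smooth_fun n' (N.img V) (\<gamma> a)"
    and pb_coord: "\<And>a. a < n \<Longrightarrow> res V (pb \<phi> (cdom c) (coord c (False, a))) = pull C V (\<gamma> a)"
begin

definition "Vp W = V \<inter> pre W"

text \<open>Slots from \<open>n\<close> on are 0, as points of \<open>Euclidean_space n\<close>
  demand.\<close>

definition \<Gamma> :: "(nat \<Rightarrow> real) \<Rightarrow> nat \<Rightarrow> real" where
  "\<Gamma> v = (\<lambda>a. if a < n then \<gamma> a v else 0)"

lemma Vp_sub: "M.sub W \<Longrightarrow> N.sub (Vp W)"
  unfolding Vp_def by (intro N.sub_Int V pre_open M.sub_open)

lemma Vp_V: "Vp W \<subseteq> V" and Vp_pre: "Vp W \<subseteq> pre W"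
  by (auto simp: Vp_def)

lemma Vp_mono: "W \<subseteq> W' \<Longrightarrow> Vp W \<subseteq> Vp W'"
  using pre_mono by (auto simp: Vp_def)

lemma Vp_cdom: "Vp (cdom c) = V"
  using V by (auto simp: Vp_def)

lemma pb_pull_coord:
  assumes W: "M.sub W" and a: "a < n"
  shows "res (Vp W) (pb \<phi> W (pull c W (\<lambda>v. v a - r))) = pull C (Vp W) (\<lambda>v. \<gamma> a v - r)"
proof -
  have co: "coord c (False, a) \<in> secs M (cdom c)"
    by (rule M.coord_secs) (use a in \<open>auto simp: cidx_def\<close>)
  have sV: "smooth_fun n' (N.img (Vp W)) (\<gamma> a)"
    using N.smooth_img_subset[OF V(1) Vp_sub[OF W] Vp_V \<gamma>[OF a]] .
  have "pb \<phi> W (pull c W (\<lambda>v. v a - r)) = pb \<phi> W (res W (coord c (False, a))) - pb \<phi> W (scl r (res W 1))"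
    unfolding M.pull_coord_minus[OF W]
    by (rule pb_diff[OF M.sub_open[OF W]])
      (use W co in \<open>auto intro!: M.secs_scl M.one_secs M.secs_res[OF M.cdom_open] simp: M.sub_def\<close>)
  also have "\<dots> = res (pre W) (pb \<phi> (cdom c) (coord c (False, a))) - scl r (res (pre W) 1)"
    using pb_res[OF M.cdom_open co, of W] W by (simp add: M.sub_def pb_const)
  finally have "res (Vp W) (pb \<phi> W (pull c W (\<lambda>v. v a - r))) =
      res (Vp W) (res V (pb \<phi> (cdom c) (coord c (False, a)))) - scl r (res (Vp W) 1)"
    by (simp add: Vp_def Int_absorb Int_ac)
  also have "\<dots> = pull C (Vp W) (\<gamma> a) - pull C (Vp W) (\<lambda>v. r)"
    unfolding pb_coord[OF a] N.pull_res[OF V(1) \<gamma>[OF a] N.sub_open[OF Vp_sub[OF W]] Vp_V]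
    by (simp add: N.pull_const[OF Vp_sub[OF W]])
  also have "\<dots> = pull C (Vp W) (\<lambda>v. \<gamma> a v - r)"
    by (rule N.pull_diff[OF Vp_sub[OF W] sV, symmetric]) (intro smooth_const N.img_open Vp_sub W)
  finally show ?thesis .
qed

text \<open>Germs do not show the body map directly. If the two numbers differed,
  \<open>v a - r\<close> would be invertible near the image point and its pullback would be a unit;
  but that pullback has value 0 at \<open>x\<close>, so it lies in the ideal
  \<open>vanishing x\<close>, which contains no unit.\<close>

lemma body:
  assumes x: "x \<in> V" and a: "a < n"
  shows "\<gamma> a (bmap C x) = bmap c (bodymap \<phi> x) a"
proof (rule ccontr)
  let ?r = "\<gamma> a (bmap C x)" and ?y = "bodymap \<phi> x"
  assume ne: "?r \<noteq> bmap c ?y a"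
  have y: "?y \<in> cdom c" using x V(2) by (auto simp: preim_def)
  \<comment> \<open>With the gap as radius, the cube misses the hyperplane where
    \<open>v a - ?r\<close> is zero.\<close>
  let ?e = "\<bar>bmap c ?y a - ?r\<bar>"
  let ?W = "{z \<in> cdom c. bmap c z \<in> ecube n (bmap c ?y) ?e}"
  have W: "M.sub ?W" by (rule M.preimage_open[OF M.sub_cdom openin_ecube])
  have yW: "?y \<in> ?W"
    using y ne centre_in_ecube[OF _ M.img_cdom_open, of ?e "bmap c ?y"] by auto
  have nz: "v a - ?r \<noteq> 0" if "v \<in> M.img ?W" for v
    using that a by (auto simp: ecube_def)
  have s: "smooth_fun n (M.img ?W) (\<lambda>v. v a - ?r)" by (rule M.smooth_coord_minus[OF W])
  have i: "smooth_fun n (M.img ?W) (\<lambda>v. inverse (v a - ?r))"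
    by (rule smooth_inverse[OF M.img_open[OF W] s]) (rule nz)
  have inv: "pull c ?W (\<lambda>v. v a - ?r) * pull c ?W (\<lambda>v. inverse (v a - ?r)) = res ?W 1"
    unfolding M.pull_mult[OF W s i, symmetric] M.pull_1[OF W, symmetric]
    by (rule M.pull_cong[OF W smooth_const[OF M.img_open[OF W]]]) (use nz in auto)
  have "pb \<phi> ?W (pull c ?W (\<lambda>v. v a - ?r)) * pb \<phi> ?W (pull c ?W (\<lambda>v. inverse (v a - ?r))) = res (pre ?W) 1"
    using trans[OF pb_mult[OF M.sub_open[OF W] M.pull_secs[OF W s] M.pull_secs[OF W i], symmetric,
        unfolded inv] pb_one[OF M.sub_open[OF W]]] .
  then have "res (Vp ?W) (pb \<phi> ?W (pull c ?W (\<lambda>v. v a - ?r))) *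
      res (Vp ?W) (pb \<phi> ?W (pull c ?W (\<lambda>v. inverse (v a - ?r)))) = res (Vp ?W) (res (pre ?W) 1)"
    unfolding res_simps(6)[symmetric] by (rule arg_cong)
  then have e: "pull C (Vp ?W) (\<lambda>v. \<gamma> a v - ?r) *
      res (Vp ?W) (pb \<phi> ?W (pull c ?W (\<lambda>v. inverse (v a - ?r)))) = res (Vp ?W) 1"
    unfolding pb_pull_coord[OF W a] by (simp add: Vp_def Int_absorb Int_ac)
  note sV = Vp_sub[OF W]
  have xV: "x \<in> Vp ?W" using x yW N.sub_dom[OF V(1)] openin_subset[OF N.cdom_open] by (auto simp: Vp_def preim_def)
  have "N.vanishing x (pull C (Vp ?W) (\<lambda>v. \<gamma> a v - ?r))"
    by (rule N.vanishing_pull[OF sV xV])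
      (auto intro!: smooth_diff smooth_const N.img_open sV N.smooth_img_subset[OF V(1) sV Vp_V \<gamma>[OF a]])
  moreover have ss: "res (Vp ?W) (pb \<phi> ?W (pull c ?W (\<lambda>v. inverse (v a - ?r)))) \<in> secs N (Vp ?W)"
    by (rule N.secs_res[OF pre_open pb_secs N.sub_open[OF sV] Vp_pre])
      (use M.sub_open[OF W] M.pull_secs[OF W i] in auto)
  ultimately have "N.vanishing x (pull C (Vp ?W) (\<lambda>v. \<gamma> a v - ?r) *
      res (Vp ?W) (pb \<phi> ?W (pull c ?W (\<lambda>v. inverse (v a - ?r)))))"
    using N.vanishing_mult[OF _ xV N.sub_open[OF sV] ss] by blast
  then have "N.vanishing x (res (Vp ?W) 1)" unfolding e .
  then show False using N.not_vanishing_one[OF xV sV] by simp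
qed

lemma \<Gamma>_body: "x \<in> V \<Longrightarrow> \<Gamma> (bmap C x) = bmap c (bodymap \<phi> x)"
proof
  fix a assume x: "x \<in> V"
  then have "bodymap \<phi> x \<in> cdom c" using V(2) by (auto simp: preim_def)
  then show "\<Gamma> (bmap C x) a = bmap c (bodymap \<phi> x) a"
    using body[OF x] M.img_zero by (auto simp: \<Gamma>_def)
qed

lemma smooth_\<Gamma>:
  assumes W: "M.sub W" and g: "smooth_fun n (M.img W) g"
  shows "smooth_fun n' (N.img (Vp W)) (\<lambda>v. g (\<Gamma> v))"
proof (rule smooth_compose[OF N.img_open[OF Vp_sub[OF W]] M.img_open[OF W] _ _ g])
  show "\<Gamma> v \<in> M.img W" if "v \<in> N.img (Vp W)" for v
    using that \<Gamma>_body by (auto simp: Vp_def preim_def)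
  show "smooth_fun n' (N.img (Vp W)) (\<lambda>v. \<Gamma> v a)" if "a < n" for a
    using N.smooth_img_subset[OF V(1) Vp_sub[OF W] Vp_V \<gamma>[OF that]] that by (simp add: \<Gamma>_def)
qed

text \<open>Hadamard's lemma around \<open>y\<close>, read as an identity of sections.\<close>

lemma pull_hadamard:
  assumes W: "M.sub W" and g: "smooth_fun n (M.img W) g" and y: "y \<in> W"
  obtains W' G where "M.sub W'" "W' \<subseteq> W" "y \<in> W'" "\<And>a. a < n \<Longrightarrow> smooth_fun n (M.img W') (G a)"
    "res W' (pull c W g) = scl (g (bmap c y)) (res W' 1) +
       (\<Sum>a<n. pull c W' (\<lambda>v. v a - bmap c y a) * pull c W' (G a))"
proof -
  obtain e G where eG: "e > 0" "ecube n (bmap c y) e \<subseteq> M.img W"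
    "\<And>a. a < n \<Longrightarrow> smooth_fun n (ecube n (bmap c y) e) (G a)"
    "\<And>v. v \<in> ecube n (bmap c y) e \<Longrightarrow> g v = g (bmap c y) + (\<Sum>a<n. (v a - bmap c y a) * G a v)"
    using hadamard[OF M.img_open[OF W] imageI[OF y] g] by auto
  let ?E = "ecube n (bmap c y) e"
  let ?W = "{z \<in> W. bmap c z \<in> ?E}"
  have W': "M.sub ?W" by (rule M.preimage_open[OF W openin_ecube])
  have im: "M.img ?W = ?E" by (rule M.img_preimage[OF W eG(2)])
  have sm: "smooth_fun n (M.img ?W) (\<lambda>v. (v a - bmap c y a) * G a v)" if "a < n" for a
    unfolding im using eG(3) that by (intro smooth_mult smooth_diff smooth_coord smooth_const openin_ecube)
  have "res ?W (pull c W g) = pull c ?W g"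
    using M.pull_res[OF W g M.sub_open[OF W']] by auto
  also have "\<dots> = pull c ?W (\<lambda>v. g (bmap c y) + (\<Sum>a<n. (v a - bmap c y a) * G a v))"
    by (rule M.pull_cong[OF W'])
      (use im eG(4) sm in \<open>auto intro!: smooth_add smooth_const smooth_sum openin_ecube\<close>)
  also have "\<dots> = pull c ?W (\<lambda>v. g (bmap c y)) + pull c ?W (\<lambda>v. \<Sum>a<n. (v a - bmap c y a) * G a v)"
    by (rule M.pull_add[OF W']) (use sm in \<open>auto intro!: smooth_const smooth_sum M.img_open W'\<close>)
  also have "pull c ?W (\<lambda>v. \<Sum>a<n. (v a - bmap c y a) * G a v) =
      (\<Sum>a<n. pull c ?W (\<lambda>v. (v a - bmap c y a) * G a v))"
    by (rule M.pull_sum[OF W']) (use sm in auto)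
  also have "\<dots> = (\<Sum>a<n. pull c ?W (\<lambda>v. v a - bmap c y a) * pull c ?W (G a))"
    by (intro sum.cong refl M.pull_mult[OF W' M.smooth_coord_minus[OF W']]) (use im eG(3) in auto)
  finally have "res ?W (pull c W g) = scl (g (bmap c y)) (res ?W 1) +
       (\<Sum>a<n. pull c ?W (\<lambda>v. v a - bmap c y a) * pull c ?W (G a))"
    by (simp only: M.pull_const[OF W'])
  moreover have "y \<in> ?W"
    using y centre_in_ecube[OF eG(1) M.img_open[OF W] imageI[OF y]] by simp
  ultimately show ?thesis
    by (intro that[of ?W G]) (use W' im eG(3) in auto)
qed

lemma vanishing_pb_coord:
  assumes W: "M.sub W" and x: "x \<in> Vp W" and a: "a < n"
  shows "N.vanishing x (res (Vp W) (pb \<phi> W (pull c W (\<lambda>v. v a - bmap c (bodymap \<phi> x) a))))"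
  unfolding pb_pull_coord[OF W a]
proof (rule N.vanishing_pull[OF Vp_sub[OF W] x])
  show "smooth_fun n' (N.img (Vp W)) (\<lambda>v. \<gamma> a v - bmap c (bodymap \<phi> x) a)"
    by (intro smooth_diff smooth_const N.img_open Vp_sub W N.smooth_img_subset[OF V(1) Vp_sub[OF W] Vp_V \<gamma>[OF a]])
  show "\<gamma> a (bmap C x) - bmap c (bodymap \<phi> x) a = 0"
    using body[of x a] x a by (auto simp: Vp_def)
qed

text \<open>By \<open>\<Gamma>_body\<close> both sides have the same constant term at
  \<open>x\<close>, and what remains on the left is a combination of pulled-back centred
  coordinates. So the difference lies in \<open>vanishing x\<close> for every
  \<open>x\<close>.\<close>

lemma pb_pull:
  assumes W: "M.sub W" and g: "smooth_fun n (M.img W) g"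
  shows "res (Vp W) (pb \<phi> W (pull c W g)) = pull C (Vp W) (\<lambda>v. g (\<Gamma> v))"
proof -
  let ?f = "res (Vp W) (pb \<phi> W (pull c W g)) - pull C (Vp W) (\<lambda>v. g (\<Gamma> v))"
  note oV = N.sub_open[OF Vp_sub]
  have s: "res (Vp W) (pb \<phi> W h) \<in> secs N (Vp W)" if "M.sub W" "h \<in> secs M W" for W h
    by (rule N.secs_res[OF pre_open pb_secs oV Vp_pre]) (use that M.sub_open in auto)
  have "?f = 0"
  proof (rule N.vanishing_imp_0[OF Vp_sub[OF W]])
    show "?f \<in> secs N (Vp W)"
      by (intro N.secs_diff oV W s M.pull_secs g N.pull_secs Vp_sub smooth_\<Gamma>)
    fix x assume x: "x \<in> Vp W"
    let ?y = "bodymap \<phi> x"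
    have yW: "?y \<in> W" using x by (auto simp: Vp_def preim_def)
    obtain W' G where W': "M.sub W'" "W' \<subseteq> W" "?y \<in> W'" "\<And>a. a < n \<Longrightarrow> smooth_fun n (M.img W') (G a)"
      "res W' (pull c W g) = scl (g (bmap c ?y)) (res W' 1) +
         (\<Sum>a<n. pull c W' (\<lambda>v. v a - bmap c ?y a) * pull c W' (G a))"
      by (rule pull_hadamard[OF W g yW], rule that)
    have xW': "x \<in> Vp W'" using x W'(3) by (auto simp: Vp_def preim_def)
    note sp = M.pull_secs[OF W'(1) M.smooth_coord_minus[OF W'(1)]] M.pull_secs[OF W'(1) W'(4)]
    have t: "pull c W' (\<lambda>v. v a - bmap c ?y a) * pull c W' (G a) \<in> secs M W'" if "a < n" for a
      by (intro M.secs_mult M.sub_open W' sp that)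
    have "res (Vp W') (pb \<phi> W (pull c W g)) = res (Vp W') (pb \<phi> W' (res W' (pull c W g)))"
      using pb_res[OF M.sub_open[OF W] M.pull_secs[OF W g] M.sub_open[OF W'(1)] W'(2)] Vp_pre[of W']
      by (simp add: Int_absorb2)
    also have "\<dots> = scl (g (bmap c ?y)) (res (Vp W') 1) +
       (\<Sum>a<n. res (Vp W') (pb \<phi> W' (pull c W' (\<lambda>v. v a - bmap c ?y a))) * res (Vp W') (pb \<phi> W' (pull c W' (G a))))"
    proof -
      note o = M.sub_open[OF W'(1)]
      let ?p = "\<lambda>a. pull c W' (\<lambda>v. v a - bmap c ?y a)"
      have "pb \<phi> W' (\<Sum>a<n. ?p a * pull c W' (G a)) = (\<Sum>a<n. pb \<phi> W' (?p a * pull c W' (G a)))"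
        by (rule pb_sum[OF o]) (use t in auto)
      also have "\<dots> = (\<Sum>a<n. pb \<phi> W' (?p a) * pb \<phi> W' (pull c W' (G a)))"
        by (intro sum.cong refl pb_mult[OF o]) (use sp in auto)
      finally have s: "pb \<phi> W' (\<Sum>a<n. ?p a * pull c W' (G a)) = (\<Sum>a<n. pb \<phi> W' (?p a) * pb \<phi> W' (pull c W' (G a)))" .
      have "pb \<phi> W' (scl (g (bmap c ?y)) (res W' 1) + (\<Sum>a<n. ?p a * pull c W' (G a))) =
          scl (g (bmap c ?y)) (res (pre W') 1) + (\<Sum>a<n. pb \<phi> W' (?p a) * pb \<phi> W' (pull c W' (G a)))"
        unfolding s[symmetric] pb_const[OF o, symmetric]
        by (rule pb_add[OF o]) (use t o in \<open>auto intro!: M.secs_sum M.secs_scl\<close>)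
      then show ?thesis unfolding W'(5) using Vp_pre[of W'] by (simp add: res_sum Int_absorb2)
    qed
    finally have e: "res (Vp W') ?f = (scl (g (bmap c ?y)) (res (Vp W') 1) - pull C (Vp W') (\<lambda>v. g (\<Gamma> v))) +
       (\<Sum>a<n. res (Vp W') (pb \<phi> W' (pull c W' (\<lambda>v. v a - bmap c ?y a))) * res (Vp W') (pb \<phi> W' (pull c W' (G a))))"
      using Vp_mono[OF W'(2)] N.pull_res[OF Vp_sub[OF W] smooth_\<Gamma>[OF W g] oV[OF W'(1)] Vp_mono[OF W'(2)]]
      by (simp add: Int_absorb2)
    have xd: "x \<in> cdom C" using x V(1) N.sub_dom by (auto simp: Vp_def)
    have g': "smooth_fun n' (N.img (Vp W')) (\<lambda>v. g (\<Gamma> v))"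
      by (rule N.smooth_img_subset[OF Vp_sub[OF W] Vp_sub[OF W'(1)] Vp_mono[OF W'(2)] smooth_\<Gamma>[OF W g]])
    have v: "N.vanishing x (pull C (Vp W') (\<lambda>v. g (bmap c ?y) - g (\<Gamma> v)))"
    proof (rule N.vanishing_pull[OF Vp_sub[OF W'(1)] xW'])
      show "smooth_fun n' (N.img (Vp W')) (\<lambda>v. g (bmap c ?y) - g (\<Gamma> v))"
        by (intro smooth_diff smooth_const g' N.img_open Vp_sub W')
      show "g (bmap c ?y) - g (\<Gamma> (bmap C x)) = 0"
        using \<Gamma>_body[of x] x by (auto simp: Vp_def)
    qed
    have eq: "pull C (Vp W') (\<lambda>v. g (bmap c ?y) - g (\<Gamma> v)) =
        scl (g (bmap c ?y)) (res (Vp W') 1) - pull C (Vp W') (\<lambda>v. g (\<Gamma> v))"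
      using N.pull_diff[OF Vp_sub[OF W'(1)] smooth_const[OF N.img_open[OF Vp_sub[OF W'(1)]]] g']
      by (simp add: N.pull_const Vp_sub W')
    have "N.vanishing x (res (Vp W') ?f)"
      unfolding e
      by (intro v[unfolded eq] N.vanishing_add N.vanishing_sum xd N.vanishing_mult[OF vanishing_pb_coord xW' oV] s)
        (use W' xW' sp in auto)
    then show "N.vanishing x ?f"
      by (rule N.vanishing_cong[OF _ oV[OF W'(1)] xW']) (simp add: Int_absorb)
  qed
  then show ?thesis by simp
qed

text \<open>Hadamard's lemma writes a pullback as a constant plus multiples of centred coordinates.
  A derivation along \<open>\<phi>\<close> that kills coordinates turns these into multiples of
  pulled-back centred coordinates, which vanish at \<open>x\<close>. Odd factors follow by
  \<open>section_induct\<close>. The sign \<open>s\<close> stays abstract to cover fields of either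
  parity.\<close>

lemma derivation_eq_0:
  fixes D :: "'y set \<Rightarrow> ('y \<Rightarrow> 'h) \<Rightarrow> 'x \<Rightarrow> 'g"
  assumes D_secs: "\<And>W f. M.sub W \<Longrightarrow> f \<in> secs M W \<Longrightarrow> D W f \<in> secs N (Vp W)"
    and D_add: "\<And>W f g. M.sub W \<Longrightarrow> f \<in> secs M W \<Longrightarrow> g \<in> secs M W \<Longrightarrow> D W (f + g) = D W f + D W g"
    and D_const: "\<And>W r. M.sub W \<Longrightarrow> D W (scl r (res W 1)) = 0"
    and D_mult: "\<And>W j f g. M.sub W \<Longrightarrow> f \<in> sect M j W \<Longrightarrow> g \<in> secs M W \<Longrightarrow>
      D W (f * g) = D W f * res (Vp W) (pb \<phi> W g) + scl (s j) (res (Vp W) (pb \<phi> W f) * D W g)"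
    and s: "s False = 1"
    and D_res: "\<And>W W' f. M.sub W \<Longrightarrow> f \<in> secs M W \<Longrightarrow> openin (body M) W' \<Longrightarrow> W' \<subseteq> W \<Longrightarrow>
      D W' (res W' f) = res (Vp W') (D W f)"
    and D_coord: "\<And>A. A \<in> cidx n m \<Longrightarrow> D (cdom c) (coord c A) = 0"
    and W: "M.sub W" and f: "f \<in> secs M W"
  shows "D W f = 0"
proof -
  note oV = N.sub_open[OF Vp_sub]
  have Dc: "D W (res W (coord c A)) = 0" if "A \<in> cidx n m" "M.sub W" for A W
    using D_res[OF M.sub_cdom M.coord_secs[OF that(1)], of W] that D_coord[OF that(1)] by (simp add: M.sub_def)
  \<comment> \<open>The Leibniz rule is available for a homogeneous left factor only, so
    \<open>f\<close> is split by parity.\<close>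
  have D0: "D W (f * g) = 0" if W: "M.sub W" and f: "f \<in> secs M W" and g: "g \<in> secs M W" and "D W f = 0" "D W g = 0" for W f g
    using f
  proof (rule M.secsE)
    fix a b assume f: "f = a + b" and a: "a \<in> sect M False W" and b: "b \<in> sect M True W"
    note o = M.sub_open[OF W]
    note as = M.sect_secs[OF o a] and bs = M.sect_secs[OF o b]
    have "D W (f * g) = D W (a * g) + D W (b * g)"
      unfolding f distrib_right by (rule D_add[OF W M.secs_mult[OF o as g] M.secs_mult[OF o bs g]])
    also have "\<dots> = (D W a + D W b) * res (Vp W) (pb \<phi> W g)"
      unfolding D_mult[OF W a g] D_mult[OF W b g] \<open>D W g = 0\<close> by (simp add: distrib_right)
    also have "\<dots> = D W f * res (Vp W) (pb \<phi> W g)"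
      unfolding f D_add[OF W as bs] ..
    also have "\<dots> = 0" unfolding \<open>D W f = 0\<close> by simp
    finally show ?thesis .
  qed
  show ?thesis using W f
  proof (induct rule: M.section_induct)
    case (pull g)
    show ?case
    proof (rule N.vanishing_imp_0[OF Vp_sub[OF W]])
      show "D W (pull c W g) \<in> secs N (Vp W)" by (intro D_secs W M.pull_secs pull)
      fix x assume x: "x \<in> Vp W"
      let ?y = "bodymap \<phi> x"
      have yW: "?y \<in> W" using x by (auto simp: Vp_def preim_def)
      obtain W' G where W': "M.sub W'" "W' \<subseteq> W" "?y \<in> W'" "\<And>a. a < n \<Longrightarrow> smooth_fun n (M.img W') (G a)"
        "res W' (pull c W g) = scl (g (bmap c ?y)) (res W' 1) +
           (\<Sum>a<n. pull c W' (\<lambda>v. v a - bmap c ?y a) * pull c W' (G a))"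
        by (rule pull_hadamard[OF W pull yW], rule that)
      have xW': "x \<in> Vp W'" using x W'(3) by (auto simp: Vp_def preim_def)
      have xd: "x \<in> cdom C" using x V(1) N.sub_dom by (auto simp: Vp_def)
      let ?p = "\<lambda>a. pull c W' (\<lambda>v. v a - bmap c ?y a)"
      note o = M.sub_open[OF W'(1)]
      note sp = M.pull_secs[OF W'(1) M.smooth_coord_minus[OF W'(1)]] M.pull_secs[OF W'(1) W'(4)]
      have t: "?p a * pull c W' (G a) \<in> secs M W'" if "a < n" for a
        by (intro M.secs_mult o sp that)
      have Dp: "D W' (?p a) = 0" if "a < n" for a
      proof -
        have A: "(False, a) \<in> cidx n m" using that by (auto simp: cidx_def)
        have "?p a = res W' (coord c (False, a)) + scl (- bmap c ?y a) (res W' 1)"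
          unfolding M.pull_coord_minus[OF W'(1)] by simp
        then have "D W' (?p a) = D W' (res W' (coord c (False, a))) + D W' (scl (- bmap c ?y a) (res W' 1))"
          using D_add[OF W'(1) M.secs_res[OF M.cdom_open M.coord_secs[OF A] o M.sub_dom[OF W'(1)]]
              M.secs_scl[OF o M.one_secs[OF o]]] by (simp only:)
        then show ?thesis unfolding Dc[OF A W'(1)] D_const[OF W'(1)] by simp
      qed
      have sumD: "D W' (\<Sum>a\<in>A. f a) = (\<Sum>a\<in>A. D W' (f a))" if "\<And>a. a \<in> A \<Longrightarrow> f a \<in> secs M W'" for A :: "nat set" and f
        using that
        by (induct A rule: infinite_finite_induct) (use D_const[OF W'(1), of 0] in \<open>simp_all add: D_add W' M.secs_sum o\<close>)
      have "res (Vp W') (D W (pull c W g)) = D W' (res W' (pull c W g))"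
        by (rule D_res[OF W M.pull_secs[OF W pull] o W'(2), symmetric])
      also have "\<dots> = D W' (\<Sum>a<n. ?p a * pull c W' (G a))"
        unfolding W'(5) using D_const[OF W'(1)] t
        by (subst D_add[OF W'(1)]) (auto intro!: M.secs_scl M.secs_sum M.one_secs o)
      also have "\<dots> = (\<Sum>a<n. D W' (?p a * pull c W' (G a)))" by (rule sumD) (use t in auto)
      also have "\<dots> = (\<Sum>a<n. res (Vp W') (pb \<phi> W' (?p a)) * D W' (pull c W' (G a)))"
        by (intro sum.cong refl)
          (use D_mult[OF W'(1) M.pull_sect[OF W'(1) M.smooth_coord_minus[OF W'(1)]] sp(2)] Dp s in auto)
      finally have e: "res (Vp W') (D W (pull c W g)) = \<dots>" .
      have "N.vanishing x (res (Vp W') (D W (pull c W g)))"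
        unfolding e
        by (intro N.vanishing_sum xd N.vanishing_mult[OF vanishing_pb_coord xW' oV] D_secs)
          (use W' xW' sp in auto)
      then show "N.vanishing x (D W (pull c W g))"
        by (rule N.vanishing_cong[OF _ oV[OF W'(1)] xW']) (simp add: Int_absorb)
    qed
  next
    case (add f g)
    have "D W (f + g) = 0"
      unfolding D_add[OF W add(1,2)] using add(3,4) by (simp add: zero_fun_def)
    then show ?case .
  next
    case (odd j f)
    have A: "(True, j) \<in> cidx n m" using odd by (auto simp: cidx_def)
    have "D W f = 0" using odd(3) .
    then have "D W (f * res W (oddc c j)) = 0"
      using D0[OF W odd(2)] Dc[OF A W] M.sect_secs[OF M.sub_open[OF W] M.coord_res_sect[OF A W]]
      by (simp add: coord_def)
    then show ?case .
  qed
qed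

text \<open>Both morphisms substitute the same \<open>\<gamma>\<close>, so they agree on pullbacks,
  and on body points because \<open>bmap c\<close> is injective; the odd coordinates are the
  remaining generators.\<close>

lemma determined:
  assumes \<psi>: "chart_mor N M \<psi> n m c n' m' C V \<gamma>"
    and o: "\<And>j. j < m \<Longrightarrow> res V (pb \<phi> (cdom c) (oddc c j)) = res V (pb \<psi> (cdom c) (oddc c j))"
  shows "x \<in> V \<Longrightarrow> bodymap \<phi> x = bodymap \<psi> x"
    and "M.sub W \<Longrightarrow> f \<in> secs M W \<Longrightarrow> res (Vp W) (pb \<phi> W f) = res (Vp W) (pb \<psi> W f)"
proof -
  interpret P: chart_mor N M \<psi> n m c n' m' C V \<gamma> by (rule \<psi>)
  have b: "bodymap \<phi> x = bodymap \<psi> x" if "x \<in> V" for x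
  proof -
    have "\<Gamma> = P.\<Gamma>" by (simp add: \<Gamma>_def P.\<Gamma>_def fun_eq_iff)
    then have "bmap c (bodymap \<phi> x) = bmap c (bodymap \<psi> x)"
      using \<Gamma>_body[OF that] P.\<Gamma>_body[OF that] by simp
    moreover have "bodymap \<phi> x \<in> cdom c" "bodymap \<psi> x \<in> cdom c"
      using that V(2) P.V(2) by (auto simp: preim_def)
    ultimately show ?thesis using M.inj_bmap by (auto dest: inj_onD)
  qed
  then show "x \<in> V \<Longrightarrow> bodymap \<phi> x = bodymap \<psi> x" .
  have VpP: "P.Vp W = Vp W" for W
    using b by (auto simp: Vp_def P.Vp_def preim_def)
  assume W: "M.sub W" and f: "f \<in> secs M W"
  from W f show "res (Vp W) (pb \<phi> W f) = res (Vp W) (pb \<psi> W f)"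
  proof (induct rule: M.section_induct)
    case (pull g)
    then show ?case
      using pb_pull[OF W, of g] P.pb_pull[OF W, of g] VpP
      by (simp add: \<Gamma>_def P.\<Gamma>_def)
  next
    case (add f g)
    have "res (Vp W) (pb \<phi> W (f + g)) = res (Vp W) (pb \<psi> W (f + g))"
      unfolding pb_add[OF M.sub_open[OF W] add(1,2)] P.pb_add[OF M.sub_open[OF W] add(1,2)]
        res_simps add(3,4) ..
    then show ?case .
  next
    case (odd j f)
    have A: "(True, j) \<in> cidx n m" using odd by (auto simp: cidx_def)
    have os: "oddc c j \<in> secs M (cdom c)" using M.coord_secs[OF A] by (simp add: coord_def)
    have ors: "res W (oddc c j) \<in> secs M W"
      using M.secs_res[OF M.cdom_open os M.sub_open[OF W] M.sub_dom[OF W]] .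
    have "res (Vp W) (pb \<phi> W (res W (oddc c j))) = res (Vp W) (res V (pb \<phi> (cdom c) (oddc c j)))"
      using pb_res[OF M.cdom_open os M.sub_open[OF W] M.sub_dom[OF W]]
      by (simp add: Vp_def Int_ac)
    also have "\<dots> = res (Vp W) (res V (pb \<psi> (cdom c) (oddc c j)))" using o[OF odd(1)] by simp
    also have "\<dots> = res (Vp W) (pb \<psi> W (res W (oddc c j)))"
      using P.pb_res[OF M.cdom_open os M.sub_open[OF W] M.sub_dom[OF W]]
      by (simp add: P.Vp_def Int_ac flip: VpP)
    finally have e: "res (Vp W) (pb \<phi> W (res W (oddc c j))) = res (Vp W) (pb \<psi> W (res W (oddc c j)))" .
    have "res (Vp W) (pb \<phi> W (f * res W (oddc c j))) = res (Vp W) (pb \<psi> W (f * res W (oddc c j)))"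
      unfolding pb_mult[OF M.sub_open[OF W] odd(2) ors] P.pb_mult[OF M.sub_open[OF W] odd(2) ors] res_simps(6) odd(3) e ..
    then show ?case .
  qed
qed

end

section \<open>Coordinate vector fields\<close>

text \<open>The sign of moving the \<open>j\<close>-th odd coordinate to its place in an increasing monomial.\<close>

definition sg :: "nat \<Rightarrow> nat set \<Rightarrow> real" where
  "sg j S = (-1) ^ card {i \<in> S. i < j}"

lemma sg_sq [simp]: "sg j S * sg j S = 1" "sg j S * (sg j S * r) = r"
  by (simp_all add: sg_def flip: power_mult_distrib mult.assoc)

lemma sg_nonzero [simp]: "sg j S \<noteq> 0"
  by (simp add: sg_def)

lemma sg_insert: "finite S \<Longrightarrow> k \<notin> S \<Longrightarrow> sg j (insert k S) = (if k < j then - sg j S else sg j S)"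
proof -
  assume S: "finite S" "k \<notin> S"
  have "{i \<in> insert k S. i < j} = (if k < j then insert k {i \<in> S. i < j} else {i \<in> S. i < j})" by auto
  then show ?thesis using S by (simp add: sg_def)
qed

lemma sg_remove_self: "sg j (S - {j}) = sg j S"
proof -
  have "{i \<in> S - {j}. i < j} = {i \<in> S. i < j}" by auto
  then show ?thesis by (simp add: sg_def)
qed

lemma sg_remove: "finite S \<Longrightarrow> k \<in> S \<Longrightarrow> sg j (S - {k}) = (if k < j then - sg j S else sg j S)"
  using sg_insert[of "S - {k}" k j] by (simp add: insert_absorb split: if_splits)

text \<open>As the list is sorted, insertion passes exactly the entries below \<open>j\<close>, and
  each passage costs a sign.\<close>

lemma prod_list_insort:
  fixes \<xi> :: "nat \<Rightarrow> 'x \<Rightarrow> 'g::real_algebra_1"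
  assumes "sorted xs" "distinct xs" "j \<notin> set xs" "\<And>i. i \<in> set xs \<Longrightarrow> \<xi> j * \<xi> i = - (\<xi> i * \<xi> j)"
  shows "\<xi> j * prod_list (map \<xi> xs) = scl (sg j (set xs)) (prod_list (map \<xi> (insort j xs)))"
  using assms
proof (induct xs)
  case Nil
  have "\<xi> j * prod_list (map \<xi> []) = scl (sg j (set [])) (prod_list (map \<xi> (insort j [])))"
    by (simp add: sg_def)
  then show ?case .
next
  case (Cons a xs)
  have "\<xi> j * prod_list (map \<xi> (a # xs)) = scl (sg j (set (a # xs))) (prod_list (map \<xi> (insort j (a # xs))))"
  proof (cases "j \<le> a")
    case True
    then have "{i \<in> set (a # xs). i < j} = {}" using Cons.prems by auto
    then have "sg j (set (a # xs)) = 1" unfolding sg_def by (simp only: card.empty power_0)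
    then show ?thesis using True by simp
  next
    case False
    have anti: "\<xi> j * \<xi> i = - (\<xi> i * \<xi> j)" if "i \<in> set (a # xs)" for i
      using Cons.prems(4)[OF that] .
    have IH: "\<xi> j * prod_list (map \<xi> xs) = scl (sg j (set xs)) (prod_list (map \<xi> (insort j xs)))"
      by (rule Cons.hyps[OF _ _ _ anti]) (use Cons.prems(1-3) in auto)
    have "\<xi> j * prod_list (map \<xi> (a # xs)) = \<xi> j * \<xi> a * prod_list (map \<xi> xs)"
      by (simp add: mult.assoc)
    also have "\<dots> = - (\<xi> a * \<xi> j) * prod_list (map \<xi> xs)" using anti[of a] by simp
    also have "\<dots> = - (\<xi> a * (\<xi> j * prod_list (map \<xi> xs)))" by (simp add: mult.assoc)
    also have "\<dots> = scl (- sg j (set xs)) (\<xi> a * prod_list (map \<xi> (insort j xs)))"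
      unfolding IH by simp
    finally have e: "\<xi> j * prod_list (map \<xi> (a # xs)) = \<dots>" .
    have "- sg j (set xs) = sg j (set (a # xs))"
      using False Cons.prems(1-3) sg_insert[of "set xs" a j] by simp
    then show ?thesis unfolding e using False by simp
  qed
  then show ?case .
qed

lemma scl_eq_0: "scl r f = 0 \<Longrightarrow> r \<noteq> 0 \<Longrightarrow> f = 0"
  by (auto simp: scl_def fun_eq_iff)

section \<open>Multiplication by an odd coordinate\<close>

context schart_loc
begin

lemma oddc_anticommute: "i < m \<Longrightarrow> j < m \<Longrightarrow> oddc c i * oddc c j = - (oddc c j * oddc c i)"
  using sect_commute[OF cdom_open oddc_sect oddc_sect, of i j] by simp

text \<open>The coordinate anticommutes with itself, and 2 is invertible in a real algebra.\<close>

lemma oddc_sq: "j < m \<Longrightarrow> oddc c j * oddc c j = 0"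
proof -
  assume "j < m"
  then have "oddc c j * oddc c j + oddc c j * oddc c j = 0"
    using oddc_anticommute[of j j] by (metis add.right_inverse)
  then have "scl 2 (oddc c j * oddc c j) = 0"
    using scl_add_left[of 1 1 "oddc c j * oddc c j"] by simp
  then show ?thesis by (rule scl_eq_0) simp
qed

lemma odd_monom_insert:
  assumes "j < m" "S \<subseteq> {..<m}" "j \<notin> S"
  shows "oddc c j * odd_monom (oddc c) S = scl (sg j S) (odd_monom (oddc c) (insert j S))"
proof -
  have f: "finite S" using assms(2) finite_subset by blast
  have "oddc c j * prod_list (map (oddc c) (sorted_list_of_set S)) =
      scl (sg j (set (sorted_list_of_set S))) (prod_list (map (oddc c) (insort j (sorted_list_of_set S))))"
    by (rule prod_list_insort) (use assms f oddc_anticommute in auto)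
  then show ?thesis using f assms(3) by (simp add: odd_monom_def sorted_list_of_set_insert)
qed

lemma odd_monom_mult_0:
  assumes "j < m" "S \<subseteq> {..<m}" "j \<in> S"
  shows "oddc c j * odd_monom (oddc c) S = 0"
proof -
  have e: "oddc c j * odd_monom (oddc c) (S - {j}) = scl (sg j (S - {j})) (odd_monom (oddc c) S)"
    using odd_monom_insert[of j "S - {j}"] assms by (auto simp: insert_absorb)
  have "scl (sg j (S - {j})) (oddc c j * odd_monom (oddc c) S) = oddc c j * (oddc c j * odd_monom (oddc c) (S - {j}))"
    unfolding e by simp
  also have "\<dots> = 0" using oddc_sq[OF assms(1)] by (simp flip: mult.assoc)
  finally show ?thesis by (rule scl_eq_0) simp
qed

text \<open>The coefficients after multiplication by the \<open>j\<close>-th odd coordinate from the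
  left.\<close>

definition mul_odd :: "nat \<Rightarrow> (nat set \<Rightarrow> (nat \<Rightarrow> real) \<Rightarrow> real) \<Rightarrow> nat set \<Rightarrow> (nat \<Rightarrow> real) \<Rightarrow> real" where
  "mul_odd j F S = (if j \<in> S then (\<lambda>v. sg j S * F (S - {j}) v) else (\<lambda>v. 0))"

lemma smooth_mul_odd: "sub W \<Longrightarrow> smooth_coeffs W F \<Longrightarrow> smooth_coeffs W (mul_odd j F)"
proof (intro allI impI)
  fix S assume W: "sub W" and F: "smooth_coeffs W F" and S: "S \<subseteq> {..<m}"
  have "smooth_fun n (img W) (F (S - {j}))" using F S by blast
  then show "smooth_fun n (img W) (mul_odd j F S)"
    unfolding mul_odd_def by (auto intro!: smooth_mult smooth_const img_open W)
qed

lemma mul_odd_expansion: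
  assumes W: "sub W" and F: "smooth_coeffs W F" and j: "j < m"
  shows "res W (oddc c j) * expansion m c W F = expansion m c W (mul_odd j F)"
proof -
  let ?t = "\<lambda>S. pull c W (F S) * odd_monom (oddc c) S"
  let ?A = "{S \<in> Pow {..<m}. j \<notin> S}" and ?B = "{S \<in> Pow {..<m}. j \<in> S}"
  have xi: "res W (oddc c j) \<in> secs M W"
    using secs_res[OF cdom_open sect_secs[OF cdom_open oddc_sect[OF j]]] W by (simp add: sub_def)
  have t: "res W (oddc c j) * ?t S = (if j \<in> S then 0 else scl (sg j S) (pull c W (F S) * odd_monom (oddc c) (insert j S)))"
    if S: "S \<subseteq> {..<m}" for S
  proof -
    have "res W (oddc c j) * ?t S = (pull c W (F S) * res W (oddc c j)) * odd_monom (oddc c) S"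
      using pull_commute[OF W _ xi, of "F S"] F S by (simp flip: mult.assoc)
    also have "\<dots> = pull c W (F S) * (oddc c j * odd_monom (oddc c) S)"
      using pull_mult_res[OF W, of "F S" "oddc c j"] F S by (simp flip: mult.assoc)
    finally have e: "res W (oddc c j) * ?t S = pull c W (F S) * (oddc c j * odd_monom (oddc c) S)" .
    show ?thesis unfolding e using odd_monom_mult_0[OF j S] odd_monom_insert[OF j S] by simp
  qed
  have "res W (oddc c j) * expansion m c W F = (\<Sum>S\<in>Pow {..<m}. res W (oddc c j) * ?t S)"
    unfolding expansion_def by (rule sum_distrib_left)
  also have "\<dots> = (\<Sum>S\<in>?A. scl (sg j S) (pull c W (F S) * odd_monom (oddc c) (insert j S)))"
    by (rule sum.mono_neutral_cong_right) (auto simp: t)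
  also have "\<dots> = (\<Sum>S\<in>?B. pull c W (mul_odd j F S) * odd_monom (oddc c) S)"
  proof (rule sum.reindex_bij_witness[where i = "\<lambda>S. S - {j}" and j = "insert j"])
    fix S assume S: "S \<in> ?A"
    then have "F S = F (insert j S - {j})" "sg j (insert j S) = sg j S" by (auto simp: sg_remove_self[of j "insert j S", symmetric])
    then have "pull c W (mul_odd j F (insert j S)) = scl (sg j S) (pull c W (F S))"
      using pull_scl[OF W, of "F S" "sg j S"] F S by (simp add: mul_odd_def)
    then show "pull c W (mul_odd j F (insert j S)) * odd_monom (oddc c) (insert j S) =
        scl (sg j S) (pull c W (F S) * odd_monom (oddc c) (insert j S))" by simp
  qed (use j in auto)
  also have "\<dots> = expansion m c W (mul_odd j F)"
    unfolding expansion_def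
    by (rule sum.mono_neutral_cong_left) (auto simp: mul_odd_def pull_0 W)
  finally show ?thesis .
qed

text \<open>A coordinate derivative in terms of coefficients. For odd coordinates it is the left
  derivative: the coordinate is moved to the front of its monomial, at the cost \<open>sg\<close>,
  and then dropped.\<close>

definition cop :: "bool \<times> nat \<Rightarrow> (nat set \<Rightarrow> (nat \<Rightarrow> real) \<Rightarrow> real) \<Rightarrow> nat set \<Rightarrow> (nat \<Rightarrow> real) \<Rightarrow> real" where
  "cop A F S = (if fst A then if snd A \<in> S then (\<lambda>v. 0) else (\<lambda>v. sg (snd A) S * F (insert (snd A) S) v)
     else pd (snd A) (F S))"

lemma smooth_cop: "A \<in> cidx n m \<Longrightarrow> sub W \<Longrightarrow> smooth_coeffs W F \<Longrightarrow> smooth_coeffs W (cop A F)"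
  by (auto simp: cop_def cidx_def intro!: smooth_mult smooth_const smooth_pd img_open)

lemma cop_cong:
  assumes "A \<in> cidx n m" "sub W" "\<And>S v. S \<subseteq> {..<m} \<Longrightarrow> v \<in> img W \<Longrightarrow> F S v = G S v"
    "S \<subseteq> {..<m}" "v \<in> img W"
  shows "cop A F S v = cop A G S v"
proof (cases "fst A")
  case True
  then show ?thesis using assms by (auto simp: cop_def cidx_def)
next
  case False
  then show ?thesis
    using pd_cong[OF img_open[OF assms(2)], of "F S" "G S" v "snd A"] assms by (auto simp: cop_def cidx_def)
qed

text \<open>The choice of \<open>F\<close> is harmless: coefficients are unique on the image of
  \<open>W\<close>, and \<open>cop\<close> depends on their values there only.\<close>

definition dc :: "bool \<times> nat \<Rightarrow> ('x, 'g) svf" where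
  "dc A W f = (if sub W \<and> f \<in> secs M W
     then expansion m c W (cop A (SOME F. smooth_coeffs W F \<and> f = expansion m c W F)) else 0)"

lemma dc_expansion:
  assumes A: "A \<in> cidx n m" and W: "sub W" and F: "smooth_coeffs W F"
  shows "dc A W (expansion m c W F) = expansion m c W (cop A F)"
proof -
  let ?G = "SOME G. smooth_coeffs W G \<and> expansion m c W F = expansion m c W G"
  have G: "smooth_coeffs W ?G \<and> expansion m c W F = expansion m c W ?G"
    by (rule someI[of _ F]) (use F in auto)
  have "expansion m c W (cop A ?G) = expansion m c W (cop A F)"
    by (rule expansion_cong[OF W smooth_cop[OF A W F]], rule cop_cong[OF A W])
      (use expansion_inj[OF W _ F, of ?G] G in auto)
  then show ?thesis using W expansion_secs[OF W F] by (simp add: dc_def)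
qed

lemma dc_outside: "\<not> (sub W \<and> f \<in> secs M W) \<Longrightarrow> dc A W f = 0"
  unfolding dc_def by (rule if_not_P)

context
  fixes A W
  assumes A: "A \<in> cidx n m" and W: "sub W"
begin

lemma dc_secs: "f \<in> secs M W \<Longrightarrow> dc A W f \<in> secs M W"
  using ex_expansion[OF W, of f] dc_expansion[OF A W] expansion_secs[OF W smooth_cop[OF A W]] by auto

lemma dc_add: "f \<in> secs M W \<Longrightarrow> g \<in> secs M W \<Longrightarrow> dc A W (f + g) = dc A W f + dc A W g"
proof -
  assume "f \<in> secs M W" "g \<in> secs M W"
  then obtain F G where F: "smooth_coeffs W F" "f = expansion m c W F"
    and G: "smooth_coeffs W G" "g = expansion m c W G"
    using ex_expansion[OF W] by blast
  have FG: "smooth_coeffs W (\<lambda>S v. F S v + G S v)"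
    using F G by (auto intro!: smooth_add img_open W)
  have "cop A (\<lambda>S v. F S v + G S v) S v = cop A F S v + cop A G S v"
    if "S \<subseteq> {..<m}" "v \<in> img W" for S v
    using pd_add[OF img_open[OF W], of "F S" "G S" "snd A" v] F G that A
    by (auto simp: cop_def cidx_def algebra_simps)
  then have "expansion m c W (cop A (\<lambda>S v. F S v + G S v)) = expansion m c W (\<lambda>S v. cop A F S v + cop A G S v)"
    using smooth_cop[OF A W F(1)] smooth_cop[OF A W G(1)]
    by (intro expansion_cong W) (auto intro!: smooth_add img_open W)
  also have "\<dots> = expansion m c W (cop A F) + expansion m c W (cop A G)"
    by (rule expansion_add[OF W smooth_cop[OF A W F(1)] smooth_cop[OF A W G(1)]])
  finally show ?thesis
    using dc_expansion[OF A W FG] dc_expansion[OF A W F(1)] dc_expansion[OF A W G(1)]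
      expansion_add[OF W F(1) G(1)] F(2) G(2) by simp
qed

lemma dc_pull_mult:
  assumes h: "smooth_fun n (img W) h" and f: "f \<in> secs M W"
  shows "dc A W (pull c W h * f) = dc A W (pull c W h) * f + pull c W h * dc A W f"
proof -
  obtain F where F: "smooth_coeffs W F" "f = expansion m c W F"
    using ex_expansion[OF W f] by blast
  let ?P = "\<lambda>S::nat set. if S = {} then h else (\<lambda>v. 0)"
  let ?d = "if fst A then (\<lambda>v. 0) else pd (snd A) h"
  have P: "smooth_coeffs W ?P" using h smooth_const[OF img_open[OF W]] by (simp split: if_split)
  have hF: "smooth_coeffs W (\<lambda>S v. h v * F S v)" using h F(1) by (auto intro!: smooth_mult img_open W)
  have d: "smooth_fun n (img W) ?d"
    using A h by (auto simp: cidx_def intro!: smooth_const smooth_pd img_open W)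
  have "expansion m c W (cop A ?P) = expansion m c W (\<lambda>S. if S = {} then ?d else (\<lambda>v. 0))"
    using d smooth_const[OF img_open[OF W], of 0]
    by (intro expansion_cong W) (auto simp: cop_def pd_const split: if_splits)
  also have "\<dots> = pull c W ?d" by (rule expansion_pull[OF W d])
  finally have dh: "dc A W (pull c W h) = pull c W ?d"
    using dc_expansion[OF A W P] expansion_pull[OF W h] by simp
  have "cop A (\<lambda>S v. h v * F S v) S v = ?d v * F S v + h v * cop A F S v"
    if "S \<subseteq> {..<m}" "v \<in> img W" for S v
    using pd_mult[OF img_open[OF W] h, of "F S" "snd A" v] F that A by (auto simp: cop_def cidx_def)
  then have "expansion m c W (cop A (\<lambda>S v. h v * F S v)) = expansion m c W (\<lambda>S v. ?d v * F S v + h v * cop A F S v)"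
    using smooth_cop[OF A W F(1)] F(1) h d
    by (intro expansion_cong W allI impI smooth_add smooth_mult img_open) auto
  also have "\<dots> = expansion m c W (\<lambda>S v. ?d v * F S v) + expansion m c W (\<lambda>S v. h v * cop A F S v)"
    using smooth_cop[OF A W F(1)] F(1) h d
    by (intro expansion_add W allI impI smooth_mult img_open) auto
  also have "\<dots> = pull c W ?d * f + pull c W h * dc A W f"
    using expansion_pull_mult[OF W F(1) d] expansion_pull_mult[OF W smooth_cop[OF A W F(1)] h]
      dc_expansion[OF A W F(1)] F(2) by simp
  finally have "dc A W (expansion m c W (\<lambda>S v. h v * F S v)) = pull c W ?d * f + pull c W h * dc A W f"
    using dc_expansion[OF A W hF] by simp
  then show ?thesis using expansion_pull_mult[OF W F(1) h] F(2) dh by simp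
qed

text \<open>The commutation relation of derivatives and multiplications by odd coordinates, with its
  Kronecker delta. For two different odd indices the sign arises because exactly one of
  \<open>j\<close> and \<open>k\<close> is below the other, so that exactly one of the two counts in
  \<open>sg\<close> changes.\<close>

lemma cop_mul_odd:
  assumes S: "S \<subseteq> {..<m}" and F: "smooth_coeffs W F" and v: "v \<in> img W"
  shows "cop A (mul_odd j F) S v =
     (if A = (True, j) then F S v else 0) + ksign (fst A) True * mul_odd j (cop A F) S v"
proof -
  have fS: "finite S" using S finite_subset by blast
  obtain p k where Apk: "A = (p, k)" by (cases A)
  show ?thesis
  proof (cases p)
    case False
    have "pd k (\<lambda>v. sg j S * F (S - {j}) v) v = sg j S * pd k (F (S - {j})) v"
    proof -
      have "S - {j} \<subseteq> {..<m}" using S by auto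
      then have s: "smooth_fun n (img W) (F (S - {j}))" using F by blast
      have k: "k < n" using A Apk False by (auto simp: cidx_def)
      show ?thesis
        using pd_mult[OF img_open[OF W] smooth_const[OF img_open[OF W], of "sg j S"] s k v]
        by (simp add: pd_const)
    qed
    then show ?thesis using False Apk by (auto simp: cop_def mul_odd_def pd_const)
  next
    case True
    show ?thesis
    proof (cases "j = k")
      case True
      have "sg k (insert k S) = sg k S" if "k \<notin> S" using sg_insert[OF fS that, of k] by simp
      moreover have "insert k S - {k} = S" if "k \<notin> S" using that by auto
      moreover have "insert k (S - {k}) = S" if "k \<in> S" using that by auto
      ultimately show ?thesis using \<open>p\<close> Apk True sg_remove_self[of k S]
        by (cases "k \<in> S") (simp_all add: cop_def mul_odd_def)
    next
      case False
      show ?thesis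
      proof (cases "k \<notin> S \<and> j \<in> S")
        case True
        have "insert k S - {j} = insert k (S - {j})" using False by auto
        moreover have "sg k S * sg j (insert k S) = - (sg j S * sg k (S - {j}))"
          using sg_insert[OF fS, of k j] sg_remove[OF fS, of j k] True False by auto
        ultimately show ?thesis
          using \<open>p\<close> Apk False True by (auto simp: cop_def mul_odd_def simp flip: mult.assoc)
      next
        case F: False
        then show ?thesis using \<open>p\<close> Apk False by (auto simp: cop_def mul_odd_def)
      qed
    qed
  qed
qed

lemma dc_odd_mult:
  assumes j: "j < m" and f: "f \<in> secs M W"
  shows "dc A W (res W (oddc c j) * f) =
     (if A = (True, j) then f else 0) + scl (ksign (fst A) True) (res W (oddc c j) * dc A W f)"
proof -
  obtain F where F: "smooth_coeffs W F" "f = expansion m c W F"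
    using ex_expansion[OF W f] by blast
  let ?d = "if A = (True, j) then 1 else 0::real"
  let ?k = "ksign (fst A) True"
  note sF = smooth_cop[OF A W F(1)] and sm = smooth_mul_odd[OF W F(1)]
  note smc = smooth_mul_odd[OF W sF, of j]
  have 1: "smooth_coeffs W (\<lambda>S v. ?d * F S v)" and 2: "smooth_coeffs W (\<lambda>S v. ?k * mul_odd j (cop A F) S v)"
    using F(1) smc by (intro allI impI smooth_mult smooth_const img_open W; simp)+
  have "dc A W (res W (oddc c j) * f) = expansion m c W (cop A (mul_odd j F))"
    unfolding F(2) mul_odd_expansion[OF W F(1) j] by (rule dc_expansion[OF A W sm])
  also have "\<dots> = expansion m c W (\<lambda>S v. ?d * F S v + ?k * mul_odd j (cop A F) S v)"
  proof (rule expansion_cong[OF W])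
    show "smooth_coeffs W (\<lambda>S v. ?d * F S v + ?k * mul_odd j (cop A F) S v)"
      using 1 2 by (intro allI impI smooth_add img_open W; simp)
    show "cop A (mul_odd j F) S v = ?d * F S v + ?k * mul_odd j (cop A F) S v"
      if "S \<subseteq> {..<m}" "v \<in> img W" for S v
      unfolding cop_mul_odd[OF that(1) F(1) that(2)] by simp
  qed
  also have "\<dots> = scl ?d (expansion m c W F) + scl ?k (expansion m c W (mul_odd j (cop A F)))"
    unfolding expansion_add[OF W 1 2] expansion_scl[OF W F(1)] expansion_scl[OF W smc] ..
  also have "\<dots> = (if A = (True, j) then f else 0) + scl ?k (res W (oddc c j) * dc A W f)"
    unfolding F(2) dc_expansion[OF A W F(1)] mul_odd_expansion[OF W sF j] by simp
  finally show ?thesis .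
qed

text \<open>As an iterated left multiplication a monomial can be treated by
  \<open>dc_odd_mult\<close>, one factor at a time.\<close>

lemma pull_prod_list:
  assumes h: "smooth_fun n (img W) h" and xs: "set xs \<subseteq> {..<m}"
  shows "pull c W h * prod_list (map (oddc c) xs) = foldr (\<lambda>j f. res W (oddc c j) * f) xs (pull c W h)"
  using xs
proof (induct xs)
  case Nil
  have "pull c W h * prod_list (map (oddc c) []) = foldr (\<lambda>j f. res W (oddc c j) * f) [] (pull c W h)" by simp
  then show ?case .
next
  case (Cons j xs)
  have j: "j < m" using Cons.prems by simp
  have IH: "pull c W h * prod_list (map (oddc c) xs) = foldr (\<lambda>j f. res W (oddc c j) * f) xs (pull c W h)"
    by (rule Cons.hyps) (use Cons.prems in simp)
  have xi: "res W (oddc c j) \<in> secs M W"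
    using secs_res[OF cdom_open sect_secs[OF cdom_open oddc_sect[OF j]]] W by (simp add: sub_def)
  have c: "pull c W h * oddc c j = res W (oddc c j) * pull c W h"
    unfolding pull_mult_res[OF W h, of "oddc c j"] by (rule pull_commute[OF W h xi])
  have "pull c W h * prod_list (map (oddc c) (j # xs)) = pull c W h * oddc c j * prod_list (map (oddc c) xs)"
    by (simp add: mult.assoc)
  also have "\<dots> = res W (oddc c j) * foldr (\<lambda>j f. res W (oddc c j) * f) xs (pull c W h)"
    unfolding c mult.assoc IH ..
  also have "\<dots> = foldr (\<lambda>j f. res W (oddc c j) * f) (j # xs) (pull c W h)" by simp
  finally show ?case .
qed

lemma dc_leib_monomial:
  assumes h: "smooth_fun n (img W) h" and xs: "set xs \<subseteq> {..<m}" and g: "g \<in> secs M W"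
  defines "t \<equiv> \<lambda>xs. foldr (\<lambda>j f. res W (oddc c j) * f) xs (pull c W h)"
  shows "t xs \<in> secs M W \<and>
    dc A W (t xs * g) = dc A W (t xs) * g + scl (ksign (fst A) (odd (length xs))) (t xs * dc A W g)"
  using xs
proof (induct xs)
  case Nil
  have "t [] \<in> secs M W \<and>
    dc A W (t [] * g) = dc A W (t []) * g + scl (ksign (fst A) (odd (length ([] :: nat list)))) (t [] * dc A W g)"
    unfolding t_def using dc_pull_mult[OF h g] pull_secs[OF W h] by simp
  then show ?case .
next
  case (Cons j xs)
  have j: "j < m" and xs: "set xs \<subseteq> {..<m}" using Cons.prems by auto
  note ts = Cons.hyps[OF xs, THEN conjunct1] and IH = Cons.hyps[OF xs, THEN conjunct2]
  let ?x = "res W (oddc c j)"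
  have xi: "?x \<in> secs M W"
    using secs_res[OF cdom_open sect_secs[OF cdom_open oddc_sect[OF j]]] W by (simp add: sub_def)
  have t: "t (j # xs) = ?x * t xs" by (simp add: t_def)
  have 1: "dc A W (?x * t xs * g) = (if A = (True, j) then t xs * g else 0) +
      scl (ksign (fst A) True) (?x * dc A W (t xs * g))"
    using dc_odd_mult[OF j secs_mult[OF sub_open[OF W] ts g]] by (simp add: mult.assoc)
  have 2: "dc A W (?x * t xs) = (if A = (True, j) then t xs else 0) + scl (ksign (fst A) True) (?x * dc A W (t xs))"
    by (rule dc_odd_mult[OF j ts])
  have "dc A W (t (j # xs) * g) = dc A W (t (j # xs)) * g +
      scl (ksign (fst A) (odd (length (j # xs)))) (t (j # xs) * dc A W g)"
    unfolding t 1 2 IH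
    by (cases "fst A"; cases "odd (length xs)") (auto simp: algebra_simps scl_add)
  then show ?case using secs_mult[OF sub_open[OF W] xi ts] t by metis
qed

end

text \<open>Split the coefficients by the parity of the index set. The part of the wrong parity
  equals \<open>f\<close> minus the other part, so it is a section of both parities and hence
  zero.\<close>

lemma homogeneous_expansion:
  assumes W: "sub W" and f: "f \<in> sect M i W"
  obtains F where "smooth_coeffs W F" "f = expansion m c W F" "\<And>S. odd (card S) \<noteq> i \<Longrightarrow> F S = (\<lambda>v. 0)"
proof -
  obtain F where F: "smooth_coeffs W F" "f = expansion m c W F"
    using ex_expansion[OF W sect_secs[OF sub_open[OF W] f]] by blast
  define G where "G j S = (if odd (card S) = j then F S else (\<lambda>v. 0))" for j S
  have G: "smooth_coeffs W (G j)" for j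
    using F(1) smooth_const[OF img_open[OF W]] by (simp add: G_def)
  have s: "expansion m c W (G j) \<in> sect M j W" for j
    unfolding expansion_def
  proof (rule sect_sum[OF sub_open[OF W]])
    fix S assume S: "S \<in> Pow {..<m}"
    show "pull c W (G j S) * odd_monom (oddc c) S \<in> sect M j W"
    proof (cases "odd (card S) = j")
      case True
      then show ?thesis using expansion_term_sect[OF W, of "G j S" S] G S by auto
    next
      case False
      then show ?thesis by (simp add: G_def pull_0 W sub_open)
    qed
  qed
  have "expansion m c W (\<lambda>S v. G i S v + G (\<not> i) S v) = expansion m c W F"
    by (rule expansion_cong[OF W F(1)]) (auto simp: G_def)
  then have sum: "f = expansion m c W (G i) + expansion m c W (G (\<not> i))"
    using expansion_add[OF W G G] F(2) by simp
  have "expansion m c W (G (\<not> i)) = f - expansion m c W (G i)" using sum by simp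
  also have "\<dots> \<in> sect M i W" by (rule sect_diff[OF sub_open[OF W] f s])
  finally have "expansion m c W (G (\<not> i)) = 0"
    using s[of "\<not> i"] sect_int[OF sub_open[OF W]] by (cases i) auto
  then have "f = expansion m c W (G i)" using sum by simp
  then show ?thesis by (rule that[OF G]) (simp add: G_def)
qed

lemma expansion_parity:
  assumes W: "sub W" and F: "smooth_coeffs W F" and p: "\<And>S. S \<subseteq> {..<m} \<Longrightarrow> odd (card S) \<noteq> i \<Longrightarrow> F S = (\<lambda>v. 0)"
  shows "expansion m c W F \<in> sect M i W"
  unfolding expansion_def
proof (rule sect_sum[OF sub_open[OF W]])
  fix S assume S: "S \<in> Pow {..<m}"
  show "pull c W (F S) * odd_monom (oddc c) S \<in> sect M i W"
  proof (cases "odd (card S) = i")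
    case True
    then show ?thesis using expansion_term_sect[OF W, of "F S" S] F S by auto
  next
    case False
    then have "F S = (\<lambda>v. 0)" using p S by auto
    then show ?thesis by (simp only: pull_0[OF W] mult_zero_left zero_sect[OF sub_open[OF W]])
  qed
qed

lemma dc_sect:
  assumes A: "A \<in> cidx n m" and W: "sub W" and f: "f \<in> sect M j W"
  shows "dc A W f \<in> sect M (fst A \<noteq> j) W"
proof -
  obtain F where F: "smooth_coeffs W F" "f = expansion m c W F" "\<And>S. odd (card S) \<noteq> j \<Longrightarrow> F S = (\<lambda>v. 0)"
    using homogeneous_expansion[OF W f] by auto
  show ?thesis
    unfolding F(2) dc_expansion[OF A W F(1)]
  proof (rule expansion_parity[OF W smooth_cop[OF A W F(1)]])
    fix S assume S: "S \<subseteq> {..<m}" and p: "odd (card S) \<noteq> (fst A \<noteq> j)"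
    have "finite S" using S finite_subset by blast
    then show "cop A F S = (\<lambda>v. 0)"
      using p F(3)[of S] F(3)[of "insert (snd A) S"] pd_const[of _ 0] by (auto simp: cop_def)
  qed
qed

lemma dc_sum:
  assumes A: "A \<in> cidx n m" and W: "sub W" and f: "\<And>a. a \<in> I \<Longrightarrow> f a \<in> secs M W"
  shows "dc A W (\<Sum>a\<in>I. f a) = (\<Sum>a\<in>I. dc A W (f a))"
proof -
  have 0: "dc A W 0 = 0"
    using dc_add[OF A W zero_secs[OF sub_open[OF W]] zero_secs[OF sub_open[OF W]]] by simp
  show ?thesis
    using f by (induct I rule: infinite_finite_induct) (simp_all add: 0 dc_add[OF A W] secs_sum sub_open W)
qed

lemma dc_leib:
  assumes A: "A \<in> cidx n m" and W: "sub W" and f: "f \<in> sect M j W" and g: "g \<in> secs M W"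
  shows "dc A W (f * g) = dc A W f * g + scl (ksign (fst A) j) (f * dc A W g)"
proof -
  obtain F where F: "smooth_coeffs W F" "f = expansion m c W F" "\<And>S. odd (card S) \<noteq> j \<Longrightarrow> F S = (\<lambda>v. 0)"
    using homogeneous_expansion[OF W f] by auto
  let ?t = "\<lambda>S. pull c W (F S) * odd_monom (oddc c) S"
  have t: "?t S \<in> secs M W" "dc A W (?t S * g) = dc A W (?t S) * g + scl (ksign (fst A) j) (?t S * dc A W g)"
    if S: "S \<in> Pow {..<m}" for S
  proof -
    have fS: "finite S" using S finite_subset[of S "{..<m}"] by auto
    have sF: "smooth_fun n (img W) (F S)" using F(1) S by auto
    have xs: "set (sorted_list_of_set S) \<subseteq> {..<m}" using fS S by auto
    note l = dc_leib_monomial[OF A W sF xs g, folded pull_prod_list[OF A W sF xs], folded odd_monom_def]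
    show "?t S \<in> secs M W" using l by blast
    show "dc A W (?t S * g) = dc A W (?t S) * g + scl (ksign (fst A) j) (?t S * dc A W g)"
    proof (cases "odd (card S) = j")
      case True
      then show ?thesis using l fS by simp
    next
      case False
      \<comment> \<open>This monomial has the wrong parity for the sign in the claim, but its
        coefficient is 0.\<close>
      have "?t S = 0" unfolding F(3)[OF False] pull_0[OF W] by simp
      moreover have "dc A W 0 = 0"
        using dc_add[OF A W zero_secs[OF sub_open[OF W]] zero_secs[OF sub_open[OF W]]] by simp
      ultimately show ?thesis by simp
    qed
  qed
  have tg: "?t S * g \<in> secs M W" if "S \<in> Pow {..<m}" for S
    by (rule secs_mult[OF sub_open[OF W] t(1)[OF that] g])
  have "f * g = (\<Sum>S\<in>Pow {..<m}. ?t S * g)"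
    unfolding F(2) expansion_def by (rule sum_distrib_right)
  then have "dc A W (f * g) = dc A W (\<Sum>S\<in>Pow {..<m}. ?t S * g)" by (rule arg_cong)
  also have "\<dots> = (\<Sum>S\<in>Pow {..<m}. dc A W (?t S * g))"
    by (rule dc_sum[OF A W tg])
  also have "\<dots> = (\<Sum>S\<in>Pow {..<m}. dc A W (?t S) * g + scl (ksign (fst A) j) (?t S * dc A W g))"
    by (rule sum.cong[OF refl t(2)])
  also have "\<dots> = (\<Sum>S\<in>Pow {..<m}. dc A W (?t S)) * g + scl (ksign (fst A) j) ((\<Sum>S\<in>Pow {..<m}. ?t S) * dc A W g)"
    by (simp only: sum.distrib sum_distrib_right scl_sum)
  also have "(\<Sum>S\<in>Pow {..<m}. dc A W (?t S)) = dc A W f"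
    unfolding F(2) expansion_def by (rule dc_sum[OF A W t(1), symmetric])
  finally show ?thesis unfolding F(2) expansion_def .
qed

lemma vfield_dc:
  assumes A: "A \<in> cidx n m"
  shows "vfield M (fst A) (cdom c) (dc A)"
proof (rule vfieldI)
  show "\<not> (openin (body M) W \<and> W \<subseteq> cdom c \<and> f \<in> secs M W) \<Longrightarrow> dc A W f = 0" for W f
    by (rule dc_outside) (auto simp: sub_def)
  fix W assume "openin (body M) W" "W \<subseteq> cdom c"
  then have W: "sub W" by (simp add: sub_def)
  show "dc A W f \<in> sect M (fst A \<noteq> j) W" if "f \<in> sect M j W" for j f
    by (rule dc_sect[OF A W that])
  show "dc A W (f * g) = dc A W f * g + scl (ksign (fst A) j) (f * dc A W g)"
    if "f \<in> sect M j W" "g \<in> secs M W" for j f g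
    by (rule dc_leib[OF A W that])
  fix f assume f: "f \<in> secs M W"
  obtain F where F: "smooth_coeffs W F" "f = expansion m c W F"
    using ex_expansion[OF W f] by blast
  show "dc A W (f + g) = dc A W f + dc A W g" if "g \<in> secs M W" for g
    by (rule dc_add[OF A W f that])
  show "dc A W (scl r f) = scl r (dc A W f)" for r
  proof -
    have c: "scl r (res W 1) = pull c W (\<lambda>v. r)" by (rule pull_const[OF W, symmetric])
    have "scl r f = scl r (res W 1) * f" using secs_id[OF sub_open[OF W] f] by (simp add: res_one_mult)
    then have "dc A W (scl r f) = dc A W (pull c W (\<lambda>v. r)) * f + scl r (res W 1) * dc A W f"
      using dc_pull_mult[OF A W smooth_const[OF img_open[OF W]] f, of r] c by simp
    moreover have "dc A W (pull c W (\<lambda>v. r)) = 0"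
    proof -
      let ?P = "\<lambda>S::nat set. if S = {} then (\<lambda>v. r) else (\<lambda>v. 0)"
      have P: "smooth_coeffs W ?P" using smooth_const[OF img_open[OF W]] by (simp split: if_split)
      have "dc A W (pull c W (\<lambda>v. r)) = expansion m c W (cop A ?P)"
        using dc_expansion[OF A W P] expansion_pull[OF W smooth_const[OF img_open[OF W]], of r] by simp
      also have "\<dots> = expansion m c W (\<lambda>S v. 0)"
        by (intro expansion_cong W) (auto simp: cop_def pd_const intro: smooth_const img_open W split: if_splits)
      finally show ?thesis by (simp add: expansion_def pull_0 W)
    qed
    moreover have "res W (dc A W f) = dc A W f" by (rule secs_id[OF sub_open[OF W] dc_secs[OF A W f]])
    ultimately show ?thesis by (simp add: res_one_mult)
  qed
  show "dc A W' (res W' f) = res W' (dc A W f)" if W': "openin (body M) W'" "W' \<subseteq> W" for W'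
  proof -
    have sW': "sub W'" by (rule sub_subset[OF W W'])
    have F': "smooth_coeffs W' F" using F(1) smooth_img_subset[OF W sW' W'(2)] by blast
    show ?thesis
      unfolding F(2) expansion_res[OF W F(1) W'] dc_expansion[OF A W F(1)] dc_expansion[OF A sW' F']
      by (rule expansion_res[OF W smooth_cop[OF A W F(1)] W', symmetric])
  qed
qed

lemma dc_coord:
  assumes A: "A \<in> cidx n m" and B: "B \<in> cidx n m"
  shows "dc A (cdom c) (coord c B) = (if A = B then res (cdom c) 1 else 0)"
proof -
  obtain p k where Bpk: "B = (p, k)" by (cases B)
  note o = cdom_open and one = one_secs[OF cdom_open]
  have dc1: "dc A (cdom c) (res (cdom c) 1) = 0"
    by (rule vf_one[OF vfield_dc[OF A] o subset_refl])
  show ?thesis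
  proof (cases p)
    case True
    then have k: "k < m" using B Bpk by (auto simp: cidx_def)
    have x: "res (cdom c) (oddc c k) = oddc c k" by (rule sect_id[OF o oddc_sect[OF k]])
    then have "coord c B = res (cdom c) (oddc c k) * res (cdom c) 1"
      using True Bpk by (simp add: coord_def res_one_mult)
    then show ?thesis using dc_odd_mult[OF A sub_cdom k one] dc1 True Bpk by simp
  next
    case False
    let ?P = "\<lambda>S::nat set. if S = {} then (\<lambda>v. v k) else (\<lambda>v. 0)"
    let ?d = "if A = B then 1 else 0::real"
    let ?Q = "\<lambda>S::nat set. if S = {} then (\<lambda>v::nat \<Rightarrow> real. ?d) else (\<lambda>v. 0)"
    have P: "smooth_coeffs (cdom c) ?P"
      using smooth_const[OF img_cdom_open] smooth_coord[OF img_cdom_open] by (simp split: if_split)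
    have Q: "smooth_coeffs (cdom c) ?Q"
      using smooth_const[OF img_cdom_open] by (simp split: if_split)
    have "dc A (cdom c) (coord c B) = expansion m c (cdom c) (cop A ?P)"
      using dc_expansion[OF A sub_cdom P] expansion_pull[OF sub_cdom smooth_coord[OF img_cdom_open], of k] False Bpk
      by (simp add: coord_def)
    also have "\<dots> = expansion m c (cdom c) ?Q"
      by (rule expansion_cong[OF sub_cdom Q])
        (use A False Bpk in \<open>auto simp: cop_def pd_const pd_coord cidx_def split: if_splits\<close>)
    also have "\<dots> = scl ?d (res (cdom c) 1)"
      using expansion_pull[OF sub_cdom smooth_const[OF img_cdom_open], of ?d] pull_const[OF sub_cdom, of ?d] by simp
    finally show ?thesis by simp
  qed
qed

section \<open>Vector fields are determined by their values on coordinates\<close>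

lemma mid_simps [simp]: "bodymap mid x = x" "pb mid W f = f"
  by (simp_all add: mid_def)

lemma is_mor_mid: "is_mor M M mid"
proof -
  have p: "W \<inter> total M = W" "preim M mid W = W" if "openin (body M) W" for W
    using openin_subset[OF that] by (auto simp: preim_def mid_def)
  show ?thesis
    unfolding is_mor_def using p by (simp add: mid_def)
qed

text \<open>A vector field is a derivation along the identity; in this form
  \<open>derivation_eq_0\<close> applies to it.\<close>

lemma id_chart_mor: "sub U \<Longrightarrow> chart_mor M M mid n m c n m c U (\<lambda>a v. v a)"
proof -
  assume U: "sub U"
  have "preim M mid (cdom c) = cdom c" using openin_subset[OF cdom_open] by (auto simp: preim_def mid_def)
  then show ?thesis
    using is_mor_mid U sub_dom[OF U]
    by unfold_locales (auto simp: smooth_coord_img pull_coord mid_def)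
qed

lemma vfield_chart_eqI:
  assumes U: "sub U" and X: "vfield M i U X" and Y: "vfield M i U Y"
    and e: "\<And>A. A \<in> cidx n m \<Longrightarrow> X U (res U (coord c A)) = Y U (res U (coord c A))"
  shows "X = Y"
proof (rule vfield_eqI[OF X Y])
  interpret I: chart_mor M M mid n m c n m c U "\<lambda>a v. v a" by (rule id_chart_mor[OF U])
  have pre: "I.Vp W = U \<inter> W" if "sub W" for W
    using openin_subset[OF sub_open[OF that]] by (auto simp: I.Vp_def preim_def)
  have mid: "pb mid W f = f" for W and f :: "'x \<Rightarrow> 'g" by (simp add: mid_def)
  \<comment> \<open>The fields live on \<open>U\<close> only, while \<open>derivation_eq_0\<close>
    tests all open subsets of the chart; restricting to \<open>U \<inter> W\<close> first bridges
    the gap.\<close>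
  let ?D = "\<lambda>W f. X (U \<inter> W) (res (U \<inter> W) f) - Y (U \<inter> W) (res (U \<inter> W) f)"
  have o: "openin (body M) (U \<inter> W)" "U \<inter> W \<subseteq> U" "U \<inter> W \<subseteq> W" if "sub W" for W
    using sub_open[OF that] sub_open[OF U] by auto
  have r: "res (U \<inter> W) f \<in> secs M (U \<inter> W)" if "sub W" "f \<in> secs M W" for W f
    by (rule secs_res[OF sub_open[OF that(1)] that(2) o(1,3)[OF that(1)]])
  have D0: "?D W f = 0" if W: "sub W" and f: "f \<in> secs M W" for W f
  proof (rule I.derivation_eq_0[where D = ?D and s = "ksign i", OF _ _ _ _ _ _ _ W f])
    fix W f assume W: "sub W" and f: "f \<in> secs M W"
    note oW = o(1,2)[OF W]
    show "?D W f \<in> secs M (I.Vp W)"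
      unfolding pre[OF W] by (intro secs_diff oW vf_secs[OF X] vf_secs[OF Y] r W f)
    show "?D W (f + g) = ?D W f + ?D W g" if g: "g \<in> secs M W" for g
      by (simp add: vf_add[OF X oW r[OF W f] r[OF W g]] vf_add[OF Y oW r[OF W f] r[OF W g]])
    fix W' assume W': "openin (body M) W'" "W' \<subseteq> W"
    have oo: "openin (body M) (U \<inter> W')" "U \<inter> W' \<subseteq> U \<inter> W" using W' sub_open[OF U] by auto
    have i: "U \<inter> W' \<inter> W' = U \<inter> W'" "U \<inter> W' \<inter> (U \<inter> W) = U \<inter> W'" using W' by auto
    show "?D W' (res W' f) = res (I.Vp W') (?D W f)"
      unfolding pre[OF sub_subset[OF W W']] res_simps(4) vf_res[OF X oW r[OF W f] oo, symmetric]
        vf_res[OF Y oW r[OF W f] oo, symmetric] res_simps(2) i ..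
  next
    fix W r assume W: "sub W"
    show "?D W (scl r (res W 1)) = 0"
      using vf_const[OF X o(1,2)[OF W]] vf_const[OF Y o(1,2)[OF W]] by (simp add: Int_absorb2 Int_ac)
  next
    fix W j f g assume W: "sub W" and f: "f \<in> sect M j W" and g: "g \<in> secs M W"
    have fr: "res (U \<inter> W) f \<in> sect M j (U \<inter> W)" by (rule sect_res[OF sub_open[OF W] f o(1,3)[OF W]])
    show "?D W (f * g) = ?D W f * res (I.Vp W) (pb mid W g) + scl (ksign i j) (res (I.Vp W) (pb mid W f) * ?D W g)"
      unfolding mid pre[OF W] res_simps(6) vf_leib[OF X o(1,2)[OF W] fr r[OF W g]]
        vf_leib[OF Y o(1,2)[OF W] fr r[OF W g]]
      by (simp add: algebra_simps scl_diff)
  next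
    fix A assume A: "A \<in> cidx n m"
    show "?D (cdom c) (coord c A) = 0" using e[OF A] sub_dom[OF U] by (simp add: Int_absorb2)
  qed simp
  fix W f assume W: "openin (body M) W" "W \<subseteq> U" and f: "f \<in> secs M W"
  have sW: "sub W" by (rule sub_subset[OF U W])
  have "U \<inter> W = W" using W by auto
  then show "X W f = Y W f"
    using D0[OF sW f] secs_id[OF W(1) f] by simp
qed

lemma dcoord_eq:
  assumes A: "A \<in> cidx n m"
  shows "dcoord n m M c A = dc A"
  unfolding dcoord_def
proof (rule the_equality)
  show "vfield M (fst A) (cdom c) (dc A) \<and>
      (\<forall>B\<in>cidx n m. dc A (cdom c) (coord c B) = (if A = B then res (cdom c) 1 else 0))"
    using vfield_dc[OF A] dc_coord[OF A] by blast
  fix X assume X: "vfield M (fst A) (cdom c) X \<and>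
      (\<forall>B\<in>cidx n m. X (cdom c) (coord c B) = (if A = B then res (cdom c) 1 else 0))"
  show "X = dc A"
    by (rule vfield_chart_eqI[OF sub_cdom conjunct1[OF X] vfield_dc[OF A]])
      (use X dc_coord[OF A] secs_id[OF cdom_open coord_secs] in auto)
qed

lemma finite_cidx [simp]: "finite (cidx n m)"
  by (simp add: cidx_def)

lemma sum_vfield_apply: "(\<Sum>a\<in>I. X a) W f = (\<Sum>a\<in>I. X a W f)"
  for X :: "'i \<Rightarrow> ('x, 'g) svf"
  by (simp add: sum_fun_apply)

lemma vres_dc_coord:
  assumes U: "sub U" and A: "A \<in> cidx n m" and B: "B \<in> cidx n m"
  shows "vres U (dc A) U (res U (coord c B)) = (if A = B then res U 1 else 0)"
  using vf_res[OF vfield_dc[OF A] cdom_open subset_refl coord_secs[OF B] sub_open[OF U] sub_dom[OF U]]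
    dc_coord[OF A B] sub_dom[OF U]
  by (simp add: vres_apply Int_absorb2)

lemma vfield_combination:
  assumes U: "sub U" and g: "\<And>A. A \<in> cidx n m \<Longrightarrow> g A \<in> sect M (i \<noteq> fst A) U"
  shows "vfield M i U (\<Sum>A\<in>cidx n m. vscl (g A) (vres U (dc A)))"
    and "B \<in> cidx n m \<Longrightarrow> (\<Sum>A\<in>cidx n m. vscl (g A) (vres U (dc A))) U (res U (coord c B)) = g B"
proof -
  show "vfield M i U (\<Sum>A\<in>cidx n m. vscl (g A) (vres U (dc A)))"
  proof (rule vfield_sum)
    fix A assume A: "A \<in> cidx n m"
    have "vfield M ((i \<noteq> fst A) \<noteq> fst A) U (vscl (g A) (vres U (dc A)))"
      by (intro vfield_vscl vfield_vres[OF vfield_dc[OF A]] sub_open U sub_dom g A)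
    moreover have "((i \<noteq> fst A) \<noteq> fst A) = i" by auto
    ultimately show "vfield M i U (vscl (g A) (vres U (dc A)))" by (simp only:)
  qed
  assume B: "B \<in> cidx n m"
  have "(\<Sum>A\<in>cidx n m. vscl (g A) (vres U (dc A))) U (res U (coord c B)) =
      (\<Sum>A\<in>cidx n m. if A = B then g B else 0)"
    unfolding sum_vfield_apply vscl_apply
    by (rule sum.cong[OF refl]) (use vres_dc_coord[OF U _ B] sect_id[OF sub_open[OF U] g[OF B]] in \<open>auto simp: res_one_mult\<close>)
  also have "\<dots> = g B" using B by simp
  finally show "(\<Sum>A\<in>cidx n m. vscl (g A) (vres U (dc A))) U (res U (coord c B)) = g B" .
qed

text \<open>Both sides are fields of the same parity with the same values on coordinates.\<close>

lemma vfield_decomposition: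
  assumes U: "sub U" and X: "vfield M i U X"
  shows "X = (\<Sum>A\<in>cidx n m. vscl (X U (res U (coord c A))) (vres U (dc A)))"
proof -
  have s: "X U (res U (coord c A)) \<in> sect M (i \<noteq> fst A) U" if "A \<in> cidx n m" for A
    by (rule vf_sect[OF X sub_open[OF U] subset_refl coord_res_sect[OF that U]])
  show ?thesis
    by (rule vfield_chart_eqI[OF U X vfield_combination(1)[OF U s]]) (use vfield_combination(2)[OF U s] in auto)
qed

end

text \<open>The difference of the two sides is a derivation along \<open>\<phi>\<close> with the
  parity of \<open>X\<close>, and it kills all coordinates.\<close>

lemma (in chart_mor) chain_rule:
  assumes X: "vfield N i V X" and W: "M.sub W" and f: "f \<in> secs M W"
  shows "X (Vp W) (res (Vp W) (pb \<phi> W f)) =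
     (\<Sum>A\<in>cidx n m. res (Vp W) (X V (res V (pb \<phi> (cdom c) (coord c A)))) * res (Vp W) (pb \<phi> W (M.dc A W f)))"
proof -
  let ?g = "\<lambda>A. X V (res V (pb \<phi> (cdom c) (coord c A)))"
  let ?D = "\<lambda>W f. X (Vp W) (res (Vp W) (pb \<phi> W f)) -
     (\<Sum>A\<in>cidx n m. res (Vp W) (?g A) * res (Vp W) (pb \<phi> W (M.dc A W f)))"
  have oV: "openin (body N) (Vp W)" "Vp W \<subseteq> V" if "M.sub W" for W
    using N.sub_open[OF Vp_sub[OF that]] Vp_V by auto
  have V': "openin (body N) V" using V(1) N.sub_open by blast
  have s: "res (Vp W) (pb \<phi> W h) \<in> secs N (Vp W)" if "M.sub W" "h \<in> secs M W" for W h
    by (rule N.secs_res[OF pre_open pb_secs oV(1) Vp_pre]) (use that M.sub_open in auto)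
  have st: "res (Vp W) (pb \<phi> W h) \<in> sect N j (Vp W)" if "M.sub W" "h \<in> sect M j W" for W h j
    by (rule N.sect_res[OF pre_open pb_sect oV(1) Vp_pre]) (use that M.sub_open in auto)
  have g: "?g A \<in> sect N (i \<noteq> fst A) V" if A: "A \<in> cidx n m" for A
  proof (rule N.vf_sect[OF X V' subset_refl])
    have "res (Vp (cdom c)) (pb \<phi> (cdom c) (coord c A)) \<in> sect N (fst A) (Vp (cdom c))"
      by (rule st[OF M.sub_cdom M.coord_sect[OF A]])
    then show "res V (pb \<phi> (cdom c) (coord c A)) \<in> sect N (fst A) V" by (simp add: Vp_cdom)
  qed
  have gr: "res (Vp W) (?g A) \<in> sect N (i \<noteq> fst A) (Vp W)" if "A \<in> cidx n m" "M.sub W" for A W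
    by (rule N.sect_res[OF V' g[OF that(1)] oV[OF that(2)]])
  note pbs = M.sub_open M.dc_secs
  have "?D W f = 0"
  proof (rule derivation_eq_0[where D = ?D and s = "ksign i", OF _ _ _ _ _ _ _ W f])
    fix W f assume W: "M.sub W" and f: "f \<in> secs M W"
    note o = oV[OF W]
    show "?D W f \<in> secs N (Vp W)"
      by (intro N.secs_diff N.secs_sum N.secs_mult N.vf_secs[OF X] o s M.dc_secs W f N.sect_secs[OF o(1) gr])
    show "?D W (f + h) = ?D W f + ?D W h" if h: "h \<in> secs M W" for h
    proof -
      have 1: "X (Vp W) (res (Vp W) (pb \<phi> W (f + h))) = X (Vp W) (res (Vp W) (pb \<phi> W f)) + X (Vp W) (res (Vp W) (pb \<phi> W h))"
        unfolding pb_add[OF M.sub_open[OF W] f h] res_simps(3)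
        by (rule N.vf_add[OF X o s[OF W f] s[OF W h]])
      have 2: "pb \<phi> W (M.dc A W (f + h)) = pb \<phi> W (M.dc A W f) + pb \<phi> W (M.dc A W h)" if "A \<in> cidx n m" for A
        unfolding M.dc_add[OF that W f h] by (rule pb_add[OF M.sub_open[OF W] M.dc_secs[OF that W f] M.dc_secs[OF that W h]])
      have "(\<Sum>A\<in>cidx n m. res (Vp W) (?g A) * res (Vp W) (pb \<phi> W (M.dc A W (f + h)))) =
          (\<Sum>A\<in>cidx n m. res (Vp W) (?g A) * res (Vp W) (pb \<phi> W (M.dc A W f)) +
             res (Vp W) (?g A) * res (Vp W) (pb \<phi> W (M.dc A W h)))"
        by (rule sum.cong[OF refl]) (simp add: 2 distrib_left)
      then show ?thesis unfolding 1 by (simp add: sum.distrib)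
    qed
    fix W' assume W': "openin (body M) W'" "W' \<subseteq> W"
    have sW': "M.sub W'" by (rule M.sub_subset[OF W W'])
    have vs: "Vp W' \<subseteq> Vp W" by (rule Vp_mono[OF W'(2)])
    have pr: "res (Vp W') (pb \<phi> W' (res W' h)) = res (Vp W') (res (Vp W) (pb \<phi> W h))" if "h \<in> secs M W" for h
      using pb_res[OF M.sub_open[OF W] that W'] Vp_pre[of W'] vs by (simp add: Int_absorb2)
    have dr: "M.dc A W' (res W' f) = res W' (M.dc A W f)" if "A \<in> cidx n m" for A
      by (rule M.vf_res[OF M.vfield_dc[OF that] M.sub_open[OF W] M.sub_dom[OF W] f W'])
    have "(\<Sum>A\<in>cidx n m. res (Vp W') (?g A) * res (Vp W') (pb \<phi> W' (M.dc A W' (res W' f)))) =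
        res (Vp W') (\<Sum>A\<in>cidx n m. res (Vp W) (?g A) * res (Vp W) (pb \<phi> W (M.dc A W f)))"
      unfolding res_sum
      by (rule sum.cong[OF refl]) (simp add: dr pr[OF M.dc_secs[OF _ W f]] Int_absorb2 vs)
    moreover have "X (Vp W') (res (Vp W') (pb \<phi> W' (res W' f))) = res (Vp W') (X (Vp W) (res (Vp W) (pb \<phi> W f)))"
      unfolding pr[OF f] by (rule N.vf_res[OF X o s[OF W f] oV(1)[OF sW'] vs])
    ultimately show "?D W' (res W' f) = res (Vp W') (?D W f)" by simp
  next
    fix W r assume W: "M.sub W"
    note o = oV[OF W] and oW = M.sub_open[OF W]
    have 1: "res (Vp W) (pb \<phi> W (scl r (res W 1))) = scl r (res (Vp W) 1)"
      using pb_const[OF oW, of r] Vp_pre[of W] by (simp add: Int_absorb2)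
    have 2: "M.dc A W (scl r (res W 1)) = 0" if "A \<in> cidx n m" for A
      by (rule M.vf_const[OF M.vfield_dc[OF that] oW M.sub_dom[OF W]])
    show "?D W (scl r (res W 1)) = 0"
      unfolding 1 N.vf_const[OF X o] by (simp add: 2 pb_zero oW)
  next
    fix W j f h assume W: "M.sub W" and f: "f \<in> sect M j W" and h: "h \<in> secs M W"
    note o = oV[OF W] and oW = M.sub_open[OF W]
    have fs: "f \<in> secs M W" by (rule M.sect_secs[OF oW f])
    let ?p = "\<lambda>h. res (Vp W) (pb \<phi> W h)"
    have 1: "X (Vp W) (?p (f * h)) = X (Vp W) (?p f) * ?p h + scl (ksign i j) (?p f * X (Vp W) (?p h))"
      unfolding pb_mult[OF oW fs h] res_simps(6) by (rule N.vf_leib[OF X o st[OF W f] s[OF W h]])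
    have 2: "res (Vp W) (?g A) * ?p (M.dc A W (f * h)) = res (Vp W) (?g A) * ?p (M.dc A W f) * ?p h +
        scl (ksign i j) (?p f * (res (Vp W) (?g A) * ?p (M.dc A W h)))" if A: "A \<in> cidx n m" for A
    proof -
      have d: "?p (M.dc A W (f * h)) = ?p (M.dc A W f) * ?p h + scl (ksign (fst A) j) (?p f * ?p (M.dc A W h))"
        unfolding M.dc_leib[OF A W f h] using M.dc_secs[OF A W fs] M.dc_secs[OF A W h] fs h
        by (simp add: pb_add pb_mult pb_scl oW M.secs_mult M.secs_scl)
      have c: "res (Vp W) (?g A) * ?p f = scl (ksign (i \<noteq> fst A) j) (?p f * res (Vp W) (?g A))"
        by (rule N.sect_commute[OF o(1) gr[OF A W] st[OF W f]])
      have "res (Vp W) (?g A) * (?p f * ?p (M.dc A W h)) =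
          scl (ksign (i \<noteq> fst A) j) (?p f * (res (Vp W) (?g A) * ?p (M.dc A W h)))"
        using arg_cong[OF c, of "\<lambda>a. a * ?p (M.dc A W h)"] by (simp add: mult.assoc)
      then show ?thesis unfolding d
        by (cases i; cases j; cases "fst A") (simp_all add: algebra_simps)
    qed
    have "(\<Sum>A\<in>cidx n m. res (Vp W) (?g A) * ?p (M.dc A W (f * h))) =
        (\<Sum>A\<in>cidx n m. res (Vp W) (?g A) * ?p (M.dc A W f)) * ?p h +
        scl (ksign i j) (?p f * (\<Sum>A\<in>cidx n m. res (Vp W) (?g A) * ?p (M.dc A W h)))"
      by (simp only: sum.cong[OF refl 2] sum.distrib sum_distrib_left sum_distrib_right scl_sum)
    then show "?D W (f * h) = ?D W f * ?p h + scl (ksign i j) (?p f * ?D W h)"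
      unfolding 1 by (simp add: algebra_simps scl_diff)
  next
    fix B assume B: "B \<in> cidx n m"
    have gB: "res V (?g B) = ?g B" by (rule N.sect_id[OF V' g[OF B]])
    have "(\<Sum>A\<in>cidx n m. res V (?g A) * res V (pb \<phi> (cdom c) (M.dc A (cdom c) (coord c B)))) =
        (\<Sum>A\<in>cidx n m. if A = B then ?g B else 0)"
      using V(2) gB
      by (intro sum.cong refl)
        (auto simp: M.dc_coord[OF _ B] pb_one pb_zero res_one_mult Int_absorb2)
    also have "\<dots> = ?g B" using B by simp
    finally show "?D (cdom c) (coord c B) = 0" unfolding Vp_cdom by simp
  qed simp
  then show ?thesis by simp
qed

section \<open>The differential of a one-form\<close>

lemma ksign_sq [simp]: "ksign i j * ksign i j = 1"
  by (cases i; cases j) auto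

definition rscl :: "real \<Rightarrow> ('x, 'g::real_algebra_1) svf \<Rightarrow> ('x, 'g) svf" where
  "rscl s X = (\<lambda>W f. scl s (X W f))"

context ssheaf
begin

text \<open>Linearity of forms is stated for \<open>vscl\<close>; a real factor is brought to that
  shape by means of a constant even section.\<close>

lemma rscl_eq_vscl: "vfield M i U X \<Longrightarrow> rscl s X = vscl (scl s (res U 1)) X"
proof (intro ext)
  fix W f x
  assume X: "vfield M i U X"
  show "rscl s X W f x = vscl (scl s (res U 1)) X W f x"
  proof (cases "openin (body M) W \<and> W \<subseteq> U \<and> f \<in> secs M W")
    case True
    then have "res U (X W f) = X W f" using vf_id[OF X, of W f] res_subset by blast
    then show ?thesis by (simp add: rscl_def vscl_def res_one_mult)
  next
    case False
    then show ?thesis using vf_ext[OF X False] by (simp add: rscl_def vscl_def)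
  qed
qed

lemma vfield_rscl: "vfield M i U X \<Longrightarrow> openin (body M) U \<Longrightarrow> vfield M i U (rscl s X)"
  using vfield_vscl[of i U X "scl s (res U 1)" False] by (simp add: rscl_eq_vscl sect_scl)

lemma vf_at_zero: "vfield M i U X \<Longrightarrow> X W 0 = 0"
  using vf_zero[of i U X W] vf_ext[of i U X W 0] by blast

context
  fixes \<eta> :: "'x set \<Rightarrow> ('x, 'g) svf \<Rightarrow> 'x \<Rightarrow> 'g"
  assumes \<eta>: "one_form M False (total M) \<eta>"
begin

lemma
  assumes W: "openin (body M) W" and X: "vfield M j W X"
  shows of_sect: "\<eta> W X \<in> sect M j W"
    and of_add: "vfield M j W Y \<Longrightarrow> \<eta> W (X + Y) = \<eta> W X + \<eta> W Y"
    and of_vscl: "f \<in> sect M l W \<Longrightarrow> \<eta> W (vscl f X) = f * \<eta> W X"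
    and of_res: "openin (body M) W' \<Longrightarrow> W' \<subseteq> W \<Longrightarrow> \<eta> W' (vres W' X) = res W' (\<eta> W X)"
proof -
  note o = \<eta>[unfolded one_form_def, rule_format, OF conjI[OF W conjI[OF openin_subset[OF W] X]]]
  show "\<eta> W X \<in> sect M j W" using o[THEN conjunct1] by simp
  show "vfield M j W Y \<Longrightarrow> \<eta> W (X + Y) = \<eta> W X + \<eta> W Y"
    using o[THEN conjunct2, THEN conjunct1] by (simp add: vadd_eq_plus)
  show "f \<in> sect M l W \<Longrightarrow> \<eta> W (vscl f X) = f * \<eta> W X"
    using o[THEN conjunct2, THEN conjunct2, THEN conjunct1] by blast
  show "openin (body M) W' \<Longrightarrow> W' \<subseteq> W \<Longrightarrow> \<eta> W' (vres W' X) = res W' (\<eta> W X)"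
    using o[THEN conjunct2, THEN conjunct2, THEN conjunct2] by blast
qed

lemma of_rscl: "openin (body M) W \<Longrightarrow> vfield M j W X \<Longrightarrow> \<eta> W (rscl s X) = scl s (\<eta> W X)"
  using of_vscl[of W j X "scl s (res W 1)" False] rscl_eq_vscl[of j W X s] sect_id[OF _ of_sect, of W j X]
  by (simp add: sect_scl res_one_mult)

lemma of_zero: "openin (body M) W \<Longrightarrow> \<eta> W 0 = 0"
  using of_add[of W False 0 0] vfield_0 by simp

lemma vbr_zero: "vfield M j U Y \<Longrightarrow> vbr p q 0 Y = 0" "vfield M j U Y \<Longrightarrow> vbr p q Y 0 = 0"
proof -
  assume Y: "vfield M j U Y"
  have "vbr p q 0 Y W f = 0" "vbr p q Y 0 W f = 0" for W f
    by (simp_all add: vbr_apply vf_at_zero[OF Y])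
  then show "vbr p q 0 Y = 0" "vbr p q Y 0 = 0" by (simp_all add: fun_eq_iff)
qed

text \<open>\<open>ext_d\<close> finds the parities by testing for oddness. The test can contradict
  \<open>i\<close> or \<open>j\<close> only if the field is 0, and then both expressions are
  0.\<close>

lemma ext_d_eq:
  assumes U: "openin (body M) U" and X: "vfield M i U X" and Y: "vfield M j U Y"
  shows "ext_d M \<eta> U X Y =
     X U (\<eta> U Y) - scl (ksign i j) (Y U (\<eta> U X)) - \<eta> U (vbr i j X Y)"
proof -
  define p q where "p = vfield M True U X" and "q = vfield M True U Y"
  have e: "ext_d M \<eta> U X Y = X U (\<eta> U Y) - scl (ksign p q) (Y U (\<eta> U X)) - \<eta> U (vbr p q X Y)"
    by (simp add: ext_d_def Let_def p_def q_def)
  consider "X = 0" | "Y = 0" | "p = i" "q = j"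
    using X Y vfield_both_parities[of U X] vfield_both_parities[of U Y] unfolding p_def q_def
    by (cases i; cases j) auto
  then show ?thesis
  proof cases
    case 1
    then show ?thesis unfolding e
      using of_zero[OF U] vbr_zero(1)[OF Y] vf_at_zero[OF Y] by simp
  next
    case 2
    then show ?thesis unfolding e
      using of_zero[OF U] vbr_zero(2)[OF X] vf_at_zero[OF X] by simp
  qed (simp add: e)
qed

lemma vbr_add_left:
  assumes "vfield M i U X" "vfield M i U Z" "vfield M j U Y" "openin (body M) U"
  shows "vbr i j (X + Z) Y = vbr i j X Y + vbr i j Z Y"
proof (rule vfield_eqI)
  show "vfield M (i \<noteq> j) U (vbr i j (X + Z) Y)"
    by (intro vfield_vbr vfield_add assms)
  show "vfield M (i \<noteq> j) U (vbr i j X Y + vbr i j Z Y)"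
    by (intro vfield_vbr vfield_add assms)
  fix W f assume W: "openin (body M) W" "W \<subseteq> U" and f: "f \<in> secs M W"
  show "vbr i j (X + Z) Y W f = (vbr i j X Y + vbr i j Z Y) W f"
    using vf_add[OF assms(3) W vf_secs[OF assms(1) W f] vf_secs[OF assms(2) W f]]
    by (simp add: vbr_apply scl_add)
qed

text \<open>The second summand comes from \<open>Y\<close> differentiating the factor
  \<open>h\<close>. It keeps the bracket from being tensorial and is compensated in
  \<open>ext_d\<close> by the derivative of \<open>h * \<eta> U X\<close>.\<close>

lemma vbr_vscl_left:
  assumes X: "vfield M i U X" and Y: "vfield M j U Y" and U: "openin (body M) U" and h: "h \<in> sect M l U"
  shows "vbr (l \<noteq> i) j (vscl h X) Y =
     vscl h (vbr i j X Y) + vscl (scl (- ksign (l \<noteq> i) j) (Y U h)) X"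
proof (rule vfield_eqI)
  have Yh: "Y U h \<in> sect M (j \<noteq> l) U" by (rule vf_sect[OF Y U subset_refl h])
  show "vfield M ((l \<noteq> i) \<noteq> j) U (vbr (l \<noteq> i) j (vscl h X) Y)"
    by (intro vfield_vbr vfield_vscl X Y U h)
  have "vfield M ((j \<noteq> l) \<noteq> i) U (vscl (scl (- ksign (l \<noteq> i) j) (Y U h)) X)"
    by (intro vfield_vscl X U sect_scl Yh)
  moreover have "vfield M (l \<noteq> (i \<noteq> j)) U (vscl h (vbr i j X Y))"
    by (intro vfield_vbr vfield_vscl X Y U h)
  moreover have "((j \<noteq> l) \<noteq> i) = ((l \<noteq> i) \<noteq> j)" "(l \<noteq> (i \<noteq> j)) = ((l \<noteq> i) \<noteq> j)" by auto
  ultimately show "vfield M ((l \<noteq> i) \<noteq> j) U (vscl h (vbr i j X Y) + vscl (scl (- ksign (l \<noteq> i) j) (Y U h)) X)"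
    by (intro vfield_add) (simp_all only:)
  fix W f assume W: "openin (body M) W" "W \<subseteq> U" and f: "f \<in> secs M W"
  have hW: "res W h \<in> sect M l W" by (rule sect_res[OF U h W])
  have Xf: "X W f \<in> secs M W" by (rule vf_secs[OF X W f])
  have YXf: "res W (Y W (X W f)) = Y W (X W f)" by (rule vf_id[OF Y W Xf])
  have "Y W (h * X W f) = Y W (res W h * X W f)"
    using mult_res_left[OF vf_id[OF X W f], of h] by simp
  also have "\<dots> = Y W (res W h) * X W f + scl (ksign j l) (res W h * Y W (X W f))"
    by (rule vf_leib[OF Y W hW Xf])
  also have "Y W (res W h) = res W (Y U h)"
    by (rule vf_res[OF Y U subset_refl sect_secs[OF U h] W])
  finally have "Y W (h * X W f) = res W (Y U h) * X W f + scl (ksign j l) (res W h * Y W (X W f))" .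
  also have "res W (Y U h) * X W f = Y U h * X W f" by (rule mult_res_left[OF vf_id[OF X W f], symmetric])
  also have "res W h * Y W (X W f) = h * Y W (X W f)" by (rule mult_res_left[OF YXf, symmetric])
  finally have e: "Y W (h * X W f) = Y U h * X W f + scl (ksign j l) (h * Y W (X W f))" .
  have k: "ksign j l * ksign (l \<noteq> i) j = ksign i j" by (cases i; cases j; cases l) auto
  show "vbr (l \<noteq> i) j (vscl h X) Y W f =
      (vscl h (vbr i j X Y) + vscl (scl (- ksign (l \<noteq> i) j) (Y U h)) X) W f"
    using k by (simp add: vbr_apply vscl_apply e scl_add algebra_simps)
qed

lemma vbr_antisym: "vbr j i Y X = rscl (- ksign i j) (vbr i j X Y)"
  unfolding vbr_def rscl_def
  by (intro ext) (cases i; cases j; simp add: scl_diff)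

lemma vbr_vres: "vbr i j (vres W X) (vres W Y) = vres W (vbr i j X Y)"
  by (intro ext) (auto simp: vbr_apply vres_apply)

lemma even_two_form_ext_d: "even_two_form M (ext_d M \<eta>)"
  unfolding even_two_form_def
proof (intro allI impI, elim conjE)
  fix U i j X Y
  assume U: "openin (body M) U" and X: "vfield M i U X" and Y: "vfield M j U Y"
  note XY = vfield_vbr[OF X Y U]
  note Us = U subset_refl
  have a: "X U (\<eta> U Y) \<in> sect M (i \<noteq> j) U" by (rule vf_sect[OF X Us of_sect[OF U Y]])
  have b: "Y U (\<eta> U X) \<in> sect M (i \<noteq> j) U"
    using vf_sect[OF Y Us of_sect[OF U X]] by (simp add: eq_commute)
  have sec: "ext_d M \<eta> U X Y \<in> sect M (i \<noteq> j) U"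
    unfolding ext_d_eq[OF U X Y] by (intro sect_diff U sect_scl a b of_sect XY)
  have add: "ext_d M \<eta> U (vadd X Z) Y = ext_d M \<eta> U X Y + ext_d M \<eta> U Z Y" if Z: "vfield M i U Z" for Z
  proof -
    have 1: "Y U (\<eta> U X + \<eta> U Z) = Y U (\<eta> U X) + Y U (\<eta> U Z)"
      by (rule vf_add[OF Y Us sect_secs[OF U of_sect[OF U X]] sect_secs[OF U of_sect[OF U Z]]])
    show ?thesis
      unfolding vadd_eq_plus ext_d_eq[OF U vfield_add[OF X Z] Y] ext_d_eq[OF U X Y] ext_d_eq[OF U Z Y]
        vbr_add_left[OF X Z Y U] of_add[OF U XY vfield_vbr[OF Z Y U]] of_add[OF U X Z] 1
      by (simp add: scl_add algebra_simps)
  qed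
  have scal: "ext_d M \<eta> U (vscl h X) Y = h * ext_d M \<eta> U X Y" if h: "h \<in> sect M l U" for h l
  proof -
    have Yh: "Y U h \<in> sect M (j \<noteq> l) U" by (rule vf_sect[OF Y Us h])
    have v1: "vfield M ((l \<noteq> i) \<noteq> j) U (vscl h (vbr i j X Y))"
    proof -
      have "(l \<noteq> (i \<noteq> j)) = ((l \<noteq> i) \<noteq> j)" by auto
      then show ?thesis using vfield_vscl[OF XY U h] by simp
    qed
    have v2: "vfield M ((l \<noteq> i) \<noteq> j) U (vscl (scl (- ksign (l \<noteq> i) j) (Y U h)) X)"
    proof -
      have "((j \<noteq> l) \<noteq> i) = ((l \<noteq> i) \<noteq> j)" by auto
      then show ?thesis using vfield_vscl[OF X U sect_scl[OF U Yh, of "- ksign (l \<noteq> i) j"]] by simp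
    qed
    have 1: "Y U (h * \<eta> U X) = Y U h * \<eta> U X + scl (ksign j l) (h * Y U (\<eta> U X))"
      by (rule vf_leib[OF Y Us h sect_secs[OF U of_sect[OF U X]]])
    have k: "ksign j l * ksign (l \<noteq> i) j = ksign i j" by (cases i; cases j; cases l) auto
    show ?thesis
      unfolding ext_d_eq[OF U vfield_vscl[OF X U h] Y] ext_d_eq[OF U X Y] vbr_vscl_left[OF X Y U h]
        of_add[OF U v1 v2] of_vscl[OF U XY h] of_vscl[OF U X sect_scl[OF U Yh]] of_vscl[OF U X h] 1
      using k by (simp add: scl_add algebra_simps vscl_apply)
  qed
  have anti: "ext_d M \<eta> U Y X = scl (- ksign i j) (ext_d M \<eta> U X Y)"
    unfolding ext_d_eq[OF U Y X] ext_d_eq[OF U X Y] vbr_antisym[of j i Y X] of_rscl[OF U XY]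
    by (cases i; cases j) (simp_all add: algebra_simps)
  have restr: "ext_d M \<eta> W (vres W X) (vres W Y) = res W (ext_d M \<eta> U X Y)"
    if W: "openin (body M) W" "W \<subseteq> U" for W
  proof -
    have vf: "vres W X W (\<eta> W (vres W Y)) = res W (X U (\<eta> U Y))" if "vfield M i U X" "vfield M j U Y" for i j X Y
      using vf_res[OF that(1) Us sect_secs[OF U of_sect[OF U that(2)]] W] of_res[OF U that(2) W] W
      by (simp add: vres_apply)
    show ?thesis
      unfolding ext_d_eq[OF W(1) vfield_vres[OF X W] vfield_vres[OF Y W]] ext_d_eq[OF U X Y]
        vbr_vres of_res[OF U XY W] vf[OF X Y] vf[OF Y X] by simp
  qed
  show "ext_d M \<eta> U X Y \<in> sect M (i \<noteq> j) U \<and>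
       (\<forall>Z. vfield M i U Z \<longrightarrow> ext_d M \<eta> U (vadd X Z) Y = ext_d M \<eta> U X Y + ext_d M \<eta> U Z Y) \<and>
       (\<forall>l. \<forall>f\<in>sect M l U. ext_d M \<eta> U (vscl f X) Y = f * ext_d M \<eta> U X Y) \<and>
       ext_d M \<eta> U Y X = scl (- ksign i j) (ext_d M \<eta> U X Y) \<and>
       (\<forall>W. openin (body M) W \<and> W \<subseteq> U \<longrightarrow> ext_d M \<eta> W (vres W X) (vres W Y) = res W (ext_d M \<eta> U X Y))"
    using sec add scal anti restr by blast
qed

text \<open>The six orderings of \<open>X\<close>, \<open>Y\<close>, \<open>Z\<close> each occur
  twice, with opposite signs. Real factors are written as \<open>rscl\<close>, which one-forms
  respect.\<close>

lemma jacobi: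
  assumes X: "vfield M i U X" and Y: "vfield M j U Y" and Z: "vfield M l U Z" and U: "openin (body M) U"
  shows "vbr (i \<noteq> j) l (vbr i j X Y) Z + (rscl (- ksign j l) (vbr (i \<noteq> l) j (vbr i l X Z) Y) +
     rscl (ksign i (j \<noteq> l)) (vbr (j \<noteq> l) i (vbr j l Y Z) X)) = 0"
    (is "?A + (?B + ?C) = 0")
proof (intro ext)
  fix W f x
  show "(?A + (?B + ?C)) W f x = 0 W f x"
  proof (cases "openin (body M) W \<and> W \<subseteq> U \<and> f \<in> secs M W")
    case True
    then have W: "openin (body M) W" "W \<subseteq> U" and f: "f \<in> secs M W" by auto
    note s = vf_secs[OF X W] vf_secs[OF Y W] vf_secs[OF Z W]
    note d = vf_diff[OF X W] vf_diff[OF Y W] vf_diff[OF Z W] vf_scl[OF X W] vf_scl[OF Y W] vf_scl[OF Z W]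
      vf_add[OF X W] vf_add[OF Y W] vf_add[OF Z W]
    have "(?A + (?B + ?C)) W f = 0"
      using f by (cases i; cases j; cases l) (simp_all add: vbr_apply rscl_def d s secs_scl secs_diff secs_add W scl_diff scl_add)
    then show ?thesis by simp
  next
    case False
    note v = vf_ext[OF X False] vf_ext[OF Y False] vf_ext[OF Z False] vf_at_zero[OF X] vf_at_zero[OF Y] vf_at_zero[OF Z]
    then show ?thesis by (simp add: vbr_apply rscl_def)
  qed
qed

text \<open>Second derivatives of the values of \<open>\<eta>\<close> combine to brackets of fields
  acting on these values, and cancel against the terms of Cartan's formula that contain one bracket.
  What is left is \<open>\<eta>\<close> on double brackets, which is zero by the Jacobi
  identity.\<close>

lemma closed_form_ext_d: "closed_form M (ext_d M \<eta>)"
  unfolding closed_form_def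
proof (intro allI impI, elim conjE)
  fix U i j l X Y Z
  assume U: "openin (body M) U" and X: "vfield M i U X" and Y: "vfield M j U Y" and Z: "vfield M l U Z"
  note Us = U subset_refl
  let ?e = "\<eta> U"
  note XY = vfield_vbr[OF X Y U] and XZ = vfield_vbr[OF X Z U] and YZ = vfield_vbr[OF Y Z U]
  note e = sect_secs[OF U of_sect[OF U X]] sect_secs[OF U of_sect[OF U Y]] sect_secs[OF U of_sect[OF U Z]]
    sect_secs[OF U of_sect[OF U XY]] sect_secs[OF U of_sect[OF U XZ]] sect_secs[OF U of_sect[OF U YZ]]
  note s = e vf_secs[OF X Us] vf_secs[OF Y Us] vf_secs[OF Z Us]
  note d = vf_diff[OF X Us] vf_diff[OF Y Us] vf_diff[OF Z Us] vf_scl[OF X Us] vf_scl[OF Y Us] vf_scl[OF Z Us]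
    vf_add[OF X Us] vf_add[OF Y Us] vf_add[OF Z Us] vf_uminus[OF X Us] vf_uminus[OF Y Us] vf_uminus[OF Z Us]
  let ?J1 = "vbr (i \<noteq> j) l (vbr i j X Y) Z" and ?J2 = "vbr (i \<noteq> l) j (vbr i l X Z) Y"
    and ?J3 = "vbr (j \<noteq> l) i (vbr j l Y Z) X"
  let ?p = "(i \<noteq> j) \<noteq> l"
  have p: "((i \<noteq> l) \<noteq> j) = ?p" "((j \<noteq> l) \<noteq> i) = ?p" by auto
  have J1: "vfield M ?p U ?J1" by (rule vfield_vbr[OF XY Z U])
  have J2: "vfield M ?p U ?J2" using vfield_vbr[OF XZ Y U] unfolding p .
  have J3: "vfield M ?p U ?J3" using vfield_vbr[OF YZ X U] unfolding p .
  have J: "?e ?J1 + (scl (- ksign j l) (?e ?J2) + scl (ksign i (j \<noteq> l)) (?e ?J3)) = 0"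
  proof -
    have "?e (?J1 + (rscl (- ksign j l) ?J2 + rscl (ksign i (j \<noteq> l)) ?J3)) = 0"
      unfolding jacobi[OF X Y Z U] by (rule of_zero[OF U])
    then show ?thesis
      by (simp only: of_add[OF U J1 vfield_add[OF vfield_rscl[OF J2 U] vfield_rscl[OF J3 U]]]
          of_add[OF U vfield_rscl[OF J2 U] vfield_rscl[OF J3 U]] of_rscl[OF U J2] of_rscl[OF U J3])
  qed
  define x y z xy xz yz j1 j2 j3 where
    "x = ?e X" "y = ?e Y" "z = ?e Z" "xy = ?e (vbr i j X Y)" "xz = ?e (vbr i l X Z)" "yz = ?e (vbr j l Y Z)"
    "j1 = ?e ?J1" "j2 = ?e ?J2" "j3 = ?e ?J3"
  note defs = this
  note s' = s[folded defs]
  \<comment> \<open>The Jacobi identity is solved for one double bracket; after substituting it,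
    only an identity between linear expressions remains.\<close>
  have j1: "j1 = scl (ksign j l) j2 - scl (ksign i (j \<noteq> l)) j3"
    using J[folded defs] by (simp add: algebra_simps)
  show "X U (ext_d M \<eta> U Y Z) - scl (ksign i j) (Y U (ext_d M \<eta> U X Z))
        + scl (ksign l (i \<noteq> j)) (Z U (ext_d M \<eta> U X Y))
        - ext_d M \<eta> U (vbr i j X Y) Z
        + scl (ksign j l) (ext_d M \<eta> U (vbr i l X Z) Y)
        - scl (ksign i (j \<noteq> l)) (ext_d M \<eta> U (vbr j l Y Z) X) = 0"
    unfolding ext_d_eq[OF U Y Z] ext_d_eq[OF U X Z] ext_d_eq[OF U X Y] ext_d_eq[OF U XY Z]
      ext_d_eq[OF U XZ Y] ext_d_eq[OF U YZ X] defs[symmetric] vbr_apply j1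
    by (cases i; cases j; cases l)
      (simp_all add: d s' secs_scl secs_diff secs_add secs_uminus U scl_diff scl_add algebra_simps)
qed

end

end

section \<open>The Liouville form\<close>

text \<open>Momenta are numbered after the positions.\<close>

definition msh :: "nat \<Rightarrow> nat \<Rightarrow> bool \<times> nat \<Rightarrow> bool \<times> nat" where
  "msh n r A = (fst A, (if fst A then r else n) + snd A)"

lemma fst_msh [simp]: "fst (msh n r A) = fst A"
  by (simp add: msh_def)

lemma cidx_subset: "A \<in> cidx n r \<Longrightarrow> A \<in> cidx (2 * n) (2 * r)"
  and msh_cidx: "A \<in> cidx n r \<Longrightarrow> msh n r A \<in> cidx (2 * n) (2 * r)"
  by (auto simp: cidx_def msh_def)

section \<open>Symbols and momenta\<close>

locale cotan =
  fixes n r :: nat and M :: "('x, 'g::real_algebra_1) sspace" and K :: "('z, 's::real_algebra_1, 'x, 'g) cot"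
  assumes sman: "supermanifold n r M" and cotangent: "cotangent n r M K"
begin

abbreviation "N \<equiv> csp K"

sublocale MS: ssheaf M
  using sman by unfold_locales (simp add: supermanifold_def)

sublocale NS: ssheaf N
  using cotangent by unfold_locales (simp add: cotangent_def supermanifold_def)

sublocale P: mor_loc N M "cpr K"
  using cotangent by unfold_locales (simp add: cotangent_def)

lemma
  assumes U: "openin (body M) U" and X: "vfield M i U X"
  shows csym_sect: "csym K U X \<in> sect N i (cpre K U)"
    and csym_add: "vfield M i U Y \<Longrightarrow> csym K U (X + Y) = csym K U X + csym K U Y"
    and csym_vscl: "f \<in> sect M j U \<Longrightarrow> csym K U (vscl f X) = pb (cpr K) U f * csym K U X"
    and csym_res: "openin (body M) W \<Longrightarrow> W \<subseteq> U \<Longrightarrow> csym K W (vres W X) = res (cpre K W) (csym K U X)"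
  using cotangent[unfolded cotangent_def, THEN conjunct2, THEN conjunct2, THEN conjunct1, rule_format, OF conjI[OF U X]]
  by (simp_all add: vadd_eq_plus)

lemma csym_sum:
  assumes U: "openin (body M) U" and X: "\<And>A. A \<in> I \<Longrightarrow> vfield M i U (X A)"
  shows "csym K U (\<Sum>A\<in>I. X A) = (\<Sum>A\<in>I. csym K U (X A))"
proof -
  have 0: "csym K U 0 = 0" using csym_add[of U i 0 0] U MS.vfield_0 by simp
  show ?thesis
    using X by (induct I rule: infinite_finite_induct) (simp_all add: 0 csym_add[OF U, of i] MS.vfield_sum)
qed

lemma ex_cot_chart: "chart n r M c \<Longrightarrow> \<exists>C. cot_chart n r M K c C"
  using cotangent by (simp add: cotangent_def)

lemma ex_chart: "x \<in> total M \<Longrightarrow> \<exists>c. chart n r M c \<and> x \<in> cdom c"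
  using sman by (simp add: supermanifold_def)

lemma chart_schart: "chart n r M c \<Longrightarrow> schart_loc M n r c"
  by unfold_locales

context
  fixes c assumes c: "chart n r M c"
begin

interpretation c: schart_loc M n r c by (rule chart_schart[OF c])

lemma cpre_open: "openin (body N) (cpre K (cdom c))"
  by (rule P.pre_open[OF c.cdom_open])

lemma pos_sect: "A \<in> cidx n r \<Longrightarrow> pos K c A \<in> sect N (fst A) (cpre K (cdom c))"
  unfolding pos_def by (rule P.pb_sect[OF c.cdom_open c.coord_sect])

lemma mom_eq: "A \<in> cidx n r \<Longrightarrow> mom n r M K c A = csym K (cdom c) (c.dc A)"
  by (simp add: mom_def c.dcoord_eq)

lemma mom_sect: "A \<in> cidx n r \<Longrightarrow> mom n r M K c A \<in> sect N (fst A) (cpre K (cdom c))"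
  unfolding mom_eq by (rule csym_sect[OF c.cdom_open c.vfield_dc])

text \<open>The symbol is linear over functions, and the momenta are the symbols of the coordinate
  fields.\<close>

lemma csym_local:
  assumes U: "openin (body M) U" "U \<subseteq> cdom c" and X: "vfield M i U X"
  shows "csym K U X = (\<Sum>A\<in>cidx n r. pb (cpr K) U (X U (res U (coord c A))) * res (cpre K U) (mom n r M K c A))"
proof -
  have sU: "c.sub U" by (rule c.subI[OF U])
  have s: "X U (res U (coord c A)) \<in> sect M (i \<noteq> fst A) U" if "A \<in> cidx n r" for A
    by (rule MS.vf_sect[OF X U(1) subset_refl c.coord_res_sect[OF that sU]])
  have v: "vfield M (fst A) U (vres U (c.dc A))" if "A \<in> cidx n r" for A
    by (rule MS.vfield_vres[OF c.vfield_dc[OF that] U])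
  have vi: "vfield M i U (vscl (X U (res U (coord c A))) (vres U (c.dc A)))" if "A \<in> cidx n r" for A
  proof -
    have "((i \<noteq> fst A) \<noteq> fst A) = i" by auto
    then show ?thesis using MS.vfield_vscl[OF v[OF that] U(1) s[OF that]] by simp
  qed
  have "csym K U X = csym K U (\<Sum>A\<in>cidx n r. vscl (X U (res U (coord c A))) (vres U (c.dc A)))"
    by (rule arg_cong[OF c.vfield_decomposition[OF sU X]])
  also have "\<dots> = (\<Sum>A\<in>cidx n r. csym K U (vscl (X U (res U (coord c A))) (vres U (c.dc A))))"
    by (rule csym_sum[OF U(1) vi])
  also have "\<dots> = (\<Sum>A\<in>cidx n r. pb (cpr K) U (X U (res U (coord c A))) * res (cpre K U) (mom n r M K c A))"
    by (rule sum.cong[OF refl])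
      (simp add: csym_vscl[OF U(1) v s] csym_res[OF c.cdom_open c.vfield_dc U] mom_eq)
  finally show ?thesis .
qed

text \<open>In a canonical chart the even base coordinates are among the coordinates upstairs, so
  the projection pulls them back without nilpotent parts.\<close>

lemma cot_chart_mor:
  assumes C: "cot_chart n r M K c C" and V: "openin (body N) V" "V \<subseteq> cpre K (cdom c)"
  shows "chart_mor N M (cpr K) n r c (2 * n) (2 * r) C V (\<lambda>a v. v a)"
proof -
  have ch: "chart (2 * n) (2 * r) N C" and d: "cdom C = cpre K (cdom c)"
    and co: "\<And>a. a < n \<Longrightarrow> coord C (False, a) = pos K c (False, a)"
    using C by (auto simp: cot_chart_def)
  interpret C: schart_loc N "2 * n" "2 * r" C by unfold_locales (rule ch)
  have sV: "C.sub V" using V d by (simp add: C.sub_def)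
  show ?thesis
  proof unfold_locales
    show "C.sub V" by (rule sV)
    show "V \<subseteq> cpre K (cdom c)" by (rule V(2))
    show "smooth_fun (2 * n) (C.img V) (\<lambda>v. v a)" for a by (rule C.smooth_coord_img[OF sV])
    show "res V (pb (cpr K) (cdom c) (coord c (False, a))) = pull C V (\<lambda>v. v a)" if "a < n" for a
      using C.pull_coord[OF sV, of a] co[OF that] by (simp add: pos_def)
  qed
qed

end

text \<open>The Liouville form as read off in the chart \<open>c\<close>; \<open>liouville\<close>
  is the section that restricts to all these local values.\<close>

definition lam :: "('x, 'g) schart \<Rightarrow> 'z set \<Rightarrow> ('z, 's) svf \<Rightarrow> 'z \<Rightarrow> 's" where
  "lam c U X = (\<Sum>A\<in>cidx n r. X (U \<inter> cpre K (cdom c)) (res (U \<inter> cpre K (cdom c)) (pos K c A)) * mom n r M K c A)"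

context
  fixes U i X assumes U: "openin (body N) U" and X: "vfield N i U X"
begin

lemma lam_restrict:
  assumes c: "chart n r M c" and V: "openin (body N) V" "V \<subseteq> U" "V \<subseteq> cpre K (cdom c)"
  shows "res V (lam c U X) = (\<Sum>A\<in>cidx n r. X V (res V (pos K c A)) * res V (mom n r M K c A))"
  unfolding lam_def res_sum
proof (rule sum.cong[OF refl])
  fix A assume A: "A \<in> cidx n r"
  let ?W = "U \<inter> cpre K (cdom c)"
  have W: "openin (body N) ?W" "?W \<subseteq> U" "?W \<subseteq> cpre K (cdom c)" and VW: "V \<subseteq> ?W"
    using U cpre_open[OF c] V by auto
  have "X V (res V (res ?W (pos K c A))) = res V (X ?W (res ?W (pos K c A)))"
    by (rule NS.vf_res[OF X W(1,2) NS.secs_res[OF cpre_open[OF c] NS.sect_secs[OF cpre_open[OF c] pos_sect[OF c A]] W(1,3)] V(1) VW])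
  then show "res V (X ?W (res ?W (pos K c A)) * mom n r M K c A) = X V (res V (pos K c A)) * res V (mom n r M K c A)"
    using VW by (simp add: Int_absorb2)
qed

lemma lam_sect:
  assumes c: "chart n r M c" and V: "openin (body N) V" "V \<subseteq> U" "V \<subseteq> cpre K (cdom c)"
  shows "res V (lam c U X) \<in> sect N i V"
  unfolding lam_restrict[OF c V]
proof (rule NS.sect_sum[OF V(1)])
  fix A assume A: "A \<in> cidx n r"
  have "X V (res V (pos K c A)) * res V (mom n r M K c A) \<in> sect N ((i \<noteq> fst A) \<noteq> fst A) V"
    by (intro NS.sect_mult V NS.vf_sect[OF X] NS.sect_res[OF cpre_open[OF c] pos_sect[OF c A]]
        NS.sect_res[OF cpre_open[OF c] mom_sect[OF c A]])
  moreover have "((i \<noteq> fst A) \<noteq> fst A) = i" by auto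
  ultimately show "X V (res V (pos K c A)) * res V (mom n r M K c A) \<in> sect N i V" by simp
qed

text \<open>Positions transform by the chain rule, momenta as symbols of coordinate fields. Both use
  the same Jacobian \<open>?J\<close>, contracted once in each index, so the claim becomes an
  exchange of two sums.\<close>

lemma lam_change_chart:
  assumes c: "chart n r M c" and c': "chart n r M c'"
  shows "res (U \<inter> cpre K (cdom c \<inter> cdom c')) (lam c' U X) = res (U \<inter> cpre K (cdom c \<inter> cdom c')) (lam c U X)"
proof -
  interpret c: schart_loc M n r c by (rule chart_schart[OF c])
  interpret c': schart_loc M n r c' by (rule chart_schart[OF c'])
  let ?T = "cdom c \<inter> cdom c'"
  let ?V = "U \<inter> cpre K ?T"
  have T: "openin (body M) ?T" by auto
  have V: "openin (body N) ?V" "?V \<subseteq> U" "?V \<subseteq> cpre K ?T" "?V \<subseteq> cpre K (cdom c)" "?V \<subseteq> cpre K (cdom c')"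
    using U P.pre_open[OF T] by (auto simp: preim_def)
  obtain C where C: "cot_chart n r M K c C" using ex_cot_chart[OF c] by blast
  interpret F: chart_mor N M "cpr K" n r c "2 * n" "2 * r" C ?V "\<lambda>a v. v a"
    by (rule cot_chart_mor[OF c C V(1,4)])
  have XV: "vfield N i ?V (vres ?V X)" by (rule NS.vfield_vres[OF X V(1,2)])
  have sT: "c.sub ?T" "c'.sub ?T" using T by (auto simp: c.sub_def c'.sub_def)
  have VpT: "F.Vp ?T = ?V" using V by (auto simp: F.Vp_def)
  have z': "res ?T (coord c' B) \<in> secs M ?T" if "B \<in> cidx n r" for B
    by (rule MS.secs_res[OF c'.cdom_open c'.coord_secs[OF that] T]) auto
  let ?J = "\<lambda>A B. res ?V (pb (cpr K) ?T (c.dc A ?T (res ?T (coord c' B))))"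
  have pos': "X ?V (res ?V (pos K c' B)) = (\<Sum>A\<in>cidx n r. X ?V (res ?V (pos K c A)) * ?J A B)"
    if B: "B \<in> cidx n r" for B
  proof -
    have e: "res ?V (pb (cpr K) ?T (res ?T (coord c' B))) = res ?V (pos K c' B)"
      unfolding pos_def using P.pb_res[OF c'.cdom_open c'.coord_secs[OF B] T] V(3) by (simp add: Int_absorb2)
    have "X ?V (res ?V (pos K c A)) \<in> secs N ?V" if A: "A \<in> cidx n r" for A
      by (rule NS.vf_secs[OF X V(1,2) NS.sect_secs[OF V(1) NS.sect_res[OF cpre_open[OF c] pos_sect[OF c A] V(1,4)]]])
    then have "res ?V (X ?V (res ?V (pos K c A))) = X ?V (res ?V (pos K c A))" if "A \<in> cidx n r" for A
      using NS.secs_id[OF V(1)] that by blast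
    then show ?thesis
      using F.chain_rule[OF XV sT(1) z'[OF B]] unfolding VpT e
      by (simp add: vres_apply flip: pos_def)
  qed
  have mom: "res ?V (mom n r M K c A) = (\<Sum>B\<in>cidx n r. ?J A B * res ?V (mom n r M K c' B))"
    if A: "A \<in> cidx n r" for A
  proof -
    have v: "vfield M (fst A) ?T (vres ?T (c.dc A))" by (rule MS.vfield_vres[OF c.vfield_dc[OF A] T]) auto
    have "res ?V (mom n r M K c A) = res ?V (csym K ?T (vres ?T (c.dc A)))"
      using csym_res[OF c.cdom_open c.vfield_dc[OF A] T] V(3) mom_eq[OF c A] by (simp add: Int_absorb2)
    also have "csym K ?T (vres ?T (c.dc A)) =
        (\<Sum>B\<in>cidx n r. pb (cpr K) ?T (vres ?T (c.dc A) ?T (res ?T (coord c' B))) * res (cpre K ?T) (mom n r M K c' B))"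
      by (rule csym_local[OF c' T _ v]) auto
    finally show ?thesis using V(3) by (simp add: res_sum Int_absorb2 vres_apply)
  qed
  have "res ?V (lam c' U X) = (\<Sum>B\<in>cidx n r. (\<Sum>A\<in>cidx n r. X ?V (res ?V (pos K c A)) * ?J A B) * res ?V (mom n r M K c' B))"
    unfolding lam_restrict[OF c' V(1,2,5)] by (rule sum.cong[OF refl]) (simp only: pos')
  also have "\<dots> = (\<Sum>B\<in>cidx n r. \<Sum>A\<in>cidx n r. X ?V (res ?V (pos K c A)) * (?J A B * res ?V (mom n r M K c' B)))"
    by (simp only: sum_distrib_right mult.assoc)
  also have "\<dots> = (\<Sum>A\<in>cidx n r. \<Sum>B\<in>cidx n r. X ?V (res ?V (pos K c A)) * (?J A B * res ?V (mom n r M K c' B)))"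
    by (rule sum.swap)
  also have "\<dots> = (\<Sum>A\<in>cidx n r. X ?V (res ?V (pos K c A)) * res ?V (mom n r M K c A))"
    by (rule sum.cong[OF refl]) (simp only: mom sum_distrib_left)
  also have "\<dots> = res ?V (lam c U X)" by (rule lam_restrict[OF c V(1,2,4), symmetric])
  finally show ?thesis .
qed

text \<open>The description in \<open>liouville\<close> has a solution because the local values
  agree on overlaps; it is assembled pointwise from a chosen chart at each point. It is unique
  because the charts fix it on \<open>U\<close> and it is 0 elsewhere.\<close>

lemma liouville_local:
  shows "res U (liouville n r M K U X) = liouville n r M K U X"
    and "chart n r M c \<Longrightarrow> res (U \<inter> cpre K (cdom c)) (liouville n r M K U X) = lam c U X"
proof -
  define cc where "cc z = (SOME c. chart n r M c \<and> bodymap (cpr K) z \<in> cdom c)" for z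
  have cc: "chart n r M (cc z)" "z \<in> cpre K (cdom (cc z))" if z: "z \<in> U" for z
  proof -
    have zt: "z \<in> total N" using z openin_subset[OF U] by blast
    have "chart n r M (cc z) \<and> bodymap (cpr K) z \<in> cdom (cc z)"
      unfolding cc_def by (rule someI_ex) (rule ex_chart[OF P.bodymap_total[OF zt]])
    then show "chart n r M (cc z)" "z \<in> cpre K (cdom (cc z))" using zt by (auto simp: preim_def)
  qed
  define s where "s = (\<lambda>z. if z \<in> U then lam (cc z) U X z else 0)"
  have lid: "res (U \<inter> cpre K (cdom c)) (lam c U X) = lam c U X" if c: "chart n r M c" for c
  proof -
    let ?W = "U \<inter> cpre K (cdom c)"
    have W: "openin (body N) ?W" "?W \<subseteq> U" "?W \<subseteq> cpre K (cdom c)" using U cpre_open[OF c] by auto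
    have "res ?W (X ?W (res ?W (pos K c A)) * mom n r M K c A) = X ?W (res ?W (pos K c A)) * mom n r M K c A"
      if A: "A \<in> cidx n r" for A
    proof -
      have "X ?W (res ?W (pos K c A)) \<in> secs N ?W"
        by (rule NS.vf_secs[OF X W(1,2) NS.sect_secs[OF W(1) NS.sect_res[OF cpre_open[OF c] pos_sect[OF c A] W(1,3)]]])
      from NS.secs_id[OF W(1) this] show ?thesis by (simp only: res_mult_right)
    qed
    then show ?thesis unfolding lam_def res_sum by (intro sum.cong refl)
  qed
  have s: "res U s = s" "res (U \<inter> cpre K (cdom c)) s = lam c U X" if c: "chart n r M c" for c
  proof -
    show "res U s = s" by (auto simp: s_def res_def)
    have "res (U \<inter> cpre K (cdom c)) s = res (U \<inter> cpre K (cdom c)) (lam c U X)"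
    proof (rule res_eqI)
      fix z assume z: "z \<in> U \<inter> cpre K (cdom c)"
      then have "z \<in> U \<inter> cpre K (cdom c \<inter> cdom (cc z))" using cc[of z] by (auto simp: preim_def)
      from res_eqD[OF lam_change_chart[OF c cc(1)] this] show "s z = lam c U X z"
        using z by (simp add: s_def)
    qed
    then show "res (U \<inter> cpre K (cdom c)) s = lam c U X" using lid[OF c] by simp
  qed
  have eq: "liouville n r M K U X = s"
    unfolding liouville_def
  proof (rule the_equality)
    have "res U s = s" by (auto simp: s_def res_def)
    then show "res U s = s \<and> (\<forall>c. chart n r M c \<longrightarrow>
        (let W = U \<inter> cpre K (cdom c) in res W s = (\<Sum>A\<in>cidx n r. X W (res W (pos K c A)) * mom n r M K c A)))"
      using s(2) by (simp add: Let_def lam_def)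
    fix t assume "res U t = t \<and> (\<forall>c. chart n r M c \<longrightarrow>
        (let W = U \<inter> cpre K (cdom c) in res W t = (\<Sum>A\<in>cidx n r. X W (res W (pos K c A)) * mom n r M K c A)))"
    then have t: "res U t = t" "\<And>c. chart n r M c \<Longrightarrow> res (U \<inter> cpre K (cdom c)) t = lam c U X"
      by (auto simp: Let_def lam_def)
    show "t = s"
    proof
      fix z
      show "t z = s z"
      proof (cases "z \<in> U")
        case True
        then have "res (U \<inter> cpre K (cdom (cc z))) t = res (U \<inter> cpre K (cdom (cc z))) s"
          using t(2) s(2) cc by simp
        then show ?thesis by (rule res_eqD) (use True cc in auto)
      next
        case False
        then show ?thesis using t(1) by (metis res_apply s_def)
      qed
    qed
  qed
  show "res U (liouville n r M K U X) = liouville n r M K U X"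
    unfolding eq by (auto simp: s_def res_def)
  show "chart n r M c \<Longrightarrow> res (U \<inter> cpre K (cdom c)) (liouville n r M K U X) = lam c U X"
    unfolding eq by (rule s(2))
qed

lemma liouville_chart:
  assumes c: "chart n r M c" and V: "openin (body N) V" "V \<subseteq> U" "V \<subseteq> cpre K (cdom c)"
  shows "res V (liouville n r M K U X) = (\<Sum>A\<in>cidx n r. X V (res V (pos K c A)) * res V (mom n r M K c A))"
proof -
  have "V \<inter> (U \<inter> cpre K (cdom c)) = V" using V by auto
  then have "res V (liouville n r M K U X) = res V (res (U \<inter> cpre K (cdom c)) (liouville n r M K U X))" by simp
  also have "\<dots> = res V (lam c U X)" by (simp only: liouville_local(2)[OF c])
  also have "\<dots> = (\<Sum>A\<in>cidx n r. X V (res V (pos K c A)) * res V (mom n r M K c A))" by (rule lam_restrict[OF c V])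
  finally show ?thesis .
qed

end

lemma cover:
  assumes U: "openin (body N) U" and z: "z \<in> U"
  obtains c where "chart n r M c" "z \<in> U \<inter> cpre K (cdom c)" "openin (body N) (U \<inter> cpre K (cdom c))"
proof -
  have zt: "z \<in> total N" using z openin_subset[OF U] by blast
  obtain c where c: "chart n r M c" "bodymap (cpr K) z \<in> cdom c" using ex_chart[OF P.bodymap_total[OF zt]] by blast
  then show ?thesis using that[OF c(1)] z zt U cpre_open[OF c(1)] by (auto simp: preim_def)
qed

lemma cover_eqI:
  assumes U: "openin (body N) U" and f: "res U f = f" and g: "res U g = g"
    and e: "\<And>c. chart n r M c \<Longrightarrow> res (U \<inter> cpre K (cdom c)) f = res (U \<inter> cpre K (cdom c)) g"
  shows "f = g"
proof
  fix z
  show "f z = g z"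
  proof (cases "z \<in> U")
    case True
    obtain c where c: "chart n r M c" "z \<in> U \<inter> cpre K (cdom c)" by (rule cover[OF U True])
    show ?thesis by (rule res_eqD[OF e[OF c(1)] c(2)])
  next
    case False
    then show ?thesis using f g by (metis res_apply)
  qed
qed

lemma one_form_liouville: "one_form N False (total N) (liouville n r M K)"
  unfolding one_form_def
proof (intro allI impI, elim conjE)
  let ?l = "liouville n r M K"
  fix U i X assume U: "openin (body N) U" and X: "vfield N i U X"
  let ?W = "\<lambda>c. U \<inter> cpre K (cdom c)"
  have W: "openin (body N) (?W c)" "?W c \<subseteq> U" "?W c \<subseteq> cpre K (cdom c)" if "chart n r M c" for c
    using U cpre_open[OF that] by auto
  have id: "res U (?l U X) = ?l U X" if "vfield N i U X" for i X by (rule liouville_local(1)[OF U that])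
  have 1: "?l U X \<in> sect N (False \<noteq> i) U"
  proof (rule NS.sect_glue[OF U id[OF X]])
    fix z assume z: "z \<in> U"
    obtain c where c: "chart n r M c" "z \<in> ?W c" by (rule cover[OF U z])
    have "res (?W c) (?l U X) \<in> sect N i (?W c)"
      using lam_sect[OF U X c(1) W[OF c(1)]] lam_restrict[OF U X c(1) W[OF c(1)]] liouville_chart[OF U X c(1) W[OF c(1)]]
      by simp
    then show "\<exists>W. openin (body N) W \<and> z \<in> W \<and> W \<subseteq> U \<and> res W (?l U X) \<in> sect N (False \<noteq> i) W"
      using W[OF c(1)] c(2) by (intro exI[of _ "?W c"]) simp
  qed
  have 2: "?l U (vadd X Y) = ?l U X + ?l U Y" if Y: "vfield N i U Y" for Y
    unfolding vadd_eq_plus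
  proof (rule cover_eqI[OF U id[OF NS.vfield_add[OF X Y]]])
    show "res U (?l U X + ?l U Y) = ?l U X + ?l U Y" using id[OF X] id[OF Y] by simp
    fix c assume c: "chart n r M c"
    show "res (?W c) (?l U (X + Y)) = res (?W c) (?l U X + ?l U Y)"
      unfolding liouville_chart[OF U NS.vfield_add[OF X Y] c W[OF c]] res_simps(3)
        liouville_chart[OF U X c W[OF c]] liouville_chart[OF U Y c W[OF c]]
      by (simp add: distrib_right sum.distrib)
  qed
  have 3: "?l U (vscl f X) = f * ?l U X" if f: "f \<in> sect N j U" for f j
  proof (rule cover_eqI[OF U id[OF NS.vfield_vscl[OF X U f]]])
    show "res U (f * ?l U X) = f * ?l U X" using id[OF X] by (metis res_mult_left)
    fix c assume c: "chart n r M c"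
    have "res (?W c) (f * ?l U X) = f * res (?W c) (?l U X)" by (rule res_mult_left)
    then show "res (?W c) (?l U (vscl f X)) = res (?W c) (f * ?l U X)"
      unfolding liouville_chart[OF U NS.vfield_vscl[OF X U f] c W[OF c]] liouville_chart[OF U X c W[OF c]]
      by (simp add: NS.vscl_apply sum_distrib_left mult.assoc)
  qed
  have 4: "?l V (vres V X) = res V (?l U X)" if V: "openin (body N) V" "V \<subseteq> U" for V
  proof (rule cover_eqI[OF V(1) liouville_local(1)[OF V(1) NS.vfield_vres[OF X V]]])
    show "res V (res V (?l U X)) = res V (?l U X)" by simp
    fix c assume c: "chart n r M c"
    let ?T = "V \<inter> cpre K (cdom c)"
    have T: "openin (body N) ?T" "?T \<subseteq> V" "?T \<subseteq> U" "?T \<subseteq> cpre K (cdom c)" using V cpre_open[OF c] by auto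
    have "res ?T (res V (?l U X)) = res ?T (?l U X)" using T(2) by (simp add: Int_absorb2)
    then show "res ?T (?l V (vres V X)) = res ?T (res V (?l U X))"
      using liouville_chart[OF V(1) NS.vfield_vres[OF X V] c T(1,2,4)] liouville_chart[OF U X c T(1,3,4)] T(2)
      by (simp add: vres_apply)
  qed
  show "?l U X \<in> sect N (False \<noteq> i) U \<and> (\<forall>Y. vfield N i U Y \<longrightarrow> ?l U (vadd X Y) = ?l U X + ?l U Y) \<and>
       (\<forall>l. \<forall>f\<in>sect N l U. ?l U (vscl f X) = f * ?l U X) \<and>
       (\<forall>W'. openin (body N) W' \<and> W' \<subseteq> U \<longrightarrow> ?l W' (vres W' X) = res W' (?l U X))"
    using 1 2 3 4 by blast
qed

end

text \<open>\<open>dp\<^sub>A \<and> dq\<^sub>A\<close> evaluated on \<open>X\<close>, \<open>Y\<close> of parities \<open>i\<close>, \<open>j\<close>, where \<open>q\<^sub>A\<close> and \<open>p\<^sub>A\<close> have parity \<open>a\<close>.\<close>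

definition dterm :: "bool \<Rightarrow> bool \<Rightarrow> bool \<Rightarrow> 'z set \<Rightarrow> ('z, 's::real_algebra_1) svf \<Rightarrow> ('z, 's) svf \<Rightarrow>
    ('z \<Rightarrow> 's) \<Rightarrow> ('z \<Rightarrow> 's) \<Rightarrow> 'z \<Rightarrow> 's" where
  "dterm a i j U X Y q p = scl (ksign i (j \<noteq> a)) (Y U (res U q) * X U (res U p)) -
     scl (ksign i j * ksign j (i \<noteq> a)) (X U (res U q) * Y U (res U p))"

text \<open>The terms with second derivatives, such as \<open>X (Y q) * p\<close>, cancel against
  the bracket term of Cartan's formula.\<close>

lemma (in cotan) canonical_form_local:
  assumes c: "chart n r M c" and U: "openin (body N) U" "U \<subseteq> cpre K (cdom c)"
    and X: "vfield N i U X" and Y: "vfield N j U Y"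
  shows "canonical_form n r M K U X Y = (\<Sum>A\<in>cidx n r. dterm (fst A) i j U X Y (pos K c A) (mom n r M K c A))"
proof -
  let ?l = "liouville n r M K U"
  let ?q = "\<lambda>A. res U (pos K c A)" and ?p = "\<lambda>A. res U (mom n r M K c A)"
  note Us = U(1) subset_refl
  have q: "?q A \<in> sect N (fst A) U" and p: "?p A \<in> sect N (fst A) U" if "A \<in> cidx n r" for A
    using NS.sect_res[OF cpre_open[OF c] pos_sect[OF c that] U] NS.sect_res[OF cpre_open[OF c] mom_sect[OF c that] U] .
  note qs = NS.sect_secs[OF U(1) q] and ps = NS.sect_secs[OF U(1) p]
  have l: "?l X = (\<Sum>A\<in>cidx n r. X U (?q A) * ?p A)" if "vfield N i U X" for i X
    using liouville_chart[OF U(1) that c Us U(2)] liouville_local(1)[OF U(1) that] by simp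
  have d: "X U (?l Y) = (\<Sum>A\<in>cidx n r. X U (Y U (?q A)) * ?p A + scl (ksign i (j \<noteq> fst A)) (Y U (?q A) * X U (?p A)))"
    if X: "vfield N i U X" and Y: "vfield N j U Y" for X Y i j
  proof -
    have "X U (?l Y) = (\<Sum>A\<in>cidx n r. X U (Y U (?q A) * ?p A))"
      unfolding l[OF Y]
      by (rule NS.vf_sum[OF X Us]) (intro NS.secs_mult U NS.vf_secs[OF Y Us] qs ps; assumption)
    also have "\<dots> = (\<Sum>A\<in>cidx n r. X U (Y U (?q A)) * ?p A + scl (ksign i (j \<noteq> fst A)) (Y U (?q A) * X U (?p A)))"
      by (intro sum.cong refl NS.vf_leib[OF X Us NS.vf_sect[OF Y Us q] ps])
    finally show ?thesis .
  qed
  have b: "?l (vbr i j X Y) = (\<Sum>A\<in>cidx n r. X U (Y U (?q A)) * ?p A - scl (ksign i j) (Y U (X U (?q A)) * ?p A))"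
    unfolding l[OF NS.vfield_vbr[OF X Y U(1)]] by (simp add: vbr_apply left_diff_distrib)
  show ?thesis
    unfolding canonical_form_def NS.ext_d_eq[OF one_form_liouville U(1) X Y] d[OF X Y] d[OF Y X] b scl_sum
      sum_subtractf[symmetric]
    by (rule sum.cong[OF refl]) (simp add: dterm_def scl_add)
qed

section \<open>Darboux charts\<close>

text \<open>Additivity and left-linearity carry the decomposition of \<open>Y\<close> over to
  \<open>L\<close>. Applied to a one-form and to the first argument of a two-form, this allows
  comparing them on finitely many fields.\<close>

lemma (in schart_loc) functional_expand:
  assumes W: "sub W" and Y: "vfield M j W Y"
    and add: "\<And>A B. vfield M j W A \<Longrightarrow> vfield M j W B \<Longrightarrow> L (A + B) = L A + L B"
    and scal: "\<And>f l i Z. vfield M i W Z \<Longrightarrow> f \<in> sect M l W \<Longrightarrow> L (vscl f Z) = f * L Z"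
  shows "L Y = (\<Sum>B\<in>cidx n m. Y W (res W (coord c B)) * L (vres W (dc B)))"
proof -
  let ?t = "\<lambda>B. vscl (Y W (res W (coord c B))) (vres W (dc B))"
  note o = sub_open[OF W]
  have v: "vfield M (fst B) W (vres W (dc B))" if "B \<in> cidx n m" for B
    by (rule vfield_vres[OF vfield_dc[OF that] o sub_dom[OF W]])
  have s: "Y W (res W (coord c B)) \<in> sect M (j \<noteq> fst B) W" if "B \<in> cidx n m" for B
    by (rule vf_sect[OF Y o subset_refl coord_res_sect[OF that W]])
  have t: "vfield M j W (?t B)" if "B \<in> cidx n m" for B
  proof -
    have "((j \<noteq> fst B) \<noteq> fst B) = j" by auto
    then show ?thesis using vfield_vscl[OF v[OF that] o s[OF that]] by simp
  qed
  have L0: "L 0 = 0" using add[OF vfield_0 vfield_0] by simp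
  have sum: "L (\<Sum>B\<in>I. ?t B) = (\<Sum>B\<in>I. L (?t B))" if "I \<subseteq> cidx n m" for I
    using finite_subset[OF that finite_cidx] that
  proof (induct I rule: finite_induct)
    case empty
    have "L (\<Sum>B\<in>{}. ?t B) = (\<Sum>B\<in>{}. L (?t B))" by (simp add: L0)
    then show ?case .
  next
    case (insert x F)
    have "L (?t x + (\<Sum>B\<in>F. ?t B)) = L (?t x) + L (\<Sum>B\<in>F. ?t B)"
      by (rule add[OF t vfield_sum[OF t]]) (use insert.prems in auto)
    then have "L (\<Sum>B\<in>insert x F. ?t B) = (\<Sum>B\<in>insert x F. L (?t B))"
      using insert by simp
    then show ?case .
  qed
  have "L Y = L (\<Sum>B\<in>cidx n m. ?t B)" by (rule arg_cong[OF vfield_decomposition[OF W Y]])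
  also have "\<dots> = (\<Sum>B\<in>cidx n m. L (?t B))" by (rule sum) simp
  also have "\<dots> = (\<Sum>B\<in>cidx n m. Y W (res W (coord c B)) * L (vres W (dc B)))"
    by (rule sum.cong[OF refl scal[OF v s]])
  finally show ?thesis .
qed

lemma (in ssheaf)
  assumes w: "even_two_form M \<omega>" and U: "openin (body M) U" and X: "vfield M i U X" and Y: "vfield M j U Y"
  shows form_sect: "\<omega> U X Y \<in> sect M (i \<noteq> j) U"
    and form_add: "vfield M i U Z \<Longrightarrow> \<omega> U (X + Z) Y = \<omega> U X Y + \<omega> U Z Y"
    and form_vscl: "f \<in> sect M l U \<Longrightarrow> \<omega> U (vscl f X) Y = f * \<omega> U X Y"
    and form_anti: "\<omega> U Y X = scl (- ksign i j) (\<omega> U X Y)"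
    and form_res: "openin (body M) W \<Longrightarrow> W \<subseteq> U \<Longrightarrow> \<omega> W (vres W X) (vres W Y) = res W (\<omega> U X Y)"
  using w[unfolded even_two_form_def, rule_format, OF conjI[OF U conjI[OF X Y]]]
  by (simp_all add: vadd_eq_plus)

lemma (in ssheaf) form_zero_right:
  assumes w: "even_two_form M \<omega>" and U: "openin (body M) U" and Y: "vfield M j U Y"
  shows "\<omega> U Y 0 = 0"
proof -
  have "\<omega> U 0 Y = 0" using form_add[OF w U vfield_0[of False U] Y vfield_0[of False U]] by simp
  then show ?thesis using form_anti[OF w U vfield_0[of False U] Y] by simp
qed

text \<open>The family \<open>\<sigma>\<close> numbers the coordinates: \<open>\<sigma> False A\<close> is the position and \<open>\<sigma> True A\<close> the momentum with
  index \<open>A\<close>.\<close>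

locale darboux = schart_loc N "2 * n" "2 * r" C
  for N :: "('z, 's::real_algebra_1) sspace" and n r C +
  fixes \<omega> :: "('z, 's) sform2" and \<sigma> :: "bool \<Rightarrow> bool \<times> nat \<Rightarrow> bool \<times> nat"
  assumes two_form: "even_two_form N \<omega>"
    and \<sigma>_cidx: "\<And>A b. A \<in> cidx n r \<Longrightarrow> \<sigma> b A \<in> cidx (2 * n) (2 * r)"
    and \<sigma>_fst: "\<And>A b. A \<in> cidx n r \<Longrightarrow> fst (\<sigma> b A) = fst A"
    and \<sigma>_inj: "\<And>A B b b'. A \<in> cidx n r \<Longrightarrow> B \<in> cidx n r \<Longrightarrow> \<sigma> b A = \<sigma> b' B \<longleftrightarrow> b = b' \<and> A = B"
    and \<sigma>_surj: "\<And>B. B \<in> cidx (2 * n) (2 * r) \<Longrightarrow> \<exists>b. \<exists>A\<in>cidx n r. B = \<sigma> b A"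
    and form_local: "\<And>U i j X Y. openin (body N) U \<Longrightarrow> U \<subseteq> cdom C \<Longrightarrow> vfield N i U X \<Longrightarrow> vfield N j U Y \<Longrightarrow>
      \<omega> U X Y = (\<Sum>A\<in>cidx n r. dterm (fst A) i j U X Y (coord C (\<sigma> False A)) (coord C (\<sigma> True A)))"
begin

abbreviation "q A \<equiv> coord C (\<sigma> False A)"
abbreviation "p A \<equiv> coord C (\<sigma> True A)"
abbreviation "d b A \<equiv> dc (\<sigma> b A)"

lemma finite_cidx' [simp]: "finite (cidx n r)"
  by (simp add: cidx_def)

context
  fixes U assumes U: "sub U"
begin

lemma vf_d: "A \<in> cidx n r \<Longrightarrow> vfield N (fst A) U (vres U (d b A))"
  using vfield_vres[OF vfield_dc[OF \<sigma>_cidx] sub_open[OF U] sub_dom[OF U]] by (simp add: \<sigma>_fst)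

lemma d_coord: "A \<in> cidx n r \<Longrightarrow> B \<in> cidx n r \<Longrightarrow>
   vres U (d b A) U (res U (coord C (\<sigma> b' B))) = (if b = b' \<and> A = B then res U 1 else 0)"
  using vres_dc_coord[OF U \<sigma>_cidx \<sigma>_cidx, of A B b b'] by (simp add: \<sigma>_inj)

text \<open>Only the summand with \<open>B = A\<close> survives. Pairing with a momentum field reads
  off the position component of \<open>X\<close>; \<open>form_dq\<close> does the same for the
  momentum component, so that \<open>\<omega>\<close> can be inverted explicitly.\<close>

lemma form_dp:
  assumes X: "vfield N i U X" and A: "A \<in> cidx n r"
  shows "\<omega> U (vres U (d True A)) X = scl (ksign (fst A) (i \<noteq> fst A)) (X U (res U (q A)))"
proof -
  have s: "res U (X U (res U (q A))) = X U (res U (q A))"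
    by (rule vf_id[OF X sub_open[OF U] subset_refl sect_secs[OF sub_open[OF U] coord_res_sect[OF \<sigma>_cidx[OF A] U]]])
  have "\<omega> U (vres U (d True A)) X = (\<Sum>B\<in>cidx n r. if B = A then scl (ksign (fst A) (i \<noteq> fst A)) (X U (res U (q A))) else 0)"
    unfolding form_local[OF sub_open[OF U] sub_dom[OF U] vf_d[OF A] X]
    by (rule sum.cong[OF refl]) (auto simp: dterm_def d_coord[OF A] res_one_mult s)
  then show ?thesis using A by simp
qed

lemma form_dq:
  assumes X: "vfield N i U X" and A: "A \<in> cidx n r"
  shows "\<omega> U (vres U (d False A)) X = scl (- ksign (fst A) i) (X U (res U (p A)))"
proof -
  have s: "res U (X U (res U (p A))) = X U (res U (p A))"
    by (rule vf_id[OF X sub_open[OF U] subset_refl sect_secs[OF sub_open[OF U] coord_res_sect[OF \<sigma>_cidx[OF A] U]]])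
  have "\<omega> U (vres U (d False A)) X = (\<Sum>B\<in>cidx n r. if B = A then scl (- ksign (fst A) i) (X U (res U (p A))) else 0)"
    unfolding form_local[OF sub_open[OF U] sub_dom[OF U] vf_d[OF A] X]
    by (rule sum.cong[OF refl]) (auto simp: dterm_def d_coord[OF A] res_one_mult s)
  then show ?thesis using A by simp
qed

lemma form_determines:
  assumes X: "vfield N i U X" and X': "vfield N i U X'"
    and e: "\<And>j Y. vfield N j U Y \<Longrightarrow> \<omega> U Y X = \<omega> U Y X'"
  shows "X = X'"
proof (rule vfield_chart_eqI[OF U X X'])
  fix B assume "B \<in> cidx (2 * n) (2 * r)"
  then obtain b A where A: "A \<in> cidx n r" and B: "B = \<sigma> b A" using \<sigma>_surj by blast
  have c: "f = g" if "scl (ksign k l) f = scl (ksign k l) g" for k l and f g :: "'z \<Rightarrow> 's"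
    using that by (cases k; cases l) auto
  have "X U (res U (coord C (\<sigma> b A))) = X' U (res U (coord C (\<sigma> b A)))"
  proof (cases b)
    case True
    have "scl (- ksign (fst A) i) (X U (res U (p A))) = scl (- ksign (fst A) i) (X' U (res U (p A)))"
      using e[OF vf_d[OF A, of False]] form_dq[OF X A] form_dq[OF X' A] by (simp only:)
    then have "scl (ksign (fst A) i) (X U (res U (p A))) = scl (ksign (fst A) i) (X' U (res U (p A)))" by simp
    then show ?thesis using c True by auto
  next
    case False
    have "scl (ksign (fst A) (i \<noteq> fst A)) (X U (res U (q A))) = scl (ksign (fst A) (i \<noteq> fst A)) (X' U (res U (q A)))"
      using e[OF vf_d[OF A, of True]] form_dp[OF X A] form_dp[OF X' A] by (simp only:)
    then show ?thesis using c False by auto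
  qed
  then show "X U (res U (coord C B)) = X' U (res U (coord C B))" unfolding B .
qed

end

text \<open>The components of \<open>X\<close> are dictated by \<open>form_dp\<close> and
  \<open>form_dq\<close>, whose signs are their own inverses. Agreement with \<open>\<eta>\<close>
  on the coordinate fields is enough by \<open>functional_expand\<close>.\<close>

lemma form_surjective:
  assumes U: "sub U" and \<eta>: "one_form N i U \<eta>"
  shows "\<exists>X. vfield N i U X \<and> (\<forall>W j Y. openin (body N) W \<and> W \<subseteq> U \<and> vfield N j W Y \<longrightarrow> \<omega> W Y (vres W X) = \<eta> W Y)"
proof -
  note o = sub_open[OF U]
  note \<eta>' = \<eta>[unfolded one_form_def, rule_format]
  \<comment> \<open>\<open>t\<close> inverts the numbering \<open>\<sigma>\<close>, so that
    components prescribed for positions and momenta become one family over all coordinates.\<close>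
  obtain t where t: "\<And>B. B \<in> cidx (2 * n) (2 * r) \<Longrightarrow> snd (t B) \<in> cidx n r \<and> B = \<sigma> (fst (t B)) (snd (t B))"
  proof -
    have "\<forall>B\<in>cidx (2 * n) (2 * r). \<exists>y. snd y \<in> cidx n r \<and> B = \<sigma> (fst y) (snd y)"
      using \<sigma>_surj by force
    then show ?thesis using that bchoice[of "cidx (2 * n) (2 * r)"] by metis
  qed
  have t\<sigma>: "t (\<sigma> b A) = (b, A)" if A: "A \<in> cidx n r" for b A
  proof -
    have "b = fst (t (\<sigma> b A)) \<and> A = snd (t (\<sigma> b A))"
      using t[OF \<sigma>_cidx[OF A, of b]] \<sigma>_inj[OF A, of "snd (t (\<sigma> b A))" b "fst (t (\<sigma> b A))"] by blast
    then show ?thesis by (simp add: prod_eq_iff)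
  qed
  define G where "G b A = (if b then scl (- ksign (fst A) i) (\<eta> U (vres U (d False A)))
      else scl (ksign (fst A) (i \<noteq> fst A)) (\<eta> U (vres U (d True A))))" for b A
  define g where "g B = G (fst (t B)) (snd (t B))" for B
  have g\<sigma>: "g (\<sigma> b A) = G b A" if "A \<in> cidx n r" for b A
    by (simp add: g_def t\<sigma>[OF that])
  note vf_d = vf_d[OF U]
  have Gs: "G b A \<in> sect N (i \<noteq> fst A) U" if A: "A \<in> cidx n r" for b A
  proof -
    have "\<eta> U (vres U (d b' A)) \<in> sect N (i \<noteq> fst A) U" for b'
      using \<eta>'[OF conjI[OF o conjI[OF subset_refl vf_d[OF A, of b']]]] by blast
    then show ?thesis unfolding G_def by (cases b) (simp_all only: if_True if_False sect_scl[OF o])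
  qed
  have gs: "g B \<in> sect N (i \<noteq> fst B) U" if B: "B \<in> cidx (2 * n) (2 * r)" for B
    using Gs[of "snd (t B)" "fst (t B)"] t[OF B] \<sigma>_fst[of "snd (t B)" "fst (t B)"] by (simp add: g_def)
  define X where "X = (\<Sum>B\<in>cidx (2 * n) (2 * r). vscl (g B) (vres U (dc B)))"
  have X: "vfield N i U X" unfolding X_def by (rule vfield_combination(1)[OF U gs])
  have Xc: "X U (res U (coord C (\<sigma> b A))) = G b A" if A: "A \<in> cidx n r" for b A
    using vfield_combination(2)[OF U gs \<sigma>_cidx[OF A, of b]] g\<sigma>[OF A] by (simp add: X_def)
  have "\<omega> W Y (vres W X) = \<eta> W Y" if W: "openin (body N) W" "W \<subseteq> U" and Y: "vfield N j W Y" for W j Y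
  proof -
    have sW: "sub W" by (rule sub_subset[OF U W])
    have XW: "vfield N i W (vres W X)" by (rule vfield_vres[OF X W])
    have XWc: "vres W X W (res W (coord C (\<sigma> b A))) = res W (G b A)" if A: "A \<in> cidx n r" for b A
      using vf_res[OF X o subset_refl sect_secs[OF o coord_res_sect[OF \<sigma>_cidx[OF A] U]] W, of b] Xc[OF A] W(2)
      by (simp add: vres_apply Int_absorb2)
    have \<eta>r: "\<eta> W (vres W (d b A)) = res W (\<eta> U (vres U (d b A)))" if A: "A \<in> cidx n r" for b A
      using \<eta>'[OF conjI[OF o conjI[OF subset_refl vf_d[OF A, of b]]]] W by (simp add: vres_vres)
    have base: "\<omega> W (vres W (dc B)) (vres W X) = \<eta> W (vres W (dc B))" if B: "B \<in> cidx (2 * n) (2 * r)" for B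
    proof -
      obtain b A where A: "A \<in> cidx n r" and B: "B = \<sigma> b A" using \<sigma>_surj[OF B] by blast
      have "\<omega> W (vres W (d b A)) (vres W X) = \<eta> W (vres W (d b A))"
      proof (cases b)
        case True
        then show ?thesis using form_dp[OF sW XW A] XWc[OF A, of False] \<eta>r[OF A, of True] by (simp add: G_def)
      next
        case False
        then show ?thesis using form_dq[OF sW XW A] XWc[OF A, of True] \<eta>r[OF A, of False] by (simp add: G_def)
      qed
      then show ?thesis unfolding B .
    qed
    have "\<omega> W Y (vres W X) = (\<Sum>B\<in>cidx (2 * n) (2 * r). Y W (res W (coord C B)) * \<omega> W (vres W (dc B)) (vres W X))"
      by (rule functional_expand[where L = "\<lambda>Y. \<omega> W Y (vres W X)", OF sW Y])
        (rule form_add[OF two_form W(1) _ XW] form_vscl[OF two_form W(1) _ XW]; assumption)+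
    also have "\<dots> = (\<Sum>B\<in>cidx (2 * n) (2 * r). Y W (res W (coord C B)) * \<eta> W (vres W (dc B)))"
      by (rule sum.cong[OF refl]) (simp only: base)
    also have "\<dots> = \<eta> W Y"
    proof (rule functional_expand[where L = "\<eta> W", OF sW Y, symmetric])
      show "\<eta> W (A + B) = \<eta> W A + \<eta> W B" if "vfield N j W A" "vfield N j W B" for A B
        using \<eta>'[OF conjI[OF W(1) conjI[OF W(2) that(1)]]] that(2) by (simp add: vadd_eq_plus)
      show "\<eta> W (vscl f Z) = f * \<eta> W Z" if "vfield N i W Z" "f \<in> sect N l W" for f l i Z
        using \<eta>'[OF conjI[OF W(1) conjI[OF W(2) that(1)]]] that(2) by blast
    qed
    finally show ?thesis .
  qed
  then show ?thesis using X by blast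
qed

text \<open>If \<open>X\<close> is the Hamiltonian vector field of \<open>H = \<Sum> \<pi>\<^sup>*(Q(z\<^sup>A)) p\<^sub>A\<close>, then \<open>X\<close> is \<open>\<pi>\<close>-related to \<open>Q\<close>, so
  \<open>X(X(q\<^sub>A)) = 0\<close>. Hence \<open>\<omega>(X, X) = 2 X(H)\<close>, while \<open>\<omega>(X, X) = X(H)\<close> by the choice of \<open>X\<close>.\<close>

lemma hamiltonian_bracket_zero:
  fixes M0 :: "('y, 'h::real_algebra_1) sspace"
  assumes \<pi>: "mor_loc N M0 \<pi>" and b: "schart_loc M0 n r b" and dom: "cdom C = preim N \<pi> (cdom b)"
    and Q: "homological M0 Q"
    and q: "\<And>A. A \<in> cidx n r \<Longrightarrow> q A = pb \<pi> (cdom b) (coord b A)"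
    and H: "H = (\<Sum>A\<in>cidx n r. pb \<pi> (cdom b) (Q (cdom b) (coord b A)) * p A)"
    and X: "vfield N True (cdom C) X"
    and XH: "\<And>j Y. vfield N j (cdom C) Y \<Longrightarrow> \<omega> (cdom C) Y X = Y (cdom C) H"
  shows "X (cdom C) H = 0"
proof -
  interpret b: schart_loc M0 n r b by (rule b)
  interpret \<pi>: mor_loc N M0 \<pi> by (rule \<pi>)
  have Qv: "vfield M0 True (total M0) Q" and QQ: "\<And>W f. openin (body M0) W \<Longrightarrow> f \<in> secs M0 W \<Longrightarrow> Q W (Q W f) = 0"
    using Q by (auto simp: homological_def)
  let ?D = "cdom C" and ?B = "cdom b"
  note Bs = b.cdom_open openin_subset[OF b.cdom_open]
  note Ds = cdom_open subset_refl
  have pure: "coord C (\<sigma> False (False, a)) = pull C ?D (\<lambda>v. v (snd (\<sigma> False (False, a))))" if "a < n" for a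
    using \<sigma>_fst[of "(False, a)" False] that by (simp add: coord_def cidx_def)
  interpret F: chart_mor N M0 \<pi> n r b "2 * n" "2 * r" C ?D "\<lambda>a v. v (snd (\<sigma> False (False, a)))"
  proof unfold_locales
    show "sub ?D" by simp
    show "?D \<subseteq> \<pi>.pre ?B" using dom by simp
    show "smooth_fun (2 * n) (img ?D) (\<lambda>v. v (snd (\<sigma> False (False, a))))" for a
      by (rule smooth_coord_img) simp
    show "res ?D (pb \<pi> ?B (coord b (False, a))) = pull C ?D (\<lambda>v. v (snd (\<sigma> False (False, a))))" if "a < n" for a
      using pure[OF that] q[of "(False, a)"] that secs_id[OF cdom_open coord_secs[OF \<sigma>_cidx[of "(False, a)" False]]]
      by (simp add: cidx_def)
  qed
  have qD: "res ?D (q A) = q A" and pD: "res ?D (p A) = p A" if "A \<in> cidx n r" for A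
    by (rule secs_id[OF cdom_open coord_secs[OF \<sigma>_cidx[OF that]]])+
  have pbD: "res ?D (pb \<pi> ?B f) = pb \<pi> ?B f" if "f \<in> secs M0 ?B" for f
    unfolding dom by (rule \<pi>.pb_id[OF b.cdom_open that])
  \<comment> \<open>On functions pulled back along \<open>\<pi>\<close> a field acts through its
    values on positions; in particular the momentum fields kill them.\<close>
  have chain: "Y ?D (pb \<pi> ?B f) = (\<Sum>A\<in>cidx n r. Y ?D (q A) * pb \<pi> ?B (b.dc A ?B f))"
    if Y: "vfield N i ?D Y" and f: "f \<in> secs M0 ?B" for i Y f
  proof -
    have "(\<Sum>A\<in>cidx n r. res ?D (Y ?D (res ?D (pb \<pi> ?B (coord b A)))) * res ?D (pb \<pi> ?B (b.dc A ?B f))) =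
        (\<Sum>A\<in>cidx n r. Y ?D (q A) * pb \<pi> ?B (b.dc A ?B f))"
    proof (rule sum.cong[OF refl])
      fix A assume A: "A \<in> cidx n r"
      have "res ?D (Y ?D (q A)) = Y ?D (q A)"
        by (rule vf_id[OF Y Ds coord_secs[OF \<sigma>_cidx[OF A]]])
      then show "res ?D (Y ?D (res ?D (pb \<pi> ?B (coord b A)))) * res ?D (pb \<pi> ?B (b.dc A ?B f)) =
          Y ?D (q A) * pb \<pi> ?B (b.dc A ?B f)"
        unfolding q[OF A, symmetric] qD[OF A] pbD[OF b.dc_secs[OF A b.sub_cdom f]] by simp
    qed
    then show ?thesis using F.chain_rule[OF Y b.sub_cdom f] by (simp add: F.Vp_cdom pbD[OF f])
  qed
  let ?Q = "\<lambda>A. Q ?B (coord b A)"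
  have Qs: "?Q A \<in> sect M0 (True \<noteq> fst A) ?B" if "A \<in> cidx n r" for A
    by (rule b.vf_sect[OF Qv Bs b.coord_sect[OF that]])
  have pQ: "pb \<pi> ?B (?Q A) \<in> sect N (True \<noteq> fst A) ?D" if "A \<in> cidx n r" for A
    unfolding dom by (rule \<pi>.pb_sect[OF b.cdom_open Qs[OF that]])
  have pQs: "pb \<pi> ?B (?Q A) \<in> secs N ?D" if "A \<in> cidx n r" for A
    by (rule sect_secs[OF cdom_open pQ[OF that]])
  have ps: "p A \<in> secs N ?D" if "A \<in> cidx n r" for A
    by (rule coord_secs[OF \<sigma>_cidx[OF that]])
  have YH: "Y ?D H = (\<Sum>A\<in>cidx n r. Y ?D (pb \<pi> ?B (?Q A)) * p A +
      scl (ksign i (True \<noteq> fst A)) (pb \<pi> ?B (?Q A) * Y ?D (p A)))" if Y: "vfield N i ?D Y" for i Y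
  proof -
    have "Y ?D H = (\<Sum>A\<in>cidx n r. Y ?D (pb \<pi> ?B (?Q A) * p A))"
      unfolding H by (rule vf_sum[OF Y Ds secs_mult[OF cdom_open pQs ps]])
    also have "\<dots> = (\<Sum>A\<in>cidx n r. Y ?D (pb \<pi> ?B (?Q A)) * p A +
      scl (ksign i (True \<noteq> fst A)) (pb \<pi> ?B (?Q A) * Y ?D (p A)))"
      by (rule sum.cong[OF refl vf_leib[OF Y Ds pQ ps]])
    finally show ?thesis .
  qed
  have ds: "d b' A ?D (coord C (\<sigma> b'' B)) = (if b' = b'' \<and> A = B then res ?D 1 else 0)"
    if "A \<in> cidx n r" "B \<in> cidx n r" for A B b' b''
    using dc_coord[OF \<sigma>_cidx[OF that(1)] \<sigma>_cidx[OF that(2)], of b' b''] by (simp add: \<sigma>_inj that)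
  have vd: "vfield N (fst A) ?D (d b' A)" if "A \<in> cidx n r" for A b'
    using vfield_dc[OF \<sigma>_cidx[OF that], of b'] \<sigma>_fst[OF that] by simp
  have Xq: "X ?D (q A) = pb \<pi> ?B (?Q A)" if A: "A \<in> cidx n r" for A
  proof -
    \<comment> \<open>Of a parity and its opposite only one is odd, so the sign in
      \<open>form_dp\<close> disappears.\<close>
    have k: "ksign (fst A) (True \<noteq> fst A) = 1" by (cases "fst A") auto
    have "d True A ?D (pb \<pi> ?B (?Q B)) = 0" if B: "B \<in> cidx n r" for B
      unfolding chain[OF vd[OF A] b.sect_secs[OF b.cdom_open Qs[OF B]]]
      by (rule sum.neutral) (simp add: ds[OF A])
    then have "d True A ?D H = (\<Sum>B\<in>cidx n r. if B = A then pb \<pi> ?B (?Q A) else 0)"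
      unfolding YH[OF vd[OF A]]
      by (intro sum.cong refl) (use k secs_id[OF cdom_open pQs[OF A]] in \<open>auto simp: ds[OF A] res_one_mult\<close>)
    also have "\<dots> = pb \<pi> ?B (?Q A)" using A by simp
    finally have 1: "d True A ?D H = pb \<pi> ?B (?Q A)" .
    have "\<omega> ?D (vres ?D (d True A)) X = X ?D (res ?D (q A))"
      using form_dp[OF sub_cdom X A] k by simp
    then show ?thesis using XH[OF vd[OF A, of True]] 1 by (simp add: vres_id[OF vd[OF A]] qD[OF A])
  qed
  have XXq: "X ?D (pb \<pi> ?B (?Q A)) = 0" if A: "A \<in> cidx n r" for A
  proof -
    note f = b.sect_secs[OF b.cdom_open Qs[OF A]]
    have QB: "vfield M0 True ?B (vres ?B Q)" by (rule b.vfield_vres[OF Qv Bs])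
    have Qc: "Q ?B (res ?B (coord b B)) = ?Q B" if "B \<in> cidx n r" for B
      using b.secs_id[OF b.cdom_open b.coord_secs[OF that]] by simp
    have "Q ?B (?Q A) = vres ?B Q ?B (?Q A)" by (simp add: vres_apply)
    also have "\<dots> = (\<Sum>B\<in>cidx n r. vscl (vres ?B Q ?B (res ?B (coord b B))) (vres ?B (b.dc B))) ?B (?Q A)"
      using b.vfield_decomposition[OF b.sub_cdom QB] by (rule arg_cong[where f = "\<lambda>X. X ?B (?Q A)"])
    also have "\<dots> = (\<Sum>B\<in>cidx n r. ?Q B * b.dc B ?B (?Q A))"
      unfolding b.sum_vfield_apply by (rule sum.cong[OF refl]) (simp add: b.vscl_apply Qc vres_apply)
    finally have e: "(\<Sum>B\<in>cidx n r. ?Q B * b.dc B ?B (?Q A)) = 0"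
      using QQ[OF b.cdom_open b.coord_secs[OF A]] by simp
    have m: "pb \<pi> ?B (?Q B * b.dc B ?B (?Q A)) = pb \<pi> ?B (?Q B) * pb \<pi> ?B (b.dc B ?B (?Q A))" if B: "B \<in> cidx n r" for B
      by (rule \<pi>.pb_mult[OF b.cdom_open b.sect_secs[OF b.cdom_open Qs[OF B]] b.dc_secs[OF B b.sub_cdom f]])
    have "X ?D (pb \<pi> ?B (?Q A)) = (\<Sum>B\<in>cidx n r. pb \<pi> ?B (?Q B * b.dc B ?B (?Q A)))"
      unfolding chain[OF X f] by (rule sum.cong[OF refl]) (simp only: Xq m)
    also have "\<dots> = pb \<pi> ?B (\<Sum>B\<in>cidx n r. ?Q B * b.dc B ?B (?Q A))"
      by (rule \<pi>.pb_sum[OF b.cdom_open, symmetric])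
        (rule b.secs_mult[OF b.cdom_open b.sect_secs[OF b.cdom_open Qs] b.dc_secs[OF _ b.sub_cdom f]])
    also have "\<dots> = 0" unfolding e by (rule \<pi>.pb_zero[OF b.cdom_open])
    finally show ?thesis .
  qed
  have 1: "X ?D H = (\<Sum>A\<in>cidx n r. scl (ksign True (True \<noteq> fst A)) (pb \<pi> ?B (?Q A) * X ?D (p A)))"
    unfolding YH[OF X] by (rule sum.cong[OF refl]) (simp add: XXq)
  \<comment> \<open>As \<open>X\<close> is odd, the two halves of \<open>dterm\<close> coincide, and
    each summand of \<open>X ?D H\<close> appears twice.\<close>
  have "\<omega> ?D X X = (\<Sum>A\<in>cidx n r. scl (ksign True (True \<noteq> fst A)) (pb \<pi> ?B (?Q A) * X ?D (p A)) +
      scl (ksign True (True \<noteq> fst A)) (pb \<pi> ?B (?Q A) * X ?D (p A)))"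
    unfolding form_local[OF Ds X X]
    by (rule sum.cong[OF refl]) (simp add: dterm_def Xq qD pD)
  then have "\<omega> ?D X X = X ?D H + X ?D H" unfolding 1 sum.distrib .
  then show ?thesis using XH[OF X] by simp
qed

lemma darboux_swap: "darboux N n r C \<omega> (\<lambda>b A. \<sigma> (b \<noteq> fst A) A)"
proof unfold_locales
  show "even_two_form N \<omega>" by (rule two_form)
  fix A B b b' assume A: "A \<in> cidx n r"
  show "\<sigma> (b \<noteq> fst A) A \<in> cidx (2 * n) (2 * r)" "fst (\<sigma> (b \<noteq> fst A) A) = fst A"
    using \<sigma>_cidx[OF A] \<sigma>_fst[OF A] by auto
  show "B \<in> cidx n r \<Longrightarrow> (\<sigma> (b \<noteq> fst A) A = \<sigma> (b' \<noteq> fst B) B) = (b = b' \<and> A = B)"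
    using \<sigma>_inj[OF A] by auto
next
  fix B assume "B \<in> cidx (2 * n) (2 * r)"
  then obtain b A where "A \<in> cidx n r" "B = \<sigma> b A" using \<sigma>_surj by blast
  then have "B = \<sigma> ((b \<noteq> fst A) \<noteq> fst A) A" by (cases "fst A") auto
  then show "\<exists>b. \<exists>A\<in>cidx n r. B = \<sigma> (b \<noteq> fst A) A" using \<open>A \<in> cidx n r\<close> by blast
next
  fix U i j X Y
  assume U: "openin (body N) U" "U \<subseteq> cdom C" and X: "vfield N i U X" and Y: "vfield N j U Y"
  have sU: "sub U" using U by (simp add: sub_def)
  note Us = U(1) subset_refl
  show "\<omega> U X Y = (\<Sum>A\<in>cidx n r. dterm (fst A) i j U X Y (coord C (\<sigma> (False \<noteq> fst A) A)) (coord C (\<sigma> (True \<noteq> fst A) A)))"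
    unfolding form_local[OF U X Y]
  proof (rule sum.cong[OF refl])
    fix A assume A: "A \<in> cidx n r"
    let ?q = "res U (q A)" and ?p = "res U (p A)"
    have s: "?q \<in> sect N (fst A) U" "?p \<in> sect N (fst A) U"
      using coord_res_sect[OF \<sigma>_cidx[OF A] sU] \<sigma>_fst[OF A] by auto
    \<comment> \<open>Reordering these products produces the signs that, for an odd index, turn
      \<open>dterm\<close> with position and momentum exchanged back into itself.\<close>
    have 1: "X U ?p * Y U ?q = scl (ksign (i \<noteq> fst A) (j \<noteq> fst A)) (Y U ?q * X U ?p)"
      by (rule sect_commute[OF U(1) vf_sect[OF X Us s(2)] vf_sect[OF Y Us s(1)]])
    have 2: "Y U ?p * X U ?q = scl (ksign (j \<noteq> fst A) (i \<noteq> fst A)) (X U ?q * Y U ?p)"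
      by (rule sect_commute[OF U(1) vf_sect[OF Y Us s(2)] vf_sect[OF X Us s(1)]])
    show "dterm (fst A) i j U X Y (q A) (p A) =
        dterm (fst A) i j U X Y (coord C (\<sigma> (False \<noteq> fst A) A)) (coord C (\<sigma> (True \<noteq> fst A) A))"
    proof (cases "fst A")
      case True
      then show ?thesis using 1 2 by (cases i; cases j) (simp_all add: dterm_def)
    qed simp
  qed
qed

end

section \<open>Hamiltonian vector fields\<close>

context ssheaf
begin

lemma one_form_subset:
  assumes "one_form M i U \<eta>" "V \<subseteq> U"
  shows "one_form M i V \<eta>"
  unfolding one_form_def
  by (intro allI impI, rule assms(1)[unfolded one_form_def, THEN spec, THEN spec, THEN spec, THEN mp])
    (use assms(2) in blast)

text \<open>Solutions exist on Darboux domains, and on open subsets of such a domain restrictions of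
  solutions coincide; hence they glue.\<close>

lemma nondegenerate_local:
  assumes w: "even_two_form M \<omega>"
    and cov: "\<And>x. x \<in> total M \<Longrightarrow> \<exists>C \<sigma>. darboux M n r C \<omega> \<sigma> \<and> x \<in> cdom C"
  shows "nondegenerate M \<omega>"
  unfolding nondegenerate_def
proof (intro allI impI, elim conjE)
  fix U i \<eta> assume U: "openin (body M) U" and \<eta>: "one_form M i U \<eta>"
  let ?P = "\<lambda>V X. vfield M i V X \<and> (\<forall>W j Y. openin (body M) W \<and> W \<subseteq> V \<and> vfield M j W Y \<longrightarrow> \<omega> W Y (vres W X) = \<eta> W Y)"
  have "\<exists>C \<sigma>. darboux M n r C \<omega> \<sigma> \<and> x \<in> cdom C" if "x \<in> U" for x
    using cov[of x] openin_subset[OF U] that by blast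
  then obtain C \<sigma> where C: "\<And>x. x \<in> U \<Longrightarrow> darboux M n r (C x) \<omega> (\<sigma> x)" "\<And>x. x \<in> U \<Longrightarrow> x \<in> cdom (C x)"
    by metis
  have cd: "openin (body M) (cdom (C x))" if "x \<in> U" for x
  proof -
    interpret darboux M n r "C x" \<omega> "\<sigma> x" by (rule C(1)[OF that])
    show ?thesis by simp
  qed
  let ?V = "\<lambda>x. U \<inter> cdom (C x)"
  have V: "openin (body M) (?V x)" "x \<in> ?V x" "?V x \<subseteq> U" if "x \<in> U" for x
    using cd[OF that] C(2)[OF that] U that by auto
  \<comment> \<open>Stated for restrictions of solutions over arbitrary \<open>T\<close> and
    \<open>T'\<close>, since it serves both the compatibility of the local solutions and the
    uniqueness of the global one.\<close>
  have uniq: "vres V X = vres V X'" if x: "x \<in> U" and V': "openin (body M) V" "V \<subseteq> ?V x"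
    and VT: "V \<subseteq> T" "?P T X" and VT': "V \<subseteq> T'" "?P T' X'" and T: "openin (body M) T" "openin (body M) T'" for x V X X' T T'
  proof -
    interpret D: darboux M n r "C x" \<omega> "\<sigma> x" by (rule C(1)[OF x])
    have s: "D.sub V" using V' by (simp add: D.sub_def)
    show ?thesis
    proof (rule D.form_determines[OF s])
      show "vfield M i V (vres V X)" by (rule vfield_vres[OF conjunct1[OF VT(2)] V'(1) VT(1)])
      show "vfield M i V (vres V X')" by (rule vfield_vres[OF conjunct1[OF VT'(2)] V'(1) VT'(1)])
      show "\<omega> V Y (vres V X) = \<omega> V Y (vres V X')" if Y: "vfield M j V Y" for j Y
        using conjunct2[OF VT(2), rule_format, OF conjI[OF V'(1) conjI[OF VT(1) Y]]]
          conjunct2[OF VT'(2), rule_format, OF conjI[OF V'(1) conjI[OF VT'(1) Y]]] by simp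
    qed
  qed
  have "\<exists>X. ?P (?V x) X" if x: "x \<in> U" for x
  proof -
    interpret D: darboux M n r "C x" \<omega> "\<sigma> x" by (rule C(1)[OF x])
    have s: "D.sub (?V x)" using V[OF x] by (auto simp: D.sub_def)
    have "one_form M i (?V x) \<eta>" by (rule one_form_subset[OF \<eta> V(3)[OF x]])
    from D.form_surjective[OF s this] show ?thesis .
  qed
  then obtain X where X: "\<And>x. x \<in> U \<Longrightarrow> ?P (?V x) (X x)" by metis
  have "\<exists>Y. vfield M i U Y \<and> (\<forall>x\<in>U. vres (?V x) Y = X x)"
  proof (rule vfield_glue[OF U])
    show "openin (body M) (?V x) \<and> x \<in> ?V x \<and> ?V x \<subseteq> U \<and> vfield M i (?V x) (X x)" if "x \<in> U" for x
      using V[OF that] X[OF that] by blast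
    show "vres (?V x \<inter> ?V y) (X x) = vres (?V x \<inter> ?V y) (X y)" if "x \<in> U" "y \<in> U" for x y
      by (rule uniq[OF that(1) _ _ _ X[OF that(1)] _ X[OF that(2)]]) (use V(1)[OF that(1)] V(1)[OF that(2)] in auto)
  qed
  then obtain Z where Z: "vfield M i U Z" "\<And>x. x \<in> U \<Longrightarrow> vres (?V x) Z = X x" by blast
  have PZ: "?P U Z"
  proof (intro conjI allI impI Z(1), elim conjE)
    fix W j Y assume W: "openin (body M) W" "W \<subseteq> U" and Y: "vfield M j W Y"
    have ZW: "vfield M i W (vres W Z)" by (rule vfield_vres[OF Z(1) W])
    note e = \<eta>[unfolded one_form_def, rule_format, OF conjI[OF W(1) conjI[OF W(2) Y]]]
    show "\<omega> W Y (vres W Z) = \<eta> W Y"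
    proof
      fix x
      show "\<omega> W Y (vres W Z) x = \<eta> W Y x"
      proof (cases "x \<in> W")
        case True
        then have x: "x \<in> U" using W by auto
        let ?T = "W \<inter> ?V x"
        have T: "openin (body M) ?T" "?T \<subseteq> W" "?T \<subseteq> ?V x" using W V(1)[OF x] by auto
        have YT: "vfield M j ?T (vres ?T Y)" by (rule vfield_vres[OF Y T(1,2)])
        have "vres ?T (vres W Z) = vres ?T (vres (?V x) Z)" by (simp only: vres_vres[OF T(2)] vres_vres[OF T(3)])
        also have "\<dots> = vres ?T (X x)" using Z(2)[OF x] by simp
        finally have 0: "vres ?T (vres W Z) = vres ?T (X x)" .
        have "res ?T (\<omega> W Y (vres W Z)) = \<omega> ?T (vres ?T Y) (vres ?T (vres W Z))"
          by (rule form_res[OF w W(1) Y ZW T(1,2), symmetric])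
        also have "\<dots> = \<omega> ?T (vres ?T Y) (vres ?T (X x))" unfolding 0 ..
        also have "\<dots> = \<eta> ?T (vres ?T Y)" using X[OF x] T YT by blast
        also have "\<dots> = res ?T (\<eta> W Y)" using e T by blast
        finally show ?thesis using True V(2)[OF x] by (blast dest: res_eqD)
      next
        case False
        have "\<omega> W Y (vres W Z) \<in> sect M (j \<noteq> i) W" by (rule form_sect[OF w W(1) Y ZW])
        moreover have "\<eta> W Y \<in> sect M (i \<noteq> j) W" using e by blast
        ultimately show ?thesis using sect_id[OF W(1)] False by (metis res_apply)
      qed
    qed
  qed
  have un: "Z' = Z" if Z': "?P U Z'" for Z'
  proof (rule vfield_local_eqI[OF conjunct1[OF Z'] Z(1) U])
    fix x assume x: "x \<in> U"
    have "vres (?V x) Z' = vres (?V x) Z"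
      by (rule uniq[OF x V(1)[OF x] subset_refl V(3)[OF x] Z' V(3)[OF x] PZ U U])
    then show "\<exists>V. openin (body M) V \<and> x \<in> V \<and> vres (U \<inter> V) Z' = vres (U \<inter> V) Z"
      using cd[OF x] C(2)[OF x] by blast
  qed
  show "\<exists>!X. ?P U X" by (rule ex1I[where P = "?P U", OF PZ un])
qed

text \<open>The differential of \<open>f\<close> is a one-form, so nondegeneracy supplies the field.
  The description in \<open>ham_vf\<close> leaves the parity open, which is ambiguous for
  \<open>f = 0\<close> only.\<close>

lemma ham_vf_props:
  assumes w: "even_two_form M \<omega>" and nd: "nondegenerate M \<omega>" and f: "f \<in> sect M i (total M)"
  shows "vfield M i (total M) (ham_vf M \<omega> f)"
    and "openin (body M) W \<Longrightarrow> vfield M j W Y \<Longrightarrow> \<omega> W Y (vres W (ham_vf M \<omega> f)) = Y W (res W f)"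
proof -
  let ?T = "total M"
  have T: "openin (body M) ?T" by simp
  let ?P = "\<lambda>i X. vfield M i ?T X \<and> (\<forall>W j Y. openin (body M) W \<and> vfield M j W Y \<longrightarrow> \<omega> W Y (vres W X) = Y W (res W f))"
  have ex1: "\<exists>!X. ?P i X" if f: "f \<in> sect M i ?T" for i
  proof -
    have "one_form M i ?T (\<lambda>W Y. Y W (res W f))"
      unfolding one_form_def
    proof (intro allI impI, elim conjE)
      fix W j Y assume W: "openin (body M) W" and WT: "W \<subseteq> ?T" and Y: "vfield M j W Y"
      have fW: "res W f \<in> sect M i W" by (rule sect_res[OF T f W WT])
      have 1: "Y W (res W f) \<in> sect M (i \<noteq> j) W"
        using vf_sect[OF Y W subset_refl fW] by (simp add: eq_commute)
      have 2: "vres W' Y W' (res W' f) = res W' (Y W (res W f))" if "openin (body M) W'" "W' \<subseteq> W" for W'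
        using vf_res[OF Y W subset_refl sect_secs[OF W fW] that] that(2) by (simp add: vres_apply Int_absorb2)
      show "Y W (res W f) \<in> sect M (i \<noteq> j) W \<and>
          (\<forall>Ya. vfield M j W Ya \<longrightarrow> vadd Y Ya W (res W f) = Y W (res W f) + Ya W (res W f)) \<and>
          (\<forall>l. \<forall>fa\<in>sect M l W. vscl fa Y W (res W f) = fa * Y W (res W f)) \<and>
          (\<forall>W'. openin (body M) W' \<and> W' \<subseteq> W \<longrightarrow> vres W' Y W' (res W' f) = res W' (Y W (res W f)))"
        using 1 2 by (simp add: vadd_def vscl_apply)
    qed
    note 1 = nd[unfolded nondegenerate_def, rule_format, OF conjI[OF T this]]
    have eq: "(openin (body M) W \<and> W \<subseteq> ?T \<and> Z) = (openin (body M) W \<and> Z)" for W Z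
      using openin_subset[of "body M" W] by blast
    show ?thesis using 1 unfolding eq .
  qed
  define P where "P k X \<longleftrightarrow> ?P k X" for k X
  have ex1P: "\<exists>!X. P k X" if "f \<in> sect M k ?T" for k
    unfolding P_def by (rule ex1[OF that])
  have uniq: "X = Y" if "f \<in> sect M k ?T" "P k X" "P k Y" for k X Y
    using ex1P[OF that(1)] that(2,3) by blast
  obtain X where XP: "P i X" using ex1P[OF f] by blast
  note X = XP[unfolded P_def]
  have "ham_vf M \<omega> f = X"
    unfolding ham_vf_def
  proof (rule the_equality)
    show "(\<exists>i. f \<in> sect M i ?T \<and> vfield M i ?T X) \<and>
        (\<forall>W j Y. openin (body M) W \<and> vfield M j W Y \<longrightarrow> \<omega> W Y (vres W X) = Y W (res W f))"
      using X f by blast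
    fix X' assume X': "(\<exists>i. f \<in> sect M i ?T \<and> vfield M i ?T X') \<and>
        (\<forall>W j Y. openin (body M) W \<and> vfield M j W Y \<longrightarrow> \<omega> W Y (vres W X') = Y W (res W f))"
    then obtain i' where i': "f \<in> sect M i' ?T" "P i' X'" unfolding P_def by auto
    show "X' = X"
    proof (cases "i' = i")
      case True
      show ?thesis by (rule uniq[OF f i'(2)[unfolded True] XP])
    next
      case False
      \<comment> \<open>A section of both parities is 0, and then the zero field meets the condition
        for either parity.\<close>
      have "f = 0" using sect_int[OF T, of f] f i'(1) False by (cases i; cases i') auto
      have v0: "vres W (0 :: ('x, 'g) svf) = 0" for W by (auto simp: vres_def fun_eq_iff)
      have P0: "P k 0" for k
        unfolding P_def using vfield_0[of k ?T] form_zero_right[OF w] vf_at_zero by (auto simp: v0 \<open>f = 0\<close>)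
      have "X = 0" by (rule uniq[OF f XP P0])
      moreover have "X' = 0" by (rule uniq[OF i'(1,2) P0])
      ultimately show ?thesis by simp
    qed
  qed
  then show "vfield M i ?T (ham_vf M \<omega> f)"
    "openin (body M) W \<Longrightarrow> vfield M j W Y \<Longrightarrow> \<omega> W Y (vres W (ham_vf M \<omega> f)) = Y W (res W f)"
    using X by simp_all
qed

text \<open>On the Hamiltonian fields of odd functions the form is symmetric, hence so is the
  bracket. Additivity in the second argument thus gives additivity in the first, and both mixed
  brackets vanish.\<close>

lemma poisson_sum_zero:
  assumes w: "even_two_form M \<omega>" and nd: "nondegenerate M \<omega>"
    and f: "f \<in> sect M True (total M)" and g: "g \<in> sect M True (total M)"
    and ff: "poisson M \<omega> f f = 0" and gg: "poisson M \<omega> g g = 0" and fg: "poisson M \<omega> f g = 0"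
  shows "poisson M \<omega> (f + g) (f + g) = 0"
proof -
  let ?T = "total M"
  have T: "openin (body M) ?T" by simp
  note Ts = T subset_refl
  let ?X = "ham_vf M \<omega>"
  have fg': "f + g \<in> sect M True ?T" by (rule sect_add[OF T f g])
  note vf = ham_vf_props(1)[OF w nd f] and vg = ham_vf_props(1)[OF w nd g] and vfg = ham_vf_props(1)[OF w nd fg']
  have tot: "\<omega> ?T Y (?X h) = Y ?T h" if "h \<in> sect M True ?T" "vfield M j ?T Y" for h j Y
    using ham_vf_props(2)[OF w nd that(1) T that(2)] vres_id[OF ham_vf_props(1)[OF w nd that(1)]] sect_id[OF T that(1)]
    by simp
  have fs: "f \<in> secs M ?T" "g \<in> secs M ?T" using sect_secs[OF T] f g by auto
  have "\<omega> ?T (?X g) (?X f) = scl (- ksign True True) (\<omega> ?T (?X f) (?X g))"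
    by (rule form_anti[OF w T vf vg])
  then have gf: "?X g ?T f = 0"
    using tot[OF f vg] tot[OF g vf] fg by (simp add: poisson_def)
  have "?X (f + g) ?T (f + g) = \<omega> ?T (?X (f + g)) (?X (f + g))" by (rule tot[OF fg' vfg, symmetric])
  have "?X (f + g) ?T h = ?X f ?T h + ?X g ?T h" if h: "h \<in> sect M True ?T" for h
  proof -
    have anti: "\<omega> ?T (?X a) (?X b) = \<omega> ?T (?X b) (?X a)" if "a \<in> sect M True ?T" "b \<in> sect M True ?T" for a b
      using form_anti[OF w T ham_vf_props(1)[OF w nd that(2)] ham_vf_props(1)[OF w nd that(1)]] by simp
    have "?X (f + g) ?T h = \<omega> ?T (?X h) (?X (f + g))"
      using tot[OF h vfg] anti[OF fg' h] by simp
    also have "\<dots> = ?X h ?T (f + g)" by (rule tot[OF fg' ham_vf_props(1)[OF w nd h]])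
    also have "\<dots> = ?X h ?T f + ?X h ?T g" by (rule vf_add[OF ham_vf_props(1)[OF w nd h] Ts fs])
    also have "\<dots> = ?X f ?T h + ?X g ?T h"
      using tot[OF f ham_vf_props(1)[OF w nd h]] tot[OF g ham_vf_props(1)[OF w nd h]]
        tot[OF h vf] tot[OF h vg] anti[OF f h] anti[OF g h] by simp
    finally show ?thesis .
  qed
  then have "?X (f + g) ?T f = 0" "?X (f + g) ?T g = 0"
    using f g ff gg fg gf by (simp_all add: poisson_def)
  then show ?thesis
    unfolding poisson_def vf_add[OF vfg Ts fs] by simp
qed

end

section \<open>The canonical form is symplectic\<close>

context cotan
begin

lemma even_two_form_canonical: "even_two_form N (canonical_form n r M K)"
  unfolding canonical_form_def by (rule NS.even_two_form_ext_d[OF one_form_liouville])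

lemma cot_chart_coord:
  assumes "cot_chart n r M K c C" "A \<in> cidx n r"
  shows "coord C A = pos K c A" "coord C (msh n r A) = mom n r M K c A"
  using assms by (auto simp: cot_chart_def cidx_def msh_def)

lemma darboux_canonical:
  assumes c: "chart n r M c" and C: "cot_chart n r M K c C"
  shows "darboux N n r C (canonical_form n r M K) (\<lambda>b A. if b then msh n r A else A)"
proof -
  have ch: "chart (2 * n) (2 * r) N C" and d: "cdom C = cpre K (cdom c)"
    using C by (auto simp: cot_chart_def)
  interpret C: schart_loc N "2 * n" "2 * r" C by unfold_locales (rule ch)
  show ?thesis
  proof unfold_locales
    show "even_two_form N (canonical_form n r M K)" by (rule even_two_form_canonical)
    show "(if b then msh n r A else A) \<in> cidx (2 * n) (2 * r)" if "A \<in> cidx n r" for A b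
      using that cidx_subset msh_cidx by auto
    show "fst (if b then msh n r A else A) = fst A" for A b by simp
    show "((if b then msh n r A else A) = (if b' then msh n r B else B)) = (b = b' \<and> A = B)"
      if "A \<in> cidx n r" "B \<in> cidx n r" for A B b b'
      using that by (auto simp: cidx_def msh_def prod_eq_iff split: if_splits)
    show "\<exists>b. \<exists>A\<in>cidx n r. B = (if b then msh n r A else A)" if B: "B \<in> cidx (2 * n) (2 * r)" for B
    proof (cases "B \<in> cidx n r")
      case True
      then show ?thesis by (intro exI[of _ False]) auto
    next
      case False
      let ?A = "(fst B, snd B - (if fst B then r else n))"
      have "?A \<in> cidx n r" "B = msh n r ?A"
        using B False by (auto simp: cidx_def msh_def prod_eq_iff)
      then show ?thesis by (intro exI[of _ True]) auto
    qed
    fix U i j X Y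
    assume U: "openin (body N) U" "U \<subseteq> cdom C" and X: "vfield N i U X" and Y: "vfield N j U Y"
    show "canonical_form n r M K U X Y = (\<Sum>A\<in>cidx n r. dterm (fst A) i j U X Y
        (coord C (if False then msh n r A else A)) (coord C (if True then msh n r A else A)))"
      unfolding canonical_form_local[OF c U(1) U(2)[unfolded d] X Y]
      by (rule sum.cong[OF refl]) (simp add: cot_chart_coord[OF C])
  qed
qed

lemma ex_darboux: "z \<in> total N \<Longrightarrow> \<exists>C \<sigma>. darboux N n r C (canonical_form n r M K) \<sigma> \<and> z \<in> cdom C"
proof -
  assume z: "z \<in> total N"
  obtain c where c: "chart n r M c" "bodymap (cpr K) z \<in> cdom c" using ex_chart[OF P.bodymap_total[OF z]] by blast
  obtain C where C: "cot_chart n r M K c C" using ex_cot_chart[OF c(1)] by blast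
  have "z \<in> cdom C" using C z c(2) by (auto simp: cot_chart_def preim_def)
  then show ?thesis using darboux_canonical[OF c(1) C] by blast
qed

lemma even_symplectic_canonical: "even_symplectic N (canonical_form n r M K)"
  unfolding even_symplectic_def
  using even_two_form_canonical NS.nondegenerate_local[OF even_two_form_canonical ex_darboux]
    NS.closed_form_ext_d[OF one_form_liouville] by (simp add: canonical_form_def)

end

section \<open>Homogeneity structures\<close>

lemma preim_mcomp: "is_mor M N \<phi> \<Longrightarrow> preim M (mcomp N \<psi> \<phi>) W = preim M \<phi> (preim N \<psi> W)"
  by (auto simp: preim_def mcomp_def is_mor_def continuous_map_def)

lemma pb_mcomp: "pb (mcomp N \<psi> \<phi>) W f = pb \<phi> (preim N \<psi> W) (pb \<psi> W f)"
  and bodymap_mcomp: "bodymap (mcomp N \<psi> \<phi>) x = bodymap \<psi> (bodymap \<phi> x)"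
  by (simp_all add: mcomp_def)

lemma is_mor_mcomp:
  assumes "superalgebra_sheaf M" "superalgebra_sheaf N" "superalgebra_sheaf L"
    and \<phi>: "is_mor M N \<phi>" and \<psi>: "is_mor N L \<psi>"
  shows "is_mor M L (mcomp N \<psi> \<phi>)"
proof -
  interpret F: mor_loc M N \<phi> using assms by unfold_locales
  interpret G: mor_loc N L \<psi> using assms by unfold_locales
  have cm: "continuous_map (body M) (body L) (bodymap \<psi> \<circ> bodymap \<phi>)"
    by (rule continuous_map_compose[OF \<phi>[unfolded is_mor_def, THEN conjunct1] \<psi>[unfolded is_mor_def, THEN conjunct1]])
  show ?thesis
    unfolding is_mor_def preim_mcomp[OF \<phi>] pb_mcomp
  proof (intro conjI allI impI ballI)
    show "continuous_map (body M) (body L) (bodymap (mcomp N \<psi> \<phi>))"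
      using cm by (simp add: mcomp_def)
    fix W assume W: "openin (body L) W"
    note o = G.pre_open[OF W]
    show "pb \<phi> (G.pre W) (pb \<psi> W (res W 1)) = res (F.pre (G.pre W)) 1"
      unfolding G.pb_one[OF W] by (rule F.pb_one[OF o])
    show "pb \<phi> (G.pre W) (pb \<psi> W f) \<in> sect M i (F.pre (G.pre W))" if "f \<in> sect L i W" for i f
      by (rule F.pb_sect[OF o G.pb_sect[OF W that]])
    fix f assume f: "f \<in> secs L W"
    note s = G.pb_secs[OF W f]
    show "pb \<phi> (G.pre W) (pb \<psi> W (scl a f)) = scl a (pb \<phi> (G.pre W) (pb \<psi> W f))" for a
      unfolding G.pb_scl[OF W f] by (rule F.pb_scl[OF o s])
    show "pb \<phi> (G.pre W) (pb \<psi> W (f + g)) = pb \<phi> (G.pre W) (pb \<psi> W f) + pb \<phi> (G.pre W) (pb \<psi> W g)"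
      "pb \<phi> (G.pre W) (pb \<psi> W (f * g)) = pb \<phi> (G.pre W) (pb \<psi> W f) * pb \<phi> (G.pre W) (pb \<psi> W g)"
      if g: "g \<in> secs L W" for g
      unfolding G.pb_add[OF W f g] G.pb_mult[OF W f g]
      by (rule F.pb_add[OF o s G.pb_secs[OF W g]] F.pb_mult[OF o s G.pb_secs[OF W g]])+
    show "pb \<phi> (G.pre W') (pb \<psi> W' (res W' f)) = res (F.pre (G.pre W')) (pb \<phi> (G.pre W) (pb \<psi> W f))"
      if "openin (body L) W' \<and> W' \<subseteq> W" for W'
      unfolding G.pb_res[OF W f conjunct1[OF that] conjunct2[OF that]]
      by (rule F.pb_res[OF o s G.pre_open[OF conjunct1[OF that]] G.pre_mono[OF conjunct2[OF that]]])
  qed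
qed

lemma mor_eq_sym: "mor_eq M N \<phi> \<psi> \<Longrightarrow> mor_eq M N \<psi> \<phi>"
  and mor_eq_trans [trans]: "mor_eq M N \<phi> \<psi> \<Longrightarrow> mor_eq M N \<psi> \<upsilon> \<Longrightarrow> mor_eq M N \<phi> \<upsilon>"
  by (simp_all add: mor_eq_def)

lemma mor_eq_preim: "mor_eq M N \<phi> \<psi> \<Longrightarrow> preim M \<phi> W = preim M \<psi> W"
  by (auto simp: mor_eq_def preim_def)

section \<open>Composition and addition of actions\<close>

context ssheaf
begin

abbreviation endo :: "('x, 'g, 'x, 'g) smor \<Rightarrow> bool" where "endo \<phi> \<equiv> is_mor M M \<phi>"
abbreviation comp2 (infixr "\<cdot>" 70) where "\<psi> \<cdot> \<phi> \<equiv> mcomp M \<psi> \<phi>"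
abbreviation meq (infix "\<approx>" 50) where "\<phi> \<approx> \<psi> \<equiv> mor_eq M M \<phi> \<psi>"

lemma endo_comp: "endo \<phi> \<Longrightarrow> endo \<psi> \<Longrightarrow> endo (\<psi> \<cdot> \<phi>)"
  by (rule is_mor_mcomp[OF sheaf sheaf sheaf])

lemma endo_mor: "endo \<phi> \<Longrightarrow> mor_loc M M \<phi>"
  by unfold_locales

lemma meq_cong_left: "\<psi> \<approx> \<psi>' \<Longrightarrow> endo \<phi> \<Longrightarrow> \<psi> \<cdot> \<phi> \<approx> \<psi>' \<cdot> \<phi>"
  using mor_loc.bodymap_total[OF endo_mor, of \<phi>] mor_eq_preim[of M M \<psi> \<psi>']
  unfolding mor_eq_def pb_mcomp bodymap_mcomp by auto

lemma meq_cong_right: "\<phi> \<approx> \<phi>' \<Longrightarrow> endo \<psi> \<Longrightarrow> \<psi> \<cdot> \<phi> \<approx> \<psi> \<cdot> \<phi>'"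
  using mor_loc.pre_open[OF endo_mor, of \<psi>] mor_loc.pb_secs[OF endo_mor, of \<psi>]
  unfolding mor_eq_def pb_mcomp bodymap_mcomp by auto

lemma meq_assoc: "endo \<upsilon> \<Longrightarrow> (\<phi> \<cdot> \<psi>) \<cdot> \<upsilon> \<approx> \<phi> \<cdot> (\<psi> \<cdot> \<upsilon>)" if "endo \<psi>"
  unfolding mor_eq_def pb_mcomp bodymap_mcomp preim_mcomp[OF that] by simp

lemma meq_assoc': "endo \<psi> \<Longrightarrow> endo \<upsilon> \<Longrightarrow> \<phi> \<cdot> (\<psi> \<cdot> \<upsilon>) \<approx> (\<phi> \<cdot> \<psi>) \<cdot> \<upsilon>"
  by (rule mor_eq_sym[OF meq_assoc])

text \<open>The monoid law of a composite action needs its two inner factors exchanged. Morphisms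
  are compared by \<open>mor_eq\<close>, so each rebracketing is a step of its own.\<close>

lemma interchange:
  assumes e: "endo a" "endo b" "endo c" "endo d" and bc: "b \<cdot> c \<approx> c \<cdot> b"
  shows "(a \<cdot> b) \<cdot> (c \<cdot> d) \<approx> (a \<cdot> c) \<cdot> (b \<cdot> d)"
proof -
  have "(a \<cdot> b) \<cdot> (c \<cdot> d) \<approx> a \<cdot> (b \<cdot> (c \<cdot> d))" by (intro meq_assoc e endo_comp)
  also have "\<dots> \<approx> a \<cdot> ((b \<cdot> c) \<cdot> d)" by (intro meq_cong_right meq_assoc' e)
  also have "\<dots> \<approx> a \<cdot> ((c \<cdot> b) \<cdot> d)" by (intro meq_cong_right meq_cong_left bc e)
  also have "\<dots> \<approx> a \<cdot> (c \<cdot> (b \<cdot> d))" by (intro meq_cong_right meq_assoc e)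
  also have "\<dots> \<approx> (a \<cdot> c) \<cdot> (b \<cdot> d)" by (intro meq_assoc' e endo_comp)
  finally show ?thesis .
qed

lemma monoid_action_add_weights:
  assumes h: "monoid_action M h" and l: "monoid_action M l" and hl: "commuting M h l"
  shows "monoid_action M (add_weights M h l)"
proof -
  have e: "endo (h t)" "endo (l t)" for t using h l by (auto simp: monoid_action_def)
  have m: "h (s * t) \<approx> h s \<cdot> h t" "l (s * t) \<approx> l s \<cdot> l t" for s t using h l by (auto simp: monoid_action_def)
  have "h 1 \<cdot> l 1 \<approx> mid \<cdot> l 1" by (intro meq_cong_left e) (use h in \<open>simp add: monoid_action_def\<close>)
  also have "mid \<cdot> l 1 \<approx> l 1"
  proof -
    have "preim M mid W = W" if "openin (body M) W" for W
      using openin_subset[OF that] by (auto simp: preim_def mid_def)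
    then show ?thesis by (simp add: mor_eq_def pb_mcomp bodymap_mcomp mid_def)
  qed
  also have "l 1 \<approx> mid" using l by (simp add: monoid_action_def)
  finally have one: "h 1 \<cdot> l 1 \<approx> mid" .
  have "h (s * t) \<cdot> l (s * t) \<approx> (h s \<cdot> l s) \<cdot> (h t \<cdot> l t)" for s t
  proof -
    have "h (s * t) \<cdot> l (s * t) \<approx> (h s \<cdot> h t) \<cdot> l (s * t)" by (intro meq_cong_left m e)
    also have "\<dots> \<approx> (h s \<cdot> h t) \<cdot> (l s \<cdot> l t)" by (intro meq_cong_right m e endo_comp)
    also have "\<dots> \<approx> (h s \<cdot> l s) \<cdot> (h t \<cdot> l t)"
      by (intro interchange e) (use hl in \<open>simp add: commuting_def\<close>)
    finally show ?thesis .
  qed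
  then show ?thesis
    unfolding monoid_action_def add_weights_def using one e endo_comp by blast
qed

lemma commuting_add_weights:
  assumes e: "\<And>t. endo (k t)" "\<And>t. endo (h t)" "\<And>t. endo (l t)"
    and kh: "commuting M k h" and kl: "commuting M k l"
  shows "commuting M k (add_weights M h l)"
  unfolding commuting_def add_weights_def
proof (intro allI)
  fix s t
  have "k s \<cdot> (h t \<cdot> l t) \<approx> (k s \<cdot> h t) \<cdot> l t" by (intro meq_assoc' e)
  also have "\<dots> \<approx> (h t \<cdot> k s) \<cdot> l t" by (intro meq_cong_left e) (use kh in \<open>simp add: commuting_def\<close>)
  also have "\<dots> \<approx> h t \<cdot> (k s \<cdot> l t)" by (intro meq_assoc e)
  also have "\<dots> \<approx> h t \<cdot> (l t \<cdot> k s)" by (intro meq_cong_right e) (use kl in \<open>simp add: commuting_def\<close>)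
  also have "\<dots> \<approx> (h t \<cdot> l t) \<cdot> k s" by (intro meq_assoc' e)
  finally show "k s \<cdot> (h t \<cdot> l t) \<approx> (h t \<cdot> l t) \<cdot> k s" .
qed

lemma hom_chart_add_weights:
  assumes e: "\<And>t. endo (h t)" "\<And>t. endo (l t)"
    and h: "hom_chart n m M h c w" and l: "hom_chart n m M l c w'"
  shows "hom_chart n m M (add_weights M h l) c (\<lambda>A. w A + w' A)"
proof -
  interpret schart_loc M n m c using h by unfold_locales (simp add: hom_chart_def)
  have "res (cdom c) (pb (h t \<cdot> l t) (cdom c) (coord c A)) = scl (t ^ (w A + w' A)) (coord c A)"
    if A: "A \<in> cidx n m" for A t
  proof -
    interpret H: mor_loc M M "h t" by (rule endo_mor[OF e(1)])
    interpret L: mor_loc M M "l t" by (rule endo_mor[OF e(2)])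
    let ?P = "H.pre (cdom c)" and ?g = "pb (h t) (cdom c) (coord c A)"
    have sub: "cdom c \<subseteq> ?P" "cdom c \<subseteq> L.pre (cdom c)"
      using h l openin_subset[OF cdom_open] by (auto simp: hom_chart_def preim_def image_subset_iff)
    have "res (cdom c) (pb (l t) ?P ?g) = res (cdom c) (res (L.pre (cdom c)) (pb (l t) ?P ?g))"
      using sub by (simp add: Int_absorb2)
    also have "\<dots> = res (cdom c) (pb (l t) (cdom c) (res (cdom c) ?g))"
      using L.pb_res[OF H.pre_open[OF cdom_open] H.pb_secs[OF cdom_open coord_secs[OF A]] cdom_open sub(1)] by simp
    also have "res (cdom c) ?g = scl (t ^ w A) (coord c A)" using h A by (simp add: hom_chart_def)
    also have "pb (l t) (cdom c) (scl (t ^ w A) (coord c A)) = scl (t ^ w A) (pb (l t) (cdom c) (coord c A))"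
      by (rule L.pb_scl[OF cdom_open coord_secs[OF A]])
    also have "res (cdom c) (scl (t ^ w A) (pb (l t) (cdom c) (coord c A))) = scl (t ^ (w A + w' A)) (coord c A)"
      using l A by (simp add: hom_chart_def power_add)
    finally show ?thesis unfolding pb_mcomp .
  qed
  moreover have "bodymap (h t \<cdot> l t) ` cdom c \<subseteq> cdom c" for t
    using h l by (auto simp: hom_chart_def bodymap_mcomp image_subset_iff)
  ultimately show ?thesis
    using chart by (simp add: hom_chart_def add_weights_def)
qed

end

section \<open>Actions in homogeneous coordinates\<close>

locale homchart = schart_loc N n m C for N :: "('x, 'g::real_algebra_1) sspace" and n m C +
  fixes h :: "('x, 'g) saction" and w :: "bool \<times> nat \<Rightarrow> nat"
  assumes mors: "\<And>t. is_mor N N (h t)" and hom: "hom_chart n m N h C w"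
begin

lemma hom_inv: "x \<in> cdom C \<Longrightarrow> bodymap (h t) x \<in> cdom C"
  using hom by (auto simp: hom_chart_def)

lemma hom_coord: "A \<in> cidx n m \<Longrightarrow> res (cdom C) (pb (h t) (cdom C) (coord C A)) = scl (t ^ w A) (coord C A)"
  using hom by (simp add: hom_chart_def)

text \<open>Homogeneous coordinates are multiplied by constants, so no nilpotent parts
  arise.\<close>

lemma chart_mor_act: "chart_mor N N (h t) n m C n m C (cdom C) (\<lambda>a v. t ^ w (False, a) * v a)"
proof -
  have "res (cdom C) (pb (h t) (cdom C) (coord C (False, a))) = pull C (cdom C) (\<lambda>v. t ^ w (False, a) * v a)"
    if "a < n" for a
    using hom_coord[of "(False, a)" t] that pull_scl[OF sub_cdom smooth_coord_img[OF sub_cdom], of "t ^ w (False, a)" a]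
    by (simp add: cidx_def coord_def)
  moreover have "cdom C \<subseteq> preim N (h t) (cdom C)"
    using hom_inv openin_subset[OF cdom_open] by (auto simp: preim_def)
  moreover have "smooth_fun n (img (cdom C)) (\<lambda>v. t ^ w (False, a) * v a)" for a
    by (intro smooth_mult smooth_const smooth_coord_img sub_cdom img_open)
  ultimately show ?thesis using mors by unfold_locales auto
qed

definition "act t v = (\<lambda>a. if a < n then t ^ w (False, a) * v a else 0 :: real)"

lemma act_body: "x \<in> cdom C \<Longrightarrow> act t (bmap C x) = bmap C (bodymap (h t) x)"
proof -
  assume x: "x \<in> cdom C"
  interpret A: chart_mor N N "h t" n m C n m C "cdom C" "\<lambda>a v. t ^ w (False, a) * v a" by (rule chart_mor_act)
  show ?thesis using A.\<Gamma>_body[OF x] by (simp add: A.\<Gamma>_def act_def)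
qed

definition "Wp t W = cdom C \<inter> preim N (h t) W"

text \<open>Even coordinates are rescaled inside the coefficients, by substitution; each odd
  coordinate of a monomial contributes its own power of \<open>t\<close>.\<close>

lemma pb_act:
  assumes W: "sub W" and G: "smooth_coeffs W G"
  shows "res (Wp t W) (pb (h t) W (expansion m C W G)) =
      expansion m C (Wp t W) (\<lambda>S v. t ^ (\<Sum>j\<in>S. w (True, j)) * G S (act t v))"
proof -
  interpret A: chart_mor N N "h t" n m C n m C "cdom C" "\<lambda>a v. t ^ w (False, a) * v a" by (rule chart_mor_act)
  have Vp: "A.Vp W = Wp t W" for W by (simp add: A.Vp_def Wp_def)
  have \<Gamma>: "A.\<Gamma> = act t" by (simp add: A.\<Gamma>_def act_def fun_eq_iff)
  let ?V = "Wp t W"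
  note o = sub_open[OF W]
  have V: "sub ?V" using A.Vp_sub[OF W] Vp by simp
  have sG: "smooth_fun n (img ?V) (\<lambda>v. G S (act t v))" if "S \<subseteq> {..<m}" for S
    using A.smooth_\<Gamma>[OF W, of "G S"] G that by (simp add: Vp \<Gamma>)
  have mono: "pull C W g * prod_list (map (oddc C) xs) \<in> secs N W \<and>
      res ?V (pb (h t) W (pull C W g * prod_list (map (oddc C) xs))) =
      scl (t ^ (\<Sum>j\<leftarrow>xs. w (True, j))) (pull C ?V (\<lambda>v. g (act t v)) * prod_list (map (oddc C) xs))"
    if g: "smooth_fun n (img W) g" and xs: "set xs \<subseteq> {..<m}" for g xs
    using xs
  proof (induct xs rule: rev_induct)
    case Nil
    have "pull C W g * prod_list (map (oddc C) []) \<in> secs N W \<and>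
      res ?V (pb (h t) W (pull C W g * prod_list (map (oddc C) []))) =
      scl (t ^ (\<Sum>j\<leftarrow>[]. w (True, j))) (pull C ?V (\<lambda>v. g (act t v)) * prod_list (map (oddc C) []))"
      using A.pb_pull[OF W g] pull_secs[OF W g] by (simp add: Vp \<Gamma>)
    then show ?case .
  next
    case (snoc j xs)
    let ?f = "pull C W g * prod_list (map (oddc C) xs)" and ?x = "res W (oddc C j)"
    have xs: "set xs \<subseteq> {..<m}" and j: "j < m" using snoc.prems by auto
    have IH: "?f \<in> secs N W"
      "res ?V (pb (h t) W ?f) = scl (t ^ (\<Sum>j\<leftarrow>xs. w (True, j))) (pull C ?V (\<lambda>v. g (act t v)) * prod_list (map (oddc C) xs))"
      by (rule snoc.hyps[OF xs, THEN conjunct1], rule snoc.hyps[OF xs, THEN conjunct2])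
    have A: "(True, j) \<in> cidx n m" using j by (auto simp: cidx_def)
    have os: "oddc C j \<in> secs N (cdom C)" using coord_secs[OF A] by (simp add: coord_def)
    have xis: "?x \<in> secs N W" by (rule secs_res[OF cdom_open os o sub_dom[OF W]])
    have e: "pull C W g * prod_list (map (oddc C) (xs @ [j])) = ?f * ?x"
      using mult_res_right[OF secs_id[OF o IH(1)], of "oddc C j"]
      by (simp only: map_append prod_list.append list.map prod_list.Cons prod_list.Nil mult.assoc mult_1_right)
    have vs: "?V \<subseteq> A.pre W" "?V \<subseteq> cdom C" by (auto simp: Wp_def)
    have "res ?V (pb (h t) W ?x) = res ?V (res (cdom C) (pb (h t) (cdom C) (oddc C j)))"
      using A.pb_res[OF cdom_open os o sub_dom[OF W]] vs by (simp add: Int_absorb2)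
    also have "\<dots> = scl (t ^ w (True, j)) (res ?V (oddc C j))"
      using hom_coord[OF A, of t] by (simp add: coord_def)
    finally have x: "res ?V (pb (h t) W ?x) = scl (t ^ w (True, j)) (res ?V (oddc C j))" .
    let ?p = "pull C ?V (\<lambda>v. g (act t v)) * prod_list (map (oddc C) xs)"
    have sg: "smooth_fun n (img ?V) (\<lambda>v. g (act t v))" using A.smooth_\<Gamma>[OF W g] by (simp add: Vp \<Gamma>)
    have pid: "res ?V ?p = ?p" using pull_id[OF V sg] by (simp only: res_mult_right)
    have "res ?V (pb (h t) W (?f * ?x)) = res ?V (pb (h t) W ?f) * res ?V (pb (h t) W ?x)"
      unfolding A.pb_mult[OF o IH(1) xis] by simp
    also have "\<dots> = scl (t ^ (\<Sum>j\<leftarrow>xs. w (True, j)) * t ^ w (True, j)) (?p * res ?V (oddc C j))"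
      unfolding IH(2) x by (simp add: mult.commute)
    also have "?p * res ?V (oddc C j) = ?p * oddc C j" by (rule mult_res_right[OF pid, symmetric])
    finally have r: "res ?V (pb (h t) W (?f * ?x)) = scl (t ^ (\<Sum>j\<leftarrow>xs. w (True, j)) * t ^ w (True, j)) (?p * oddc C j)" .
    have "pull C W g * prod_list (map (oddc C) (xs @ [j])) \<in> secs N W \<and>
      res ?V (pb (h t) W (pull C W g * prod_list (map (oddc C) (xs @ [j])))) =
      scl (t ^ (\<Sum>j\<leftarrow>xs @ [j]. w (True, j))) (pull C ?V (\<lambda>v. g (act t v)) * prod_list (map (oddc C) (xs @ [j])))"
      unfolding e r using secs_mult[OF o IH(1) xis] by (simp add: power_add mult.assoc)
    then show ?case .
  qed
  have mon: "pull C W (G S) * odd_monom (oddc C) S \<in> secs N W"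
    "res ?V (pb (h t) W (pull C W (G S) * odd_monom (oddc C) S)) =
       pull C ?V (\<lambda>v. t ^ (\<Sum>j\<in>S. w (True, j)) * G S (act t v)) * odd_monom (oddc C) S"
    if S: "S \<in> Pow {..<m}" for S
  proof -
    have f: "finite S" using S finite_subset[of S "{..<m}"] by auto
    have g: "smooth_fun n (img W) (G S)" using G S by auto
    have xs: "set (sorted_list_of_set S) \<subseteq> {..<m}" using S f by auto
    have sl: "(\<Sum>j\<leftarrow>sorted_list_of_set S. w (True, j)) = (\<Sum>j\<in>S. w (True, j))"
      using sum.distinct_set_conv_list[of "sorted_list_of_set S" "\<lambda>j. w (True, j)"] f by simp
    note m = mono[OF g xs, folded odd_monom_def, unfolded sl]
    show "pull C W (G S) * odd_monom (oddc C) S \<in> secs N W" using m by blast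
    show "res ?V (pb (h t) W (pull C W (G S) * odd_monom (oddc C) S)) =
       pull C ?V (\<lambda>v. t ^ (\<Sum>j\<in>S. w (True, j)) * G S (act t v)) * odd_monom (oddc C) S"
      using m pull_scl[OF V sG, of S "t ^ (\<Sum>j\<in>S. w (True, j))"] S by simp
  qed
  show "res ?V (pb (h t) W (expansion m C W G)) =
      expansion m C ?V (\<lambda>S v. t ^ (\<Sum>j\<in>S. w (True, j)) * G S (act t v))"
  proof -
    let ?m = "\<lambda>S. pull C W (G S) * odd_monom (oddc C) S"
    have "res ?V (pb (h t) W (\<Sum>S\<in>Pow {..<m}. ?m S)) = (\<Sum>S\<in>Pow {..<m}. res ?V (pb (h t) W (?m S)))"
      using A.pb_sum[OF o mon(1), of "Pow {..<m}" "\<lambda>S. S"] by (simp add: res_sum)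
    then show ?thesis unfolding expansion_def using sum.cong[OF refl mon(2)] by (simp only:)
  qed
qed

text \<open>In homogeneous coordinates the action is polynomial in \<open>t\<close>, so the
  coefficients from \<open>pb_act\<close> are jointly smooth once \<open>t\<close> is read from slot
  \<open>n\<close>.\<close>

lemma smooth_act_chart:
  assumes W: "openin (body N) W" and f: "f \<in> secs N W"
  defines "\<Omega> \<equiv> {(bmap C x)(n := t) |x t. x \<in> cdom C \<and> bodymap (h t) x \<in> W}"
  shows "openin (Euclidean_space (Suc n)) \<Omega> \<and>
    (\<exists>F. (\<forall>S\<subseteq>{..<m}. smooth_fun (Suc n) \<Omega> (F S)) \<and>
      (\<forall>t. res (cdom C) (pb (h t) W f) =
        expansion m C (cdom C \<inter> preim N (h t) W) (\<lambda>S v. F S (v(n := t)))))"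
proof -
  let ?W = "W \<inter> cdom C"
  have sW: "sub ?W" using W by (auto simp: sub_def)
  obtain G where G: "smooth_coeffs ?W G" "res ?W f = expansion m C ?W G"
    using ex_expansion[OF sW secs_res[OF W f sub_open[OF sW]]] by blast
  define \<sigma> where "\<sigma> v = act (v n) v" for v
  let ?E = "{v :: nat \<Rightarrow> real. \<forall>i\<ge>Suc n. v i = 0}"
  \<comment> \<open>Two conditions describe the set: the first \<open>n\<close> slots give a point
    of the chart, and the rescaled point lies in the image of \<open>?W\<close>. Both are open by
    continuity.\<close>
  have \<Omega>: "\<Omega> = {v \<in> ?E. v(n := 0) \<in> img (cdom C)} \<inter> {v \<in> ?E. \<sigma> v \<in> img ?W}"
  proof (intro equalityI subsetI)
    fix v assume "v \<in> \<Omega>"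
    then obtain x t where v: "v = (bmap C x)(n := t)" "x \<in> cdom C" "bodymap (h t) x \<in> W"
      by (auto simp: \<Omega>_def)
    have z: "bmap C x n = 0" using img_zero[OF v(2)] by simp
    have "v(n := 0) = bmap C x" using z v(1) by (simp add: fun_eq_iff)
    moreover have "\<sigma> v = act t (bmap C x)" by (auto simp: \<sigma>_def act_def v(1) fun_eq_iff)
    then have "\<sigma> v = bmap C (bodymap (h t) x)" using act_body[OF v(2)] by simp
    moreover have "v \<in> ?E" using img_zero[OF v(2)] v(1) by auto
    ultimately show "v \<in> {v \<in> ?E. v(n := 0) \<in> img (cdom C)} \<inter> {v \<in> ?E. \<sigma> v \<in> img ?W}"
      using v(2,3) hom_inv[OF v(2)] by auto
  next
    fix v assume "v \<in> {v \<in> ?E. v(n := 0) \<in> img (cdom C)} \<inter> {v \<in> ?E. \<sigma> v \<in> img ?W}"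
    then obtain x y where x: "x \<in> cdom C" "v(n := 0) = bmap C x" and y: "y \<in> W" "y \<in> cdom C" "\<sigma> v = bmap C y" by auto
    have "\<sigma> v = act (v n) (bmap C x)" unfolding x(2)[symmetric] by (auto simp: \<sigma>_def act_def fun_eq_iff)
    then have "bmap C y = bmap C (bodymap (h (v n)) x)" using y(3) act_body[OF x(1)] by simp
    then have "y = bodymap (h (v n)) x" using inj_bmap y(2) hom_inv[OF x(1)] by (auto dest: inj_onD)
    moreover have "v = (bmap C x)(n := v n)" unfolding x(2)[symmetric] by simp
    ultimately show "v \<in> \<Omega>" using x(1) y(1) by (auto simp: \<Omega>_def)
  qed
  have cont: "openin (Euclidean_space (Suc n)) {v \<in> ?E. g v \<in> V}"
    if g: "\<And>a. continuous_on ?E (\<lambda>v. g v a)" "\<And>v a. v \<in> ?E \<Longrightarrow> a \<ge> n \<Longrightarrow> g v a = 0"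
      and V: "openin (Euclidean_space n) V" for g :: "(nat \<Rightarrow> real) \<Rightarrow> nat \<Rightarrow> real" and V
  proof -
    have "continuous_on ?E g" by (rule continuous_on_coordinatewise_then_product[OF g(1)])
    then have "continuous_map (Euclidean_space (Suc n)) (Euclidean_space n) g"
      unfolding Euclidean_space_top_of_set continuous_map_in_subtopology using g(2) by auto
    from openin_continuous_map_preimage[OF this V] show ?thesis by (simp add: topspace_Euclidean_space)
  qed
  have cc: "continuous_on ?E (\<lambda>v. v a)" for a
    by (rule continuous_on_subset[OF continuous_on_product_coordinates]) simp
  have 1: "openin (Euclidean_space (Suc n)) {v \<in> ?E. v(n := 0) \<in> img (cdom C)}"
  proof (rule cont[OF _ _ img_cdom_open])
    show "continuous_on ?E (\<lambda>v. (v(n := 0)) a)" for a by (cases "a = n") (auto intro: cc)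
  qed auto
  have 2: "openin (Euclidean_space (Suc n)) {v \<in> ?E. \<sigma> v \<in> img ?W}"
  proof (rule cont[OF _ _ img_open[OF sW]])
    show "continuous_on ?E (\<lambda>v. \<sigma> v a)" for a
      unfolding \<sigma>_def act_def by (cases "a < n") (auto intro!: continuous_intros cc)
  qed (auto simp: \<sigma>_def act_def)
  have o: "openin (Euclidean_space (Suc n)) \<Omega>" unfolding \<Omega> by (rule openin_Int[OF 1 2])
  define F where "F S v = (v n) ^ (\<Sum>j\<in>S. w (True, j)) * G S (\<sigma> v)" for S v
  have "smooth_fun (Suc n) \<Omega> (F S)" if S: "S \<subseteq> {..<m}" for S
  proof -
    have 1: "smooth_fun (Suc n) \<Omega> (\<lambda>v. G S (\<sigma> v))"
    proof (rule smooth_compose[OF o img_open[OF sW], of \<sigma> "G S"])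
      show "\<sigma> v \<in> img ?W" if "v \<in> \<Omega>" for v using that unfolding \<Omega> by auto
      show "smooth_fun (Suc n) \<Omega> (\<lambda>v. \<sigma> v a)" if "a < n" for a
        using that smooth_mult[OF o smooth_power[OF o smooth_coord[OF o]] smooth_coord[OF o], of n "w (False, a)" a]
        by (simp add: \<sigma>_def act_def)
      show "smooth_fun n (img ?W) (G S)" using G(1) S by blast
    qed
    show ?thesis unfolding F_def by (rule smooth_mult[OF o smooth_power[OF o smooth_coord[OF o]] 1])
  qed
  moreover have "res (cdom C) (pb (h t) W f) = expansion m C (cdom C \<inter> preim N (h t) W) (\<lambda>S v. F S (v(n := t)))" for t
  proof -
    interpret A: mor_loc N N "h t" by unfold_locales (rule mors)
    let ?V = "cdom C \<inter> A.pre W"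
    have V: "Wp t ?W = ?V" using hom_inv by (auto simp: Wp_def preim_def)
    have "A.pre ?W \<subseteq> A.pre W" by (rule A.pre_mono) auto
    have i1: "cdom C \<inter> A.pre W \<inter> A.pre W = ?V" by auto
    have i2: "?V \<inter> A.pre ?W = ?V" using V by (auto simp: Wp_def)
    have "res (cdom C) (pb (h t) W f) = res (cdom C) (res (A.pre W) (pb (h t) W f))"
      using A.pb_id[OF W f] by simp
    also have "\<dots> = res ?V (res (A.pre ?W) (pb (h t) W f))" using i2 by simp
    also have "\<dots> = res ?V (pb (h t) ?W (res ?W f))"
      using A.pb_res[OF W f sub_open[OF sW]] by simp
    also have "\<dots> = expansion m C ?V (\<lambda>S v. t ^ (\<Sum>j\<in>S. w (True, j)) * G S (act t v))"
      unfolding G(2) using pb_act[OF sW G(1), of t] unfolding V .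
    also have "(\<lambda>S v. t ^ (\<Sum>j\<in>S. w (True, j)) * G S (act t v)) = (\<lambda>S v. F S (v(n := t)))"
    proof -
      have "\<sigma> (v(n := t)) = act t v" for v by (auto simp: \<sigma>_def act_def fun_eq_iff)
      then show ?thesis by (simp add: F_def)
    qed
    finally show ?thesis .
  qed
  ultimately show ?thesis using o by blast
qed

end

text \<open>A homogeneous atlas forces the action to be smooth, by
  \<open>smooth_act_chart\<close>.\<close>

lemma homogeneity_structureI:
  assumes M: "supermanifold n m M" and h: "monoid_action M h"
    and at: "\<And>x. x \<in> total M \<Longrightarrow> \<exists>c w. hom_chart n m M h c w \<and> x \<in> cdom c \<and> (\<forall>A\<in>cidx n m. w A \<le> d)"
  shows "homogeneity_structure d n m M h"
proof -
  have "smooth_action n m M h"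
    unfolding smooth_action_def
  proof
    fix y assume "y \<in> total M"
    then obtain c w where c: "hom_chart n m M h c w" "y \<in> cdom c" using at by blast
    have ch: "chart n m M c" using c(1) by (simp add: hom_chart_def)
    interpret homchart M n m c h w
      using M h c(1) ch by unfold_locales (auto simp: supermanifold_def monoid_action_def)
    show "\<exists>c. chart n m M c \<and> y \<in> cdom c \<and>
        (\<forall>W f. openin (body M) W \<and> f \<in> secs M W \<longrightarrow>
           (let \<Omega> = {(bmap c x)(n := t) |x t. x \<in> cdom c \<and> bodymap (h t) x \<in> W} in
            openin (Euclidean_space (Suc n)) \<Omega> \<and>
            (\<exists>F. (\<forall>S\<subseteq>{..<m}. smooth_fun (Suc n) \<Omega> (F S)) \<and>
                 (\<forall>t. res (cdom c) (pb (h t) W f) =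
                    expansion m c (cdom c \<inter> preim M (h t) W) (\<lambda>S v. F S (v(n := t)))))))"
      unfolding Let_def using smooth_act_chart ch c(2) by blast
  qed
  then show ?thesis unfolding homogeneity_structure_def using M h at by blast
qed

text \<open>The domain of homogeneous coordinates is saturated: if \<open>h\<^sub>t x\<close> lies in it, then so does \<open>h\<^sub>0 x\<close>, hence
  \<open>h\<^sub>s x\<close> for some small \<open>s \<noteq> 0\<close>, and \<open>h\<^sub>s\<close> is invertible.\<close>

lemma hom_chart_saturated:
  assumes h: "homogeneity_structure d n m M h" and c: "hom_chart n m M h c w"
  shows "preim M (h t) (cdom c) = cdom c"
proof -
  have ma: "monoid_action M h" and sm: "smooth_action n m M h" and M: "supermanifold n m M"
    using h by (auto simp: homogeneity_structure_def)
  have ch: "chart n m M c" using c by (simp add: hom_chart_def)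
  interpret c: schart_loc M n m c using M ch by unfold_locales (auto simp: supermanifold_def)
  have inv: "x \<in> cdom c \<Longrightarrow> bodymap (h t) x \<in> cdom c" for t x using c by (auto simp: hom_chart_def)
  have mult: "bodymap (h (s * t)) x = bodymap (h s) (bodymap (h t) x)" and one: "bodymap (h 1) x = x"
    if "x \<in> total M" for s t x
    using ma that by (auto simp: monoid_action_def mor_eq_def bodymap_mcomp)
  have "x \<in> cdom c" if x: "x \<in> total M" and hx: "bodymap (h t) x \<in> cdom c" for x
  proof -
    have h0: "bodymap (h 0) x \<in> cdom c" using mult[OF x, of 0 t] inv[OF hx, of 0] by simp
    \<comment> \<open>The zero section over \<open>cdom c\<close> is enough to extract from
      smoothness that the set of pairs of a point and a time with \<open>bodymap (h t) x\<close> in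
      \<open>cdom c\<close> is open.\<close>
    obtain c' where c': "chart n m M c'" "x \<in> cdom c'"
      "openin (Euclidean_space (Suc n)) {(bmap c' x)(n := t) |x t. x \<in> cdom c' \<and> bodymap (h t) x \<in> cdom c}"
      (is "openin _ ?\<Omega>")
      using sm[unfolded smooth_action_def, rule_format, OF x] c.zero_secs[OF c.cdom_open] c.cdom_open
      unfolding Let_def by blast
    interpret c': schart_loc M n m c' using c'(1) by unfold_locales
    have "(bmap c' x)(n := 0) \<in> ?\<Omega>" using c'(2) h0 by blast
    from eventually_fun_upd_in_open[OF c'(3) this, of n]
    have "eventually (\<lambda>s. (bmap c' x)(n := s) \<in> ?\<Omega>) (nhds 0)" by simp
    then obtain e where e: "e > 0" "\<And>s. dist s 0 < e \<Longrightarrow> (bmap c' x)(n := s) \<in> ?\<Omega>"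
      unfolding eventually_nhds_metric by blast
    \<comment> \<open>Any nonzero number within \<open>e\<close> of 0 serves, since
      \<open>h (1 / ?s)\<close> then undoes \<open>h ?s\<close>.\<close>
    let ?s = "e / 2"
    have "(bmap c' x)(n := ?s) \<in> ?\<Omega>" by (rule e(2)) (use e(1) in \<open>simp add: dist_real_def\<close>)
    then obtain x' t' where x': "x' \<in> cdom c'" "bodymap (h t') x' \<in> cdom c" "(bmap c' x)(n := ?s) = (bmap c' x')(n := t')"
      by blast
    have "t' = ?s" using fun_cong[OF x'(3), of n] by simp
    have "bmap c' x a = bmap c' x' a" for a
      using fun_cong[OF x'(3), of a] c'.img_zero[OF c'(2), of n] c'.img_zero[OF x'(1), of n] by (cases "a = n") auto
    then have "x = x'" using c'.inj_bmap c'(2) x'(1) by (auto dest: inj_onD)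
    then have "bodymap (h ?s) x \<in> cdom c" using x'(2) \<open>t' = ?s\<close> by simp
    from inv[OF this, of "1 / ?s"] show ?thesis
      using mult[OF x, of "1 / ?s" ?s] one[OF x] e(1) by simp
  qed
  then show ?thesis using inv openin_subset[OF c.cdom_open] by (auto simp: preim_def)
qed

lemma hom_chart_pb:
  assumes h: "homogeneity_structure d n m M h" and c: "hom_chart n m M h c w" and A: "A \<in> cidx n m"
  shows "pb (h t) (cdom c) (coord c A) = scl (t ^ w A) (coord c A)"
proof -
  have ch: "chart n m M c" using c by (simp add: hom_chart_def)
  interpret c: schart_loc M n m c
    using h ch by unfold_locales (auto simp: homogeneity_structure_def supermanifold_def)
  interpret mor_loc M M "h t"
    using h by unfold_locales (auto simp: homogeneity_structure_def monoid_action_def)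
  have "res (cdom c) (pb (h t) (cdom c) (coord c A)) = pb (h t) (cdom c) (coord c A)"
    using pb_id[OF c.cdom_open c.coord_secs[OF A]] hom_chart_saturated[OF h c] by simp
  then show ?thesis using c A by (simp add: hom_chart_def)
qed

text \<open>If the weights have the right parity in an atlas, then \<open>h\<^sub>-\<^sub>1\<close> is the parity operator.\<close>

lemma N_manifoldI:
  assumes h: "homogeneity_structure d n m M h"
    and at: "\<And>x. x \<in> total M \<Longrightarrow> \<exists>c w. hom_chart n m M h c w \<and> x \<in> cdom c \<and> (\<forall>A\<in>cidx n m. odd (w A) \<longleftrightarrow> fst A)"
  shows "N_manifold d n m M h"
  unfolding N_manifold_def
proof (intro conjI h allI impI ballI, elim conjE)
  fix c w A assume c: "hom_chart n m M h c w" and ne: "cdom c \<noteq> {}" and A: "A \<in> cidx n m"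
  have ma: "monoid_action M h" and M: "supermanifold n m M"
    using h by (auto simp: homogeneity_structure_def)
  have ch: "chart n m M c" using c by (simp add: hom_chart_def)
  interpret c: schart_loc M n m c using M ch by unfold_locales (auto simp: supermanifold_def)
  obtain x where x: "x \<in> cdom c" using ne by blast
  then have "x \<in> total M" using openin_subset[OF c.cdom_open] by blast
  then obtain C v where C: "hom_chart n m M h C v" "x \<in> cdom C" "\<And>A. A \<in> cidx n m \<Longrightarrow> odd (v A) \<longleftrightarrow> fst A"
    using at by blast
  have chC: "chart n m M C" using C(1) by (simp add: hom_chart_def)
  interpret C: homchart M n m C h v
    using chC C(1) ma by unfold_locales (auto simp: monoid_action_def)
  interpret L: mor_loc M M "h (-1)" by unfold_locales (rule C.mors)
  let ?T = "cdom c \<inter> cdom C" and ?k = "if fst A then -1 else 1 :: real"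
  have T: "openin (body M) ?T" "C.sub ?T" "c.sub ?T" by (auto simp: C.sub_def c.sub_def)
  have act: "C.act (-1) u = u" if "u \<in> C.img (cdom C)" for u
  proof
    fix a
    show "C.act (-1) u a = u a"
    proof (cases "a < n")
      case True
      then have "even (v (False, a))" using C(3)[of "(False, a)"] by (auto simp: cidx_def)
      then show ?thesis using True by (simp add: C.act_def)
    next
      case False
      then show ?thesis using that C.img_zero by (auto simp: C.act_def)
    qed
  qed
  have id: "bodymap (h (-1)) y = y" if y: "y \<in> cdom C" for y
  proof -
    have "bmap C (bodymap (h (-1)) y) = bmap C y" using C.act_body[OF y, of "-1"] act[of "bmap C y"] y by auto
    then show ?thesis using C.inj_bmap y C.hom_inv[OF y] by (auto dest: inj_onD)
  qed
  have WT: "C.Wp (-1) ?T = ?T"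
    using id openin_subset[OF T(1)] by (auto simp: C.Wp_def preim_def)
  \<comment> \<open>A coordinate of the unknown chart is expanded in the known one. The pullback by
    \<open>h (-1)\<close> multiplies it by the sign of its parity, and by \<open>(-1) ^ w A\<close>
    because it is homogeneous; comparing the two gives the claim.\<close>
  let ?f = "res ?T (coord c A)"
  have f: "?f \<in> sect M (fst A) ?T" by (rule c.coord_res_sect[OF A T(3)])
  obtain F where F: "C.smooth_coeffs ?T F" "?f = expansion m C ?T F" "\<And>S. odd (card S) \<noteq> fst A \<Longrightarrow> F S = (\<lambda>v. 0)"
    using C.homogeneous_expansion[OF T(2) f] by auto
  have "(-1) ^ (\<Sum>j\<in>S. v (True, j)) * F S (C.act (-1) u) = ?k * F S u" if S: "S \<subseteq> {..<m}" and u: "u \<in> C.img ?T" for S u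
  proof (cases "odd (card S) = fst A")
    case True
    have "finite S" using S finite_subset by blast
    then have "even (\<Sum>j\<in>S. v (True, j)) \<longleftrightarrow> even (card S)"
      using S
    proof (induct S rule: finite_induct)
      case (insert j F)
      have "odd (v (True, j))" using C(3)[of "(True, j)"] insert.prems by (auto simp: cidx_def)
      then show ?case using insert by auto
    qed simp
    then have "(-1) ^ (\<Sum>j\<in>S. v (True, j)) = ?k" using True by auto
    moreover have "C.act (-1) u = u" by (rule act) (use u in auto)
    ultimately show ?thesis by simp
  next
    case False
    then show ?thesis using F(3)[OF False] by simp
  qed
  note coeff = this
  have "expansion m C ?T (\<lambda>S u. (-1) ^ (\<Sum>j\<in>S. v (True, j)) * F S (C.act (-1) u)) = expansion m C ?T (\<lambda>S u. ?k * F S u)"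
  proof (rule C.expansion_cong[OF T(2) _ coeff])
    show "C.smooth_coeffs ?T (\<lambda>S u. ?k * F S u)"
    proof (intro allI impI)
      fix S assume "S \<subseteq> {..<m}"
      then have "smooth_fun n (C.img ?T) (F S)" using F(1) by blast
      then show "smooth_fun n (C.img ?T) (\<lambda>u. ?k * F S u)"
        by (rule smooth_mult[OF C.img_open[OF T(2)] smooth_const[OF C.img_open[OF T(2)]]])
    qed
  qed
  then have 1: "res ?T (pb (h (-1)) ?T ?f) = scl ?k ?f"
    using C.pb_act[OF T(2) F(1), of "-1"] C.expansion_scl[OF T(2) F(1), of ?k] F(2) WT by simp
  have "?T \<subseteq> L.pre ?T" using WT by (auto simp: C.Wp_def)
  then have "res ?T (pb (h (-1)) ?T ?f) = res ?T (res (cdom c) (pb (h (-1)) (cdom c) (coord c A)))"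
    using L.pb_res[OF c.cdom_open c.coord_secs[OF A] T(1)] by (simp add: Int_absorb2)
  also have "\<dots> = scl ((-1) ^ w A) ?f" using c A by (simp add: hom_chart_def)
  finally have e: "scl ?k ?f = scl ((-1) ^ w A) ?f" using 1 by simp
  show "odd (w A) \<longleftrightarrow> fst A"
  proof (rule ccontr)
    assume "\<not> (odd (w A) \<longleftrightarrow> fst A)"
    then have k: "?k \<noteq> (-1) ^ w A" by auto
    have "scl (?k - (-1) ^ w A) ?f = 0"
      using e scl_add_left[of "?k - (-1) ^ w A" "(-1) ^ w A" ?f] by simp
    then have f0: "?f = 0" using k scl_eq_0[of "?k - (-1) ^ w A" ?f] by simp
    \<comment> \<open>A coordinate is not 0 near \<open>x\<close>: otherwise its own coordinate
      field would send it both to 0 and to 1.\<close>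
    have "vres ?T (c.dc A) ?T 0 = 0"
      by (rule c.vf_at_zero[OF c.vfield_vres[OF c.vfield_dc[OF A] T(1)]]) auto
    then have "res ?T 1 = (0 :: 'a \<Rightarrow> 'b)" using c.vres_dc_coord[OF T(3) A A] f0 by simp
    then show False
      using c.not_vanishing_one[of x ?T] c.vanishing_zero[OF x] x C(2) T(3) by auto
  qed
qed

section \<open>Weights of Hamiltonians and of the canonical form\<close>

text \<open>Weights of \<open>H = \<Sum> \<pi>\<^sup>*(Q(z\<^sup>A)) p\<^sub>A\<close> under morphisms \<open>\<eta>\<close> and \<open>\<epsilon>\<close> that are intertwined by \<open>\<pi>\<close>.\<close>

lemma pb_hamiltonian:
  fixes N :: "('z, 's::real_algebra_1) sspace" and M0 :: "('y, 'h::real_algebra_1) sspace"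
  assumes C: "schart_loc N n' m' C" and b: "schart_loc M0 n r b" and \<pi>: "is_mor N M0 \<pi>"
    and dom: "cdom C = preim N \<pi> (cdom b)"
    and \<eta>: "is_mor N N \<eta>" "preim N \<eta> (cdom C) = cdom C"
    and \<epsilon>: "is_mor M0 M0 \<epsilon>" "preim M0 \<epsilon> (cdom b) = cdom b"
    and pure: "\<And>a. a < n \<Longrightarrow> pb \<pi> (cdom b) (coord b (False, a)) = coord C (False, k a)"
    and q: "\<And>A. A \<in> cidx n r \<Longrightarrow> pb \<eta> (cdom C) (pb \<pi> (cdom b) (coord b A)) = scl (s A) (pb \<pi> (cdom b) (coord b A))"
    and z: "\<And>A. A \<in> cidx n r \<Longrightarrow> pb \<epsilon> (cdom b) (coord b A) = scl (s A) (coord b A)"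
    and p: "\<And>A. A \<in> cidx n r \<Longrightarrow> P A \<in> secs N (cdom C) \<and> pb \<eta> (cdom C) (P A) = scl (s' A) (P A)"
    and Q: "vfield M0 i (total M0) Q"
    and Qw: "\<And>f. f \<in> secs M0 (cdom b) \<Longrightarrow> pb \<epsilon> (cdom b) (Q (cdom b) f) = scl d (Q (cdom b) (pb \<epsilon> (cdom b) f))"
    and T: "\<And>A. A \<in> cidx n r \<Longrightarrow> d * s A * s' A = T"
  shows "pb \<eta> (cdom C) (\<Sum>A\<in>cidx n r. pb \<pi> (cdom b) (Q (cdom b) (coord b A)) * P A) =
    scl T (\<Sum>A\<in>cidx n r. pb \<pi> (cdom b) (Q (cdom b) (coord b A)) * P A)"
proof -
  interpret b: schart_loc M0 n r b by (rule b)
  interpret C: schart_loc N n' m' C by (rule C)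
  interpret \<pi>: mor_loc N M0 \<pi> by unfold_locales (rule \<pi>)
  interpret \<eta>: mor_loc N N \<eta> by unfold_locales (rule \<eta>)
  interpret \<epsilon>: mor_loc M0 M0 \<epsilon> by unfold_locales (rule \<epsilon>)
  let ?D = "cdom C" and ?B = "cdom b"
  have b_total: "?B \<subseteq> total M0" by (rule openin_subset[OF b.cdom_open])
  let ?\<phi> = "mcomp N \<pi> \<eta>" and ?\<psi> = "mcomp M0 \<epsilon> \<pi>"
  let ?\<gamma> = "\<lambda>a v. s (False, a) * v (k a)"
  have m\<phi>: "is_mor N M0 ?\<phi>" by (rule is_mor_mcomp[OF C.sheaf C.sheaf b.sheaf \<eta>(1) \<pi>])
  have m\<psi>: "is_mor N M0 ?\<psi>" by (rule is_mor_mcomp[OF C.sheaf b.sheaf b.sheaf \<pi> \<epsilon>(1)])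
  have pre\<phi>: "preim N ?\<phi> ?B = ?D" using preim_mcomp[OF \<eta>(1)] dom \<eta>(2) by metis
  have pre\<psi>: "preim N ?\<psi> ?B = ?D" using preim_mcomp[OF \<pi>] dom \<epsilon>(2) by metis
  have pb\<phi>: "pb ?\<phi> ?B f = pb \<eta> ?D (pb \<pi> ?B f)" for f by (simp add: pb_mcomp dom)
  have pb\<psi>: "pb ?\<psi> ?B f = pb \<pi> ?B (pb \<epsilon> ?B f)" for f by (simp add: pb_mcomp \<epsilon>(2))
  have pbs: "pb \<pi> ?B f \<in> secs N ?D" if "f \<in> secs M0 ?B" for f
    using \<pi>.pb_secs[OF b.cdom_open that] dom by simp
  have c\<phi>: "pb ?\<phi> ?B (coord b A) = scl (s A) (pb \<pi> ?B (coord b A))" if "A \<in> cidx n r" for A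
    unfolding pb\<phi> by (rule q[OF that])
  have c\<psi>: "pb ?\<psi> ?B (coord b A) = scl (s A) (pb \<pi> ?B (coord b A))" if "A \<in> cidx n r" for A
    unfolding pb\<psi> z[OF that] by (rule \<pi>.pb_scl[OF b.cdom_open b.coord_secs[OF that]])
  have ev: "res ?D (scl (s (False, a)) (pb \<pi> ?B (coord b (False, a)))) = pull C ?D (?\<gamma> a)" if a: "a < n" for a
  proof -
    have "(False, a) \<in> cidx n r" using a by (simp add: cidx_def)
    then have "res ?D (pb \<pi> ?B (coord b (False, a))) = pb \<pi> ?B (coord b (False, a))"
      by (intro C.secs_id[OF C.cdom_open] pbs b.coord_secs)
    then show ?thesis
      using pure[OF a] C.pull_scl[OF C.sub_cdom C.smooth_coord_img[OF C.sub_cdom], of "s (False, a)" "k a"]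
      by (simp add: coord_def)
  qed
  have sm: "smooth_fun n' (C.img ?D) (?\<gamma> a)" for a
    by (intro smooth_mult smooth_const C.smooth_coord_img C.sub_cdom C.img_open)
  have cm: "chart_mor N M0 \<phi> n r b n' m' C ?D ?\<gamma>"
    if "is_mor N M0 \<phi>" "preim N \<phi> ?B = ?D" "\<And>A. A \<in> cidx n r \<Longrightarrow> pb \<phi> ?B (coord b A) = scl (s A) (pb \<pi> ?B (coord b A))" for \<phi>
  proof unfold_locales
    show "is_mor N M0 \<phi>" by (rule that(1))
    show "C.sub ?D" by simp
    show "?D \<subseteq> preim N \<phi> ?B" using that(2) by simp
    show "smooth_fun n' (C.img ?D) (?\<gamma> a)" for a by (rule sm)
    show "res ?D (pb \<phi> ?B (coord b (False, a))) = pull C ?D (?\<gamma> a)" if "a < n" for a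
      using ev[OF that] \<open>\<And>A. A \<in> cidx n r \<Longrightarrow> pb \<phi> ?B (coord b A) = scl (s A) (pb \<pi> ?B (coord b A))\<close>[of "(False, a)"] that
      by (simp add: cidx_def)
  qed
  interpret \<phi>: chart_mor N M0 ?\<phi> n r b n' m' C ?D ?\<gamma> by (rule cm[OF m\<phi> pre\<phi> c\<phi>])
  have odd: "res ?D (pb ?\<phi> ?B (oddc b j)) = res ?D (pb ?\<psi> ?B (oddc b j))" if "j < r" for j
    using c\<phi>[of "(True, j)"] c\<psi>[of "(True, j)"] that by (simp add: cidx_def coord_def)
  \<comment> \<open>Both ways around the square multiply the coordinates by \<open>s\<close>, so by
    \<open>determined\<close> they agree on all functions.\<close>
  have inter: "pb \<eta> ?D (pb \<pi> ?B f) = pb \<pi> ?B (pb \<epsilon> ?B f)" if f: "f \<in> secs M0 ?B" for f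
  proof -
    have "res ?D (pb ?\<phi> ?B f) = res ?D (pb ?\<psi> ?B f)"
      using \<phi>.determined(2)[OF cm[OF m\<psi> pre\<psi> c\<psi>] odd b.sub_cdom f] unfolding \<phi>.Vp_cdom .
    moreover have "res ?D (pb \<eta> ?D (pb \<pi> ?B f)) = pb \<eta> ?D (pb \<pi> ?B f)"
      using \<eta>.pb_id[OF C.cdom_open pbs[OF f]] \<eta>(2) by simp
    moreover have "pb \<epsilon> ?B f \<in> secs M0 ?B" using \<epsilon>.pb_secs[OF b.cdom_open f] \<epsilon>(2) by simp
    then have "res ?D (pb \<pi> ?B (pb \<epsilon> ?B f)) = pb \<pi> ?B (pb \<epsilon> ?B f)"
      by (intro C.secs_id[OF C.cdom_open] pbs)
    ultimately show ?thesis unfolding pb\<phi> pb\<psi> by simp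
  qed
  have Qs: "Q ?B (coord b A) \<in> secs M0 ?B" if "A \<in> cidx n r" for A
    by (rule b.vf_secs[OF Q b.cdom_open b_total b.coord_secs[OF that]])
  have t: "pb \<eta> ?D (pb \<pi> ?B (Q ?B (coord b A)) * P A) = scl T (pb \<pi> ?B (Q ?B (coord b A)) * P A)"
    if A: "A \<in> cidx n r" for A
  proof -
    have "pb \<epsilon> ?B (Q ?B (coord b A)) = scl d (scl (s A) (Q ?B (coord b A)))"
      unfolding Qw[OF b.coord_secs[OF A]] z[OF A] b.vf_scl[OF Q b.cdom_open b_total b.coord_secs[OF A]] ..
    then have "pb \<eta> ?D (pb \<pi> ?B (Q ?B (coord b A))) = scl (d * s A) (pb \<pi> ?B (Q ?B (coord b A)))"
      unfolding inter[OF Qs[OF A]] using \<pi>.pb_scl[OF b.cdom_open Qs[OF A], of "d * s A"] by simp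
    then show ?thesis
      using \<eta>.pb_mult[OF C.cdom_open pbs[OF Qs[OF A]] conjunct1[OF p[OF A]]] p[OF A] T[OF A] by (simp add: mult.commute)
  qed
  show ?thesis
    unfolding scl_sum
    by (subst \<eta>.pb_sum[OF C.cdom_open C.secs_mult[OF C.cdom_open pbs[OF Qs] conjunct1[OF p]]])
      (auto intro: sum.cong t)
qed

lemma fun_weight_local:
  assumes h: "\<And>t. is_mor M M (h t)" and M: "superalgebra_sheaf M" and f: "f \<in> secs M (total M)"
    and loc: "\<And>x. x \<in> total M \<Longrightarrow> \<exists>D. openin (body M) D \<and> x \<in> D \<and>
      (\<forall>t. preim M (h t) D = D \<and> pb (h t) D (res D f) = scl (t ^ w) (res D f))"
  shows "fun_weight M h w f"
  unfolding fun_weight_def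
proof (intro allI ext)
  fix t x
  interpret mor_loc M M "h t" using h M by unfold_locales
  have T: "openin (body M) (total M)" by simp
  have tot: "pre (total M) = total M" using bodymap_total by (auto simp: preim_def)
  show "pb (h t) (total M) f x = scl (t ^ w) f x"
  proof (cases "x \<in> total M")
    case True
    then obtain D where D: "openin (body M) D" "x \<in> D" "pre D = D" "pb (h t) D (res D f) = scl (t ^ w) (res D f)"
      using loc[OF True] by meson
    have "res D (pb (h t) (total M) f) = res D (scl (t ^ w) f)"
      using pb_res[OF T f D(1) openin_subset[OF D(1)]] D(3,4) by simp
    then show ?thesis using D(2) by (rule res_eqD)
  next
    case False
    then show ?thesis using pb_id[OF T f] tot N.secs_id[OF T f] by (metis res_apply res_simps(7))
  qed
qed

text \<open>Each product in the local formula has one factor from a position and one from its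
  conjugate momentum. The two weights add up, and the sum is the same for all pairs.\<close>

lemma (in cotan) form_weight_canonical:
  assumes h: "\<And>t. is_mor N N (h t)"
    and loc: "\<And>z. z \<in> total N \<Longrightarrow> \<exists>c C w. chart n r M c \<and> cot_chart n r M K c C \<and> z \<in> cdom C \<and>
      (\<forall>t. preim N (h t) (cdom C) = cdom C) \<and>
      (\<forall>t. \<forall>A\<in>cidx (2 * n) (2 * r). pb (h t) (cdom C) (coord C A) = scl (t ^ w A) (coord C A)) \<and>
      (\<forall>A\<in>cidx n r. w A + w (msh n r A) = W)"
  shows "form_weight N h W (canonical_form n r M K)"
  unfolding form_weight_def
proof (intro allI impI, elim conjE)
  fix t U i j X Y X' Y'
  let ?\<omega> = "canonical_form n r M K" and ?PU = "preim N (h t) U"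
  assume U: "openin (body N) U" and X: "vfield N i U X" and Y: "vfield N j U Y"
    and X': "vfield N i ?PU X'" and Y': "vfield N j ?PU Y'"
    and rX: "related N (h t) U X' X" and rY: "related N (h t) U Y' Y"
  interpret H: mor_loc N N "h t" by unfold_locales (rule h)
  have PU: "openin (body N) ?PU" by (rule H.pre_open[OF U])
  note w = even_two_form_canonical
  have s: "?\<omega> U X Y \<in> secs N U" by (rule NS.sect_secs[OF U NS.form_sect[OF w U X Y]])
  have s': "?\<omega> ?PU X' Y' \<in> secs N ?PU" by (rule NS.sect_secs[OF PU NS.form_sect[OF w PU X' Y']])
  show "pb (h t) U (?\<omega> U X Y) = scl (t ^ W) (?\<omega> ?PU X' Y')"
  proof
    fix z
    show "pb (h t) U (?\<omega> U X Y) z = scl (t ^ W) (?\<omega> ?PU X' Y') z"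
    proof (cases "z \<in> ?PU")
      case False
      then show ?thesis using H.pb_id[OF U s] NS.secs_id[OF PU s'] by (metis res_apply res_simps(7))
    next
      case True
      then have zt: "z \<in> total N" using openin_subset[OF PU] by blast
      obtain c C v where c: "chart n r M c" and C: "cot_chart n r M K c C" and z: "z \<in> cdom C"
        and sat: "preim N (h t) (cdom C) = cdom C"
        and co: "\<And>A. A \<in> cidx (2 * n) (2 * r) \<Longrightarrow> pb (h t) (cdom C) (coord C A) = scl (t ^ v A) (coord C A)"
        and wt: "\<And>A. A \<in> cidx n r \<Longrightarrow> v A + v (msh n r A) = W"
        using loc[OF zt]
      proof (elim exE conjE)
        fix c C v
        assume a: "chart n r M c" "cot_chart n r M K c C" "z \<in> cdom C" "\<forall>t. preim N (h t) (cdom C) = cdom C"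
          "\<forall>t. \<forall>A\<in>cidx (2 * n) (2 * r). pb (h t) (cdom C) (coord C A) = scl (t ^ v A) (coord C A)"
          "\<forall>A\<in>cidx n r. v A + v (msh n r A) = W"
        show thesis
          by (rule that[OF a(1-3) spec[OF a(4)]]) (use a(5,6) in auto)
      qed
      have ch: "chart (2 * n) (2 * r) N C" and dC: "cdom C = cpre K (cdom c)" using C by (auto simp: cot_chart_def)
      interpret C: schart_loc N "2 * n" "2 * r" C by unfold_locales (rule ch)
      let ?V = "U \<inter> cdom C" and ?PV = "?PU \<inter> cdom C"
      have V: "openin (body N) ?V" "?V \<subseteq> U" "?V \<subseteq> cpre K (cdom c)" "C.sub ?V" using U dC C.cdom_open by (auto simp: C.sub_def)
      have PV: "openin (body N) ?PV" "?PV \<subseteq> ?PU" "?PV \<subseteq> cpre K (cdom c)" using PU dC C.cdom_open by auto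
      have pV: "preim N (h t) ?V = ?PV" using sat by (auto simp: preim_def)

      \<comment> \<open>Relatedness moves the pullback inside the derivative, where it multiplies
        the homogeneous coordinate by a constant.\<close>
      have key: "pb (h t) ?V (X ?V (res ?V (coord C A))) = scl (t ^ v A) (X' ?PV (res ?PV (coord C A)))"
        if A: "A \<in> cidx (2 * n) (2 * r)" and X: "vfield N i U X" and X': "vfield N i ?PU X'" and r: "related N (h t) U X' X" for A i X X'
      proof -
        have cs: "res ?V (coord C A) \<in> secs N ?V" by (rule NS.sect_secs[OF V(1) C.coord_res_sect[OF A V(4)]])
        have "pb (h t) ?V (X ?V (res ?V (coord C A))) = X' (preim N (h t) ?V) (pb (h t) ?V (res ?V (coord C A)))"
          by (rule r[unfolded related_def, rule_format, OF conjI[OF V(1) conjI[OF V(2) cs]], symmetric])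
        also have "pb (h t) ?V (res ?V (coord C A)) = res ?PV (pb (h t) (cdom C) (coord C A))"
          using H.pb_res[OF C.cdom_open C.coord_secs[OF A] V(1)] pV by simp
        also have "\<dots> = scl (t ^ v A) (res ?PV (coord C A))" unfolding co[OF A] by simp
        also have "X' (preim N (h t) ?V) (scl (t ^ v A) (res ?PV (coord C A))) = scl (t ^ v A) (X' ?PV (res ?PV (coord C A)))"
          unfolding pV
          by (rule NS.vf_scl[OF X' PV(1,2) NS.secs_res[OF C.cdom_open C.coord_secs[OF A] PV(1)]]) auto
        finally show ?thesis .
      qed
      have Vs: "X ?V (res ?V (coord C A)) \<in> secs N ?V" if "A \<in> cidx (2 * n) (2 * r)" "vfield N i U X" for A i X
        by (rule NS.vf_secs[OF that(2) V(1,2) NS.sect_secs[OF V(1) C.coord_res_sect[OF that(1) V(4)]]])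
      note vX = NS.vfield_vres[OF X V(1,2)] and vY = NS.vfield_vres[OF Y V(1,2)]
      note vX' = NS.vfield_vres[OF X' PV(1,2)] and vY' = NS.vfield_vres[OF Y' PV(1,2)]
      let ?q = "\<lambda>A. coord C A" and ?p = "\<lambda>A. coord C (msh n r A)"
      have l: "?\<omega> ?V (vres ?V X) (vres ?V Y) = (\<Sum>A\<in>cidx n r. dterm (fst A) i j ?V X Y (?q A) (?p A))"
        unfolding canonical_form_local[OF c V(1,3) vX vY]
        by (rule sum.cong[OF refl]) (simp add: cot_chart_coord[OF C] dterm_def vres_apply)
      have l': "?\<omega> ?PV (vres ?PV X') (vres ?PV Y') = (\<Sum>A\<in>cidx n r. dterm (fst A) i j ?PV X' Y' (?q A) (?p A))"
        unfolding canonical_form_local[OF c PV(1,3) vX' vY']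
        by (rule sum.cong[OF refl]) (simp add: cot_chart_coord[OF C] dterm_def vres_apply)
      have dt: "dterm (fst A) i j ?V X Y (?q A) (?p A) \<in> secs N ?V"
        "pb (h t) ?V (dterm (fst A) i j ?V X Y (?q A) (?p A)) = scl (t ^ W) (dterm (fst A) i j ?PV X' Y' (?q A) (?p A))"
        if A: "A \<in> cidx n r" for A
      proof -
        note q = cidx_subset[OF A] and p = msh_cidx[OF A]
        note ss = Vs[OF q X] Vs[OF q Y] Vs[OF p X] Vs[OF p Y]
        note kk = key[OF q X X' rX] key[OF q Y Y' rY] key[OF p X X' rX] key[OF p Y Y' rY]
        show "dterm (fst A) i j ?V X Y (?q A) (?p A) \<in> secs N ?V"
          unfolding dterm_def by (intro NS.secs_diff NS.secs_scl NS.secs_mult V(1) ss)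
        have tw: "t ^ v A * t ^ v (msh n r A) = t ^ W" "t ^ v (msh n r A) * t ^ v A = t ^ W"
          using wt[OF A] by (simp_all flip: power_add add: add.commute)
        have m: "pb (h t) ?V (Y ?V (res ?V (?q A)) * X ?V (res ?V (?p A))) =
            scl (t ^ W) (Y' ?PV (res ?PV (?q A)) * X' ?PV (res ?PV (?p A)))"
          "pb (h t) ?V (X ?V (res ?V (?q A)) * Y ?V (res ?V (?p A))) =
            scl (t ^ W) (X' ?PV (res ?PV (?q A)) * Y' ?PV (res ?PV (?p A)))"
          unfolding H.pb_mult[OF V(1) ss(2,3)] H.pb_mult[OF V(1) ss(1,4)] kk by (simp_all add: tw)
        show "pb (h t) ?V (dterm (fst A) i j ?V X Y (?q A) (?p A)) = scl (t ^ W) (dterm (fst A) i j ?PV X' Y' (?q A) (?p A))"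
          unfolding dterm_def
          by (subst H.pb_diff[OF V(1)])
            (auto intro!: NS.secs_scl NS.secs_mult V(1) ss simp: H.pb_scl[OF V(1)] NS.secs_mult[OF V(1)] ss m scl_diff mult.commute)
      qed
      have "res ?PV (pb (h t) U (?\<omega> U X Y)) = pb (h t) ?V (res ?V (?\<omega> U X Y))"
        using H.pb_res[OF U s V(1,2)] pV by simp
      also have "res ?V (?\<omega> U X Y) = ?\<omega> ?V (vres ?V X) (vres ?V Y)"
        by (rule NS.form_res[OF w U X Y V(1,2), symmetric])
      also have "pb (h t) ?V (?\<omega> ?V (vres ?V X) (vres ?V Y)) = (\<Sum>A\<in>cidx n r. scl (t ^ W) (dterm (fst A) i j ?PV X' Y' (?q A) (?p A)))"
        unfolding l using H.pb_sum[OF V(1) dt(1), of "cidx n r" "\<lambda>A. A"] sum.cong[OF refl dt(2)] by (simp only:)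
      also have "\<dots> = scl (t ^ W) (?\<omega> ?PV (vres ?PV X') (vres ?PV Y'))" unfolding l' scl_sum ..
      also have "?\<omega> ?PV (vres ?PV X') (vres ?PV Y') = res ?PV (?\<omega> ?PU X' Y')"
        by (rule NS.form_res[OF w PU X' Y' PV(1,2)])
      finally have "res ?PV (pb (h t) U (?\<omega> U X Y)) = res ?PV (scl (t ^ W) (?\<omega> ?PU X' Y'))" by simp
      then show ?thesis by (rule res_eqD) (use True z in auto)
    qed
  qed
qed

lemma (in ssheaf) fun_weight_add_weights:
  assumes e: "\<And>t. endo (h t)" "\<And>t. endo (l t)" and f: "f \<in> secs M (total M)"
    and h: "fun_weight M h w f" and l: "fun_weight M l w' f"
  shows "fun_weight M (add_weights M h l) (w + w') f"
  unfolding fun_weight_def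
proof
  fix t
  interpret H: mor_loc M M "h t" by (rule endo_mor[OF e(1)])
  interpret L: mor_loc M M "l t" by (rule endo_mor[OF e(2)])
  have T: "openin (body M) (total M)" by simp
  have tot: "H.pre (total M) = total M" using H.bodymap_total by (auto simp: preim_def)
  show "pb (add_weights M h l t) (total M) f = scl (t ^ (w + w')) f"
    using h l L.pb_scl[OF T f] by (simp add: add_weights_def pb_mcomp tot fun_weight_def power_add)
qed

lemma (in ssheaf) fun_weight_add:
  assumes e: "\<And>t. endo (h t)" and f: "f \<in> secs M (total M)" and g: "g \<in> secs M (total M)"
    and fw: "fun_weight M h w f" and gw: "fun_weight M h w g"
  shows "fun_weight M h w (f + g)"
  unfolding fun_weight_def
proof
  fix t
  interpret H: mor_loc M M "h t" by (rule endo_mor[OF e])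
  have T: "openin (body M) (total M)" by simp
  show "pb (h t) (total M) (f + g) = scl (t ^ w) (f + g)"
    unfolding H.pb_add[OF T f g] using fw gw by (simp add: fun_weight_def scl_add)
qed

text \<open>The local condition speaks of every solution \<open>X\<close> over \<open>D\<close>, not
  of the global field, so that it can be verified in a Darboux chart.\<close>

lemma (in ssheaf) poisson_zero_local:
  assumes w: "even_two_form M \<omega>" and nd: "nondegenerate M \<omega>" and f: "f \<in> sect M i (total M)"
    and loc: "\<And>x. x \<in> total M \<Longrightarrow> \<exists>D. openin (body M) D \<and> x \<in> D \<and>
      (\<forall>X. vfield M i D X \<and> (\<forall>j Y. vfield M j D Y \<longrightarrow> \<omega> D Y X = Y D (res D f)) \<longrightarrow> X D (res D f) = 0)"
  shows "poisson M \<omega> f f = 0"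
proof
  fix x
  let ?X = "ham_vf M \<omega> f" and ?T = "total M"
  have T: "openin (body M) ?T" by simp
  note X = ham_vf_props[OF w nd f]
  note fs = sect_secs[OF T f]
  show "poisson M \<omega> f f x = 0 x"
  proof (cases "x \<in> ?T")
    case True
    then obtain D where D: "openin (body M) D" "x \<in> D"
      and z: "\<And>X. vfield M i D X \<Longrightarrow> (\<forall>j Y. vfield M j D Y \<longrightarrow> \<omega> D Y X = Y D (res D f)) \<Longrightarrow> X D (res D f) = 0"
      using loc[OF True] by blast
    note DT = openin_subset[OF D(1)]
    have "res D (?X ?T f) = ?X D (res D f)" by (rule vf_res[OF X(1) T subset_refl fs D(1) DT, symmetric])
    also have "\<dots> = vres D ?X D (res D f)" by (simp add: vres_apply)
    also have "\<dots> = 0" by (rule z[OF vfield_vres[OF X(1) D(1) DT]]) (use X(2)[OF D(1)] in blast)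
    finally have "res D (?X ?T f) = res D 0" by simp
    then have "?X ?T f x = 0" using D(2) res_eqD by (metis zero_fun_def)
    then show ?thesis by (simp add: poisson_def)
  next
    case False
    have "res ?T (?X ?T f) = ?X ?T f" by (rule vf_id[OF X(1) T subset_refl fs])
    from fun_cong[OF this, of x] show ?thesis using False by (simp add: poisson_def res_apply)
  qed
qed

text \<open>The three exponents in \<open>W\<close> belong to the field, to the coordinate that it
  differentiates and to the conjugate momentum. The numbering \<open>\<sigma>\<close> is left
  general so that both Hamiltonians are covered.\<close>

lemma (in darboux) hamiltonian_weight:
  fixes M0 :: "('y, 'h::real_algebra_1) sspace"
  assumes \<pi>: "mor_loc N M0 \<pi>" and b: "schart_loc M0 n r b" and dom: "cdom C = preim N \<pi> (cdom b)"
    and Q: "vfield M0 i (total M0) Q"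
    and q: "\<And>A. A \<in> cidx n r \<Longrightarrow> coord C (\<sigma> False A) = pb \<pi> (cdom b) (coord b A)"
    and h: "homogeneity_structure d0 (2 * n) (2 * r) N h" and w: "hom_chart (2 * n) (2 * r) N h C w"
    and \<epsilon>: "is_mor M0 M0 \<epsilon>" "preim M0 \<epsilon> (cdom b) = cdom b"
    and z: "\<And>A. A \<in> cidx n r \<Longrightarrow> pb \<epsilon> (cdom b) (coord b A) = scl (t ^ w (\<sigma> False A)) (coord b A)"
    and Qw: "\<And>f. f \<in> secs M0 (cdom b) \<Longrightarrow> pb \<epsilon> (cdom b) (Q (cdom b) f) = scl (t ^ e) (Q (cdom b) (pb \<epsilon> (cdom b) f))"
    and W: "\<And>A. A \<in> cidx n r \<Longrightarrow> e + w (\<sigma> False A) + w (\<sigma> True A) = W"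
    and H: "H = (\<Sum>A\<in>cidx n r. pb \<pi> (cdom b) (Q (cdom b) (coord b A)) * coord C (\<sigma> True A))"
  shows "pb (h t) (cdom C) H = scl (t ^ W) H"
proof -
  note pbw = hom_chart_pb[OF h w]
  let ?s = "\<lambda>A. t ^ w (\<sigma> False A)" and ?s' = "\<lambda>A. t ^ w (\<sigma> True A)"
    and ?P = "\<lambda>A. coord C (\<sigma> True A)" and ?k = "\<lambda>a. snd (\<sigma> False (False, a))"
  have C: "schart_loc N (2 * n) (2 * r) C" by unfold_locales
  have m: "is_mor N M0 \<pi>" using \<pi> by (rule mor_loc.mor)
  have \<eta>: "is_mor N N (h t)" using h by (simp add: homogeneity_structure_def monoid_action_def)
  have pre: "preim N (h t) (cdom C) = cdom C" by (rule hom_chart_saturated[OF h w])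
  have pure: "pb \<pi> (cdom b) (coord b (False, a)) = coord C (False, ?k a)" if "a < n" for a
  proof -
    have A: "(False, a) \<in> cidx n r" using that by (simp add: cidx_def)
    have "(False, snd (\<sigma> False (False, a))) = \<sigma> False (False, a)" using \<sigma>_fst[OF A, of False] by (simp add: prod_eq_iff)
    then show ?thesis using q[OF A] by simp
  qed
  have 1: "pb (h t) (cdom C) (pb \<pi> (cdom b) (coord b A)) = scl (?s A) (pb \<pi> (cdom b) (coord b A))"
    if "A \<in> cidx n r" for A
    using pbw[OF \<sigma>_cidx[OF that, of False]] q[OF that] by simp
  have 2: "?P A \<in> secs N (cdom C) \<and> pb (h t) (cdom C) (?P A) = scl (?s' A) (?P A)" if "A \<in> cidx n r" for A
    using pbw[OF \<sigma>_cidx[OF that, of True]] coord_secs[OF \<sigma>_cidx[OF that]] by blast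
  have 3: "t ^ e * ?s A * ?s' A = t ^ W" if "A \<in> cidx n r" for A
    using W[OF that] by (simp flip: power_add)
  show ?thesis
    unfolding H
    by (rule pb_hamiltonian[where k = ?k and s = ?s and s' = ?s' and P = ?P and T = "t ^ W" and d = "t ^ e" and Q = Q
          and \<pi> = \<pi> and \<eta> = "h t" and \<epsilon> = \<epsilon> and n = n and r = r and C = C and b = b and i = i,
          OF C b m dom \<eta> pre \<epsilon> pure 1 z 2 Q Qw 3])
qed

lemma (in cotan) hamiltonian_local:
  assumes c: "chart n r M c" and Q: "vfield M i (total M) Q"
  shows "res (cpre K (cdom c)) (csym K (total M) Q) =
    (\<Sum>A\<in>cidx n r. pb (cpr K) (cdom c) (Q (cdom c) (coord c A)) * mom n r M K c A)"
proof -
  interpret c: schart_loc M n r c by (rule chart_schart[OF c])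
  let ?B = "cdom c"
  have T: "openin (body M) (total M)" by simp
  note B = c.cdom_open openin_subset[OF c.cdom_open]
  have "res (cpre K ?B) (csym K (total M) Q) = csym K ?B (vres ?B Q)"
    by (rule csym_res[OF T Q B, symmetric])
  also have "\<dots> = (\<Sum>A\<in>cidx n r. pb (cpr K) ?B (vres ?B Q ?B (res ?B (coord c A))) * res (cpre K ?B) (mom n r M K c A))"
    by (rule csym_local[OF c c.cdom_open subset_refl MS.vfield_vres[OF Q B]])
  also have "\<dots> = (\<Sum>A\<in>cidx n r. pb (cpr K) ?B (Q ?B (coord c A)) * mom n r M K c A)"
  proof (rule sum.cong[OF refl])
    fix A assume A: "A \<in> cidx n r"
    show "pb (cpr K) ?B (vres ?B Q ?B (res ?B (coord c A))) * res (cpre K ?B) (mom n r M K c A) =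
        pb (cpr K) ?B (Q ?B (coord c A)) * mom n r M K c A"
      unfolding MS.secs_id[OF c.cdom_open c.coord_secs[OF A]] NS.sect_id[OF cpre_open[OF c] mom_sect[OF c A]]
      by (simp add: vres_apply)
  qed
  finally show ?thesis .
qed

section \<open>Parity reversal\<close>

locale lie_algebroid =
  fixes k n r :: nat and L :: "('x, 'g::real_algebra_1) wla"
  assumes algebroid: "weighted_lie_algebroid k n r L"
begin

abbreviation "E \<equiv> tot L"
abbreviation "M \<equiv> pim L"
abbreviation "B \<equiv> base E (lact L)"
abbreviation "bchart \<equiv> bundle_chart k n r E (hact L) (lact L)"
abbreviation "pchart c \<equiv> pi_chart n E (lact L) (pemb L) c"

lemma k_pos: "1 \<le> k"
  and hact: "homogeneity_structure (k - 1) (n + r) 0 E (hact L)"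
  and lact: "homogeneity_structure 1 (n + r) 0 E (lact L)"
  using algebroid by (auto simp: weighted_lie_algebroid_def gl_bundle_def double_graded_def)

lemma reversal: "parity_reversal k n r E (hact L) (lact L) M (pemb L) (phact L) (plact L)"
  using algebroid by (simp add: weighted_lie_algebroid_def)

lemma homological: "homological M (hvf L)"
  and hvf: "vfield M True (total M) (hvf L)"
  using algebroid by (auto simp: weighted_lie_algebroid_def homological_def)

lemma
  assumes U: "openin (body M) U" and f: "f \<in> secs M U"
  shows hvf_phact: "pb (phact L t) U (hvf L U f) = scl (t ^ 0) (hvf L (preim M (phact L t) U) (pb (phact L t) U f))"
    and hvf_plact: "pb (plact L t) U (hvf L U f) = scl (t ^ 1) (hvf L (preim M (plact L t) U) (pb (plact L t) U f))"
  using algebroid U f unfolding weighted_lie_algebroid_def vf_weight_def by blast+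

lemma atlas: "x \<in> B \<Longrightarrow> \<exists>c u. bchart c u \<and> x \<in> cdom c"
  and sman: "supermanifold n r M"
  and body: "body M = subtopology (body E) B"
  and chart: "bchart c u \<Longrightarrow> chart n r M (pchart c)"
  and actions: "monoid_action M (phact L)" "monoid_action M (plact L)"
  using reversal by (auto simp: parity_reversal_def)

lemma bodymap_lact: "x \<in> total E \<Longrightarrow> bodymap (lact L t) x \<in> total E"
  using lact by (auto simp: homogeneity_structure_def monoid_action_def is_mor_def continuous_map_def)

lemma total: "total M = B" and base_total: "B \<subseteq> total E"
  using body bodymap_lact by (auto simp: base_def)

lemma reversed_action:
  assumes e: "(e, eM) \<in> {(hact L, phact L), (lact L, plact L)}"
  shows "x \<in> B \<Longrightarrow> bodymap (eM t) x = bodymap (e t) x"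
    and "openin (body M) U \<Longrightarrow> w \<le> 1 \<Longrightarrow> f \<in> fibre_funs E (lact L) w U \<Longrightarrow>
      pb (eM t) U (pemb L U f) = pemb L (preim M (eM t) U) (pb (e t) (preim E (lact L 0) U) f)"
proof -
  note p = reversal[unfolded parity_reversal_def, THEN conjunct2, THEN conjunct2, THEN conjunct2,
      THEN conjunct2, THEN conjunct2, THEN conjunct2, THEN conjunct2, THEN conjunct2, rule_format, OF e, unfolded prod.case, rule_format, of t]
  show "x \<in> B \<Longrightarrow> bodymap (eM t) x = bodymap (e t) x" by (rule p[THEN conjunct1, rule_format])
  show "openin (body M) U \<Longrightarrow> w \<le> 1 \<Longrightarrow> f \<in> fibre_funs E (lact L) w U \<Longrightarrow>
      pb (eM t) U (pemb L U f) = pemb L (preim M (eM t) U) (pb (e t) (preim E (lact L 0) U) f)"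
    by (rule p[THEN conjunct2, rule_format, OF conjI[OF _ conjI]])
qed

lemma pemb_scl:
  "openin (body M) U \<Longrightarrow> w \<le> 1 \<Longrightarrow> f \<in> fibre_funs E (lact L) w U \<Longrightarrow> pemb L U (scl s f) = scl s (pemb L U f)"
  using reversal[unfolded parity_reversal_def, THEN conjunct2, THEN conjunct2, THEN conjunct2, THEN conjunct1,
      rule_format, THEN conjunct2, rule_format, OF _ conjI] by blast

text \<open>The slot that a coordinate of the parity reversal occupies among the
  \<open>n + r\<close> coordinates of the bundle, where the linear ones follow those of the
  base.\<close>

definition ix :: "bool \<times> nat \<Rightarrow> nat" where
  "ix A = (if fst A then n + snd A else snd A)"

lemma ix_cidx: "A \<in> cidx n r \<Longrightarrow> (False, ix A) \<in> cidx (n + r) 0"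
  by (auto simp: cidx_def ix_def)

context
  fixes c u assumes c: "bchart c u"
begin

lemma hom_charts: "hom_chart (n + r) 0 E (hact L) c (\<lambda>A. u (snd A))"
    "hom_chart (n + r) 0 E (lact L) c (\<lambda>A. if snd A < n then 0 else 1)"
  and u_le: "a < n + r \<Longrightarrow> u a \<le> k - 1"
  using c by (auto simp: bundle_chart_def)

interpretation c: schart_loc E "n + r" 0 c
  using hact hom_charts(1) by unfold_locales (auto simp: homogeneity_structure_def supermanifold_def hom_chart_def)

interpretation b: schart_loc M n r "pchart c"
  using sman chart[OF c] by unfold_locales (auto simp: supermanifold_def)

lemma cdom_pchart: "cdom (pchart c) = cdom c \<inter> B"
  by (simp add: pi_chart_def)

text \<open>The domain is saturated under \<open>lact L 0\<close>, the projection onto the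
  base.\<close>

lemma preim_lact_zero: "preim E (lact L 0) (cdom c \<inter> B) = cdom c"
  using hom_chart_saturated[OF lact hom_charts(2), of 0] by (auto simp: preim_def base_def)

text \<open>The truncation in \<open>pi_chart\<close> is invisible to even coordinates, because it
  leaves the first \<open>n\<close> slots alone.\<close>

lemma coord_pchart:
  assumes A: "A \<in> cidx n r"
  shows "coord (pchart c) A = pemb L (cdom c \<inter> B) (coord c (False, ix A))"
proof (cases "fst A")
  case True
  then show ?thesis by (simp add: coord_def pi_chart_def ix_def)
next
  case False
  then have "(\<lambda>v. trunc n v (snd A)) = (\<lambda>v. v (snd A))" using A by (auto simp: trunc_def cidx_def)
  then show ?thesis using False preim_lact_zero by (simp add: coord_def pi_chart_def ix_def)
qed

lemma coord_fibre:
  assumes A: "A \<in> cidx n r"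
  shows "coord c (False, ix A) \<in> fibre_funs E (lact L) (if fst A then 1 else 0) (cdom c \<inter> B)"
proof -
  have "pb (lact L t) (cdom c) (coord c (False, ix A)) = scl (t ^ (if fst A then 1 else 0)) (coord c (False, ix A))" for t
    using hom_chart_pb[OF lact hom_charts(2) ix_cidx[OF A], of t] A by (auto simp: cidx_def ix_def)
  moreover have "coord c (False, ix A) \<in> sect E False (cdom c)" using c.coord_sect[OF ix_cidx[OF A]] by simp
  ultimately show ?thesis unfolding fibre_funs_def preim_lact_zero by blast
qed

text \<open>The parity reversal respects the actions on basic and on fibrewise linear functions, and
  each bundle coordinate is of one of these two kinds.\<close>

lemma reversed_action_chart:
  assumes e: "(e, eM) \<in> {(hact L, phact L), (lact L, plact L)}"
    and hs: "homogeneity_structure d (n + r) 0 E e" and hc: "hom_chart (n + r) 0 E e c w"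
  shows "preim M (eM t) (cdom (pchart c)) = cdom (pchart c)"
    and "A \<in> cidx n r \<Longrightarrow> pb (eM t) (cdom (pchart c)) (coord (pchart c) A) = scl (t ^ w (False, ix A)) (coord (pchart c) A)"
proof -
  have eM: "is_mor M M (eM t)" using e actions by (auto simp: monoid_action_def)
  have mB: "bodymap (eM t) x \<in> B" if "x \<in> B" for x
    using eM that unfolding is_mor_def continuous_map_def total by auto
  show pre: "preim M (eM t) (cdom (pchart c)) = cdom (pchart c)"
    using reversed_action(1)[OF e] mB hom_chart_saturated[OF hs hc, of t] base_total
    unfolding cdom_pchart preim_def total by auto
  assume A: "A \<in> cidx n r"
  have o: "openin (body M) (cdom c \<inter> B)" using b.cdom_open unfolding cdom_pchart .
  have w1: "(if fst A then 1 else 0 :: nat) \<le> 1" by simp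
  show "pb (eM t) (cdom (pchart c)) (coord (pchart c) A) = scl (t ^ w (False, ix A)) (coord (pchart c) A)"
    using reversed_action(2)[OF e o w1 coord_fibre[OF A], of t] pre hom_chart_pb[OF hs hc ix_cidx[OF A], of t]
      pemb_scl[OF o w1 coord_fibre[OF A]]
    unfolding coord_pchart[OF A] cdom_pchart preim_lact_zero by simp
qed

lemmas phact_chart = reversed_action_chart[OF _ hact hom_charts(1), of "phact L", simplified]
lemmas plact_chart = reversed_action_chart[OF _ lact hom_charts(2), of "plact L", simplified]

end

end

section \<open>Lie bialgebroids\<close>

locale lie_bialgebroid =
  fixes k n r :: nat
    and L :: "('x, 'g::real_algebra_1) wla"
    and L' :: "('y, 'h::real_algebra_1) wla"
    and \<beta> :: "'x \<Rightarrow> 'y"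
    and pr :: "'x \<Rightarrow> 'y \<Rightarrow> real"
    and K :: "('z, 's::real_algebra_1, 'x, 'g) cot"
    and K' :: "('w, 'q::real_algebra_1, 'y, 'h) cot"
    and R :: "('z, 's, 'w, 'q) smor"
    and h1 h2 h3 :: "('z, 's) saction"
  assumes bialgebroid: "weighted_lie_bialgebroid k n r L L' \<beta> pr K K' R"
    and triweight: "natural_triweight k n r L K h1 h2 h3"
begin

sublocale A: lie_algebroid k n r L
  using bialgebroid by unfold_locales (simp add: weighted_lie_bialgebroid_def)

sublocale A': lie_algebroid k n r L'
  using bialgebroid by unfold_locales (simp add: weighted_lie_bialgebroid_def)

sublocale K: cotan n r "pim L" K
  using bialgebroid A.sman by unfold_locales (simp_all add: weighted_lie_bialgebroid_def)

sublocale K': cotan n r "pim L'" K'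
  using bialgebroid A'.sman by unfold_locales (simp_all add: weighted_lie_bialgebroid_def)

sublocale R: mor_loc "csp K" "csp K'" R
  using bialgebroid by unfold_locales (simp add: weighted_lie_bialgebroid_def canonical_iso_def)

abbreviation "N \<equiv> csp K"
abbreviation "\<omega> \<equiv> canonical_form n r (pim L) K"
abbreviation "Q \<equiv> hamiltonian K L"
abbreviation "S \<equiv> dual_hamiltonian R K' L'"
abbreviation "dcharts \<equiv> dual_charts k n r (tot L) (hact L) (lact L) (tot L') (hact L') (lact L') \<beta> pr"

lemma canonical: "canonical_iso k n r L L' \<beta> pr K K' R"
  and dual: "dual_bundle k n r (tot L) (hact L) (lact L) (tot L') (hact L') (lact L') \<beta> pr"
  and QS: "poisson N \<omega> Q S = 0"
  using bialgebroid by (simp_all add: weighted_lie_bialgebroid_def)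

lemma actions: "monoid_action N h1" "monoid_action N h2" "monoid_action N h3"
  and commute: "commuting N h1 h2" "commuting N h1 h3" "commuting N h2 h3"
  and tri_charts: "A.bchart c u \<Longrightarrow> cot_chart n r (pim L) K (A.pchart c) C \<Longrightarrow>
    hom_chart (2 * n) (2 * r) N h1 C (\<lambda>A. fst (tri_weight k n r u A)) \<and>
    hom_chart (2 * n) (2 * r) N h2 C (\<lambda>A. fst (snd (tri_weight k n r u A))) \<and>
    hom_chart (2 * n) (2 * r) N h3 C (\<lambda>A. snd (snd (tri_weight k n r u A)))"
  using triweight unfolding natural_triweight_def by blast+

lemma mors: "is_mor N N (h1 t)" "is_mor N N (h2 t)" "is_mor N N (h3 t)"
  using actions by (simp_all add: monoid_action_def)

lemma inj_\<beta>: "inj_on \<beta> A.B"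
proof -
  have "topspace (subtopology (body (tot L)) A.B) = A.B" using A.base_total by auto
  then show ?thesis
    using dual homeomorphic_imp_injective_map unfolding dual_bundle_def by metis
qed

lemma bodymap_R: "z \<in> total N \<Longrightarrow> bodymap (cpr K') (bodymap R z) = \<beta> (bodymap (cpr K) z)"
  using canonical by (simp add: canonical_iso_def)

lemma
  assumes d: "dcharts c u c' u'"
  defines "U \<equiv> cpre K' (cdom (A'.pchart c'))"
  shows pb_R_even: "a < n \<Longrightarrow> pb R U (pos K' (A'.pchart c') (False, a)) = pos K (A.pchart c) (False, a)"
      "a < n \<Longrightarrow> pb R U (mom n r (pim L') K' (A'.pchart c') (False, a)) = mom n r (pim L) K (A.pchart c) (False, a)"
    and pb_R_odd: "j < r \<Longrightarrow> pb R U (pos K' (A'.pchart c') (True, j)) = mom n r (pim L) K (A.pchart c) (True, j)"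
      "j < r \<Longrightarrow> pb R U (mom n r (pim L') K' (A'.pchart c') (True, j)) = pos K (A.pchart c) (True, j)"
proof -
  note x = canonical[unfolded canonical_iso_def Let_def, THEN conjunct2, THEN conjunct2, THEN conjunct2,
      rule_format, OF d, folded U_def]
  show "a < n \<Longrightarrow> pb R U (pos K' (A'.pchart c') (False, a)) = pos K (A.pchart c) (False, a)"
      "a < n \<Longrightarrow> pb R U (mom n r (pim L') K' (A'.pchart c') (False, a)) = mom n r (pim L) K (A.pchart c) (False, a)"
    using x[THEN conjunct1] by auto
  show "j < r \<Longrightarrow> pb R U (pos K' (A'.pchart c') (True, j)) = mom n r (pim L) K (A.pchart c) (True, j)"
      "j < r \<Longrightarrow> pb R U (mom n r (pim L') K' (A'.pchart c') (True, j)) = pos K (A.pchart c) (True, j)"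
    using x[THEN conjunct2] by auto
qed

text \<open>One domain carries a canonical chart over \<open>c\<close> together with dual
  coordinates \<open>c'\<close>; both Hamiltonians are studied in it.\<close>

lemma ex_adapted:
  assumes z: "z \<in> total N"
  shows "\<exists>c u c' u' C. dcharts c u c' u' \<and> cot_chart n r (pim L) K (A.pchart c) C \<and> z \<in> cdom C"
proof -
  let ?x = "bodymap (cpr K) z"
  have x: "?x \<in> A.B" using K.P.bodymap_total[OF z] A.total by simp
  obtain c u where c: "A.bchart c u" "?x \<in> cdom c" using A.atlas[OF x] by blast
  obtain c' u' where d: "dcharts c u c' u'" using dual c(1) unfolding dual_bundle_def by blast
  obtain C where C: "cot_chart n r (pim L) K (A.pchart c) C" using K.ex_cot_chart[OF A.chart[OF c(1)]] by blast
  have "z \<in> cdom C" using C c(2) x z by (simp add: cot_chart_def A.cdom_pchart[OF c(1)] preim_def)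
  then show ?thesis using d C by blast
qed

section \<open>Weights in the canonical charts\<close>

lemma tri_weight_pos:
  "A \<in> cidx n r \<Longrightarrow> tri_weight k n r u A = (u (A.ix A), if fst A then 1 else 0, 0)"
  and tri_weight_mom:
  "A \<in> cidx n r \<Longrightarrow> tri_weight k n r u (msh n r A) = (k - 1 - u (A.ix A), if fst A then 0 else 1, 1)"
  by (auto simp: cidx_def tri_weight_def msh_def A.ix_def)

lemma ix_less: "A \<in> cidx n r \<Longrightarrow> A.ix A < n + r"
  by (auto simp: cidx_def A.ix_def)

lemma cidx_cases:
  assumes "B \<in> cidx (2 * n) (2 * r)"
  obtains A where "A \<in> cidx n r" "B = A" | A where "A \<in> cidx n r" "B = msh n r A"
proof (cases "B \<in> cidx n r")
  case False
  let ?A = "(fst B, snd B - (if fst B then r else n))"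
  have "?A \<in> cidx n r" "B = msh n r ?A" using assms False by (auto simp: cidx_def msh_def prod_eq_iff)
  then show ?thesis using that by blast
qed (use that in blast)

abbreviation "w1 u \<equiv> \<lambda>A. fst (tri_weight k n r u A)"
abbreviation "w2 u \<equiv> \<lambda>A. fst (snd (tri_weight k n r u A))"
abbreviation "w3 u \<equiv> \<lambda>A. snd (snd (tri_weight k n r u A))"
abbreviation "hl \<equiv> add_weights N h2 h3"

lemma action_hl: "monoid_action N hl"
  by (rule K.NS.monoid_action_add_weights[OF actions(2,3) commute(3)])

lemma sman: "supermanifold (2 * n) (2 * r) N"
  using K.cotangent by (simp add: cotangent_def)

lemma tri_chart:
  assumes c: "A.bchart c u" and C: "cot_chart n r (pim L) K (A.pchart c) C"
  shows "hom_chart (2 * n) (2 * r) N h1 C (w1 u)" "hom_chart (2 * n) (2 * r) N h2 C (w2 u)"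
    "hom_chart (2 * n) (2 * r) N h3 C (w3 u)" "hom_chart (2 * n) (2 * r) N hl C (\<lambda>A. w2 u A + w3 u A)"
proof -
  note t = tri_charts[OF c C]
  show "hom_chart (2 * n) (2 * r) N h1 C (w1 u)" by (rule t[THEN conjunct1])
  show 2: "hom_chart (2 * n) (2 * r) N h2 C (w2 u)" by (rule t[THEN conjunct2, THEN conjunct1])
  show 3: "hom_chart (2 * n) (2 * r) N h3 C (w3 u)" by (rule t[THEN conjunct2, THEN conjunct2])
  show "hom_chart (2 * n) (2 * r) N hl C (\<lambda>A. w2 u A + w3 u A)"
    by (rule K.NS.hom_chart_add_weights[OF mors(2,3) 2 3])
qed

lemma weight_bounds:
  assumes "B \<in> cidx (2 * n) (2 * r)"
  shows "A.bchart c u \<Longrightarrow> w1 u B \<le> k - 1" "w2 u B \<le> 1" "w3 u B \<le> 1"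
    "w2 u B + w3 u B \<le> 2" "odd (w2 u B + w3 u B) \<longleftrightarrow> fst B"
proof -
  have u: "u (A.ix A) \<le> k - 1" if "A.bchart c u" "A \<in> cidx n r" for A
    by (rule A.u_le[OF that(1) ix_less[OF that(2)]])
  show "A.bchart c u \<Longrightarrow> w1 u B \<le> k - 1"
    using assms by (cases rule: cidx_cases) (simp_all add: tri_weight_pos tri_weight_mom u del: One_nat_def)
  show "w2 u B \<le> 1" "w3 u B \<le> 1" "w2 u B + w3 u B \<le> 2" "odd (w2 u B + w3 u B) \<longleftrightarrow> fst B"
    using assms by (cases rule: cidx_cases; simp add: tri_weight_pos tri_weight_mom)+
qed

lemma dcharts_bchart: "dcharts c u c' u' \<Longrightarrow> A.bchart c u" "dcharts c u c' u' \<Longrightarrow> A'.bchart c' u'"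
  by (simp_all add: dual_charts_def)

text \<open>\<open>h2\<close> and \<open>h3\<close> are kept apart here because each Hamiltonian has
  different weights for them; only the sum \<open>hl\<close> treats both Hamiltonians alike.\<close>

lemma homogeneity:
  shows "homogeneity_structure (k - 1) (2 * n) (2 * r) N h1" "homogeneity_structure 1 (2 * n) (2 * r) N h2"
    "homogeneity_structure 1 (2 * n) (2 * r) N h3" "homogeneity_structure 2 (2 * n) (2 * r) N hl"
proof -
  have *: "homogeneity_structure d (2 * n) (2 * r) N h"
    if "monoid_action N h"
      and w: "\<And>c u C. A.bchart c u \<Longrightarrow> cot_chart n r (pim L) K (A.pchart c) C \<Longrightarrow> hom_chart (2 * n) (2 * r) N h C (w u)"
        "\<And>c u B. A.bchart c u \<Longrightarrow> B \<in> cidx (2 * n) (2 * r) \<Longrightarrow> w u B \<le> d" for d h w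
  proof (rule homogeneity_structureI[OF sman that(1)])
    fix z assume "z \<in> total N"
    then obtain c u c' u' C where "dcharts c u c' u'" and C: "cot_chart n r (pim L) K (A.pchart c) C" "z \<in> cdom C"
      using ex_adapted by blast
    then have c: "A.bchart c u" using dcharts_bchart by blast
    show "\<exists>c w. hom_chart (2 * n) (2 * r) N h c w \<and> z \<in> cdom c \<and> (\<forall>A\<in>cidx (2 * n) (2 * r). w A \<le> d)"
      using w(1)[OF c C(1)] w(2)[OF c] C(2) by blast
  qed
  show "homogeneity_structure (k - 1) (2 * n) (2 * r) N h1"
    by (rule *[of h1 w1, OF actions(1) tri_chart(1) weight_bounds(1)])
  show "homogeneity_structure 1 (2 * n) (2 * r) N h2"
    by (rule *[of h2 w2, OF actions(2) tri_chart(2) weight_bounds(2)])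
  show "homogeneity_structure 1 (2 * n) (2 * r) N h3"
    by (rule *[of h3 w3, OF actions(3) tri_chart(3) weight_bounds(3)])
  show "homogeneity_structure 2 (2 * n) (2 * r) N hl"
    by (rule *[of hl "\<lambda>u A. w2 u A + w3 u A", OF action_hl tri_chart(4) weight_bounds(4)])
qed

lemma N_manifold: "N_manifold 2 (2 * n) (2 * r) N hl"
proof (rule N_manifoldI[OF homogeneity(4)])
  fix z assume "z \<in> total N"
  then obtain c u c' u' C where "dcharts c u c' u'" and C: "cot_chart n r (pim L) K (A.pchart c) C" "z \<in> cdom C"
    using ex_adapted by blast
  then have c: "A.bchart c u" using dcharts_bchart by blast
  show "\<exists>C w. hom_chart (2 * n) (2 * r) N hl C w \<and> z \<in> cdom C \<and> (\<forall>A\<in>cidx (2 * n) (2 * r). odd (w A) \<longleftrightarrow> fst A)"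
    using tri_chart(4)[OF c C(1)] C(2) weight_bounds(5) by blast
qed

lemma double_graded: "double_graded (k - 1) 2 (2 * n) (2 * r) N h1 hl"
  unfolding double_graded_def
  using homogeneity(1,4) K.NS.commuting_add_weights[OF mors(1,2,3) commute(1,2)] by blast

lemma form_weight:
  assumes h: "homogeneity_structure d (2 * n) (2 * r) N h"
    and w: "\<And>c u C. A.bchart c u \<Longrightarrow> cot_chart n r (pim L) K (A.pchart c) C \<Longrightarrow>
      hom_chart (2 * n) (2 * r) N h C (w u) \<and> (\<forall>A\<in>cidx n r. w u A + w u (msh n r A) = W)"
  shows "form_weight N h W \<omega>"
proof (rule K.form_weight_canonical)
  show "is_mor N N (h t)" for t using h by (simp add: homogeneity_structure_def monoid_action_def)
  fix z assume "z \<in> total N"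
  then obtain c u c' u' C where "dcharts c u c' u'" and C: "cot_chart n r (pim L) K (A.pchart c) C" "z \<in> cdom C"
    using ex_adapted by blast
  then have c: "A.bchart c u" using dcharts_bchart by blast
  note wC = w[OF c C(1), THEN conjunct1]
  show "\<exists>c C w. chart n r (pim L) c \<and> cot_chart n r (pim L) K c C \<and> z \<in> cdom C \<and>
      (\<forall>t. preim N (h t) (cdom C) = cdom C) \<and>
      (\<forall>t. \<forall>A\<in>cidx (2 * n) (2 * r). pb (h t) (cdom C) (coord C A) = scl (t ^ w A) (coord C A)) \<and>
      (\<forall>A\<in>cidx n r. w A + w (msh n r A) = W)"
    by (intro exI[of _ "A.pchart c"] exI[of _ C] exI[of _ "w u"] conjI allI ballI)
      (use A.chart[OF c] C hom_chart_saturated[OF h wC] hom_chart_pb[OF h wC] w[OF c C(1)] in auto)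
qed

lemma form_weights: "form_weight N h1 (k - 1) \<omega>" "form_weight N hl 2 \<omega>"
proof -
  have 1: "w1 u A + w1 u (msh n r A) = k - 1" if "A.bchart c u" "A \<in> cidx n r" for c u A
    using A.u_le[OF that(1) ix_less[OF that(2)]] that(2) by (simp add: tri_weight_pos tri_weight_mom)
  have 2: "(w2 u A + w3 u A) + (w2 u (msh n r A) + w3 u (msh n r A)) = 2" if "A \<in> cidx n r" for u A
    using that by (simp add: tri_weight_pos tri_weight_mom)
  show "form_weight N h1 (k - 1) \<omega>"
    by (rule form_weight[OF homogeneity(1), of w1]) (use tri_chart(1) 1 in blast)
  show "form_weight N hl 2 \<omega>"
    by (rule form_weight[OF homogeneity(4), of "\<lambda>u A. w2 u A + w3 u A"]) (use tri_chart(4) 2 in blast)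
qed

section \<open>The two Hamiltonians in a common chart\<close>

lemma Q_sect: "Q \<in> sect N True (total N)"
  and S_sect: "S \<in> sect N True (total N)"
proof -
  have T: "cpre K (total (pim L)) = total N" using K.P.bodymap_total by (auto simp: preim_def)
  have T': "cpre K' (total (pim L')) = total (csp K')" using K'.P.bodymap_total by (auto simp: preim_def)
  have T'': "R.pre (total (csp K')) = total N" using R.bodymap_total by (auto simp: preim_def)
  show "Q \<in> sect N True (total N)"
    using K.csym_sect[OF openin_topspace A.hvf] T by (simp add: hamiltonian_def)
  show "S \<in> sect N True (total N)"
    using R.pb_sect[OF openin_topspace K'.csym_sect[OF openin_topspace A'.hvf, unfolded T']] T''
    by (simp add: hamiltonian_def dual_hamiltonian_def)
qed

text \<open>The second projection of the cotangent bundle, onto the parity reversal of the dual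
  bundle. With respect to it \<open>S\<close> has the form that \<open>Q\<close> has with respect to
  \<open>cpr K\<close>.\<close>

definition \<pi>' :: "('z, 's, 'y, 'h) smor" where "\<pi>' = mcomp (csp K') (cpr K') R"

lemma mor_\<pi>': "mor_loc N (pim L') \<pi>'"
  using is_mor_mcomp[OF K.NS.sheaf K'.NS.sheaf K'.MS.sheaf R.mor K'.P.mor] K.NS.sheaf K'.MS.sheaf
  unfolding \<pi>'_def by unfold_locales

definition \<sigma> :: "bool \<Rightarrow> bool \<times> nat \<Rightarrow> bool \<times> nat" where "\<sigma> b A = (if b then msh n r A else A)"
text \<open>The splitting into positions and momenta that belongs to \<open>\<pi>'\<close>:
  \<open>\<theta>\<close> and \<open>\<chi>\<close> trade places, while base coordinates and their
  momenta keep theirs.\<close>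

definition \<sigma>' :: "bool \<Rightarrow> bool \<times> nat \<Rightarrow> bool \<times> nat" where "\<sigma>' b A = \<sigma> (b \<noteq> fst A) A"

context
  fixes c u c' u' C
  assumes d: "dcharts c u c' u'" and C: "cot_chart n r (pim L) K (A.pchart c) C"
begin

abbreviation "b \<equiv> A.pchart c"
abbreviation "b' \<equiv> A'.pchart c'"
abbreviation "D \<equiv> cdom C"

lemma bc: "A.bchart c u" "A'.bchart c' u'"
  using d dcharts_bchart by blast+

lemma b: "chart n r (pim L) b" and b': "chart n r (pim L') b'"
  using A.chart A'.chart bc by blast+

lemma D: "D = cpre K (cdom b)"
  using C by (simp add: cot_chart_def)

text \<open>\<open>R\<close> covers \<open>\<beta>\<close>, and \<open>\<beta>\<close> is injective
  on the base, so a point lies over \<open>cdom b\<close> exactly if its image lies over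
  \<open>cdom b'\<close>.\<close>

lemma D': "D = R.pre (cpre K' (cdom b'))"
proof -
  have "\<beta> x \<in> cdom b' \<longleftrightarrow> x \<in> cdom b" if "x \<in> A.B" for x
  proof -
    have "cdom b' = \<beta> ` cdom b" using d by (simp add: dual_charts_def A.cdom_pchart[OF bc(1)] A'.cdom_pchart[OF bc(2)])
    then show ?thesis using inj_\<beta> that A.cdom_pchart[OF bc(1)] by (auto dest: inj_onD)
  qed
  then show ?thesis
    using K.P.bodymap_total R.bodymap_total bodymap_R unfolding D preim_def A.total by auto
qed

lemma D\<pi>': "D = preim N \<pi>' (cdom b')"
  unfolding D' \<pi>'_def preim_mcomp[OF R.mor] ..

lemma darboux: "darboux N n r C \<omega> \<sigma>"
  using K.darboux_canonical[OF b C] unfolding \<sigma>_def .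

lemma darboux': "darboux N n r C \<omega> \<sigma>'"
  using darboux.darboux_swap[OF darboux] unfolding \<sigma>'_def .

lemma coord_\<sigma>: "A \<in> cidx n r \<Longrightarrow> coord C (\<sigma> False A) = pb (cpr K) (cdom b) (coord b A)"
    "A \<in> cidx n r \<Longrightarrow> coord C (\<sigma> True A) = mom n r (pim L) K b A"
  using K.cot_chart_coord[OF C, of A] by (simp_all add: \<sigma>_def pos_def)

text \<open>These are the identifications in \<open>canonical_iso\<close>: for odd indices
  \<open>R\<close> turns positions into momenta and back, which is the exchange made by
  \<open>\<sigma>'\<close>.\<close>

lemma coord_\<sigma>': "A \<in> cidx n r \<Longrightarrow> coord C (\<sigma>' False A) = pb \<pi>' (cdom b') (coord b' A)"
    "A \<in> cidx n r \<Longrightarrow> coord C (\<sigma>' True A) = pb R (cpre K' (cdom b')) (mom n r (pim L') K' b' A)"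
proof -
  assume A: "A \<in> cidx n r"
  have "pb \<pi>' (cdom b') (coord b' A) = pb R (cpre K' (cdom b')) (pos K' b' A)"
    by (simp add: \<pi>'_def pb_mcomp pos_def)
  then show "coord C (\<sigma>' False A) = pb \<pi>' (cdom b') (coord b' A)"
    "coord C (\<sigma>' True A) = pb R (cpre K' (cdom b')) (mom n r (pim L') K' b' A)"
    using K.cot_chart_coord[OF C A] pb_R_even[OF d, of "snd A"] pb_R_odd[OF d, of "snd A"] A
    by (cases "fst A"; cases A; auto simp: \<sigma>'_def \<sigma>_def cidx_def)+
qed

lemma Q_local: "res D Q = (\<Sum>A\<in>cidx n r. pb (cpr K) (cdom b) (hvf L (cdom b) (coord b A)) * coord C (\<sigma> True A))"
  unfolding hamiltonian_def D K.hamiltonian_local[OF b A.hvf]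
  by (rule sum.cong[OF refl]) (simp only: coord_\<sigma>)

lemma S_local: "res D S = (\<Sum>A\<in>cidx n r. pb \<pi>' (cdom b') (hvf L' (cdom b') (coord b' A)) * coord C (\<sigma>' True A))"
proof -
  interpret b': schart_loc "pim L'" n r b' by (rule K'.chart_schart[OF b'])
  let ?B = "cdom b'" and ?U = "cpre K' (cdom b')"
  let ?H = "hamiltonian K' L'"
  have T: "openin (body (csp K')) (total (csp K'))" by simp
  have T': "cpre K' (total (pim L')) = total (csp K')" using K'.P.bodymap_total by (auto simp: preim_def)
  have U: "openin (body (csp K')) ?U" by (rule K'.cpre_open[OF b'])
  have H: "?H \<in> secs (csp K') (total (csp K'))"
    using K'.NS.sect_secs[OF T K'.csym_sect[OF openin_topspace A'.hvf, unfolded T']] by (simp add: hamiltonian_def)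
  have Q's: "hvf L' ?B (coord b' A) \<in> secs (pim L') ?B" if "A \<in> cidx n r" for A
    by (rule K'.MS.vf_secs[OF A'.hvf b'.cdom_open openin_subset[OF b'.cdom_open] b'.coord_secs[OF that]])
  have 1: "pb (cpr K') ?B (hvf L' ?B (coord b' A)) \<in> secs (csp K') ?U" if "A \<in> cidx n r" for A
    by (rule K'.P.pb_secs[OF b'.cdom_open Q's[OF that]])
  have 2: "mom n r (pim L') K' b' A \<in> secs (csp K') ?U" if "A \<in> cidx n r" for A
    by (rule K'.NS.sect_secs[OF U K'.mom_sect[OF b' that]])
  let ?t = "\<lambda>A. pb (cpr K') ?B (hvf L' ?B (coord b' A)) * mom n r (pim L') K' b' A"
  have "res D S = pb R ?U (res ?U ?H)"
    using R.pb_res[OF T H U openin_subset[OF U]] by (simp add: dual_hamiltonian_def D')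
  also have "res ?U ?H = (\<Sum>A\<in>cidx n r. ?t A)"
    unfolding hamiltonian_def by (rule K'.hamiltonian_local[OF b' A'.hvf])
  also have "pb R ?U (\<Sum>A\<in>cidx n r. ?t A) = (\<Sum>A\<in>cidx n r. pb R ?U (?t A))"
    by (rule R.pb_sum[OF U K'.NS.secs_mult[OF U 1 2]])
  also have "\<dots> = (\<Sum>A\<in>cidx n r. pb \<pi>' ?B (hvf L' ?B (coord b' A)) * coord C (\<sigma>' True A))"
  proof (rule sum.cong[OF refl])
    fix A assume A: "A \<in> cidx n r"
    show "pb R ?U (?t A) = pb \<pi>' ?B (hvf L' ?B (coord b' A)) * coord C (\<sigma>' True A)"
      unfolding R.pb_mult[OF U 1[OF A] 2[OF A]] coord_\<sigma>'(2)[OF A] by (simp add: \<pi>'_def pb_mcomp)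
  qed
  finally show ?thesis .
qed

lemma
  assumes A: "A \<in> cidx n r"
  shows weight_\<sigma>: "tri_weight k n r u (\<sigma> False A) = (u (A.ix A), if fst A then 1 else 0, 0)"
      "tri_weight k n r u (\<sigma> True A) = (k - 1 - u (A.ix A), if fst A then 0 else 1, 1)"
    and weight_\<sigma>': "tri_weight k n r u (\<sigma>' False A) = (u' (A.ix A), 0, if fst A then 1 else 0)"
      "tri_weight k n r u (\<sigma>' True A) = (k - 1 - u' (A.ix A), 1, if fst A then 0 else 1)"
proof -
  have u': "u' (A.ix A) = (if fst A then k - 1 - u (A.ix A) else u (A.ix A))"
    using d A by (auto simp: dual_charts_def A.ix_def cidx_def)
  \<comment> \<open>Dual weights are complementary with respect to \<open>k - 1\<close>.
    Complementing twice gives back the weight only because it is at most \<open>k - 1\<close>, the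
    subtraction being that of naturals.\<close>
  have u: "k - 1 - (k - 1 - u (A.ix A)) = u (A.ix A)"
    using A.u_le[OF bc(1) ix_less[OF A]] by simp
  show "tri_weight k n r u (\<sigma> False A) = (u (A.ix A), if fst A then 1 else 0, 0)"
    "tri_weight k n r u (\<sigma> True A) = (k - 1 - u (A.ix A), if fst A then 0 else 1, 1)"
    using tri_weight_pos[OF A] tri_weight_mom[OF A] by (simp_all add: \<sigma>_def)
  show "tri_weight k n r u (\<sigma>' False A) = (u' (A.ix A), 0, if fst A then 1 else 0)"
    "tri_weight k n r u (\<sigma>' True A) = (k - 1 - u' (A.ix A), 1, if fst A then 0 else 1)"
    using tri_weight_pos[OF A] tri_weight_mom[OF A] u u' by (simp_all add: \<sigma>'_def \<sigma>_def)
qed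

text \<open>The field has weight 0 for \<open>phact\<close> and 1 for \<open>plact\<close>, which
  lie under \<open>h1\<close> and \<open>h2\<close>. Under \<open>h3\<close>, which scales momenta
  only, lies the identity, so there the field contributes 0.\<close>

lemma Q_weights:
  "pb (h1 t) D (res D Q) = scl (t ^ (k - 1)) (res D Q)"
  "pb (h2 t) D (res D Q) = scl (t ^ 2) (res D Q)"
  "pb (h3 t) D (res D Q) = scl (t ^ 1) (res D Q)"
proof -
  let ?B = "cdom b"
  interpret b: schart_loc "pim L" n r b by (rule K.chart_schart[OF b])
  note B = b.cdom_open
  note H = darboux.hamiltonian_weight[OF darboux K.P.mor_loc_axioms b.schart_loc_axioms D A.hvf coord_\<sigma>(1)]
  have m: "is_mor (pim L) (pim L) (phact L t)" "is_mor (pim L) (pim L) (plact L t)"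
    using A.actions by (simp_all add: monoid_action_def)
  have u: "0 + u (A.ix A) + (k - 1 - u (A.ix A)) = k - 1" if "A \<in> cidx n r" for A
    using A.u_le[OF bc(1) ix_less[OF that]] by simp
  show "pb (h1 t) D (res D Q) = scl (t ^ (k - 1)) (res D Q)"
  proof (rule H[OF _ homogeneity(1) tri_chart(1)[OF bc(1) C] m(1), where e = 0])
    show "preim (pim L) (phact L t) ?B = ?B" by (rule A.phact_chart(1)[OF bc(1)])
    show "pb (phact L t) ?B (coord b A) = scl (t ^ w1 u (\<sigma> False A)) (coord b A)" if "A \<in> cidx n r" for A
      using A.phact_chart(2)[OF bc(1) that] that by (simp add: weight_\<sigma>)
    show "pb (phact L t) ?B (hvf L ?B f) = scl (t ^ 0) (hvf L ?B (pb (phact L t) ?B f))" if "f \<in> secs (pim L) ?B" for f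
      using A.hvf_phact[OF B that] A.phact_chart(1)[OF bc(1)] by simp
  qed (use u Q_local in \<open>simp_all add: weight_\<sigma>\<close>)
  show "pb (h2 t) D (res D Q) = scl (t ^ 2) (res D Q)"
  proof (rule H[OF _ homogeneity(2) tri_chart(2)[OF bc(1) C] m(2), where e = 1])
    show "preim (pim L) (plact L t) ?B = ?B" by (rule A.plact_chart(1)[OF bc(1)])
    show "pb (plact L t) ?B (coord b A) = scl (t ^ w2 u (\<sigma> False A)) (coord b A)" if "A \<in> cidx n r" for A
      using A.plact_chart(2)[OF bc(1) that, of t] that by (auto simp: weight_\<sigma> A.ix_def cidx_def)
    show "pb (plact L t) ?B (hvf L ?B f) = scl (t ^ 1) (hvf L ?B (pb (plact L t) ?B f))" if "f \<in> secs (pim L) ?B" for f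
      using A.hvf_plact[OF B that] A.plact_chart(1)[OF bc(1)] by simp
  qed (use Q_local in \<open>simp_all add: weight_\<sigma>\<close>)
  show "pb (h3 t) D (res D Q) = scl (t ^ 1) (res D Q)"
    by (rule H[OF _ homogeneity(3) tri_chart(3)[OF bc(1) C] b.is_mor_mid, where e = 0])
      (use Q_local openin_subset[OF B] in \<open>auto simp: weight_\<sigma> preim_def mid_def\<close>)
qed

text \<open>Seen through \<open>\<pi>'\<close>, the action that covers \<open>plact L'\<close> is
  \<open>h3\<close>, while \<open>h2\<close> fixes all pulled-back coordinates; so these two
  exchange the parts they have for \<open>Q\<close>.\<close>

lemma S_weights:
  "pb (h1 t) D (res D S) = scl (t ^ (k - 1)) (res D S)"
  "pb (h2 t) D (res D S) = scl (t ^ 1) (res D S)"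
  "pb (h3 t) D (res D S) = scl (t ^ 2) (res D S)"
proof -
  let ?B = "cdom b'"
  interpret b': schart_loc "pim L'" n r b' by (rule K'.chart_schart[OF b'])
  note B = b'.cdom_open
  note H = darboux.hamiltonian_weight[OF darboux' mor_\<pi>' b'.schart_loc_axioms D\<pi>' A'.hvf coord_\<sigma>'(1)]
  have m: "is_mor (pim L') (pim L') (phact L' t)" "is_mor (pim L') (pim L') (plact L' t)"
    using A'.actions by (simp_all add: monoid_action_def)
  have u: "0 + u' (A.ix A) + (k - 1 - u' (A.ix A)) = k - 1" if "A \<in> cidx n r" for A
    using A'.u_le[OF bc(2) ix_less[OF that]] by simp
  show "pb (h1 t) D (res D S) = scl (t ^ (k - 1)) (res D S)"
  proof (rule H[OF _ homogeneity(1) tri_chart(1)[OF bc(1) C] m(1), where e = 0])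
    show "preim (pim L') (phact L' t) ?B = ?B" by (rule A'.phact_chart(1)[OF bc(2)])
    show "pb (phact L' t) ?B (coord b' A) = scl (t ^ w1 u (\<sigma>' False A)) (coord b' A)" if "A \<in> cidx n r" for A
      using A'.phact_chart(2)[OF bc(2) that] that by (simp add: weight_\<sigma>')
    show "pb (phact L' t) ?B (hvf L' ?B f) = scl (t ^ 0) (hvf L' ?B (pb (phact L' t) ?B f))" if "f \<in> secs (pim L') ?B" for f
      using A'.hvf_phact[OF B that] A'.phact_chart(1)[OF bc(2)] by simp
  qed (use u S_local in \<open>simp_all add: weight_\<sigma>'\<close>)
  show "pb (h3 t) D (res D S) = scl (t ^ 2) (res D S)"
  proof (rule H[OF _ homogeneity(3) tri_chart(3)[OF bc(1) C] m(2), where e = 1])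
    show "preim (pim L') (plact L' t) ?B = ?B" by (rule A'.plact_chart(1)[OF bc(2)])
    show "pb (plact L' t) ?B (coord b' A) = scl (t ^ w3 u (\<sigma>' False A)) (coord b' A)" if "A \<in> cidx n r" for A
      using A'.plact_chart(2)[OF bc(2) that, of t] that by (auto simp: weight_\<sigma>' A.ix_def cidx_def)
    show "pb (plact L' t) ?B (hvf L' ?B f) = scl (t ^ 1) (hvf L' ?B (pb (plact L' t) ?B f))" if "f \<in> secs (pim L') ?B" for f
      using A'.hvf_plact[OF B that] A'.plact_chart(1)[OF bc(2)] by simp
  qed (use S_local in \<open>simp_all add: weight_\<sigma>'\<close>)
  show "pb (h2 t) D (res D S) = scl (t ^ 1) (res D S)"
    by (rule H[OF _ homogeneity(2) tri_chart(2)[OF bc(1) C] b'.is_mor_mid, where e = 0])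
      (use S_local openin_subset[OF B] in \<open>auto simp: weight_\<sigma>' preim_def mid_def\<close>)
qed

lemma
  assumes X: "vfield N True D X"
  shows QQ_local: "(\<And>j Y. vfield N j D Y \<Longrightarrow> \<omega> D Y X = Y D (res D Q)) \<Longrightarrow> X D (res D Q) = 0"
    and SS_local: "(\<And>j Y. vfield N j D Y \<Longrightarrow> \<omega> D Y X = Y D (res D S)) \<Longrightarrow> X D (res D S) = 0"
  by (rule darboux.hamiltonian_bracket_zero[OF darboux K.P.mor_loc_axioms K.chart_schart[OF b] D A.homological coord_\<sigma>(1) Q_local X];
      blast)
    (rule darboux.hamiltonian_bracket_zero[OF darboux' mor_\<pi>' K'.chart_schart[OF b'] D\<pi>' A'.homological coord_\<sigma>'(1) S_local X];
      blast)

end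

section \<open>From charts to global statements\<close>

lemma D_open: "cot_chart n r (pim L) K c C \<Longrightarrow> openin (body N) (cdom C)"
  unfolding cot_chart_def chart_def by blast

lemma fun_weightI:
  assumes h: "homogeneity_structure d (2 * n) (2 * r) N h" and f: "f \<in> sect N True (total N)"
    and v: "\<And>c u C. A.bchart c u \<Longrightarrow> cot_chart n r (pim L) K (A.pchart c) C \<Longrightarrow> hom_chart (2 * n) (2 * r) N h C (v u)"
    and w: "\<And>c u c' u' C t. dcharts c u c' u' \<Longrightarrow> cot_chart n r (pim L) K (A.pchart c) C \<Longrightarrow>
      pb (h t) (cdom C) (res (cdom C) f) = scl (t ^ W) (res (cdom C) f)"
  shows "fun_weight N h W f"
proof (rule fun_weight_local[OF _ K.NS.sheaf K.NS.sect_secs[OF openin_topspace f]])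
  show "is_mor N N (h t)" for t using h by (simp add: homogeneity_structure_def monoid_action_def)
  fix z assume "z \<in> total N"
  then obtain c u c' u' C where d: "dcharts c u c' u'" and C: "cot_chart n r (pim L) K (A.pchart c) C" "z \<in> cdom C"
    using ex_adapted by blast
  have "preim N (h t) (cdom C) = cdom C" for t by (rule hom_chart_saturated[OF h v[OF dcharts_bchart(1)[OF d] C(1)]])
  then show "\<exists>D. openin (body N) D \<and> z \<in> D \<and>
      (\<forall>t. preim N (h t) D = D \<and> pb (h t) D (res D f) = scl (t ^ W) (res D f))"
    using w[OF d C(1)] C(2) D_open[OF C(1)] by blast
qed

lemma Q_fun_weights: "fun_weight N h1 (k - 1) Q" "fun_weight N h2 2 Q" "fun_weight N h3 1 Q"
  by (rule fun_weightI[where v = w1, OF homogeneity(1) Q_sect tri_chart(1) Q_weights(1)]; assumption)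
    ((rule fun_weightI[where v = w2, OF homogeneity(2) Q_sect tri_chart(2) Q_weights(2)]; assumption), (rule fun_weightI[where v = w3, OF homogeneity(3) Q_sect tri_chart(3) Q_weights(3)]; assumption))

lemma S_fun_weights: "fun_weight N h1 (k - 1) S" "fun_weight N h2 1 S" "fun_weight N h3 2 S"
  by (rule fun_weightI[where v = w1, OF homogeneity(1) S_sect tri_chart(1) S_weights(1)]; assumption)
    ((rule fun_weightI[where v = w2, OF homogeneity(2) S_sect tri_chart(2) S_weights(2)]; assumption), (rule fun_weightI[where v = w3, OF homogeneity(3) S_sect tri_chart(3) S_weights(3)]; assumption))

lemma total_weights: "fun_weight N h1 (k - 1) (Q + S)" "fun_weight N hl 3 (Q + S)"
proof -
  note Qs = K.NS.sect_secs[OF openin_topspace Q_sect] and Ss = K.NS.sect_secs[OF openin_topspace S_sect]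
  show "fun_weight N h1 (k - 1) (Q + S)"
    by (rule K.NS.fun_weight_add[OF mors(1) Qs Ss Q_fun_weights(1) S_fun_weights(1)])
  have "is_mor N N (hl t)" for t using action_hl by (simp add: monoid_action_def)
  moreover have "fun_weight N hl 3 Q"
    using K.NS.fun_weight_add_weights[OF mors(2,3) Qs Q_fun_weights(2,3)] by (simp add: numeral_eq_Suc)
  moreover have "fun_weight N hl 3 S"
    using K.NS.fun_weight_add_weights[OF mors(2,3) Ss S_fun_weights(2,3)] by (simp add: numeral_eq_Suc)
  ultimately show "fun_weight N hl 3 (Q + S)"
    by (rule K.NS.fun_weight_add[OF _ Qs Ss])
qed

lemma QQ: "poisson N \<omega> Q Q = 0" and SS: "poisson N \<omega> S S = 0"
proof -
  note e = K.even_symplectic_canonical[unfolded even_symplectic_def]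
  have loc: "\<exists>D. openin (body N) D \<and> z \<in> D \<and>
      (\<forall>X. vfield N True D X \<and> (\<forall>j Y. vfield N j D Y \<longrightarrow> \<omega> D Y X = Y D (res D f)) \<longrightarrow> X D (res D f) = 0)"
    if z: "z \<in> total N" and f: "\<And>c u c' u' C X. dcharts c u c' u' \<Longrightarrow> cot_chart n r (pim L) K (A.pchart c) C \<Longrightarrow>
      vfield N True (cdom C) X \<Longrightarrow> (\<And>j Y. vfield N j (cdom C) Y \<Longrightarrow> \<omega> (cdom C) Y X = Y (cdom C) (res (cdom C) f)) \<Longrightarrow>
      X (cdom C) (res (cdom C) f) = 0" for z f
  proof -
    obtain c u c' u' C where d: "dcharts c u c' u'" and C: "cot_chart n r (pim L) K (A.pchart c) C" "z \<in> cdom C"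
      using ex_adapted[OF z] by blast
    show ?thesis
      by (intro exI[of _ "cdom C"] conjI D_open[OF C(1)] C(2) allI impI, elim conjE, rule f[OF d C(1)]) auto
  qed
  show "poisson N \<omega> Q Q = 0"
  proof (rule K.NS.poisson_zero_local[OF K.even_two_form_canonical conjunct2[OF conjunct2[OF e]] Q_sect])
    fix z assume "z \<in> total N"
    then show "\<exists>D. openin (body N) D \<and> z \<in> D \<and>
      (\<forall>X. vfield N True D X \<and> (\<forall>j Y. vfield N j D Y \<longrightarrow> \<omega> D Y X = Y D (res D Q)) \<longrightarrow> X D (res D Q) = 0)"
      by (rule loc) (rule QQ_local; assumption)
  qed
  show "poisson N \<omega> S S = 0"
  proof (rule K.NS.poisson_zero_local[OF K.even_two_form_canonical conjunct2[OF conjunct2[OF e]] S_sect])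
    fix z assume "z \<in> total N"
    then show "\<exists>D. openin (body N) D \<and> z \<in> D \<and>
      (\<forall>X. vfield N True D X \<and> (\<forall>j Y. vfield N j D Y \<longrightarrow> \<omega> D Y X = Y D (res D S)) \<longrightarrow> X D (res D S) = 0)"
      by (rule loc) (rule SS_local; assumption)
  qed
qed

lemma weighted_courant: "weighted_courant k (2 * n) (2 * r) N h1 hl \<omega> (Q + S)"
  unfolding weighted_courant_def
proof (intro conjI)
  note e = K.even_symplectic_canonical[unfolded even_symplectic_def]
  show "1 \<le> k" by (rule A.k_pos)
  show "double_graded (k - 1) 2 (2 * n) (2 * r) N h1 hl" by (rule double_graded)
  show "N_manifold 2 (2 * n) (2 * r) N hl" by (rule N_manifold)
  show "even_symplectic N \<omega>" by (rule K.even_symplectic_canonical)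
  show "form_weight N h1 (k - 1) \<omega>" "form_weight N hl 2 \<omega>" by (rule form_weights)+
  show "Q + S \<in> sect N True (total N)" by (rule K.NS.sect_add[OF openin_topspace Q_sect S_sect])
  show "fun_weight N h1 (k - 1) (Q + S)" "fun_weight N hl 3 (Q + S)" by (rule total_weights)+
  show "poisson N \<omega> (Q + S) (Q + S) = 0"
    by (rule K.NS.poisson_sum_zero[OF K.even_two_form_canonical conjunct2[OF conjunct2[OF e]] Q_sect S_sect QQ SS QS])
qed

end

declare [[coercion_enabled = true]]

theorem theorem5p13:
  fixes k n r :: nat
    and L :: "('x, 'g::real_algebra_1) wla"
    and L' :: "('y, 'h::real_algebra_1) wla"
    and \<beta> :: "'x \<Rightarrow> 'y"
    and pr :: "'x \<Rightarrow> 'y \<Rightarrow> real"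
    and K :: "('z, 's::real_algebra_1, 'x, 'g) cot"
    and K' :: "('w, 'q::real_algebra_1, 'y, 'h) cot"
    and R :: "('z, 's, 'w, 'q) smor"
    and h1 h2 h3 :: "('z, 's) saction"
  assumes "weighted_lie_bialgebroid k n r L L' \<beta> pr K K' R"
    and "natural_triweight k n r L K h1 h2 h3"
  shows "weighted_courant k (2 * n) (2 * r) (csp K) h1 (add_weights (csp K) h2 h3)
           (canonical_form n r (pim L) K) (hamiltonian K L + dual_hamiltonian R K' L')"
  by (rule lie_bialgebroid.weighted_courant[OF lie_bialgebroid.intro[OF assms]])

end
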